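(* Let $F$, $H$, $m_0$ satisfy the standing assumptions stated in the context, with constants $C_o\ge 1$, $L>0$. There exist $\lambda_0\ge1$ depending only on $n,C_o,L$ and constants $K,\eta>0$ depending only on $L,C_o$ such that, for any $\lambda>\max\{\lambda_0,\eta\}$, any two solutions $(u_1,m_1)$, $(u_2,m_2)$ of $({\rm MFG}_\lambda)$ (with the same initial datum $m_0$), any $T>0$ and all $t\in[0,T]$, $$\|\lambda Du_1(\cdot,t)-\lambda Du_2(\cdot,t)\|_\infty\le K\,d_1(m_1(t),m_2(t))+Ke^{-\lambda T/2}+K\int_t^Td_1(m_1(r),m_2(r))e^{-(\lambda-\eta)(r-t)}\,dr.$$ In particular, for all $t\ge0$, $$\|\lambda Du_1(\cdot,t)-\lambda Du_2(\cdot,t)\|_\infty\le K\,d_1(m_1(t),m_2(t))+K\int_t^\infty d_1(m_1(r),m_2(r))e^{-(\lambda-\eta)(r-t)}\,dr.$$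
   Context: Fix $n\ge1$ and $\alpha\in(0,1)$. $\mathcal{P}_1(\mathbb{R}^n)$ is the set of Borel probability measures on $\mathbb{R}^n$ with finite first moment and $d_1$ is the $1$-Wasserstein distance. For functions on $\mathbb{R}^n\times[0,\infty)$, $\|u\|_\infty=\sup_{(x,t)}|u(x,t)|$ and $\|u(\cdot,t)\|_\infty=\sup_x|u(x,t)|$. $D=D_x$ is the gradient in $x$. Standing assumptions: $m_0\in\mathcal{P}_1(\mathbb{R}^n)$, $F:\mathbb{R}^n\times\mathcal{P}_1(\mathbb{R}^n)\to\mathbb{R}$, $H=H(p,x):\mathbb{R}^n\times\mathbb{R}^n\to\mathbb{R}$, and there are constants $C_o\ge1$, $L>0$ such that: - $F(\cdot,m)$ is of class $C^{2,\alpha}$ for all $m$, and $|F(x,m)|\le C_o(1+|x|)$ for all $(x,m)$. - For all $x,y\in\mathbb{R}^n$, $m,\tilde m\in\mathcal{P}_1(\mathbb{R}^n)$: $|F(x,m)-F(y,\tilde m)|\le L(|x-y|+d_1(m,\tilde m))$ and $|D_xF(x,m)-D_xF(y,\tilde m)|\le L(|x-y|+d_1(m,\tilde m))$. - $H$ is of class $C^{2,\alpha}$ and convex in its first variable $p$. - For all $p,x$: $-C_o\le H(p,x)\le C_o(1+|p|^2)$; $C_o^{-1}I_d\le D^2_{pp}H(p,x)\le C_oI_d$; $|D_xH(p,x)|+|D^2_{px}H(p,x)|\le C_o(1+|p|)$; $|D^2_{xx}H(p,x)|\le C_o$. For $\lambda>0$, the system $({\rm MFG}_\lambda)$ for $(u_\lambda,m_\lambda)$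 is $$\begin{cases}-\partial_tu_\lambda-\Delta u_\lambda+\frac1\lambda H(\lambda Du_\lambda,x)+\lambda u_\lambda=F(x,m_\lambda(t)), & x\in\mathbb{R}^n,\ t\in(0,\infty),\\ \partial_tm_\lambda-\Delta m_\lambda-\mathrm{div}(m_\lambda D_pH(\lambda Du_\lambda,x))=0,& x\in\mathbb{R}^n,\ t\in(0,\infty),\\ m_\lambda(x,0)=m_0(x),& x\in\mathbb{R}^n.\end{cases}$$ Convention: a solution of $({\rm MFG}_\lambda)$ always means a classical solution satisfying $$\inf_{\mathbb{R}^n\times[0,\infty)}u_\lambda>-\infty,\quad\sup_{(x,t)}\frac{u_\lambda(x,t)}{1+|x|}<\infty,\quad\|Du_\lambda\|_\infty<\infty,\quad\|D^2u_\lambda\|_\infty\le1.$$ The subscript $\lambda$ is dropped for the two solutions in the claim. Here classical solution means: $u_\lambda$ is $C^{2}$ in $x$ and $C^1$ in $t$ on $\mathbb{R}^n\times[0,\infty)$ and satisfies its equation pointwise; $t\mapsto m_\lambda(t)\in\mathcal{P}_1(\mathbb{R}^n)$ is $d_1$-continuous on $[0,\infty)$ with $m_\lambda(0)=m_0$, and for $t>0$ it is identified with a density solving the second equation. *)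

theory Defs
  imports "HOL-Analysis.Analysis" "HOL-Probability.Probability_Measure"
begin

(* The constants of the theorem are uniform in the dimension n, so n has to be a variable of the
   formula rather than a type: R^n is the set of real functions on {0,...,n-1}, extended by
   undefined.  On this set the topology of the type nat => real is the Euclidean one (the metric
   which the library puts on that type is not Euclidean and is not used). *)

type_synonym vec = "nat \<Rightarrow> real"

definition Rn :: "nat \<Rightarrow> vec set" where
  "Rn n = {..<n} \<rightarrow>\<^sub>E UNIV"

definition vnorm :: "nat \<Rightarrow> vec \<Rightarrow> real" where
  "vnorm n v = L2_set v {..<n}"

definition vdist :: "nat \<Rightarrow> vec \<Rightarrow> vec \<Rightarrow> real" where
  "vdist n x y = vnorm n (\<lambda>i. x i - y i)"

definition vscale :: "nat \<Rightarrow> real \<Rightarrow> vec \<Rightarrow> vec" where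
  "vscale n c v = (\<lambda>i\<in>{..<n}. c * v i)"

(* Operator norm of the n x n matrix (M i j) with respect to the Euclidean norm. *)
definition mnorm :: "nat \<Rightarrow> (nat \<Rightarrow> nat \<Rightarrow> real) \<Rightarrow> real" where
  "mnorm n M = (SUP \<xi>\<in>{\<xi>\<in>Rn n. vnorm n \<xi> \<le> 1}. vnorm n (\<lambda>i. \<Sum>j<n. M i j * \<xi> j))"

definition has_pd :: "nat \<Rightarrow> (vec \<Rightarrow> real) \<Rightarrow> vec \<Rightarrow> bool" where
  "has_pd i f x \<longleftrightarrow> (\<lambda>s. f (x(i := s))) differentiable (at (x i))"

definition pd :: "nat \<Rightarrow> (vec \<Rightarrow> real) \<Rightarrow> vec \<Rightarrow> real" where
  "pd i f x = deriv (\<lambda>s. f (x(i := s))) (x i)"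

definition grad :: "nat \<Rightarrow> (vec \<Rightarrow> real) \<Rightarrow> vec \<Rightarrow> vec" where
  "grad n f x = (\<lambda>i\<in>{..<n}. pd i f x)"

definition hess :: "(vec \<Rightarrow> real) \<Rightarrow> vec \<Rightarrow> nat \<Rightarrow> nat \<Rightarrow> real" where
  "hess f x i j = pd i (pd j f) x"

definition laplacian :: "nat \<Rightarrow> (vec \<Rightarrow> real) \<Rightarrow> vec \<Rightarrow> real" where
  "laplacian n f x = (\<Sum>i<n. pd i (pd i f) x)"

definition divergence :: "nat \<Rightarrow> (vec \<Rightarrow> vec) \<Rightarrow> vec \<Rightarrow> real" where
  "divergence n b x = (\<Sum>i<n. pd i (\<lambda>y. b y i) x)"

definition C2 :: "nat \<Rightarrow> (vec \<Rightarrow> real) \<Rightarrow> bool" where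
  "C2 n f \<longleftrightarrow>
     continuous_on (Rn n) f \<and>
     (\<forall>i<n. (\<forall>x\<in>Rn n. has_pd i f x) \<and> continuous_on (Rn n) (pd i f)) \<and>
     (\<forall>i<n. \<forall>j<n. (\<forall>x\<in>Rn n. has_pd i (pd j f) x) \<and> continuous_on (Rn n) (pd i (pd j f)))"

(* Class C^{2,alpha}: the second derivatives are alpha-Hoelder on bounded sets. *)
definition C2_alpha :: "nat \<Rightarrow> real \<Rightarrow> (vec \<Rightarrow> real) \<Rightarrow> bool" where
  "C2_alpha n \<alpha> f \<longleftrightarrow>
     C2 n f \<and>
     (\<forall>R. \<exists>C. \<forall>x\<in>Rn n. \<forall>y\<in>Rn n. vnorm n x \<le> R \<longrightarrow> vnorm n y \<le> R \<longrightarrow>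
        (\<forall>i<n. \<forall>j<n. \<bar>pd i (pd j f) x - pd i (pd j f) y\<bar> \<le> C * vdist n x y powr \<alpha>))"

(* A function of (p,x) in R^n x R^n as a function on R^{2n}. *)
definition joint :: "nat \<Rightarrow> (vec \<Rightarrow> vec \<Rightarrow> real) \<Rightarrow> vec \<Rightarrow> real" where
  "joint n h z = h (restrict z {..<n}) (\<lambda>i\<in>{..<n}. z (n + i))"

definition dt :: "real set \<Rightarrow> (vec \<Rightarrow> real \<Rightarrow> real) \<Rightarrow> vec \<Rightarrow> real \<Rightarrow> real" where
  "dt I u x t = vector_derivative (u x) (at t within I)"

(* C^2 in x and C^1 in t on R^n x I, all derivatives being jointly continuous; the time
   derivative is one-sided at an end point of I belonging to I. *)
definition C21 :: "nat \<Rightarrow> real set \<Rightarrow> (vec \<Rightarrow> real \<Rightarrow> real) \<Rightarrow> bool" where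
  "C21 n I u \<longleftrightarrow>
     continuous_on (Rn n \<times> I) (\<lambda>(x, t). u x t) \<and>
     (\<forall>i<n. (\<forall>x\<in>Rn n. \<forall>t\<in>I. has_pd i (\<lambda>y. u y t) x) \<and>
            continuous_on (Rn n \<times> I) (\<lambda>(x, t). pd i (\<lambda>y. u y t) x)) \<and>
     (\<forall>i<n. \<forall>j<n. (\<forall>x\<in>Rn n. \<forall>t\<in>I. has_pd i (pd j (\<lambda>y. u y t)) x) \<and>
            continuous_on (Rn n \<times> I) (\<lambda>(x, t). pd i (pd j (\<lambda>y. u y t)) x)) \<and>
     (\<forall>x\<in>Rn n. \<forall>t\<in>I. u x differentiable (at t within I)) \<and>
     continuous_on (Rn n \<times> I) (\<lambda>(x, t). dt I u x t)"

(* Lebesgue measure on R^n; its sigma-algebra is the Borel one. *)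
definition Leb :: "nat \<Rightarrow> vec measure" where
  "Leb n = Pi\<^sub>M {..<n} (\<lambda>_. lborel)"

definition P1 :: "nat \<Rightarrow> vec measure set" where
  "P1 n = {\<mu>. prob_space \<mu> \<and> sets \<mu> = sets (Leb n) \<and> (\<integral>\<^sup>+x. ennreal (vnorm n x) \<partial>\<mu>) < \<infinity>}"

definition couplings :: "vec measure \<Rightarrow> vec measure \<Rightarrow> (vec \<times> vec) measure set" where
  "couplings \<mu> \<nu> =
     {\<pi>. sets \<pi> = sets (\<mu> \<Otimes>\<^sub>M \<nu>) \<and> distr \<pi> \<mu> fst = \<mu> \<and> distr \<pi> \<nu> snd = \<nu>}"

definition d1 :: "nat \<Rightarrow> vec measure \<Rightarrow> vec measure \<Rightarrow> ennreal" where
  "d1 n \<mu> \<nu> = (INF \<pi>\<in>couplings \<mu> \<nu>. \<integral>\<^sup>+(x, y). ennreal (vdist n x y) \<partial>\<pi>)"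

definition assumptions_F ::
  "nat \<Rightarrow> real \<Rightarrow> real \<Rightarrow> real \<Rightarrow> (vec \<Rightarrow> vec measure \<Rightarrow> real) \<Rightarrow> bool" where
  "assumptions_F n \<alpha> Co L F \<longleftrightarrow>
     (\<forall>\<mu>\<in>P1 n. C2_alpha n \<alpha> (\<lambda>x. F x \<mu>)) \<and>
     (\<forall>x\<in>Rn n. \<forall>\<mu>\<in>P1 n. \<bar>F x \<mu>\<bar> \<le> Co * (1 + vnorm n x)) \<and>
     (\<forall>x\<in>Rn n. \<forall>y\<in>Rn n. \<forall>\<mu>\<in>P1 n. \<forall>\<nu>\<in>P1 n.
        ennreal \<bar>F x \<mu> - F y \<nu>\<bar> \<le> ennreal L * (ennreal (vdist n x y) + d1 n \<mu> \<nu>) \<and>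
        ennreal (vdist n (grad n (\<lambda>z. F z \<mu>) x) (grad n (\<lambda>z. F z \<nu>) y))
          \<le> ennreal L * (ennreal (vdist n x y) + d1 n \<mu> \<nu>))"

definition DpH :: "nat \<Rightarrow> (vec \<Rightarrow> vec \<Rightarrow> real) \<Rightarrow> vec \<Rightarrow> vec \<Rightarrow> vec" where
  "DpH n H p x = grad n (\<lambda>q. H q x) p"

definition assumptions_H ::
  "nat \<Rightarrow> real \<Rightarrow> real \<Rightarrow> (vec \<Rightarrow> vec \<Rightarrow> real) \<Rightarrow> bool" where
  "assumptions_H n \<alpha> Co H \<longleftrightarrow>
     C2_alpha (2 * n) \<alpha> (joint n H) \<and>
     (\<forall>x\<in>Rn n. \<forall>p\<in>Rn n. \<forall>q\<in>Rn n. \<forall>s\<in>{0..1}.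
        H (\<lambda>i\<in>{..<n}. (1 - s) * p i + s * q i) x \<le> (1 - s) * H p x + s * H q x) \<and>
     (\<forall>p\<in>Rn n. \<forall>x\<in>Rn n.
        - Co \<le> H p x \<and> H p x \<le> Co * (1 + (vnorm n p)\<^sup>2) \<and>
        (\<forall>\<xi>\<in>Rn n.
           1 / Co * (vnorm n \<xi>)\<^sup>2 \<le> (\<Sum>i<n. \<Sum>j<n. hess (\<lambda>q. H q x) p i j * \<xi> i * \<xi> j) \<and>
           (\<Sum>i<n. \<Sum>j<n. hess (\<lambda>q. H q x) p i j * \<xi> i * \<xi> j) \<le> Co * (vnorm n \<xi>)\<^sup>2) \<and>
        vnorm n (grad n (H p) x) + mnorm n (\<lambda>i j. pd i (\<lambda>q. pd j (H q) x) p)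
          \<le> Co * (1 + vnorm n p) \<and>
        mnorm n (hess (H p) x) \<le> Co)"

definition standing_assumptions ::
  "nat \<Rightarrow> real \<Rightarrow> real \<Rightarrow> real \<Rightarrow> vec measure \<Rightarrow> (vec \<Rightarrow> vec measure \<Rightarrow> real) \<Rightarrow>
   (vec \<Rightarrow> vec \<Rightarrow> real) \<Rightarrow> bool" where
  "standing_assumptions n \<alpha> Co L m0 F H \<longleftrightarrow>
     m0 \<in> P1 n \<and> assumptions_F n \<alpha> Co L F \<and> assumptions_H n \<alpha> Co H"

definition Du :: "nat \<Rightarrow> (vec \<Rightarrow> real \<Rightarrow> real) \<Rightarrow> vec \<Rightarrow> real \<Rightarrow> vec" where
  "Du n u x t = grad n (\<lambda>y. u y t) x"

definition solves_HJB ::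
  "nat \<Rightarrow> real \<Rightarrow> (vec \<Rightarrow> vec measure \<Rightarrow> real) \<Rightarrow> (vec \<Rightarrow> vec \<Rightarrow> real) \<Rightarrow>
   (vec \<Rightarrow> real \<Rightarrow> real) \<Rightarrow> (real \<Rightarrow> vec measure) \<Rightarrow> bool" where
  "solves_HJB n lam F H u m \<longleftrightarrow>
     C21 n {0..} u \<and>
     (\<forall>x\<in>Rn n. \<forall>t>0.
        - dt {0..} u x t - laplacian n (\<lambda>y. u y t) x
          + 1 / lam * H (vscale n lam (Du n u x t)) x + lam * u x t = F x (m t))"

definition solves_FP ::
  "nat \<Rightarrow> real \<Rightarrow> vec measure \<Rightarrow> (vec \<Rightarrow> vec \<Rightarrow> real) \<Rightarrow>
   (vec \<Rightarrow> real \<Rightarrow> real) \<Rightarrow> (real \<Rightarrow> vec measure) \<Rightarrow> bool" where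
  "solves_FP n lam m0 H u m \<longleftrightarrow>
     (\<forall>t\<ge>0. m t \<in> P1 n) \<and>
     (\<forall>t\<ge>0. ((\<lambda>s. d1 n (m s) (m t)) \<longlongrightarrow> 0) (at t within {0..})) \<and>
     m 0 = m0 \<and>
     (\<exists>\<rho>. C21 n {0<..} \<rho> \<and>
        (\<forall>x\<in>Rn n. \<forall>t>0. 0 \<le> \<rho> x t) \<and>
        (\<forall>t>0. m t = density (Leb n) (\<lambda>x. ennreal (\<rho> x t))) \<and>
        (\<forall>x\<in>Rn n. \<forall>t>0.
           dt {0<..} \<rho> x t - laplacian n (\<lambda>y. \<rho> y t) x
             - divergence n (\<lambda>y. vscale n (\<rho> y t) (DpH n H (vscale n lam (Du n u y t)) y)) x = 0))"

definition MFG_solution ::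
  "nat \<Rightarrow> real \<Rightarrow> vec measure \<Rightarrow> (vec \<Rightarrow> vec measure \<Rightarrow> real) \<Rightarrow> (vec \<Rightarrow> vec \<Rightarrow> real) \<Rightarrow>
   (vec \<Rightarrow> real \<Rightarrow> real) \<Rightarrow> (real \<Rightarrow> vec measure) \<Rightarrow> bool" where
  "MFG_solution n lam m0 F H u m \<longleftrightarrow>
     solves_HJB n lam F H u m \<and>
     solves_FP n lam m0 H u m \<and>
     bdd_below ((\<lambda>(x, t). u x t) ` (Rn n \<times> {0..})) \<and>
     bdd_above ((\<lambda>(x, t). u x t / (1 + vnorm n x)) ` (Rn n \<times> {0..})) \<and>
     (SUP (x, t)\<in>Rn n \<times> {0..}. ennreal (vnorm n (Du n u x t))) < \<infinity> \<and>
     (SUP (x, t)\<in>Rn n \<times> {0..}. ennreal (mnorm n (hess (\<lambda>y. u y t) x))) \<le> 1"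

definition grad_gap ::
  "nat \<Rightarrow> real \<Rightarrow> (vec \<Rightarrow> real \<Rightarrow> real) \<Rightarrow> (vec \<Rightarrow> real \<Rightarrow> real) \<Rightarrow> real \<Rightarrow> ennreal" where
  "grad_gap n lam u1 u2 t =
     (SUP x\<in>Rn n. ennreal (vdist n (vscale n lam (Du n u1 x t)) (vscale n lam (Du n u2 x t))))"

end

theory Submission
  imports Defs
begin

text \<open>
  For large \<open>\<lambda>\<close> the two solutions have the same spatial gradient, so that the gap vanishes and both estimates
  hold with \<open>K = \<eta> = 1\<close>. Differentiating the Hamilton--Jacobi equation (in the form of maximum
  principles for first and second differences in \<open>x\<close>) bounds \<open>\<lambda> Du\<close> and its Lipschitz constant
  independently of \<open>\<lambda>\<close>, and shows that, in the norms weighted by \<open>exp (- A t)\<close>, the gap of \<open>\<lambda> Du\<close> is bounded by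
  a multiple of the gap of the measures. Conversely both flows start at \<open>m0\<close>, so stability of the
  Fokker--Planck equation bounds the weighted Wasserstein gap by \<open>1 / (A - C)\<close> times the weighted gap of
  \<open>\<lambda> Du\<close>, where \<open>C\<close> is the Lipschitz constant of the drifts. For \<open>A\<close> large the composition is a
  contraction.
\<close>

section \<open>Calculus in coordinates\<close>

text \<open>The equation for \<open>u\<close> runs backward on an infinite horizon. The discount
  \<open>lam\<close> replaces a terminal condition and also absorbs growth like
  \<open>exp (A * t)\<close> as long as \<open>A\<close> stays below \<open>lam\<close>; this is why
  weighted gaps, which are all that a forward stability estimate controls, can be fed back.
  Solutions are only C^2 in \<open>x\<close>, so comparison is applied to increments, and bounds on
  increments are turned into bounds on derivatives afterwards. The main obstacle is the quadratic
  term: if \<open>Du\<close> has Lipschitz constant M, second differences see a source of size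
  \<open>lam\<close> M^2, and the Hessian condition alone gives an M too large to iterate. A
  preliminary bound of order n / sqrt \<open>lam\<close>, obtained by reflection, makes M small;
  here the threshold acquires its dependence on the dimension. No decay of the densities at infinity
  is available, so test functions have compact support, and in place of a dual equation one step of
  a random walk with drift is applied to them. Since \<open>d1\<close> is defined by couplings, this
  needs Kantorovich duality, which is derived from a finite transport problem.\<close>

definition mv :: "nat \<Rightarrow> vec \<Rightarrow> real \<Rightarrow> vec \<Rightarrow> vec" where
  "mv n x s v = (\<lambda>i\<in>{..<n}. x i + s * v i)"

definition C1f :: "nat \<Rightarrow> (vec \<Rightarrow> real) \<Rightarrow> bool" where
  "C1f n f \<longleftrightarrow> (\<forall>i<n. (\<forall>x\<in>Rn n. has_pd i f x) \<and> continuous_on (Rn n) (pd i f))"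

lemma mv_Rn [simp]: "mv n x s v \<in> Rn n"
  by (simp add: mv_def Rn_def)

lemma mv_nth [simp]: "i < n \<Longrightarrow> mv n x s v i = x i + s * v i"
  by (simp add: mv_def)

lemma upd_Rn [simp]: "x \<in> Rn n \<Longrightarrow> i < n \<Longrightarrow> x(i := s) \<in> Rn n"
  by (auto simp: Rn_def PiE_def extensional_def)

lemma vscale_Rn [simp]: "vscale n c v \<in> Rn n"
  by (simp add: vscale_def Rn_def)

lemma vscale_nth [simp]: "i < n \<Longrightarrow> vscale n c v i = c * v i"
  by (simp add: vscale_def)

lemma grad_Rn [simp]: "grad n f x \<in> Rn n"
  by (simp add: grad_def Rn_def)

lemma grad_nth [simp]: "i < n \<Longrightarrow> grad n f x i = pd i f x"
  by (simp add: grad_def)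

lemma Rn_eqI: "x \<in> Rn n \<Longrightarrow> y \<in> Rn n \<Longrightarrow> (\<And>i. i < n \<Longrightarrow> x i = y i) \<Longrightarrow> x = y"
  unfolding Rn_def by (rule PiE_ext) auto

section \<open>Euclidean norm and distance in coordinates\<close>

lemma vnorm_nonneg [simp]: "0 \<le> vnorm n v"
  by (simp add: vnorm_def)

lemma vdist_nonneg [simp]: "0 \<le> vdist n x y"
  by (simp add: vdist_def)

lemma vnorm_cong: "(\<And>i. i < n \<Longrightarrow> v i = w i) \<Longrightarrow> vnorm n v = vnorm n w"
  unfolding vnorm_def by (rule L2_set_cong) auto

lemma vnorm_cmult: "vnorm n (\<lambda>i. c * v i) = \<bar>c\<bar> * vnorm n v"
proof -
  have "vnorm n (\<lambda>i. c * v i) = vnorm n (\<lambda>i. \<bar>c\<bar> * v i)"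
    by (simp add: vnorm_def L2_set_def power_mult_distrib)
  then show ?thesis
    by (simp add: vnorm_def L2_set_right_distrib)
qed

lemma vnorm_vscale [simp]: "vnorm n (vscale n c v) = \<bar>c\<bar> * vnorm n v"
  by (simp add: vnorm_cmult[symmetric] cong: vnorm_cong)

lemma vnorm_add: "vnorm n (\<lambda>i. v i + w i) \<le> vnorm n v + vnorm n w"
  unfolding vnorm_def by (rule L2_set_triangle_ineq)

lemma vnorm_minus: "vnorm n (\<lambda>i. - v i) = vnorm n v"
  using vnorm_cmult[of n "-1" v] by simp

lemma vnorm_diff: "vnorm n (\<lambda>i. v i - w i) \<le> vnorm n v + vnorm n w"
  using vnorm_add[of n v "\<lambda>i. - w i"] by (simp add: vnorm_minus)

lemma vnorm_comp: "i < n \<Longrightarrow> \<bar>v i\<bar> \<le> vnorm n v"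
  unfolding vnorm_def
  using member_le_L2_set[of "{..<n}" i "\<lambda>i. \<bar>v i\<bar>"] by (simp add: L2_set_def)

lemma vnorm_sq: "(vnorm n v)\<^sup>2 = (\<Sum>i<n. (v i)\<^sup>2)"
  unfolding vnorm_def L2_set_def by (simp add: sum_nonneg)

lemma vnorm_le_sum: "vnorm n v \<le> (\<Sum>i<n. \<bar>v i\<bar>)"
  unfolding vnorm_def by (rule L2_set_le_sum_abs)

lemma vnorm_eq_0: "vnorm n v = 0 \<longleftrightarrow> (\<forall>i<n. v i = 0)"
  unfolding vnorm_def by (auto simp: L2_set_eq_0_iff)

lemma vnorm_le_const: "(\<And>i. i < n \<Longrightarrow> \<bar>v i\<bar> \<le> c) \<Longrightarrow> vnorm n v \<le> real n * c"
proof -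
  assume a: "\<And>i. i < n \<Longrightarrow> \<bar>v i\<bar> \<le> c"
  have "(\<Sum>i<n. \<bar>v i\<bar>) \<le> (\<Sum>i<n. c)" by (rule sum_mono) (use a in auto)
  then show ?thesis using vnorm_le_sum[of n v] by simp
qed

lemma vnorm_unit: "i < n \<Longrightarrow> vnorm n ((\<lambda>_. 0)(i := c)) = \<bar>c\<bar>"
proof -
  assume i: "i < n"
  have "(\<Sum>j<n. (((\<lambda>_. 0)(i := c)) j)\<^sup>2) = (\<Sum>j<n. if j = i then c\<^sup>2 else 0)"
    by (rule sum.cong) auto
  then show ?thesis using i by (simp add: vnorm_def L2_set_def)
qed

lemma vdist_upd:
  assumes "i < n"
  shows "vdist n (x(i := s)) (x(i := r)) = \<bar>s - r\<bar>"
proof -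
  have "vdist n (x(i := s)) (x(i := r)) = vnorm n ((\<lambda>_. 0)(i := s - r))"
    unfolding vdist_def by (rule vnorm_cong) auto
  then show ?thesis using vnorm_unit[OF assms] by simp
qed

lemma CS: "\<bar>\<Sum>i<n. v i * w i\<bar> \<le> vnorm n v * vnorm n w"
proof -
  have "\<bar>\<Sum>i<n. v i * w i\<bar> \<le> (\<Sum>i<n. \<bar>v i\<bar> * \<bar>w i\<bar>)"
    by (rule order_trans[OF sum_abs]) (simp add: abs_mult)
  then show ?thesis using L2_set_mult_ineq[of v w "{..<n}"] by (simp add: vnorm_def)
qed

lemma vdist_triangle: "vdist n x z \<le> vdist n x y + vdist n y z"
  using vnorm_add[of n "\<lambda>i. x i - y i" "\<lambda>i. y i - z i"] by (simp add: vdist_def)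

lemma vdist_commute: "vdist n x y = vdist n y x"
  using vnorm_minus[of n "\<lambda>i. x i - y i"] by (simp add: vdist_def)

lemma vdist_self [simp]: "vdist n x x = 0"
  by (simp add: vdist_def vnorm_def L2_set_def)

lemma vdist_mv: "vdist n (mv n x s v) x = \<bar>s\<bar> * vnorm n v"
  by (simp add: vdist_def vnorm_cmult[symmetric] cong: vnorm_cong)

lemma vdist_mv2: "vdist n (mv n x s v) (mv n y s v) = vdist n x y"
  by (simp add: vdist_def cong: vnorm_cong)

lemma vnorm_dist: "\<bar>vnorm n x - vnorm n y\<bar> \<le> vdist n x y"
  using vnorm_add[of n "\<lambda>i. x i - y i" y] vnorm_add[of n "\<lambda>i. y i - x i" x] vdist_commute[of n x y]
  by (simp add: vdist_def)

lemma mv_0 [simp]: "x \<in> Rn n \<Longrightarrow> mv n x 0 v = x"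
  by (rule Rn_eqI) auto

lemma mv_upd: "i < n \<Longrightarrow> mv n (x(i := s)) r e = (mv n x r e)(i := s + r * e i)"
  by (auto simp: mv_def fun_eq_iff)

section \<open>Topology of R^n as a subset of the function space\<close>

lemma seq_tendsto_coord:
  fixes X :: "nat \<Rightarrow> vec"
  shows "X \<longlonglongrightarrow> x \<longleftrightarrow> (\<forall>i. (\<lambda>k. X k i) \<longlonglongrightarrow> x i)"
  using limitin_componentwise[of "\<lambda>_::nat. euclidean :: real topology" UNIV X x sequentially]
  by (simp add: euclidean_product_topology)

text \<open>By contradiction through a sequence: all points of \<open>Rn n\<close> agree (value
  \<open>undefined\<close>) in the coordinates from \<open>n\<close> on, so closeness in the first
  \<open>n\<close> coordinates already forces convergence in the product topology.\<close>

lemma continuous_on_eps: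
  fixes f :: "vec \<Rightarrow> 'b::metric_space"
  assumes "continuous_on (Rn n) f" "x \<in> Rn n" "\<epsilon> > 0"
  shows "\<exists>\<delta>>0. \<forall>y\<in>Rn n. (\<forall>i<n. \<bar>y i - x i\<bar> < \<delta>) \<longrightarrow> dist (f y) (f x) < \<epsilon>"
proof (rule ccontr)
  assume neg: "\<not> ?thesis"
  have "\<forall>k. \<exists>y\<in>Rn n. (\<forall>i<n. \<bar>y i - x i\<bar> < 1 / real (Suc k)) \<and> \<not> dist (f y) (f x) < \<epsilon>"
  proof
    fix k show "\<exists>y\<in>Rn n. (\<forall>i<n. \<bar>y i - x i\<bar> < 1 / real (Suc k)) \<and> \<not> dist (f y) (f x) < \<epsilon>"
    proof -
      have "1 / real (Suc k) > 0" by simp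
      then show ?thesis using neg by blast
    qed
  qed
  then obtain Y where Y: "\<And>k. Y k \<in> Rn n" "\<And>k i. i < n \<Longrightarrow> \<bar>Y k i - x i\<bar> < 1 / real (Suc k)"
    "\<And>k. \<not> dist (f (Y k)) (f x) < \<epsilon>"
    by metis
  have "Y \<longlonglongrightarrow> x" unfolding seq_tendsto_coord
  proof
    fix i
    show "(\<lambda>k. Y k i) \<longlonglongrightarrow> x i"
    proof (cases "i < n")
      case True
      have "(\<lambda>k. Y k i - x i) \<longlonglongrightarrow> 0"
        by (rule tendsto_rabs_zero_cancel, rule real_tendsto_sandwich[OF _ _ tendsto_const LIMSEQ_inverse_real_of_nat])
           (use Y(2)[OF True] in \<open>auto intro!: always_eventually less_imp_le simp: inverse_eq_divide\<close>)
      then show ?thesis by (simp add: LIM_zero_iff)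
    next
      case False
      then have "Y k i = x i" for k
        using Y(1)[of k] assms(2) by (auto simp: Rn_def PiE_def extensional_def)
      then show ?thesis by simp
    qed
  qed
  then have "(\<lambda>k. f (Y k)) \<longlonglongrightarrow> f x"
    using assms(1,2) Y(1) unfolding continuous_on_sequentially by (auto simp: o_def)
  then have "\<forall>\<^sub>F k in sequentially. dist (f (Y k)) (f x) < \<epsilon>" using assms(3) by (rule tendstoD)
  then show False using Y(3) by simp
qed

lemma continuous_on_Rn_vec:
  fixes g :: "'a::topological_space \<Rightarrow> vec"
  assumes "\<And>i. i < n \<Longrightarrow> continuous_on S (\<lambda>x. g x i)" "\<And>x. x \<in> S \<Longrightarrow> g x \<in> Rn n"
  shows "continuous_on S g"
proof (rule continuous_on_coordinatewise_then_product)
  fix i show "continuous_on S (\<lambda>x. g x i)"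
  proof (cases "i < n")
    case False
    then have "g x i = undefined" if "x \<in> S" for x
      using assms(2)[OF that] by (auto simp: Rn_def PiE_def extensional_def)
    then show ?thesis by (simp cong: continuous_on_cong)
  qed (use assms in auto)
qed

lemma continuous_on_nth: "continuous_on S f \<Longrightarrow> continuous_on S (\<lambda>x. (f x :: vec) i)"
  by (rule continuous_on_product_then_coordinatewise)

text \<open>Tychonoff: the box is a product over all indices whose factors from \<open>n\<close> on
  are the singleton of \<open>undefined\<close>.\<close>

lemma compact_box: "compact {x \<in> Rn n. \<forall>i<n. \<bar>x i\<bar> \<le> R}"
proof -
  have "{x \<in> Rn n. \<forall>i<n. \<bar>x i\<bar> \<le> R} = PiE UNIV (\<lambda>i. if i < n then {-R..R} else {undefined})"
    by (auto simp: Rn_def PiE_def extensional_def Pi_def abs_le_iff split: if_splits)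
  moreover have "compactin (product_topology (\<lambda>_. euclidean) UNIV) (PiE UNIV (\<lambda>i. if i < n then {-R..R} else {undefined::real}))"
    by (subst compactin_PiE) auto
  ultimately show ?thesis
    by (simp add: euclidean_product_topology)
qed

section \<open>Partial derivatives, chain rule and mean value theorem\<close>

lemma pd_has_derivative:
  assumes "has_pd i f x"
  shows "((\<lambda>s. f (x(i := s))) has_real_derivative pd i f x) (at (x i))"
  using assms unfolding has_pd_def pd_def by (simp add: DERIV_deriv_iff_real_differentiable)

lemma pd_has_derivative_upd:
  assumes "has_pd i f (x(i := s))"
  shows "((\<lambda>s. f (x(i := s))) has_real_derivative pd i f (x(i := s))) (at s)"
  using pd_has_derivative[OF assms] by simp

lemma pd_eqI:
  assumes "((\<lambda>s. f (x(i := s))) has_real_derivative D) (at (x i))"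
  shows "pd i f x = D" "has_pd i f x"
  using assms unfolding has_pd_def pd_def by (auto intro!: DERIV_imp_deriv simp: real_differentiable_def)

text \<open>Differentiability from continuous partial derivatives: change one coordinate at a time.\<close>

lemma C1f_frechet:
  assumes f: "C1f n f" and x: "x \<in> Rn n" and e: "e > 0"
  shows "\<exists>\<delta>>0. \<forall>y\<in>Rn n. (\<forall>i<n. \<bar>y i - x i\<bar> < \<delta>) \<longrightarrow>
    \<bar>f y - f x - (\<Sum>i<n. pd i f x * (y i - x i))\<bar> \<le> e * (\<Sum>i<n. \<bar>y i - x i\<bar>)"
proof -
  have "\<forall>i\<in>{..<n}. \<exists>\<delta>>0. \<forall>y\<in>Rn n. (\<forall>j<n. \<bar>y j - x j\<bar> < \<delta>) \<longrightarrow> dist (pd i f y) (pd i f x) < e"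
  proof
    fix i assume "i \<in> {..<n}"
    then have "continuous_on (Rn n) (pd i f)" using f by (auto simp: C1f_def)
    then show "\<exists>\<delta>>0. \<forall>y\<in>Rn n. (\<forall>j<n. \<bar>y j - x j\<bar> < \<delta>) \<longrightarrow> dist (pd i f y) (pd i f x) < e"
      using x e by (rule continuous_on_eps)
  qed
  then obtain D where D: "\<And>i. i < n \<Longrightarrow> D i > (0::real)"
    "\<And>i y. i < n \<Longrightarrow> y \<in> Rn n \<Longrightarrow> (\<forall>j<n. \<bar>y j - x j\<bar> < D i) \<Longrightarrow> dist (pd i f y) (pd i f x) < e"
    unfolding bchoice_iff by auto
  \<comment> \<open>The extra element 1 keeps the minimum meaningful for
    \<open>n = 0\<close>.\<close>
  define \<delta> where "\<delta> = Min (insert 1 (D ` {..<n}))"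
  have \<delta>: "\<delta> > 0" "\<And>i. i < n \<Longrightarrow> \<delta> \<le> D i" unfolding \<delta>_def using D(1) by auto
  show ?thesis
  proof (intro exI[of _ \<delta>] conjI ballI impI \<delta>(1))
    fix y assume y: "y \<in> Rn n" "\<forall>i<n. \<bar>y i - x i\<bar> < \<delta>"
    define w where "w k = (\<lambda>i. if i < k then y i else x i)" for k
    have wR: "w k \<in> Rn n" for k
      using x y(1) by (auto simp: w_def Rn_def PiE_def extensional_def)
    have w0: "w 0 = x" by (auto simp: w_def)
    have wn: "w n = y" by (rule Rn_eqI[OF wR y(1)]) (auto simp: w_def)
    have step: "\<bar>f (w (Suc k)) - f (w k) - pd k f x * (y k - x k)\<bar> \<le> e * \<bar>y k - x k\<bar>" if k: "k < n" for k
    proof -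
      have ws: "w (Suc k) = (w k)(k := y k)" "w k = (w k)(k := x k)"
        by (auto simp: w_def fun_eq_iff less_Suc_eq)
      define g where "g = (\<lambda>s. f ((w k)(k := s)))"
      have dg: "(g has_real_derivative pd k f ((w k)(k := s))) (at s)" for s
        unfolding g_def using f k wR by (intro pd_has_derivative_upd) (auto simp: C1f_def)
      have bd: "\<bar>pd k f ((w k)(k := s)) - pd k f x\<bar> < e" if s: "\<bar>s - x k\<bar> \<le> \<bar>y k - x k\<bar>" for s
      proof -
        have "\<bar>((w k)(k := s)) j - x j\<bar> < D k" if "j < n" for j
          using y(2) that k s \<delta>(1) \<delta>(2)[OF k] by (auto simp: w_def intro: le_less_trans less_le_trans)
        then show ?thesis using D(2)[OF k, of "(w k)(k := s)"] wR k by (auto simp: dist_real_def)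
      qed
      have "\<exists>z. \<bar>z - x k\<bar> \<le> \<bar>y k - x k\<bar> \<and> g (y k) - g (x k) = (y k - x k) * pd k f ((w k)(k := z))"
      proof (cases "x k" "y k" rule: linorder_cases)
        case less
        from MVT2[OF this, of g "\<lambda>s. pd k f ((w k)(k := s))"] dg
        obtain z where "x k < z" "z < y k" "g (y k) - g (x k) = (y k - x k) * pd k f ((w k)(k := z))" by auto
        then show ?thesis by (intro exI[of _ z]) auto
      next
        case greater
        from MVT2[OF this, of g "\<lambda>s. pd k f ((w k)(k := s))"] dg
        obtain z where "y k < z" "z < x k" "g (x k) - g (y k) = (x k - y k) * pd k f ((w k)(k := z))" by auto
        then show ?thesis by (intro exI[of _ z]) (auto simp: algebra_simps)
      qed auto
      then obtain z where z: "\<bar>z - x k\<bar> \<le> \<bar>y k - x k\<bar>" "g (y k) - g (x k) = (y k - x k) * pd k f ((w k)(k := z))" by auto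
      have "f (w (Suc k)) - f (w k) - pd k f x * (y k - x k) = (y k - x k) * (pd k f ((w k)(k := z)) - pd k f x)"
        using z(2) ws unfolding g_def by (simp add: algebra_simps)
      also have "\<bar>\<dots>\<bar> \<le> \<bar>y k - x k\<bar> * e"
        unfolding abs_mult using bd[OF z(1)] by (intro mult_left_mono) auto
      finally show ?thesis by (simp add: mult.commute)
    qed
    have "f y - f x = (\<Sum>k<n. f (w (Suc k)) - f (w k))"
      using sum_lessThan_telescope[of "\<lambda>k. f (w k)" n] by (simp add: w0 wn)
    then have "f y - f x - (\<Sum>i<n. pd i f x * (y i - x i)) = (\<Sum>k<n. f (w (Suc k)) - f (w k) - pd k f x * (y k - x k))"
      by (simp add: sum_subtractf)
    also have "\<bar>\<dots>\<bar> \<le> (\<Sum>k<n. e * \<bar>y k - x k\<bar>)"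
      by (rule order_trans[OF sum_abs]) (rule sum_mono, use step in auto)
    finally show "\<bar>f y - f x - (\<Sum>i<n. pd i f x * (y i - x i))\<bar> \<le> e * (\<Sum>i<n. \<bar>y i - x i\<bar>)"
      by (simp add: sum_distrib_left)
  qed
qed

text \<open>The first order remainder \<open>R\<close> is small relative to the coordinate
  increments, and these are at most a fixed multiple of \<open>h\<close> because their quotients
  converge; \<open>B\<close> is any number above the limit.\<close>

lemma C1f_chain:
  assumes f: "C1f n f" and g: "\<And>s. \<gamma> s \<in> Rn n"
    and d: "\<And>i. i < n \<Longrightarrow> ((\<lambda>s. \<gamma> s i) has_real_derivative \<gamma>' i) (at s0)"
  shows "((\<lambda>s. f (\<gamma> s)) has_real_derivative (\<Sum>i<n. pd i f (\<gamma> s0) * \<gamma>' i)) (at s0)"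
proof -
  define R where "R y = f y - f (\<gamma> s0) - (\<Sum>i<n. pd i f (\<gamma> s0) * (y i - \<gamma> s0 i))" for y
  define q where "q i h = (\<gamma> (s0 + h) i - \<gamma> s0 i) / h" for i h
  have q: "(q i \<longlongrightarrow> \<gamma>' i) (at 0)" if "i < n" for i
    using d[OF that] unfolding DERIV_def q_def by simp
  have qs: "((\<lambda>h. \<Sum>i<n. \<bar>q i h\<bar>) \<longlongrightarrow> (\<Sum>i<n. \<bar>\<gamma>' i\<bar>)) (at 0)"
    by (intro tendsto_sum tendsto_rabs q) auto
  define B where "B = (\<Sum>i<n. \<bar>\<gamma>' i\<bar>) + 1"
  have B: "B > 0" unfolding B_def by (intro add_nonneg_pos sum_nonneg) auto
  have evB: "\<forall>\<^sub>F h in at 0. (\<Sum>i<n. \<bar>q i h\<bar>) < B"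
    by (rule order_tendstoD(2)[OF qs]) (simp add: B_def)
  have "((\<lambda>h. R (\<gamma> (s0 + h)) / h) \<longlongrightarrow> 0) (at 0)"
  proof (rule tendstoI)
    fix e :: real assume e: "e > 0"
    have eB: "e / (2 * B) > 0" using e B by simp
    obtain \<delta> where \<delta>: "\<delta> > 0" "\<forall>y\<in>Rn n. (\<forall>i<n. \<bar>y i - \<gamma> s0 i\<bar> < \<delta>) \<longrightarrow>
      \<bar>R y\<bar> \<le> (e / (2 * B)) * (\<Sum>i<n. \<bar>y i - \<gamma> s0 i\<bar>)"
      using C1f_frechet[OF f g eB, of s0] unfolding R_def by blast
    have "\<forall>\<^sub>F h in at 0. \<forall>i\<in>{..<n}. \<bar>\<gamma> (s0 + h) i - \<gamma> s0 i\<bar> < \<delta>"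
    proof (rule eventually_ball_finite, simp, intro ballI)
      fix i assume "i \<in> {..<n}"
      then have "isCont (\<lambda>s. \<gamma> s i) s0" using d DERIV_isCont by blast
      then have "((\<lambda>h. \<gamma> (s0 + h) i) \<longlongrightarrow> \<gamma> s0 i) (at 0)" by (simp add: isCont_iff)
      then show "\<forall>\<^sub>F h in at 0. \<bar>\<gamma> (s0 + h) i - \<gamma> s0 i\<bar> < \<delta>"
        using \<delta>(1) by (auto dest: tendstoD simp: dist_real_def)
    qed
    then show "\<forall>\<^sub>F h in at 0. dist (R (\<gamma> (s0 + h)) / h) 0 < e"
      using evB
    proof (eventually_elim)
      case (elim h)
      have "\<bar>R (\<gamma> (s0 + h))\<bar> \<le> (e / (2 * B)) * (\<Sum>i<n. \<bar>\<gamma> (s0 + h) i - \<gamma> s0 i\<bar>)"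
        using \<delta>(2)[rule_format, OF g] elim(1) by auto
      also have "\<dots> = \<bar>h\<bar> * ((e / (2 * B)) * (\<Sum>i<n. \<bar>q i h\<bar>))" if "h \<noteq> 0"
        using that by (simp add: q_def sum_divide_distrib[symmetric])
      finally have "h \<noteq> 0 \<Longrightarrow> \<bar>R (\<gamma> (s0 + h))\<bar> / \<bar>h\<bar> \<le> (e / (2 * B)) * (\<Sum>i<n. \<bar>q i h\<bar>)"
        by (simp add: field_simps)
      also have "\<dots> \<le> (e / (2 * B)) * B" using elim(2) e B by (intro mult_left_mono) auto
      finally have "h \<noteq> 0 \<Longrightarrow> \<bar>R (\<gamma> (s0 + h)) / h\<bar> \<le> e / 2" using B unfolding abs_divide by simp
      moreover have "e / 2 < e" using e by simp
      ultimately have "h \<noteq> 0 \<Longrightarrow> \<bar>R (\<gamma> (s0 + h)) / h\<bar> < e" by linarith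
      then show ?case using e by (cases "h = 0") (auto simp: dist_real_def)
    qed
  qed
  moreover have "((\<lambda>h. \<Sum>i<n. pd i f (\<gamma> s0) * q i h) \<longlongrightarrow> (\<Sum>i<n. pd i f (\<gamma> s0) * \<gamma>' i)) (at 0)"
    by (intro tendsto_sum tendsto_mult tendsto_const q) auto
  ultimately have "((\<lambda>h. R (\<gamma> (s0 + h)) / h + (\<Sum>i<n. pd i f (\<gamma> s0) * q i h)) \<longlongrightarrow> 0 + (\<Sum>i<n. pd i f (\<gamma> s0) * \<gamma>' i)) (at 0)"
    by (rule tendsto_add)
  moreover have "R (\<gamma> (s0 + h)) / h + (\<Sum>i<n. pd i f (\<gamma> s0) * q i h) = (f (\<gamma> (s0 + h)) - f (\<gamma> s0)) / h" for h
  proof -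
    have "(\<Sum>i<n. pd i f (\<gamma> s0) * q i h) = (\<Sum>i<n. pd i f (\<gamma> s0) * (\<gamma> (s0 + h) i - \<gamma> s0 i)) / h"
      by (simp add: q_def sum_divide_distrib)
    then show ?thesis unfolding R_def by (simp add: diff_divide_distrib)
  qed
  ultimately show ?thesis unfolding DERIV_def by simp
qed

lemma C1f_line:
  assumes "C1f n f"
  shows "((\<lambda>s. f (mv n x s v)) has_real_derivative (\<Sum>i<n. pd i f (mv n x s v) * v i)) (at s)"
  by (rule C1f_chain[OF assms]) (auto intro!: derivative_eq_intros)

lemma C1f_mvt:
  assumes f: "C1f n f" and x: "x \<in> Rn n" and y: "y \<in> Rn n"
  obtains \<theta> where "0 < \<theta>" "\<theta> < 1"
    "f y - f x = (\<Sum>i<n. pd i f (mv n x \<theta> (\<lambda>i. y i - x i)) * (y i - x i))"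
proof -
  have y1: "mv n x 1 (\<lambda>i. y i - x i) = y" by (rule Rn_eqI[OF _ y]) auto
  from MVT2[of 0 1 "\<lambda>s. f (mv n x s (\<lambda>i. y i - x i))", OF _ C1f_line[OF f]]
  obtain z where "0 < z" "z < 1" "f y - f x = (\<Sum>i<n. pd i f (mv n x z (\<lambda>i. y i - x i)) * (y i - x i))"
    using x y1 by auto
  then show ?thesis by (rule that)
qed

lemma C1f_lipschitz:
  assumes f: "C1f n f" and x: "x \<in> Rn n" and y: "y \<in> Rn n"
    and b: "\<And>z. z \<in> Rn n \<Longrightarrow> vnorm n (grad n f z) \<le> M"
  shows "\<bar>f y - f x\<bar> \<le> M * vdist n y x"
proof -
  obtain \<theta> where t: "f y - f x = (\<Sum>i<n. pd i f (mv n x \<theta> (\<lambda>i. y i - x i)) * (y i - x i))"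
    using C1f_mvt[OF f x y] by metis
  have "(\<Sum>i<n. pd i f (mv n x \<theta> (\<lambda>i. y i - x i)) * (y i - x i)) = (\<Sum>i<n. grad n f (mv n x \<theta> (\<lambda>i. y i - x i)) i * (y i - x i))"
    by (rule sum.cong) auto
  also have "\<bar>\<dots>\<bar> \<le> vnorm n (grad n f (mv n x \<theta> (\<lambda>i. y i - x i))) * vnorm n (\<lambda>i. y i - x i)"
    by (rule CS)
  also have "\<dots> \<le> M * vnorm n (\<lambda>i. y i - x i)"
    by (intro mult_right_mono b) auto
  finally show ?thesis using t by (simp add: vdist_def)
qed

text \<open>Tested with \<open>v\<close> divided by its norm; nonnegativity of \<open>M\<close>
  covers a vanishing \<open>v\<close>, where there is nothing to normalise.\<close>

lemma vnorm_dual: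
  assumes "\<And>w. w \<in> Rn n \<Longrightarrow> vnorm n w = 1 \<Longrightarrow> (\<Sum>i<n. v i * w i) \<le> M" "0 \<le> M"
  shows "vnorm n v \<le> M"
proof (cases "vnorm n v = 0")
  case False
  define w where "w = vscale n (1 / vnorm n v) v"
  have p: "vnorm n v > 0" using False vnorm_nonneg[of n v] by linarith
  have "(\<Sum>i<n. v i * w i) = (\<Sum>i<n. (v i)\<^sup>2) / vnorm n v"
    unfolding w_def by (simp add: sum_divide_distrib power2_eq_square)
  also have "\<dots> = vnorm n v" unfolding vnorm_sq[symmetric] using p by (simp add: power2_eq_square)
  finally show ?thesis using assms(1)[of w] p unfolding w_def by simp
qed (use assms in auto)

text \<open>Turns comparison results into derivative bounds. One-sided increments suffice because
  every unit direction is tested, its opposite included, and small increments along it produce the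
  directional derivative.\<close>

lemma C1f_grad_bound:
  assumes f: "C1f n f" and x: "x \<in> Rn n" and M: "0 \<le> M"
    and b: "\<And>e. e \<in> Rn n \<Longrightarrow> vnorm n e \<le> 1 \<Longrightarrow> f (mv n x 1 e) - f x \<le> M * vnorm n e"
  shows "vnorm n (grad n f x) \<le> M"
proof (rule vnorm_dual[OF _ M])
  fix w assume w: "w \<in> Rn n" "vnorm n w = 1"
  define l where "l = (\<Sum>i<n. grad n f x i * w i)"
  have "((\<lambda>s. f (mv n x s w)) has_real_derivative l) (at 0)"
    using C1f_line[OF f, of x w 0] x by (simp add: l_def)
  then have lim: "((\<lambda>h. (f (mv n x h w) - f x) / h) \<longlongrightarrow> l) (at 0)" unfolding DERIV_def using x by simp
  have "((\<lambda>h. (f (mv n x h w) - f x) / h) \<longlongrightarrow> l) (at_right 0)"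
    using lim by (rule filterlim_mono[OF _ order_refl at_le]) auto
  then show "l \<le> M"
  proof (rule tendsto_upperbound)
    show "\<forall>\<^sub>F h in at_right 0. (f (mv n x h w) - f x) / h \<le> M"
      unfolding eventually_at_right_field
    proof (intro exI[of _ 1] conjI allI impI)
      fix h :: real assume h: "0 < h" "h < 1"
      have "mv n x 1 (vscale n h w) = mv n x h w" by (auto simp: mv_def vscale_def)
      then have "f (mv n x h w) - f x \<le> M * h" using b[of "vscale n h w"] w h by simp
      then show "(f (mv n x h w) - f x) / h \<le> M" using h by (simp add: field_simps)
    qed simp
  qed simp
qed

text \<open>Bisection: the increments over dyadic steps telescope.\<close>

lemma second_difference_taylor:
  fixes g :: "real \<Rightarrow> real"
  assumes g: "(g has_real_derivative l) (at 0)"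
    and b: "\<And>h. \<bar>g (2 * h) - 2 * g h + g 0\<bar> \<le> K * h\<^sup>2"
  shows "\<bar>g 1 - g 0 - l\<bar> \<le> K"
proof -
  \<comment> \<open>Difference quotients with step 2^(-k): \<open>D 0\<close> is the full increment
    and the limit is \<open>l\<close>.\<close>
  define D where "D k = 2 ^ k * (g (1 / 2 ^ k) - g 0)" for k :: nat
  have K: "K \<ge> 0" using b[of 1] by simp
  \<comment> \<open>Consecutive quotients differ by \<open>2 ^ k\<close> times a second difference
    with \<open>h = 1 / 2 ^ Suc k\<close>, so the errors form a geometric series.\<close>
  have stp: "\<bar>D k - D (Suc k)\<bar> \<le> K / 4 / 2 ^ k" for k
  proof -
    have "D k - D (Suc k) = 2 ^ k * (g (2 * (1 / 2 ^ Suc k)) - 2 * g (1 / 2 ^ Suc k) + g 0)"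
      by (simp add: D_def algebra_simps)
    also have "\<bar>\<dots>\<bar> \<le> 2 ^ k * (K * (1 / 2 ^ Suc k)\<^sup>2)"
      unfolding abs_mult using b[of "1 / 2 ^ Suc k"] by (intro mult_mono) auto
    also have "\<dots> = K / 4 / 2 ^ k" by (simp add: power2_eq_square field_simps)
    finally show ?thesis .
  qed
  have dist: "\<bar>D 0 - D k\<bar> \<le> K / 2 * (1 - 1 / 2 ^ k)" for k
  proof (induction k)
    case (Suc k)
    have "\<bar>D 0 - D (Suc k)\<bar> \<le> K / 2 * (1 - 1 / 2 ^ k) + K / 4 / 2 ^ k"
      using Suc stp[of k] by linarith
    also have "\<dots> = K / 2 * (1 - 1 / 2 ^ Suc k)" by (simp add: field_simps)
    finally show ?case .
  qed simp
  have "((\<lambda>h. (g h - g 0) / h) \<longlongrightarrow> l) (at 0)" using g unfolding DERIV_def by simp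
  moreover have "filterlim (\<lambda>k::nat. 1 / 2 ^ k :: real) (at 0) sequentially"
    unfolding filterlim_at using LIMSEQ_divide_realpow_zero[of 2 1] by simp
  ultimately have "(\<lambda>k. (g (1 / 2 ^ k) - g 0) / (1 / 2 ^ k)) \<longlonglongrightarrow> l"
    by (rule filterlim_compose)
  then have "D \<longlonglongrightarrow> l" by (simp add: D_def[abs_def] mult.commute)
  then have "(\<lambda>k. \<bar>D 0 - D k\<bar>) \<longlonglongrightarrow> \<bar>D 0 - l\<bar>" by (intro tendsto_intros)
  then have "\<bar>D 0 - l\<bar> \<le> K"
  proof (rule tendsto_upperbound)
    show "\<forall>\<^sub>F k in sequentially. \<bar>D 0 - D k\<bar> \<le> K"
    proof (rule always_eventually, rule allI)
      fix k
      have "K / 2 * (1 - 1 / 2 ^ k) \<le> K / 2 * 1" using K by (intro mult_left_mono) auto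
      then show "\<bar>D 0 - D k\<bar> \<le> K" using dist[of k] K by linarith
    qed
  qed simp
  then show ?thesis by (simp add: D_def)
qed

text \<open>Small second differences make \<open>f\<close> a quadratic perturbation of its tangents.
  The expansions at \<open>x\<close> and \<open>y\<close> are compared at a third point
  \<open>z\<close> at distance \<open>d\<close> from \<open>y\<close>, in the direction being
  tested. The errors are \<open>K * d^2\<close>, \<open>4 * K * d^2\<close> and
  \<open>K * d^2\<close>: hence the constant 6.\<close>

lemma second_difference_grad_lipschitz:
  assumes f: "C1f n f" and x: "x \<in> Rn n" and y: "y \<in> Rn n" and K0: "0 \<le> K"
    and b: "\<And>x e. x \<in> Rn n \<Longrightarrow> e \<in> Rn n \<Longrightarrow>
      \<bar>f (mv n x 1 e) + f (mv n x (-1) e) - 2 * f x\<bar> \<le> K * (vnorm n e)\<^sup>2"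
  shows "vdist n (grad n f x) (grad n f y) \<le> 6 * K * vdist n x y"
proof -
  have tay: "\<bar>f y - f x - (\<Sum>i<n. pd i f x * (y i - x i))\<bar> \<le> K * (vdist n y x)\<^sup>2"
    if x: "x \<in> Rn n" and y: "y \<in> Rn n" for x y
  proof -
    define v where "v = (\<lambda>i. y i - x i)"
    define g where "g s = f (mv n x s v)" for s
    have "(g has_real_derivative (\<Sum>i<n. pd i f x * v i)) (at 0)"
      using C1f_line[OF f, of x v 0] x by (simp add: g_def[abs_def])
    moreover have "\<bar>g (2 * h) - 2 * g h + g 0\<bar> \<le> (K * (vnorm n v)\<^sup>2) * h\<^sup>2" for h
    proof -
      have "mv n (mv n x h v) 1 (vscale n h v) = mv n x (2 * h) v"
        "mv n (mv n x h v) (-1) (vscale n h v) = mv n x 0 v" by (auto simp: mv_def)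
      then show ?thesis using b[of "mv n x h v" "vscale n h v"] unfolding g_def
        by (simp add: power_mult_distrib mult_ac)
    qed
    ultimately have "\<bar>g 1 - g 0 - (\<Sum>i<n. pd i f x * v i)\<bar> \<le> K * (vnorm n v)\<^sup>2"
      by (rule second_difference_taylor)
    moreover have "mv n x 1 v = y" by (rule Rn_eqI[OF _ y]) (auto simp: v_def)
    ultimately show ?thesis using x by (simp add: g_def v_def vdist_def)
  qed
  define d where "d = vdist n x y"
  have d0: "d \<ge> 0" by (simp add: d_def)
  have *: "(\<Sum>i<n. (grad n f y i - grad n f x i) * w i) \<le> 6 * K * d" if w: "w \<in> Rn n" "vnorm n w = 1" for w
  proof (cases "d = 0")
    case True
    then have "x = y" unfolding d_def vdist_def vnorm_eq_0 by (intro Rn_eqI[OF x y]) auto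
    then show ?thesis using True by simp
  next
    case False
    with d0 have dp: "d > 0" by simp
    define z where "z = mv n y d w"
    have z: "z \<in> Rn n" by (simp add: z_def)
    have zy: "vdist n z y = d" using w(2) dp by (simp add: z_def vdist_mv)
    have zx: "vdist n z x \<le> 2 * d" using vdist_triangle[of n z x y] zy by (simp add: d_def vdist_commute)
    have zx2: "(vdist n z x)\<^sup>2 \<le> 4 * d\<^sup>2"
      using power_mono[OF zx, of 2] by (simp add: power_mult_distrib)
    have A: "\<bar>f y - f x - (\<Sum>i<n. pd i f x * (y i - x i))\<bar> \<le> K * d\<^sup>2"
      using tay[OF x y] by (simp add: d_def vdist_commute)
    have B: "\<bar>f z - f x - (\<Sum>i<n. pd i f x * (z i - x i))\<bar> \<le> K * (4 * d\<^sup>2)"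
      using tay[OF x z] mult_left_mono[OF zx2 K0] by linarith
    have C: "\<bar>f z - f y - (\<Sum>i<n. pd i f y * (z i - y i))\<bar> \<le> K * d\<^sup>2"
      using tay[OF y z] zy by simp
    have "(\<Sum>i<n. pd i f x * (z i - x i)) = (\<Sum>i<n. pd i f x * (z i - y i)) + (\<Sum>i<n. pd i f x * (y i - x i))"
      by (simp add: sum.distrib[symmetric] algebra_simps)
    then have "(\<Sum>i<n. pd i f y * (z i - y i)) - (\<Sum>i<n. pd i f x * (z i - y i)) \<le> 6 * K * d\<^sup>2"
      using A B C by (simp add: abs_le_iff)
    also have "(\<Sum>i<n. pd i f y * (z i - y i)) - (\<Sum>i<n. pd i f x * (z i - y i)) = d * (\<Sum>i<n. (grad n f y i - grad n f x i) * w i)"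
      by (simp add: sum_subtractf[symmetric] sum_distrib_left z_def algebra_simps)
    finally have "d * (\<Sum>i<n. (grad n f y i - grad n f x i) * w i) \<le> d * (6 * K * d)"
      by (simp add: power2_eq_square mult_ac)
    then show ?thesis using dp by simp
  qed
  have "vnorm n (\<lambda>i. grad n f y i - grad n f x i) \<le> 6 * K * d"
    by (rule vnorm_dual) (use * K0 d0 in auto)
  then show ?thesis using vdist_commute[of n "grad n f x" "grad n f y"] by (simp add: vdist_def d_def)
qed

section \<open>Maximum principles\<close>

text \<open>The derivatives are carried as explicit functions, so that sums, shifts and reflections
  of solutions come with theirs. Only the pure second derivatives occur, which is what the Laplacian
  sees, and time is positive throughout.\<close>

definition D21 :: "nat \<Rightarrow> (vec \<Rightarrow> real \<Rightarrow> real) \<Rightarrow> (vec \<Rightarrow> real \<Rightarrow> real) \<Rightarrow>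
    (nat \<Rightarrow> vec \<Rightarrow> real \<Rightarrow> real) \<Rightarrow> (nat \<Rightarrow> vec \<Rightarrow> real \<Rightarrow> real) \<Rightarrow> bool" where
  "D21 n z zt zi zii \<longleftrightarrow> continuous_on (Rn n \<times> {0<..}) (\<lambda>(x, t). z x t) \<and>
    (\<forall>x\<in>Rn n. \<forall>t>0. (z x has_real_derivative zt x t) (at t) \<and>
      (\<forall>i<n. ((\<lambda>s. z (x(i := s)) t) has_real_derivative zi i x t) (at (x i)) \<and>
             ((\<lambda>s. zi i (x(i := s)) t) has_real_derivative zii i x t) (at (x i))))"

text \<open>If \<open>l\<close> were positive, \<open>g'\<close> would be positive just to the right
  of \<open>s0\<close>, and the mean value theorem would lift \<open>g\<close> above its value at
  \<open>s0\<close>.\<close>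

lemma local_max_second_derivative:
  fixes g :: "real \<Rightarrow> real"
  assumes g: "\<And>s. (g has_real_derivative g' s) (at s)" and g2: "(g' has_real_derivative l) (at s0)"
    and d: "\<delta> > 0" and m: "\<And>s. \<bar>s - s0\<bar> < \<delta> \<Longrightarrow> g s \<le> g s0"
  shows "g' s0 = 0" "l \<le> 0"
proof -
  show z: "g' s0 = 0"
    by (rule DERIV_local_max[OF g d]) (use m in \<open>auto simp: abs_minus_commute\<close>)
  show "l \<le> 0"
  proof (rule ccontr)
    assume "\<not> l \<le> 0"
    then have "\<exists>e>0. \<forall>h>0. h < e \<longrightarrow> g' s0 < g' (s0 + h)" by (intro DERIV_pos_inc_right[OF g2]) simp
    then obtain e where e: "e > 0" "\<And>h. h > 0 \<Longrightarrow> h < e \<Longrightarrow> 0 < g' (s0 + h)"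
      using z by auto
    define h where "h = min e \<delta> / 2"
    have h: "h > 0" "h < e" "h < \<delta>" using e(1) d by (auto simp: h_def min_def)
    obtain w where w: "s0 < w" "w < s0 + h" "g (s0 + h) - g s0 = h * g' w"
      using MVT2[of s0 "s0 + h" g g'] g h(1) by auto
    have "0 < g' w" using e(2)[of "w - s0"] w h by simp
    then have "g (s0 + h) > g s0" using w(3) h(1) mult_pos_pos[of h "g' w"] by linarith
    then show False using m[of "s0 + h"] h by simp
  qed
qed

lemma right_max_derivative:
  fixes g :: "real \<Rightarrow> real"
  assumes g: "(g has_real_derivative l) (at s0)" and m: "\<And>s. s \<ge> s0 \<Longrightarrow> g s \<le> g s0"
  shows "l \<le> 0"
proof (rule ccontr)
  assume "\<not> l \<le> 0"
  then obtain e where "e > 0" "\<forall>h>0. h < e \<longrightarrow> g s0 < g (s0 + h)"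
    using DERIV_pos_inc_right[OF g] by auto
  then have "g s0 < g (s0 + e / 2)" by auto
  then show False using m[of "s0 + e / 2"] \<open>e > 0\<close> by simp
qed

lemma vnorm_upd_sq:
  assumes "i < n"
  shows "(vnorm n (x(i := s)))\<^sup>2 = (vnorm n x)\<^sup>2 - (x i)\<^sup>2 + s\<^sup>2"
proof -
  have "(\<Sum>j<n. ((x(i := s)) j)\<^sup>2) = (\<Sum>j\<in>insert i ({..<n} - {i}). ((x(i := s)) j)\<^sup>2)"
    using assms by (intro sum.cong) auto
  also have "\<dots> = s\<^sup>2 + (\<Sum>j\<in>{..<n} - {i}. (x j)\<^sup>2)"
    by (subst sum.insert) (auto intro!: sum.cong)
  finally have 1: "(\<Sum>j<n. ((x(i := s)) j)\<^sup>2) = s\<^sup>2 + (\<Sum>j\<in>{..<n} - {i}. (x j)\<^sup>2)" .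
  have "(\<Sum>j<n. (x j)\<^sup>2) = (\<Sum>j\<in>insert i ({..<n} - {i}). (x j)\<^sup>2)"
    using assms by (intro sum.cong) auto
  also have "\<dots> = (x i)\<^sup>2 + (\<Sum>j\<in>{..<n} - {i}. (x j)\<^sup>2)" by (subst sum.insert) auto
  finally show ?thesis using 1 unfolding vnorm_sq by simp
qed

lemma continuous_on_vnorm:
  "continuous_on S f \<Longrightarrow> continuous_on S (\<lambda>x. vnorm n (f x))"
  unfolding vnorm_def L2_set_def by (intro continuous_on_real_sqrt continuous_on_sum continuous_on_power continuous_on_nth)

lemmas cont_intros = continuous_on_add continuous_on_diff continuous_on_mult continuous_on_const
  continuous_on_fst continuous_on_snd continuous_on_id continuous_on_exp continuous_on_vnorm
  continuous_on_power continuous_on_sum continuous_on_Pair continuous_on_minus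

text \<open>The penalisation \<open>\<epsilon> (|x|\<^sup>2 + t)\<close> forces the maximum to be attained; since only times
  \<open>t \<ge> t0\<close> are compared, a maximum at \<open>t0\<close> still has nonpositive time derivative, so that the
  backward equation needs no terminal condition.\<close>

lemma max_principle_on:
  assumes Q: "Q \<subseteq> Rn n" "closed Q" and D: "D21 n z zt zi zii"
    and bd: "\<And>x t. x \<in> Q \<Longrightarrow> t > 0 \<Longrightarrow> z x t \<le> Z" and lam: "lam > 0" and \<beta>: "\<beta> \<ge> 0"
    and int: "\<And>x t. x \<in> Q \<Longrightarrow> t > 0 \<Longrightarrow> z x t > 0 \<Longrightarrow>
      \<exists>\<delta>>0. \<forall>i<n. \<forall>s. \<bar>s - x i\<bar> < \<delta> \<longrightarrow> x(i := s) \<in> Q"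
    and pde: "\<And>x t. x \<in> Q \<Longrightarrow> t > 0 \<Longrightarrow> z x t > 0 \<Longrightarrow>
      - zt x t - (\<Sum>i<n. zii i x t) + lam * z x t \<le> \<beta> * vnorm n (\<lambda>i. zi i x t)"
    and x0: "x0 \<in> Q" and t0: "t0 > 0"
  shows "z x0 t0 \<le> 0"
proof (rule ccontr)
  assume "\<not> z x0 t0 \<le> 0"
  then have zp: "z x0 t0 > 0" by simp
  \<comment> \<open>The cost of the penalisation in the equation: \<open>2 * n\<close> from the
    Laplacian of \<open>|x|^2\<close>, 1 from the time derivative, \<open>\<beta>^2 / lam\<close>
    from Young's inequality for the gradient term.\<close>
  define C where "C = 2 * n + 1 + \<beta>\<^sup>2 / lam"
  have C: "C \<ge> 1" unfolding C_def using lam by simp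
  define N where "N = (vnorm n x0)\<^sup>2 + t0"
  have N: "N > 0" unfolding N_def using t0 by (simp add: add_nonneg_pos)
  \<comment> \<open>The first entry preserves half of the value at \<open>(x0, t0)\<close>. The
    second makes the cost \<open>\<epsilon> * C\<close> at most a quarter of
    \<open>lam * z x0 t0\<close>, while the equation at the maximum would require at least a
    half.\<close>
  define \<epsilon> where "\<epsilon> = min (z x0 t0 / (2 * N)) (lam * z x0 t0 / (4 * C))"
  have e: "\<epsilon> > 0" unfolding \<epsilon>_def using zp N C lam by simp
  have eN: "\<epsilon> * N \<le> z x0 t0 / 2"
  proof -
    have "\<epsilon> * N \<le> z x0 t0 / (2 * N) * N" unfolding \<epsilon>_def using N by (intro mult_right_mono) auto
    then show ?thesis using N by simp
  qed
  have eC: "\<epsilon> * C \<le> lam * z x0 t0 / 4"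
  proof -
    have "\<epsilon> * C \<le> lam * z x0 t0 / (4 * C) * C" unfolding \<epsilon>_def using C by (intro mult_right_mono) auto
    then show ?thesis using C by simp
  qed
  define \<Phi> where "\<Phi> x t = z x t - \<epsilon> * ((vnorm n x)\<^sup>2 + t)" for x t
  have P0: "\<Phi> x0 t0 \<ge> z x0 t0 / 2" using eN unfolding \<Phi>_def N_def by simp
  \<comment> \<open>Where \<open>|x|^2 + t\<close> is at least \<open>R\<close> the penalty exceeds
    the upper bound \<open>Z\<close>, so the penalised function is negative there and a compact set
    decides.\<close>
  define R where "R = 1 + \<bar>Z\<bar> / \<epsilon> + vnorm n x0"
  have R1: "R \<ge> 1" unfolding R_def using e by simp
  have ZR: "Z < \<epsilon> * R"
  proof -
    have "Z \<le> \<epsilon> * (\<bar>Z\<bar> / \<epsilon>)" using e by simp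
    also have "\<dots> < \<epsilon> * R" unfolding R_def using e vnorm_nonneg[of n x0] by (intro mult_strict_left_mono) linarith+
    finally show ?thesis .
  qed
  define S where "S = ({x \<in> Rn n. \<forall>i<n. \<bar>x i\<bar> \<le> R} \<inter> Q) \<times> {t0..t0 + R}"
  have Sc: "compact S" unfolding S_def by (intro compact_Times compact_Int_closed compact_box Q) simp
  have "x0 \<in> Rn n" using x0 Q by auto
  moreover have "\<forall>i<n. \<bar>x0 i\<bar> \<le> R"
  proof (intro allI impI)
    fix i assume "i < n"
    then have "\<bar>x0 i\<bar> \<le> vnorm n x0" by (rule vnorm_comp)
    moreover have "\<bar>Z\<bar> / \<epsilon> \<ge> 0" using e by simp
    ultimately show "\<bar>x0 i\<bar> \<le> R" unfolding R_def by linarith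
  qed
  ultimately have S0: "(x0, t0) \<in> S" unfolding S_def using x0 R1 by auto
  have "continuous_on S (\<lambda>(x, t). z x t)"
    by (rule continuous_on_subset[of "Rn n \<times> {0<..}"]) (use D t0 in \<open>auto simp: D21_def S_def\<close>)
  then have cont: "continuous_on S (\<lambda>p. \<Phi> (fst p) (snd p))"
    unfolding \<Phi>_def by (intro cont_intros) (simp add: case_prod_beta)
  have "S \<noteq> {}" using S0 by auto
  then have "\<exists>p\<in>S. \<forall>q\<in>S. \<Phi> (fst q) (snd q) \<le> \<Phi> (fst p) (snd p)"
    by (rule continuous_attains_sup[OF Sc _ cont])
  then obtain p where p: "p \<in> S" "\<And>q. q \<in> S \<Longrightarrow> \<Phi> (fst q) (snd q) \<le> \<Phi> (fst p) (snd p)"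
    by (elim bexE) (rule that, auto)
  obtain x1 t1 where pp: "p = (x1, t1)" by (cases p)
  have x1: "x1 \<in> Q" "x1 \<in> Rn n" "t1 \<ge> t0" using p(1) pp by (auto simp: S_def)
  then have t1: "t1 > 0" using t0 by simp
  have mx0: "\<Phi> x0 t0 \<le> \<Phi> x1 t1" using p(2)[OF S0] pp by simp
  have mx: "\<Phi> x t \<le> \<Phi> x1 t1" if x: "x \<in> Q" and t: "t \<ge> t0" for x t
  proof (cases "(x, t) \<in> S")
    case True then show ?thesis using p(2)[OF True] pp by simp
  next
    case False
    have "R \<le> (vnorm n x)\<^sup>2 + t"
    proof (cases "\<exists>i<n. \<bar>x i\<bar> > R")
      case True
      then obtain i where "i < n" "\<bar>x i\<bar> > R" by auto
      then have "R < vnorm n x" using vnorm_comp[of i n x] by simp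
      moreover have "vnorm n x * 1 \<le> vnorm n x * vnorm n x"
        using R1 \<open>R < vnorm n x\<close> by (intro mult_left_mono) auto
      ultimately show ?thesis using t t0 by (simp add: power2_eq_square)
    next
      case nex: False
      then have "t > t0 + R" using False x t Q unfolding S_def by force
      then show ?thesis using t0 zero_le_power2[of "vnorm n x"] by linarith
    qed
    then have "\<epsilon> * R \<le> \<epsilon> * ((vnorm n x)\<^sup>2 + t)" using e by (intro mult_left_mono) auto
    then have "\<Phi> x t < 0" using bd[OF x, of t] ZR t t0 unfolding \<Phi>_def by simp
    then show ?thesis using mx0 P0 zp by simp
  qed
  have z1: "z x1 t1 = \<Phi> x1 t1 + \<epsilon> * ((vnorm n x1)\<^sup>2 + t1)" by (simp add: \<Phi>_def)
  have P1: "\<Phi> x1 t1 \<ge> z x0 t0 / 2" using mx0 P0 by simp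
  have zp1: "z x1 t1 > 0" 
  proof -
    have "0 \<le> \<epsilon> * ((vnorm n x1)\<^sup>2 + t1)" using e t1 by simp
    then show ?thesis using z1 P1 zp by linarith
  qed
  have ztb: "zt x1 t1 \<le> \<epsilon>"
  proof -
    have "((\<lambda>t. \<Phi> x1 t) has_real_derivative zt x1 t1 - \<epsilon> * (0 + 1)) (at t1)"
      unfolding \<Phi>_def using D x1 t1 unfolding D21_def by (intro derivative_eq_intros refl) auto
    then have "zt x1 t1 - \<epsilon> * (0 + 1) \<le> 0" by (rule right_max_derivative) (use mx x1 in auto)
    then show ?thesis by simp
  qed
  \<comment> \<open>\<open>z\<close> is positive at the maximum point, so \<open>int\<close>
    provides a margin in every coordinate and the second derivative test applies although
    \<open>Q\<close> may have a boundary.\<close>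
  obtain \<delta> where d: "\<delta> > 0" "\<And>i s. i < n \<Longrightarrow> \<bar>s - x1 i\<bar> < \<delta> \<Longrightarrow> x1(i := s) \<in> Q"
    using int[OF x1(1) t1 zp1] by auto
  have sp: "zi i x1 t1 = 2 * \<epsilon> * x1 i \<and> zii i x1 t1 \<le> 2 * \<epsilon>" if i: "i < n" for i
  proof -
    define g where "g s = \<Phi> (x1(i := s)) t1" for s
    define g' where "g' s = zi i (x1(i := s)) t1 - \<epsilon> * (2 * s)" for s
    have dg: "(g has_real_derivative g' s) (at s)" for s
    proof -
      have "((\<lambda>s. z (x1(i := s)) t1) has_real_derivative zi i (x1(i := s)) t1) (at s)"
      proof -
        have "((\<lambda>r. z ((x1(i := s))(i := r)) t1) has_real_derivative zi i (x1(i := s)) t1) (at ((x1(i := s)) i))"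
          using D upd_Rn[OF x1(2) i] t1 i unfolding D21_def by blast
        then show ?thesis by simp
      qed
      moreover have "g = (\<lambda>s. z (x1(i := s)) t1 - \<epsilon> * ((vnorm n x1)\<^sup>2 - (x1 i)\<^sup>2 + s\<^sup>2 + t1))"
        unfolding g_def \<Phi>_def by (simp add: vnorm_upd_sq[OF i])
      ultimately show ?thesis unfolding g'_def by (auto intro!: derivative_eq_intros)
    qed
    have "((\<lambda>s. zi i (x1(i := s)) t1) has_real_derivative zii i x1 t1) (at (x1 i))"
      using D x1(2) i t1 unfolding D21_def by auto
    then have dg2: "(g' has_real_derivative zii i x1 t1 - \<epsilon> * 2) (at (x1 i))"
      unfolding g'_def by (auto intro!: derivative_eq_intros)
    have m: "g s \<le> g (x1 i)" if "\<bar>s - x1 i\<bar> < \<delta>" for s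
      using mx[OF d(2)[OF i that] x1(3)] by (simp add: g_def)
    from local_max_second_derivative[OF dg dg2 d(1) m] show ?thesis by (auto simp: g'_def)
  qed
  have "vnorm n (\<lambda>i. zi i x1 t1) = vnorm n (\<lambda>i. 2 * \<epsilon> * x1 i)" by (rule vnorm_cong) (use sp in auto)
  then have gr: "vnorm n (\<lambda>i. zi i x1 t1) = 2 * \<epsilon> * vnorm n x1" using e by (simp add: vnorm_cmult)
  have "(\<Sum>i<n. zii i x1 t1) \<le> (\<Sum>i<n. 2 * \<epsilon>)" by (rule sum_mono) (use sp in auto)
  then have lp: "(\<Sum>i<n. zii i x1 t1) \<le> 2 * \<epsilon> * n" by (simp add: mult_ac)
  \<comment> \<open>Young's inequality; the square term is absorbed by \<open>lam\<close> times the
    penalty itself.\<close>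
  have y: "2 * \<beta> * vnorm n x1 \<le> lam * (vnorm n x1)\<^sup>2 + \<beta>\<^sup>2 / lam"
  proof -
    have "0 \<le> (lam * vnorm n x1 - \<beta>)\<^sup>2 / lam" using lam by simp
    also have "\<dots> = lam * (vnorm n x1)\<^sup>2 + \<beta>\<^sup>2 / lam - 2 * \<beta> * vnorm n x1"
      using lam by (simp add: power2_eq_square field_simps)
    finally show ?thesis by simp
  qed
  have "lam * z x1 t1 \<le> \<beta> * (2 * \<epsilon> * vnorm n x1) + \<epsilon> + 2 * \<epsilon> * n"
    using pde[OF x1(1) t1 zp1] ztb lp gr by simp
  also have "\<dots> = \<epsilon> * (2 * \<beta> * vnorm n x1) + \<epsilon> + 2 * \<epsilon> * n" by simp
  also have "\<dots> \<le> \<epsilon> * (lam * (vnorm n x1)\<^sup>2 + \<beta>\<^sup>2 / lam) + \<epsilon> + 2 * \<epsilon> * n"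
    using mult_left_mono[OF y, of \<epsilon>] e by simp
  also have "\<dots> = \<epsilon> * lam * (vnorm n x1)\<^sup>2 + \<epsilon> * C" by (simp add: C_def algebra_simps)
  finally have "lam * \<Phi> x1 t1 + lam * \<epsilon> * t1 \<le> \<epsilon> * C" unfolding z1 by (simp add: algebra_simps)
  moreover have "0 < lam * \<epsilon> * t1" using lam e t1 by simp
  moreover have "lam * (z x0 t0 / 2) \<le> lam * \<Phi> x1 t1" using P1 lam by (intro mult_left_mono) auto
  moreover have "0 < lam * z x0 t0" using lam zp by simp
  ultimately show False using eC by (simp add: field_simps)
qed

section \<open>Operations on functions together with their derivatives\<close>

lemma D21_add_time:
  assumes "D21 n z zt zi zii" and "\<And>t. t > 0 \<Longrightarrow> (f has_real_derivative f' t) (at t)"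
  shows "D21 n (\<lambda>x t. z x t + f t) (\<lambda>x t. zt x t + f' t) zi zii"
proof -
  have "continuous_on {0<..} f"
    by (rule continuous_at_imp_continuous_on) (use assms(2) DERIV_isCont in auto)
  then have "continuous_on (Rn n \<times> {0<..}) (\<lambda>p. f (snd p))"
    by (rule continuous_on_compose2[where g = f]) (auto intro: cont_intros)
  then show ?thesis using assms unfolding D21_def case_prod_beta
    by (auto intro!: cont_intros derivative_eq_intros)
qed

lemma D21_scale_time:
  assumes "D21 n z zt zi zii" and "\<And>t. t > 0 \<Longrightarrow> (f has_real_derivative f' t) (at t)"
  shows "D21 n (\<lambda>x t. f t * z x t) (\<lambda>x t. f' t * z x t + f t * zt x t)
    (\<lambda>i x t. f t * zi i x t) (\<lambda>i x t. f t * zii i x t)"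
proof -
  have "continuous_on {0<..} f"
    by (rule continuous_at_imp_continuous_on) (use assms(2) DERIV_isCont in auto)
  then have c: "continuous_on (Rn n \<times> {0<..}) (\<lambda>p. f (snd p))"
    by (rule continuous_on_compose2[where g = f]) (auto intro: cont_intros)
  have "continuous_on (Rn n \<times> {0<..}) (\<lambda>p. f (snd p) * z (fst p) (snd p))"
    using assms(1) unfolding D21_def case_prod_beta by (intro continuous_on_mult c) auto
  moreover have "((\<lambda>t. f t * z x t) has_real_derivative f' t * z x t + f t * zt x t) (at t)"
    if "x \<in> Rn n" "t > 0" for x t
    using DERIV_mult[OF assms(2)[OF that(2)], of "z x" "zt x t"] assms(1) that unfolding D21_def
    by (auto simp: algebra_simps)
  ultimately show ?thesis using assms(1) unfolding D21_def case_prod_beta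
    by (auto intro!: DERIV_cmult)
qed

lemma D21_add:
  assumes "D21 n z zt zi zii" "D21 n w wt wi wii"
  shows "D21 n (\<lambda>x t. z x t + w x t) (\<lambda>x t. zt x t + wt x t)
    (\<lambda>i x t. zi i x t + wi i x t) (\<lambda>i x t. zii i x t + wii i x t)"
  using assms unfolding D21_def case_prod_beta by (auto intro!: cont_intros DERIV_add)

lemma D21_diff:
  assumes "D21 n z zt zi zii" "D21 n w wt wi wii"
  shows "D21 n (\<lambda>x t. z x t - w x t) (\<lambda>x t. zt x t - wt x t)
    (\<lambda>i x t. zi i x t - wi i x t) (\<lambda>i x t. zii i x t - wii i x t)"
  using assms unfolding D21_def case_prod_beta by (auto intro!: cont_intros DERIV_diff)

lemma D21_cmult:
  assumes "D21 n z zt zi zii"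
  shows "D21 n (\<lambda>x t. c * z x t) (\<lambda>x t. c * zt x t)
    (\<lambda>i x t. c * zi i x t) (\<lambda>i x t. c * zii i x t)"
  using assms unfolding D21_def case_prod_beta by (auto intro!: cont_intros DERIV_cmult)

text \<open>Covers translations and reflections of coordinates;
  \<open>\<sigma> i * \<sigma> i = 1\<close> leaves the pure second derivatives, hence the
  Laplacian, unchanged.\<close>

lemma D21_affine:
  assumes D: "D21 n z zt zi zii" and g: "\<And>x. x \<in> Rn n \<Longrightarrow> g x \<in> Rn n" "continuous_on (Rn n) g"
    and a: "\<And>x i s. x \<in> Rn n \<Longrightarrow> i < n \<Longrightarrow> g (x(i := s)) = (g x)(i := \<sigma> i * s + c i)"
    and s: "\<And>i. i < n \<Longrightarrow> \<sigma> i * \<sigma> i = 1"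
  shows "D21 n (\<lambda>x t. z (g x) t) (\<lambda>x t. zt (g x) t) (\<lambda>i x t. \<sigma> i * zi i (g x) t) (\<lambda>i x t. zii i (g x) t)"
  unfolding D21_def
proof (intro conjI ballI allI impI)
  have gc: "continuous_on (Rn n \<times> {0<..}) (\<lambda>p. g (fst p))"
    by (rule continuous_on_compose2[OF g(2)]) (auto intro!: cont_intros)
  show "continuous_on (Rn n \<times> {0<..}) (\<lambda>(x, t). z (g x) t)"
  proof -
    have c1: "continuous_on (Rn n \<times> {0<..}) (\<lambda>p. (g (fst p), snd p))"
      by (intro continuous_on_Pair gc continuous_on_snd continuous_on_id)
    have c2: "continuous_on (Rn n \<times> {0<..}) (\<lambda>(x, t). z x t)" using D by (simp add: D21_def)
    have "continuous_on (Rn n \<times> {0<..}) (\<lambda>p. (\<lambda>(x, t). z x t) (g (fst p), snd p))"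
      by (rule continuous_on_compose2[OF c2 c1]) (use g in auto)
    then show ?thesis by (simp add: case_prod_beta)
  qed
next
  fix x t assume x: "x \<in> Rn n" and t: "(t::real) > 0"
  show "((\<lambda>t. z (g x) t) has_real_derivative zt (g x) t) (at t)"
    using D x t g unfolding D21_def by auto
  fix i assume i: "i < n"
  have gi: "g x i = \<sigma> i * x i + c i" using fun_cong[OF a[OF x i, of "x i"], of i] by simp
  have d1: "((\<lambda>s. z ((g x)(i := s)) t) has_real_derivative zi i (g x) t) (at (\<sigma> i * x i + c i))"
    "((\<lambda>s. zi i ((g x)(i := s)) t) has_real_derivative zii i (g x) t) (at (\<sigma> i * x i + c i))"
    using D[unfolded D21_def, THEN conjunct2, rule_format, OF g(1)[OF x] t] i unfolding gi[symmetric] by auto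
  have d2: "((\<lambda>s. \<sigma> i * s + c i) has_real_derivative \<sigma> i) (at (x i))" by (auto intro!: derivative_eq_intros)
  show "((\<lambda>s. z (g (x(i := s))) t) has_real_derivative \<sigma> i * zi i (g x) t) (at (x i))"
    using DERIV_chain2[OF d1(1) d2] a[OF x i] by (simp add: mult.commute)
  have "((\<lambda>s. \<sigma> i * zi i (g (x(i := s))) t) has_real_derivative \<sigma> i * (zii i (g x) t * \<sigma> i)) (at (x i))"
    using DERIV_cmult[OF DERIV_chain2[OF d1(2) d2], of "\<sigma> i"] a[OF x i] by simp
  moreover have "\<sigma> i * (zii i (g x) t * \<sigma> i) = zii i (g x) t"
  proof -
    have "\<sigma> i * (zii i (g x) t * \<sigma> i) = (\<sigma> i * \<sigma> i) * zii i (g x) t" by (simp only: ac_simps)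
    then show ?thesis using s[OF i] by simp
  qed
  ultimately show "((\<lambda>s. \<sigma> i * zi i (g (x(i := s))) t) has_real_derivative zii i (g x) t) (at (x i))" by simp
qed

lemma continuous_on_mv:
  assumes "continuous_on S g"
  shows "continuous_on S (\<lambda>x. mv n (g x) r e)"
proof (rule continuous_on_Rn_vec[where n = n])
  fix i assume "i < n"
  have "continuous_on S (\<lambda>x. g x i)" using continuous_on_nth[of S g i] assms by blast
  then have "continuous_on S (\<lambda>x. g x i + r * e i)" by (intro continuous_on_add continuous_on_const)
  then show "continuous_on S (\<lambda>x. mv n (g x) r e i)" using \<open>i < n\<close> by simp
qed auto

lemma D21_shift:
  assumes "D21 n z zt zi zii"
  shows "D21 n (\<lambda>x t. z (mv n x r e) t) (\<lambda>x t. zt (mv n x r e) t)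
    (\<lambda>i x t. zi i (mv n x r e) t) (\<lambda>i x t. zii i (mv n x r e) t)"
proof -
  have "D21 n (\<lambda>x t. z (mv n x r e) t) (\<lambda>x t. zt (mv n x r e) t)
    (\<lambda>i x t. 1 * zi i (mv n x r e) t) (\<lambda>i x t. zii i (mv n x r e) t)"
    by (rule D21_affine[OF assms, where \<sigma> = "\<lambda>_. 1" and c = "\<lambda>i. r * e i"])
       (simp_all add: mv_upd continuous_on_mv[OF continuous_on_id])
  then show ?thesis by simp
qed

lemma continuous_on_coord: "continuous_on S (\<lambda>y::vec. y i)"
  using continuous_on_nth[of S "\<lambda>y. y" i] continuous_on_id by blast

lemma closed_Rn: "closed (Rn n)"
proof -
  have "Rn n = (\<Inter>i\<in>{n..}. {x. x i = undefined})"
    by (auto simp: Rn_def PiE_def extensional_def)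
  moreover have "closed {x :: vec. x i = undefined}" for i
    by (intro closed_Collect_eq continuous_on_coord continuous_on_const)
  ultimately show ?thesis by (auto intro: closed_INT)
qed

text \<open>The constant \<open>G / lam\<close> solves the equation with source \<open>G\<close>;
  subtracting it reduces to the homogeneous case on all of \<open>Rn n\<close>.\<close>

lemma max_principle:
  assumes D: "D21 n z zt zi zii"
    and bd: "\<And>x t. x \<in> Rn n \<Longrightarrow> t > 0 \<Longrightarrow> z x t \<le> Z" and lam: "lam > 0" and \<beta>: "\<beta> \<ge> 0"
    and pde: "\<And>x t. x \<in> Rn n \<Longrightarrow> t > 0 \<Longrightarrow>
      - zt x t - (\<Sum>i<n. zii i x t) + lam * z x t \<le> \<beta> * vnorm n (\<lambda>i. zi i x t) + G"
    and x0: "x0 \<in> Rn n" and t0: "t0 > 0"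
  shows "z x0 t0 \<le> G / lam"
proof -
  have D': "D21 n (\<lambda>x t. z x t + - (G / lam)) (\<lambda>x t. zt x t + 0) zi zii"
    by (rule D21_add_time[OF D]) auto
  have "z x0 t0 + - (G / lam) \<le> 0"
  proof (rule max_principle_on[OF order_refl closed_Rn D' _ lam \<beta> _ _ x0 t0])
    show "z x t + - (G / lam) \<le> Z - G / lam" if "x \<in> Rn n" "t > 0" for x t using bd[OF that] by simp
    show "\<exists>\<delta>>0. \<forall>i<n. \<forall>s. \<bar>s - x i\<bar> < \<delta> \<longrightarrow> x(i := s) \<in> Rn n" if "x \<in> Rn n" for x
      using that by (intro exI[of _ 1]) auto
    show "- (zt x t + 0) - (\<Sum>i<n. zii i x t) + lam * (z x t + - (G / lam)) \<le> \<beta> * vnorm n (\<lambda>i. zi i x t)"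
      if "x \<in> Rn n" "t > 0" for x t
      using pde[OF that] lam by (simp add: algebra_simps)
  qed
  then show ?thesis by simp
qed

text \<open>Reflecting at the hyperplane \<open>x i = c\<close> gives a solution vanishing there, which is compared
  with the profile \<open>\<omega>\<close> solving \<open>\<lambda> \<omega> - \<omega>'' = 2 R\<close>, \<open>\<omega> 0 = 0\<close>. This gains the factor
  \<open>1 / \<surd>\<lambda>\<close> on first derivatives.\<close>

lemma reflection_gradient_bound:
  assumes D: "D21 n v vt vi vii" and lam: "lam > 0"
    and bd: "\<And>x t. x \<in> Rn n \<Longrightarrow> t > 0 \<Longrightarrow> \<bar>v x t\<bar> \<le> Z"
    and pde: "\<And>x t. x \<in> Rn n \<Longrightarrow> t > 0 \<Longrightarrow> \<bar>- vt x t - (\<Sum>i<n. vii i x t) + lam * v x t\<bar> \<le> R"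
    and x0: "x0 \<in> Rn n" and t0: "t0 > 0" and k: "k < n"
  shows "vi k x0 t0 \<le> R / sqrt lam"
proof -
  define r where "r = sqrt lam"
  have r: "r > 0" "r * r = lam" unfolding r_def using lam by auto
  have R0: "R \<ge> 0" using pde[OF x0 t0] by simp
  define c where "c = x0 k"
  \<comment> \<open>\<open>rf 1\<close> moves the hyperplane to \<open>y k = 0\<close> and
    \<open>rf (-1)\<close> combines this with the reflection, so the difference \<open>W\<close>
    below vanishes for \<open>y k = 0\<close>.\<close>
  define rf where "rf \<sigma> = (\<lambda>y::vec. y(k := \<sigma> * y k + c))" for \<sigma> :: real
  define \<omega> where "\<omega> s = 2 * R / lam * (1 - exp (- r * s))" for s
  have rfR: "rf \<sigma> y \<in> Rn n" if "y \<in> Rn n" for \<sigma> y using that k by (simp add: rf_def)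
  have rfc: "continuous_on (Rn n) (rf \<sigma>)" for \<sigma>
  proof (rule continuous_on_Rn_vec[where n = n])
    show "continuous_on (Rn n) (\<lambda>x. rf \<sigma> x i)" for i
      by (cases "i = k") (auto simp: rf_def intro!: continuous_on_add continuous_on_mult continuous_on_const continuous_on_coord)
  qed (rule rfR)
  have rfD: "D21 n (\<lambda>x t. v (rf \<sigma> x) t) (\<lambda>x t. vt (rf \<sigma> x) t)
      (\<lambda>i x t. (if i = k then \<sigma> else 1) * vi i (rf \<sigma> x) t) (\<lambda>i x t. vii i (rf \<sigma> x) t)" if "\<sigma> * \<sigma> = 1" for \<sigma>
    by (rule D21_affine[OF D rfR rfc, where c = "\<lambda>i. if i = k then c else 0"])
       (use that in \<open>auto simp: rf_def fun_eq_iff\<close>)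
  define W where "W y t = v (rf 1 y) t - v (rf (-1) y) t" for y t
  define z where "z y t = W y t - \<omega> (y k)" for y t
  define zt where "zt y t = vt (rf 1 y) t - vt (rf (-1) y) t" for y t
  define zi where "zi i y t = ((if i = k then 1 else 1) * vi i (rf 1 y) t - (if i = k then -1 else 1) * vi i (rf (-1) y) t)
      - (if i = k then 2 * R / lam * (r * exp (- r * y k)) else 0)" for i y t
  define zii where "zii i y t = (vii i (rf 1 y) t - vii i (rf (-1) y) t)
      - (if i = k then 2 * R / lam * (- r * r * exp (- r * y k)) else 0)" for i y t
  have fst_c: "continuous_on S (\<lambda>p :: vec \<times> real. fst p i)" for i S
    using continuous_on_nth[of S "\<lambda>p. fst p" i] continuous_on_fst[OF continuous_on_id] by blast
  have Dw: "D21 n (\<lambda>y t. \<omega> (y k)) (\<lambda>y t. 0) (\<lambda>i y t. if i = k then 2 * R / lam * (r * exp (- r * y k)) else 0)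
     (\<lambda>i y t. if i = k then 2 * R / lam * (- r * r * exp (- r * y k)) else 0)"
    unfolding D21_def \<omega>_def using lam
    by (auto simp: case_prod_beta intro!: continuous_on_divide continuous_on_mult continuous_on_diff continuous_on_exp
        continuous_on_const continuous_on_minus fst_c derivative_eq_intros)
  have Dz: "D21 n z zt zi zii"
    using D21_diff[OF D21_diff[OF rfD[of 1] rfD[of "-1"]] Dw]
    unfolding z_def[abs_def] W_def zt_def[abs_def] zi_def[abs_def] zii_def[abs_def] by simp
  define Q where "Q = {y \<in> Rn n. 0 \<le> y k}"
  have Qc: "closed Q"
  proof -
    have "closed {y :: vec. 0 \<le> y k}" by (intro closed_Collect_le continuous_on_const continuous_on_coord)
    then show ?thesis unfolding Q_def using closed_Rn closed_Int[of "Rn n" "{y. 0 \<le> y k}"] by (simp add: Collect_conj_eq)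
  qed
  have w0: "0 \<le> \<omega> s" if "s \<ge> 0" for s
    unfolding \<omega>_def using that r R0 lam by (intro mult_nonneg_nonneg) auto
  have main: "z y t \<le> 0" if y: "y \<in> Q" and t: "t > 0" for y t
  proof (rule max_principle_on[OF _ Qc Dz _ lam order_refl[of 0] _ _ y t])
    show "Q \<subseteq> Rn n" by (auto simp: Q_def)
    show "z x t \<le> 2 * Z" if "x \<in> Q" "t > 0" for x t
      using bd[OF rfR[of x 1] that(2)] bd[OF rfR[of x "-1"] that(2)] that w0[of "x k"]
      unfolding z_def W_def Q_def by auto
    \<comment> \<open>On the hyperplane \<open>z\<close> is 0, so \<open>z > 0\<close> forces
      \<open>x k > 0\<close>, and this number serves as the margin.\<close>
    show "\<exists>\<delta>>0. \<forall>i<n. \<forall>s. \<bar>s - x i\<bar> < \<delta> \<longrightarrow> x(i := s) \<in> Q" if x: "x \<in> Q" "t > 0" "z x t > 0" for x t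
    proof -
      have "x k \<noteq> 0"
      proof
        assume "x k = 0"
        then have "z x t = 0" unfolding z_def W_def rf_def \<omega>_def by simp
        then show False using x by simp
      qed
      then have "x k > 0" using x by (simp add: Q_def)
      then show ?thesis using x by (intro exI[of _ "x k"]) (auto simp: Q_def)
    qed
    show "- zt x t - (\<Sum>i<n. zii i x t) + lam * z x t \<le> 0 * vnorm n (\<lambda>i. zi i x t)" if x: "x \<in> Q" "t > 0" for x t
    proof -
      have a1: "- vt (rf 1 x) t - (\<Sum>i<n. vii i (rf 1 x) t) + lam * v (rf 1 x) t \<le> R"
        using pde[OF rfR[of x 1] x(2)] x by (auto simp: Q_def)
      have a2: "- (- vt (rf (-1) x) t - (\<Sum>i<n. vii i (rf (-1) x) t) + lam * v (rf (-1) x) t) \<le> R"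
        using pde[OF rfR[of x "-1"] x(2)] x by (auto simp: Q_def)
      have "(\<Sum>i<n. zii i x t) = (\<Sum>i<n. vii i (rf 1 x) t) - (\<Sum>i<n. vii i (rf (-1) x) t) + 2 * R * exp (- r * x k)"
        unfolding zii_def using k r lam by (simp add: sum_subtractf)
      moreover have "lam * \<omega> (x k) = 2 * R - 2 * R * exp (- r * x k)" unfolding \<omega>_def using lam by (simp add: field_simps)
      ultimately show ?thesis using a1 a2 unfolding zt_def z_def W_def by (simp add: algebra_simps)
    qed
  qed
  have ineq: "v (x0(k := c + s)) t0 - v (x0(k := c - s)) t0 \<le> 2 * R / r * s" if s: "s > 0" for s
  proof -
    have "z (x0(k := s)) t0 \<le> 0" by (rule main) (use x0 t0 k s in \<open>auto simp: Q_def\<close>)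
    then have "v (x0(k := c + s)) t0 - v (x0(k := c - s)) t0 \<le> \<omega> s"
      unfolding z_def W_def rf_def by (simp add: add.commute)
    also have "\<dots> \<le> 2 * R / lam * (r * s)"
      unfolding \<omega>_def using exp_ge_add_one_self[of "- r * s"] R0 lam by (intro mult_left_mono) auto
    also have "\<dots> = 2 * R / r * s" using r by (simp add: r(2)[symmetric])
    finally show ?thesis .
  qed
  \<comment> \<open>The symmetric difference has derivative twice \<open>vi k\<close>, which cancels
    the factor 2 in the profile.\<close>
  define g where "g s = v (x0(k := c + s)) t0 - v (x0(k := c - s)) t0" for s
  have dv: "((\<lambda>s. v (x0(k := s)) t0) has_real_derivative vi k x0 t0) (at c)"
    using D x0 t0 k unfolding D21_def c_def by auto
  have "(g has_real_derivative vi k x0 t0 * 1 - vi k x0 t0 * (-1)) (at 0)"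
    unfolding g_def
    by (intro DERIV_diff DERIV_chain2[where f = "\<lambda>s. v (x0(k := s)) t0"]) (use dv in \<open>auto intro!: derivative_eq_intros\<close>)
  then have lim: "((\<lambda>h. (g h - g 0) / h) \<longlongrightarrow> 2 * vi k x0 t0) (at 0)" unfolding DERIV_def by simp
  have "((\<lambda>h. (g h - g 0) / h) \<longlongrightarrow> 2 * vi k x0 t0) (at_right 0)"
    using lim by (rule filterlim_mono[OF _ order_refl at_le]) auto
  then have "2 * vi k x0 t0 \<le> 2 * R / r"
  proof (rule tendsto_upperbound)
    show "\<forall>\<^sub>F h in at_right 0. (g h - g 0) / h \<le> 2 * R / r"
      unfolding eventually_at_right_field
    proof (intro exI[of _ 1] conjI allI impI)
      fix h :: real assume h: "0 < h" "h < 1"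
      have "g h \<le> 2 * R / r * h" using ineq[OF h(1)] by (simp add: g_def)
      then have "g h / h \<le> 2 * R / r" using h by (simp add: pos_divide_le_eq)
      moreover have "g 0 = 0" by (simp add: g_def)
      ultimately show "(g h - g 0) / h \<le> 2 * R / r" by simp
    qed simp
  qed simp
  then show ?thesis by (simp add: r_def)
qed

section \<open>Hamiltonians with quadratic growth\<close>

text \<open>A real supremum is meaningful only for a bounded set, here bounded by the sum of all
  entries; homogeneity then extends the estimate from the unit ball to all vectors.\<close>

lemma mnorm_bound:
  assumes x: "\<xi> \<in> Rn n"
  shows "vnorm n (\<lambda>i. \<Sum>j<n. M i j * \<xi> j) \<le> mnorm n M * vnorm n \<xi>"
proof -
  define S where "S = {\<xi> \<in> Rn n. vnorm n \<xi> \<le> 1}"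
  have b: "vnorm n (\<lambda>i. \<Sum>j<n. M i j * \<xi> j) \<le> (\<Sum>i<n. \<Sum>j<n. \<bar>M i j\<bar>)" if "\<xi> \<in> S" for \<xi>
  proof -
    have "\<bar>\<Sum>j<n. M i j * \<xi> j\<bar> \<le> (\<Sum>j<n. \<bar>M i j\<bar>)" for i
    proof (rule order_trans[OF sum_abs], rule sum_mono)
      fix j assume "j \<in> {..<n}"
      then have "\<bar>\<xi> j\<bar> \<le> 1" using vnorm_comp[of j n \<xi>] that by (simp add: S_def)
      then show "\<bar>M i j * \<xi> j\<bar> \<le> \<bar>M i j\<bar>" by (simp add: abs_mult mult_left_le)
    qed
    then show ?thesis by (intro order_trans[OF vnorm_le_sum] sum_mono) auto
  qed
  have le: "vnorm n (\<lambda>i. \<Sum>j<n. M i j * \<xi> j) \<le> mnorm n M" if "\<xi> \<in> S" for \<xi>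
    unfolding mnorm_def S_def[symmetric] using that b by (intro cSUP_upper bdd_aboveI2) auto
  show ?thesis
  proof (cases "vnorm n \<xi> = 0")
    case True
    then have "vnorm n (\<lambda>i. \<Sum>j<n. M i j * \<xi> j) = 0" unfolding vnorm_eq_0 by (auto intro!: sum.neutral)
    then show ?thesis using True by simp
  next
    case False
    then have p: "vnorm n \<xi> > 0" using vnorm_nonneg[of n \<xi>] by linarith
    define \<zeta> where "\<zeta> = vscale n (1 / vnorm n \<xi>) \<xi>"
    have "\<zeta> \<in> S" using p by (simp add: S_def \<zeta>_def)
    then have l: "vnorm n (\<lambda>i. \<Sum>j<n. M i j * \<zeta> j) \<le> mnorm n M" by (rule le)
    have "(\<lambda>i. \<Sum>j<n. M i j * \<zeta> j) = (\<lambda>i. (1 / vnorm n \<xi>) * (\<Sum>j<n. M i j * \<xi> j))"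
      by (simp add: \<zeta>_def sum_divide_distrib)
    then have "vnorm n (\<lambda>i. \<Sum>j<n. M i j * \<zeta> j) = vnorm n (\<lambda>i. \<Sum>j<n. M i j * \<xi> j) / vnorm n \<xi>"
      by (simp only: vnorm_cmult) simp
    then show ?thesis using l p by (simp add: pos_divide_le_eq)
  qed
qed

lemma mnorm_nonneg: "0 \<le> mnorm n M"
proof -
  have "vnorm n (\<lambda>i. \<Sum>j<n. M i j * (\<lambda>_\<in>{..<n}. 0) j) \<le> mnorm n M"
    unfolding mnorm_def
  proof (rule cSUP_upper)
    show "bdd_above ((\<lambda>\<xi>. vnorm n (\<lambda>i. \<Sum>j<n. M i j * \<xi> j)) ` {\<xi> \<in> Rn n. vnorm n \<xi> \<le> 1})"
    proof (rule bdd_aboveI2[where M = "\<Sum>i<n. \<Sum>j<n. \<bar>M i j\<bar>"])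
      fix \<xi> assume x: "\<xi> \<in> {\<xi> \<in> Rn n. vnorm n \<xi> \<le> 1}"
      have "\<bar>\<Sum>j<n. M i j * \<xi> j\<bar> \<le> (\<Sum>j<n. \<bar>M i j\<bar>)" for i
      proof (rule order_trans[OF sum_abs], rule sum_mono)
        fix j assume "j \<in> {..<n}"
        then have "\<bar>\<xi> j\<bar> \<le> 1" using vnorm_comp[of j n \<xi>] x by simp
        then show "\<bar>M i j * \<xi> j\<bar> \<le> \<bar>M i j\<bar>" by (simp add: abs_mult mult_left_le)
      qed
      then show "vnorm n (\<lambda>i. \<Sum>j<n. M i j * \<xi> j) \<le> (\<Sum>i<n. \<Sum>j<n. \<bar>M i j\<bar>)"
        by (intro order_trans[OF vnorm_le_sum] sum_mono) auto
    qed
    have "vnorm n (\<lambda>_\<in>{..<n}. 0) = 0" by (simp add: vnorm_eq_0)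
    then show "(\<lambda>_\<in>{..<n}. 0) \<in> {\<xi> \<in> Rn n. vnorm n \<xi> \<le> 1}" by (auto simp: Rn_def)
  qed
  then show ?thesis using vnorm_nonneg order_trans by blast
qed

lemma mnorm_quad:
  assumes "\<xi> \<in> Rn n"
  shows "\<bar>\<Sum>i<n. \<Sum>j<n. M i j * \<xi> i * \<xi> j\<bar> \<le> mnorm n M * (vnorm n \<xi>)\<^sup>2"
proof -
  have "(\<Sum>i<n. \<Sum>j<n. M i j * \<xi> i * \<xi> j) = (\<Sum>i<n. (\<Sum>j<n. M i j * \<xi> j) * \<xi> i)"
    by (simp add: sum_distrib_left sum_distrib_right mult_ac)
  also have "\<bar>\<dots>\<bar> \<le> vnorm n (\<lambda>i. \<Sum>j<n. M i j * \<xi> j) * vnorm n \<xi>" by (rule CS)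
  also have "\<dots> \<le> mnorm n M * vnorm n \<xi> * vnorm n \<xi>" by (intro mult_right_mono mnorm_bound assms) simp
  finally show ?thesis by (simp add: power2_eq_square mult_ac)
qed

text \<open>The second difference is a difference of directional derivatives at parameters
  \<open>a\<close> in (0,1) and \<open>b\<close> in (-1,0); \<open>a - b < 2\<close> gives the
  factor 2.\<close>

lemma hess_second_difference:
  assumes f: "C1f n f" "\<And>j. j < n \<Longrightarrow> C1f n (pd j f)"
    and K: "\<And>z. z \<in> Rn n \<Longrightarrow> \<bar>\<Sum>i<n. \<Sum>j<n. hess f z i j * e i * e j\<bar> \<le> K * (vnorm n e)\<^sup>2"
    and x: "x \<in> Rn n"
  shows "\<bar>f (mv n x 1 e) + f (mv n x (-1) e) - 2 * f x\<bar> \<le> 2 * K * (vnorm n e)\<^sup>2"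
proof -
  define g where "g s = f (mv n x s e)" for s
  define G where "G s = (\<Sum>j<n. pd j f (mv n x s e) * e j)" for s
  define H where "H s = (\<Sum>j<n. (\<Sum>i<n. pd i (pd j f) (mv n x s e) * e i) * e j)" for s
  have g: "(g has_real_derivative G s) (at s)" for s unfolding g_def G_def by (rule C1f_line[OF f(1)])
  have "((\<lambda>s. \<Sum>j<n. pd j f (mv n x s e) * e j) has_real_derivative H s) (at s)" for s
    unfolding H_def by (intro DERIV_sum DERIV_cmult_right C1f_line f) auto
  then have G: "(G has_real_derivative H s) (at s)" for s by (simp add: G_def[abs_def])
  have Hb: "\<bar>H s\<bar> \<le> K * (vnorm n e)\<^sup>2" for s
  proof -
    have "H s = (\<Sum>j<n. \<Sum>i<n. hess f (mv n x s e) i j * e i * e j)"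
      by (simp add: H_def hess_def sum_distrib_right)
    also have "\<dots> = (\<Sum>i<n. \<Sum>j<n. hess f (mv n x s e) i j * e i * e j)" by (rule sum.swap)
    finally show ?thesis using K[of "mv n x s e"] by simp
  qed
  obtain a where a: "0 < a" "a < 1" "g 1 - g 0 = G a" using MVT2[of 0 1 g G] g by auto
  obtain b where b: "- 1 < b" "b < 0" "g 0 - g (- 1) = G b" using MVT2[of "-1" 0 g G] g by auto
  obtain c where c: "G a - G b = (a - b) * H c" using MVT2[of b a G H] G a b by auto
  have "\<bar>g 1 + g (-1) - 2 * g 0\<bar> = \<bar>(a - b) * H c\<bar>" using a(3) b(3) c by simp
  also have "\<dots> \<le> 2 * (K * (vnorm n e)\<^sup>2)" unfolding abs_mult using Hb a b by (intro mult_mono) auto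
  finally show ?thesis using x by (simp add: g_def)
qed

text \<open>Inverse of the splitting in \<open>joint\<close>: the \<open>p\<close> variables come
  first, the \<open>x\<close> variables are offset by \<open>n\<close>.\<close>

definition cat :: "nat \<Rightarrow> vec \<Rightarrow> vec \<Rightarrow> vec" where
  "cat n p x = (\<lambda>i\<in>{..<2 * n}. if i < n then p i else x (i - n))"

lemma cat_Rn [simp]: "cat n p x \<in> Rn (2 * n)"
  by (simp add: cat_def Rn_def)

lemma cat_upd1: "i < n \<Longrightarrow> cat n (p(i := s)) x = (cat n p x)(i := s)"
  by (auto simp: cat_def fun_eq_iff)

lemma cat_upd2: "i < n \<Longrightarrow> cat n p (x(i := s)) = (cat n p x)(n + i := s)"
  by (auto simp: cat_def fun_eq_iff)

lemma joint_cat: "p \<in> Rn n \<Longrightarrow> x \<in> Rn n \<Longrightarrow> joint n H (cat n p x) = H p x"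
proof -
  assume p: "p \<in> Rn n" and x: "x \<in> Rn n"
  have "restrict (cat n p x) {..<n} = p" by (rule Rn_eqI[OF _ p]) (simp add: Rn_def, simp add: cat_def)
  moreover have "(\<lambda>i\<in>{..<n}. cat n p x (n + i)) = x" by (rule Rn_eqI[OF _ x]) (simp add: Rn_def, simp add: cat_def)
  ultimately show ?thesis by (simp add: joint_def)
qed

lemma slice1:
  assumes f: "\<And>p. p \<in> Rn n \<Longrightarrow> f p = J (cat n p x)" and p: "p \<in> Rn n" and i: "i < n"
  shows "pd i f p = pd i J (cat n p x)" "has_pd i f p \<longleftrightarrow> has_pd i J (cat n p x)"
proof -
  have "(\<lambda>s. f (p(i := s))) = (\<lambda>s. J ((cat n p x)(i := s)))"
    using p i by (simp add: f cat_upd1)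
  moreover have "p i = cat n p x i" using i by (simp add: cat_def)
  ultimately show "pd i f p = pd i J (cat n p x)" "has_pd i f p \<longleftrightarrow> has_pd i J (cat n p x)"
    unfolding pd_def has_pd_def by simp_all
qed

lemma slice2:
  assumes f: "\<And>x. x \<in> Rn n \<Longrightarrow> f x = J (cat n p x)" and x: "x \<in> Rn n" and i: "i < n"
  shows "pd i f x = pd (n + i) J (cat n p x)" "has_pd i f x \<longleftrightarrow> has_pd (n + i) J (cat n p x)"
proof -
  have "(\<lambda>s. f (x(i := s))) = (\<lambda>s. J ((cat n p x)(n + i := s)))"
    using x i by (simp add: f cat_upd2)
  moreover have "x i = cat n p x (n + i)" using i by (simp add: cat_def)
  ultimately show "pd i f x = pd (n + i) J (cat n p x)" "has_pd i f x \<longleftrightarrow> has_pd (n + i) J (cat n p x)"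
    unfolding pd_def has_pd_def by simp_all
qed

lemma continuous_on_cat:
  assumes "continuous_on S f" "continuous_on S g"
  shows "continuous_on S (\<lambda>z. cat n (f z) (g z))"
proof (rule continuous_on_Rn_vec[where n = "2 * n"])
  fix i assume i: "i < 2 * n"
  have "continuous_on S (\<lambda>z. f z i)" "continuous_on S (\<lambda>z. g z (i - n))"
    using continuous_on_nth[of S f i] continuous_on_nth[of S g "i - n"] assms by blast+
  then show "continuous_on S (\<lambda>z. cat n (f z) (g z) i)"
    using i by (cases "i < n") (auto simp: cat_def)
qed simp

lemma C1f_slice1:
  assumes J: "C1f (2 * n) J" and f: "\<And>p. p \<in> Rn n \<Longrightarrow> f p = J (cat n p x)"
  shows "C1f n f"
  unfolding C1f_def
proof (intro allI impI conjI ballI)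
  fix i assume i: "i < n"
  then show "has_pd i f p" if "p \<in> Rn n" for p using J slice1(2)[where f = f and J = J and x = x, OF f that i] unfolding C1f_def by auto
  have "continuous_on (Rn (2 * n)) (pd i J)" using J i unfolding C1f_def by auto
  then have "continuous_on (Rn n) (\<lambda>p. pd i J (cat n p x))"
    by (rule continuous_on_compose2) (auto intro!: continuous_on_cat continuous_on_id continuous_on_const)
  then show "continuous_on (Rn n) (pd i f)"
    by (subst continuous_on_cong[OF refl slice1(1)[where f = f and J = J and x = x, OF f _ i]])
qed

lemma C1f_slice2:
  assumes J: "C1f (2 * n) J" and f: "\<And>x. x \<in> Rn n \<Longrightarrow> f x = J (cat n p x)"
  shows "C1f n f"
  unfolding C1f_def
proof (intro allI impI conjI ballI)
  fix i assume i: "i < n"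
  then show "has_pd i f x" if "x \<in> Rn n" for x using J slice2(2)[where f = f and J = J and p = p, OF f that i] unfolding C1f_def by auto
  have "continuous_on (Rn (2 * n)) (pd (n + i) J)" using J i unfolding C1f_def by auto
  then have "continuous_on (Rn n) (\<lambda>x. pd (n + i) J (cat n p x))"
    by (rule continuous_on_compose2) (auto intro!: continuous_on_cat continuous_on_id continuous_on_const)
  then show "continuous_on (Rn n) (pd i f)"
    by (subst continuous_on_cong[OF refl slice2(1)[where f = f and J = J and p = p, OF f _ i]])
qed

lemma C1f_diff: "C1f n f \<Longrightarrow> C1f n g \<Longrightarrow> C1f n (\<lambda>x. f x - g x)"
  and grad_diff: "C1f n f \<Longrightarrow> C1f n g \<Longrightarrow> x \<in> Rn n \<Longrightarrow> i < n \<Longrightarrow> pd i (\<lambda>x. f x - g x) x = pd i f x - pd i g x"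
proof -
  have *: "pd i (\<lambda>x. f x - g x) x = pd i f x - pd i g x" "has_pd i (\<lambda>x. f x - g x) x"
    if "C1f n f" "C1f n g" "x \<in> Rn n" "i < n" for i x
  proof -
    have "((\<lambda>s. f (x(i := s)) - g (x(i := s))) has_real_derivative pd i f x - pd i g x) (at (x i))"
      using that by (intro DERIV_diff pd_has_derivative) (auto simp: C1f_def)
    from pd_eqI[of "\<lambda>x. f x - g x", OF this] show "pd i (\<lambda>x. f x - g x) x = pd i f x - pd i g x" "has_pd i (\<lambda>x. f x - g x) x" by auto
  qed
  then show "C1f n f \<Longrightarrow> C1f n g \<Longrightarrow> x \<in> Rn n \<Longrightarrow> i < n \<Longrightarrow> pd i (\<lambda>x. f x - g x) x = pd i f x - pd i g x" by blast
  assume fg: "C1f n f" "C1f n g"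
  show "C1f n (\<lambda>x. f x - g x)"
    unfolding C1f_def
  proof (intro allI impI conjI ballI)
    fix i assume i: "i < n"
    show "has_pd i (\<lambda>x. f x - g x) x" if "x \<in> Rn n" for x using *(2)[OF fg that i] .
    have "continuous_on (Rn n) (\<lambda>x. pd i f x - pd i g x)"
      using fg i by (intro continuous_on_diff) (auto simp: C1f_def)
    then show "continuous_on (Rn n) (pd i (\<lambda>x. f x - g x))"
      using *(1)[OF fg _ i] by (simp cong: continuous_on_cong)
  qed
qed

locale hamiltonian =
  fixes n :: nat and \<alpha> Co :: real and H :: "vec \<Rightarrow> vec \<Rightarrow> real"
  assumes aH: "assumptions_H n \<alpha> Co H" and Co1: "1 \<le> Co"
begin

section \<open>Regularity of H in each variable, inherited from the joint function\<close>

lemma J1: "C1f (2 * n) (joint n H)"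
  and J2: "j < 2 * n \<Longrightarrow> C1f (2 * n) (pd j (joint n H))"
  using aH unfolding assumptions_H_def C2_alpha_def C2_def C1f_def by auto

lemma H_p_C1: "x \<in> Rn n \<Longrightarrow> C1f n (\<lambda>q. H q x)"
  by (rule C1f_slice1[OF J1, where x = x]) (simp add: joint_cat)

lemma H_x_C1: "p \<in> Rn n \<Longrightarrow> C1f n (H p)"
  by (rule C1f_slice2[OF J1, where p = p]) (simp add: joint_cat)

lemma pd_p: "p \<in> Rn n \<Longrightarrow> x \<in> Rn n \<Longrightarrow> j < n \<Longrightarrow> pd j (\<lambda>q. H q x) p = pd j (joint n H) (cat n p x)"
  by (rule slice1) (auto simp: joint_cat)

lemma pd_x: "p \<in> Rn n \<Longrightarrow> x \<in> Rn n \<Longrightarrow> j < n \<Longrightarrow> pd j (H p) x = pd (n + j) (joint n H) (cat n p x)"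
  by (rule slice2) (auto simp: joint_cat)

lemma H_pp_C1: "x \<in> Rn n \<Longrightarrow> j < n \<Longrightarrow> C1f n (pd j (\<lambda>q. H q x))"
  by (rule C1f_slice1[OF J2[of j], where x = x]) (simp_all add: pd_p)

lemma H_xx_C1: "p \<in> Rn n \<Longrightarrow> j < n \<Longrightarrow> C1f n (pd j (H p))"
  by (rule C1f_slice2[OF J2[of "n + j"], where p = p]) (simp_all add: pd_x)

lemma H_px_C1: "x \<in> Rn n \<Longrightarrow> j < n \<Longrightarrow> C1f n (\<lambda>p. pd j (H p) x)"
  by (rule C1f_slice1[OF J2[of "n + j"], where x = x]) (simp_all add: pd_x)

lemma bounds:
  assumes "p \<in> Rn n" "x \<in> Rn n"
  shows "- Co \<le> H p x" "H p x \<le> Co * (1 + (vnorm n p)\<^sup>2)"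
    "\<xi> \<in> Rn n \<Longrightarrow> \<bar>\<Sum>i<n. \<Sum>j<n. hess (\<lambda>q. H q x) p i j * \<xi> i * \<xi> j\<bar> \<le> Co * (vnorm n \<xi>)\<^sup>2"
    "vnorm n (grad n (H p) x) \<le> Co * (1 + vnorm n p)"
    "mnorm n (\<lambda>i j. pd i (\<lambda>q. pd j (H q) x) p) \<le> Co * (1 + vnorm n p)"
    "mnorm n (hess (H p) x) \<le> Co"
proof -
  note a = aH[unfolded assumptions_H_def, THEN conjunct2, THEN conjunct2, rule_format, OF assms]
  show "- Co \<le> H p x" "H p x \<le> Co * (1 + (vnorm n p)\<^sup>2)" "mnorm n (hess (H p) x) \<le> Co" using a by auto
  show "vnorm n (grad n (H p) x) \<le> Co * (1 + vnorm n p)"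
    "mnorm n (\<lambda>i j. pd i (\<lambda>q. pd j (H q) x) p) \<le> Co * (1 + vnorm n p)"
    using a vnorm_nonneg[of n "grad n (H p) x"] mnorm_nonneg[of n "\<lambda>i j. pd i (\<lambda>q. pd j (H q) x) p"] by linarith+
  assume "\<xi> \<in> Rn n"
  then have "1 / Co * (vnorm n \<xi>)\<^sup>2 \<le> (\<Sum>i<n. \<Sum>j<n. hess (\<lambda>q. H q x) p i j * \<xi> i * \<xi> j)"
    "(\<Sum>i<n. \<Sum>j<n. hess (\<lambda>q. H q x) p i j * \<xi> i * \<xi> j) \<le> Co * (vnorm n \<xi>)\<^sup>2" using a by blast+
  moreover have "0 \<le> 1 / Co * (vnorm n \<xi>)\<^sup>2" using Co1 by simp
  ultimately show "\<bar>\<Sum>i<n. \<Sum>j<n. hess (\<lambda>q. H q x) p i j * \<xi> i * \<xi> j\<bar> \<le> Co * (vnorm n \<xi>)\<^sup>2" by linarith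
qed

section \<open>Increment estimates for H and its gradient in p\<close>

lemma H_lip_x:
  assumes "p \<in> Rn n" "x \<in> Rn n" "y \<in> Rn n"
  shows "\<bar>H p y - H p x\<bar> \<le> Co * (1 + vnorm n p) * vdist n y x"
  by (rule C1f_lipschitz[OF H_x_C1]) (use assms bounds in auto)

lemma H_second_difference_x:
  assumes "p \<in> Rn n" "x \<in> Rn n" "e \<in> Rn n"
  shows "\<bar>H p (mv n x 1 e) + H p (mv n x (-1) e) - 2 * H p x\<bar> \<le> 2 * Co * (vnorm n e)\<^sup>2"
proof (rule hess_second_difference[OF H_x_C1 H_xx_C1])
  fix z assume z: "z \<in> Rn n"
  show "\<bar>\<Sum>i<n. \<Sum>j<n. hess (H p) z i j * e i * e j\<bar> \<le> Co * (vnorm n e)\<^sup>2"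
    using mnorm_quad[OF assms(3), of "hess (H p) z"]
      mult_right_mono[OF bounds(6)[OF assms(1) z], of "(vnorm n e)\<^sup>2"] by simp
qed (use assms in auto)

text \<open>The assumption on \<open>H\<close> bounds the quadratic form of its Hessian in
  \<open>p\<close>, which is exactly what second differences see; 12 is the 6 of
  \<open>second_difference_grad_lipschitz\<close> times the 2 of
  \<open>hess_second_difference\<close>.\<close>

lemma DpH_lip_p:
  assumes "p \<in> Rn n" "q \<in> Rn n" "x \<in> Rn n"
  shows "vdist n (DpH n H p x) (DpH n H q x) \<le> 12 * Co * vdist n p q"
proof -
  have "vdist n (grad n (\<lambda>q. H q x) p) (grad n (\<lambda>q. H q x) q) \<le> 6 * (2 * Co) * vdist n p q"
  proof (rule second_difference_grad_lipschitz[OF H_p_C1])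
    fix p e assume "p \<in> Rn n" "e \<in> Rn n"
    then show "\<bar>H (mv n p 1 e) x + H (mv n p (-1) e) x - 2 * H p x\<bar> \<le> 2 * Co * (vnorm n e)\<^sup>2"
      using assms bounds(3) by (intro hess_second_difference[OF H_p_C1 H_pp_C1]) auto
  qed (use assms Co1 in auto)
  then show ?thesis by (simp add: DpH_def)
qed

text \<open>Mean value theorem in \<open>p\<close> along the segment from \<open>p\<close> to
  \<open>p + e\<close>, where the mixed derivative is bounded. As \<open>e\<close> has norm at most
  1, its points have norm at most \<open>1 + |p|\<close>: hence the 2.\<close>

lemma grad_x_lip_p:
  assumes p: "p \<in> Rn n" and e: "e \<in> Rn n" and z: "z \<in> Rn n" and e1: "vnorm n e \<le> 1"
  shows "vnorm n (grad n (\<lambda>y. H (mv n p 1 e) y - H p y) z) \<le> Co * (2 + vnorm n p) * vnorm n e"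
proof (rule vnorm_dual)
  show "0 \<le> Co * (2 + vnorm n p) * vnorm n e" using Co1 by simp
  fix w assume w: "w \<in> Rn n" "vnorm n w = 1"
  define g where "g s = (\<Sum>j<n. pd j (H (mv n p s e)) z * w j)" for s
  define g' where "g' s = (\<Sum>j<n. (\<Sum>i<n. pd i (\<lambda>q. pd j (H q) z) (mv n p s e) * e i) * w j)" for s
  have g: "(g has_real_derivative g' s) (at s)" for s
    unfolding g_def g'_def by (intro DERIV_sum DERIV_cmult_right C1f_line H_px_C1 z) auto
  obtain a where a: "0 < a" "a < 1" "g 1 - g 0 = g' a" using MVT2[of 0 1 g g'] g by auto
  have eq: "(\<Sum>i<n. grad n (\<lambda>y. H (mv n p 1 e) y - H p y) z i * w i) = g 1 - g 0"
    using p z by (simp add: g_def grad_diff[OF H_x_C1 H_x_C1] left_diff_distrib sum_subtractf)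
  define M where "M = (\<lambda>i j. pd i (\<lambda>q. pd j (H q) z) (mv n p a e))"
  have "g' a = (\<Sum>j<n. \<Sum>i<n. M i j * e i * w j)" by (simp add: g'_def M_def sum_distrib_right)
  also have "\<dots> = (\<Sum>i<n. \<Sum>j<n. M i j * e i * w j)" by (rule sum.swap)
  also have "\<dots> = (\<Sum>i<n. (\<Sum>j<n. M i j * w j) * e i)" by (simp add: sum_distrib_left sum_distrib_right mult_ac)
  also have "\<dots> \<le> vnorm n (\<lambda>i. \<Sum>j<n. M i j * w j) * vnorm n e" by (rule order_trans[OF abs_ge_self CS])
  also have "\<dots> \<le> mnorm n M * vnorm n e" using mnorm_bound[OF w(1), of M] w(2) by (intro mult_right_mono) auto
  also have "\<dots> \<le> Co * (1 + vnorm n (mv n p a e)) * vnorm n e"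
    unfolding M_def by (intro mult_right_mono bounds z) auto
  also have "\<dots> \<le> Co * (2 + vnorm n p) * vnorm n e"
  proof -
    have "vnorm n (mv n p a e) \<le> vnorm n p + a * vnorm n e"
      using vnorm_dist[of n "mv n p a e" p] vdist_mv[of n p a e] a by simp
    also have "a * vnorm n e \<le> 1 * 1" using a e1 by (intro mult_mono) auto
    finally show ?thesis using Co1 by (intro mult_right_mono mult_left_mono) auto
  qed
  finally show "(\<Sum>i<n. grad n (\<lambda>y. H (mv n p 1 e) y - H p y) z i * w i) \<le> Co * (2 + vnorm n p) * vnorm n e"
    using eq a by simp
qed

text \<open>The mixed derivative is controlled with the \<open>x\<close>-derivative taken first. The
  order is exchanged on double increments of \<open>H\<close>: \<open>grad_x_lip_p\<close> bounds
  them through their Lipschitz constant in \<open>x\<close>, and the same increments then bound the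
  gradient in \<open>p\<close>.\<close>

lemma DpH_lip_x:
  assumes p: "p \<in> Rn n" and x: "x \<in> Rn n" and y: "y \<in> Rn n"
  shows "vdist n (DpH n H p x) (DpH n H p y) \<le> Co * (2 + vnorm n p) * vdist n x y"
proof -
  have "vnorm n (grad n (\<lambda>q. H q x - H q y) p) \<le> Co * (2 + vnorm n p) * vdist n x y"
  proof (rule C1f_grad_bound[OF C1f_diff[OF H_p_C1[OF x] H_p_C1[OF y]] p])
    fix e assume e: "e \<in> Rn n" "vnorm n e \<le> 1"
    have "\<bar>(H (mv n p 1 e) x - H p x) - (H (mv n p 1 e) y - H p y)\<bar> \<le> Co * (2 + vnorm n p) * vnorm n e * vdist n x y"
      by (rule C1f_lipschitz[OF C1f_diff[OF H_x_C1 H_x_C1] y x grad_x_lip_p]) (use p e in auto)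
    then show "H (mv n p 1 e) x - H (mv n p 1 e) y - (H p x - H p y) \<le> Co * (2 + vnorm n p) * vdist n x y * vnorm n e"
      by (simp add: mult_ac)
  qed (use Co1 in simp)
  also have "vnorm n (grad n (\<lambda>q. H q x - H q y) p) = vdist n (DpH n H p x) (DpH n H p y)"
    unfolding vdist_def DpH_def using grad_diff[OF H_p_C1[OF x] H_p_C1[OF y] p] by (intro vnorm_cong) auto
  finally show ?thesis .
qed

text \<open>Linear growth follows from \<open>DpH_lip_p\<close> once the gradient at 0 is bounded.
  There convexity dominates the slope in a direction by the increment up to norm 1, where
  \<open>H\<close> is at most \<open>2 * Co\<close>; with the lower bound \<open>- Co\<close> at 0
  this gives \<open>3 * Co\<close>.\<close>

lemma DpH_bound:
  assumes p: "p \<in> Rn n" and x: "x \<in> Rn n"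
  shows "vnorm n (DpH n H p x) \<le> 12 * Co * (1 + vnorm n p)"
proof -
  define o' where "o' = vscale n 0 p"
  have o: "o' \<in> Rn n" "vnorm n o' = 0" by (simp_all add: o'_def)
  have "vnorm n (grad n (\<lambda>q. H q x) o') \<le> 3 * Co"
  proof (rule C1f_grad_bound[OF H_p_C1[OF x] o(1)])
    fix e assume e: "e \<in> Rn n" "vnorm n e \<le> 1"
    show "H (mv n o' 1 e) x - H o' x \<le> 3 * Co * vnorm n e"
    proof (cases "vnorm n e = 0")
      case True
      then have "mv n o' 1 e = o'" unfolding vnorm_eq_0 by (intro Rn_eqI[where n = n]) (auto simp: o'_def)
      then show ?thesis using True by simp
    next
      case False
      define s where "s = vnorm n e"
      have s: "0 < s" "s \<le> 1" using False e vnorm_nonneg[of n e] unfolding s_def by linarith+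
      define q where "q = vscale n (1 / s) e"
      have q: "q \<in> Rn n" "vnorm n q = 1" using s by (simp_all add: q_def s_def)
      have eq: "(\<lambda>i\<in>{..<n}. (1 - s) * o' i + s * q i) = mv n o' 1 e"
        using s by (auto simp: mv_def q_def o'_def)
      have sI: "s \<in> {0..1}" using s by simp
      have "H (\<lambda>i\<in>{..<n}. (1 - s) * o' i + s * q i) x \<le> (1 - s) * H o' x + s * H q x"
        using aH[unfolded assumptions_H_def, THEN conjunct2, THEN conjunct1, rule_format, OF x o(1) q(1) sI] .
      then have "H (mv n o' 1 e) x - H o' x \<le> s * (H q x - H o' x)" unfolding eq by (simp add: algebra_simps)
      also have "\<dots> \<le> s * (3 * Co)"
        using bounds(2)[OF q(1) x] bounds(1)[OF o(1) x] q(2) s by (intro mult_left_mono) auto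
      finally show ?thesis by (simp add: s_def mult_ac)
    qed
  qed (use Co1 in simp)
  moreover have "vdist n (DpH n H p x) (DpH n H o' x) \<le> 12 * Co * vdist n p o'" by (rule DpH_lip_p[OF p o(1) x])
  moreover have "vdist n p o' = vnorm n p" unfolding vdist_def by (rule vnorm_cong) (simp add: o'_def)
  moreover have "vnorm n (DpH n H p x) \<le> vnorm n (DpH n H o' x) + vdist n (DpH n H p x) (DpH n H o' x)"
    using vnorm_dist[of n "DpH n H p x" "DpH n H o' x"] by simp
  ultimately show ?thesis using Co1 by (simp add: DpH_def distrib_left)
qed

lemma H_lip_p:
  assumes p: "p \<in> Rn n" and q: "q \<in> Rn n" and x: "x \<in> Rn n" and R: "vnorm n p \<le> R" "vnorm n q \<le> R"
  shows "\<bar>H p x - H q x\<bar> \<le> 12 * Co * (1 + R) * vdist n p q"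
proof -
  obtain \<theta> where t: "0 < \<theta>" "\<theta> < 1" "H p x - H q x = (\<Sum>i<n. pd i (\<lambda>q. H q x) (mv n q \<theta> (\<lambda>i. p i - q i)) * (p i - q i))"
    using C1f_mvt[OF H_p_C1[OF x] q p] by metis
  define w where "w = mv n q \<theta> (\<lambda>i. p i - q i)"
  have "vnorm n w = vnorm n (\<lambda>i. (1 - \<theta>) * q i + \<theta> * p i)" unfolding w_def by (rule vnorm_cong) (simp add: algebra_simps)
  also have "\<dots> \<le> (1 - \<theta>) * vnorm n q + \<theta> * vnorm n p"
    using vnorm_add[of n "\<lambda>i. (1 - \<theta>) * q i" "\<lambda>i. \<theta> * p i"] t by (simp add: vnorm_cmult)
  also have "\<dots> \<le> R" using R t by (intro convex_bound_le) auto
  finally have w: "vnorm n w \<le> R" .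
  have "H p x - H q x = (\<Sum>i<n. DpH n H w x i * (p i - q i))" unfolding t(3) w_def DpH_def by simp
  then have "\<bar>H p x - H q x\<bar> \<le> vnorm n (DpH n H w x) * vdist n p q" using CS[of "DpH n H w x" "\<lambda>i. p i - q i" n] by (simp add: vdist_def)
  also have "\<dots> \<le> 12 * Co * (1 + vnorm n w) * vdist n p q" using DpH_bound[of w x] x by (intro mult_right_mono) (auto simp: w_def)
  also have "\<dots> \<le> 12 * Co * (1 + R) * vdist n p q" using w Co1 by (intro mult_right_mono mult_left_mono) auto
  finally show ?thesis .
qed

text \<open>The increment \<open>q1 - q2\<close> is transplanted to \<open>p2\<close>, giving
  \<open>p3\<close>. Replacing \<open>p1\<close> by \<open>p3\<close> costs the first term; what
  remains compares the same increment from two base points and is a difference of gradients times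
  \<open>|q1 - q2|\<close>. Along the segments norms reach \<open>3 * R\<close>, and 40 (1 + R)
  dominates 12 (1 + 3 R).\<close>

lemma H_double_difference:
  assumes v: "p1 \<in> Rn n" "p2 \<in> Rn n" "q1 \<in> Rn n" "q2 \<in> Rn n" "x \<in> Rn n" "y \<in> Rn n"
    and R: "vnorm n p1 \<le> R" "vnorm n p2 \<le> R" "vnorm n q1 \<le> R" "vnorm n q2 \<le> R"
  shows "\<bar>(H p1 y - H p2 y) - (H q1 x - H q2 x)\<bar> \<le>
    40 * Co * (1 + R) * vnorm n (\<lambda>i. (p1 i - p2 i) - (q1 i - q2 i))
    + 40 * Co * (1 + R) * (vdist n p2 q2 + vdist n y x) * vdist n q1 q2"
proof -
  define \<pi> where "\<pi> = (\<lambda>i. q1 i - q2 i)"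
  define p3 where "p3 = mv n p2 1 \<pi>"
  have p3: "p3 \<in> Rn n" by (simp add: p3_def)
  have R0: "R \<ge> 0" using R(1) vnorm_nonneg[of n p1] by linarith
  have pi: "vnorm n \<pi> \<le> 2 * R" unfolding \<pi>_def using vnorm_diff[of n q1 q2] R by simp
  have nrm: "vnorm n (mv n w s \<pi>) \<le> 3 * R" if "vnorm n w \<le> R" "0 \<le> s" "s \<le> 1" for w s
  proof -
    have "vnorm n (mv n w s \<pi>) \<le> vnorm n w + s * vnorm n \<pi>"
      using vnorm_dist[of n "mv n w s \<pi>" w] vdist_mv[of n w s \<pi>] that by simp
    also have "s * vnorm n \<pi> \<le> 1 * (2 * R)" using that pi by (intro mult_mono) auto
    finally show ?thesis using that by simp
  qed
  have "\<bar>H p1 y - H p3 y\<bar> \<le> 12 * Co * (1 + 3 * R) * vdist n p1 p3"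
    using R R0 nrm[of p2 1] by (intro H_lip_p v p3) (auto simp: p3_def)
  also have "\<dots> \<le> 40 * Co * (1 + R) * vdist n p1 p3"
    using R0 Co1 by (intro mult_right_mono) (auto simp: algebra_simps)
  also have "vdist n p1 p3 = vnorm n (\<lambda>i. (p1 i - p2 i) - (q1 i - q2 i))"
    unfolding vdist_def by (rule vnorm_cong) (simp add: p3_def \<pi>_def)
  finally have A: "\<bar>H p1 y - H p3 y\<bar> \<le> 40 * Co * (1 + R) * vnorm n (\<lambda>i. (p1 i - p2 i) - (q1 i - q2 i))" .
  define g where "g s = H (mv n p2 s \<pi>) y - H (mv n q2 s \<pi>) x" for s
  define g' where "g' s = (\<Sum>i<n. pd i (\<lambda>q. H q y) (mv n p2 s \<pi>) * \<pi> i) - (\<Sum>i<n. pd i (\<lambda>q. H q x) (mv n q2 s \<pi>) * \<pi> i)" for s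
  have "(g has_real_derivative g' s) (at s)" for s
    unfolding g_def g'_def by (intro DERIV_diff C1f_line[OF H_p_C1] v)
  then obtain a where a: "0 < a" "a < 1" "g 1 - g 0 = g' a" using MVT2[of 0 1 g g'] by auto
  define P where "P = mv n p2 a \<pi>" 
  define Q where "Q = mv n q2 a \<pi>"
  have PQ: "P \<in> Rn n" "Q \<in> Rn n" "vdist n P Q = vdist n p2 q2" by (simp_all add: P_def Q_def vdist_mv2)
  have "g' a = (\<Sum>i<n. (DpH n H P y i - DpH n H Q x i) * \<pi> i)"
    by (simp add: g'_def DpH_def P_def Q_def left_diff_distrib sum_subtractf)
  then have "\<bar>g' a\<bar> \<le> vdist n (DpH n H P y) (DpH n H Q x) * vnorm n \<pi>" unfolding vdist_def using CS by simp
  also have "\<dots> \<le> (vdist n (DpH n H P y) (DpH n H Q y) + vdist n (DpH n H Q y) (DpH n H Q x)) * vnorm n \<pi>"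
    by (intro mult_right_mono vdist_triangle) simp
  also have "\<dots> \<le> (12 * Co * vdist n p2 q2 + Co * (2 + 3 * R) * vdist n y x) * vnorm n \<pi>"
  proof (intro mult_right_mono add_mono)
    show "vdist n (DpH n H P y) (DpH n H Q y) \<le> 12 * Co * vdist n p2 q2"
      using DpH_lip_p[OF PQ(1,2) v(6)] PQ(3) by simp
    have "vdist n (DpH n H Q y) (DpH n H Q x) \<le> Co * (2 + vnorm n Q) * vdist n y x" by (intro DpH_lip_x PQ v)
    also have "\<dots> \<le> Co * (2 + 3 * R) * vdist n y x"
      using nrm[OF R(4), of a] a Co1 by (intro mult_right_mono mult_left_mono) (auto simp: Q_def)
    finally show "vdist n (DpH n H Q y) (DpH n H Q x) \<le> Co * (2 + 3 * R) * vdist n y x" .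
  qed simp
  also have "\<dots> \<le> (40 * Co * (1 + R) * vdist n p2 q2 + 40 * Co * (1 + R) * vdist n y x) * vnorm n \<pi>"
    using R0 Co1 by (intro mult_right_mono add_mono) (auto simp: algebra_simps intro: mult_right_mono add_nonneg_nonneg)
  finally have B: "\<bar>g 1 - g 0\<bar> \<le> 40 * Co * (1 + R) * (vdist n p2 q2 + vdist n y x) * vdist n q1 q2"
    using a(3) by (simp add: \<pi>_def vdist_def algebra_simps)
  have "mv n q2 1 \<pi> = q1" by (rule Rn_eqI[where n = n]) (auto simp: v \<pi>_def)
  then have "g 1 - g 0 = (H p3 y - H p2 y) - (H q1 x - H q2 x)" using v by (simp add: g_def p3_def)
  then show ?thesis using A B by linarith
qed

text \<open>Expansion in \<open>p\<close> at the two points \<open>x + e\<close> and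
  \<open>x - e\<close> with one common slope \<open>b\<close>: the linear parts add up to
  \<open>b\<close> times the second difference of the momenta, the errors are quadratic, and
  \<open>H_second_difference_x\<close> treats what is left at fixed \<open>p\<close>.\<close>

lemma H_joint_second_difference:
  assumes v: "p \<in> Rn n" "p1 \<in> Rn n" "p2 \<in> Rn n" "x \<in> Rn n" "e \<in> Rn n" and R: "vnorm n p \<le> R"
  shows "\<bar>H p1 (mv n x 1 e) + H p2 (mv n x (-1) e) - 2 * H p x\<bar> \<le>
    40 * Co * (1 + R) * vnorm n (\<lambda>i. p1 i + p2 i - 2 * p i)
    + 40 * Co * (1 + R) * ((vdist n p1 p)\<^sup>2 + (vdist n p2 p)\<^sup>2 + vnorm n e * (vdist n p1 p + vdist n p2 p) + (vnorm n e)\<^sup>2)"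
proof -
  have R0: "R \<ge> 0" using R vnorm_nonneg[of n p] by linarith
  define b where "b = DpH n H p x"
  have one: "\<bar>H q y - H p y - (\<Sum>i<n. b i * (q i - p i))\<bar> \<le> 12 * Co * (vdist n q p)\<^sup>2 + Co * (2 + R) * vnorm n e * vdist n q p"
    if q: "q \<in> Rn n" and y: "y \<in> Rn n" "vdist n y x = vnorm n e" for q y
  proof -
    obtain \<theta> where t: "0 < \<theta>" "\<theta> < 1" "H q y - H p y = (\<Sum>i<n. pd i (\<lambda>q. H q y) (mv n p \<theta> (\<lambda>i. q i - p i)) * (q i - p i))"
      using C1f_mvt[OF H_p_C1[OF y(1)] v(1) q] by metis
    define w where "w = mv n p \<theta> (\<lambda>i. q i - p i)"
    have w: "w \<in> Rn n" by (simp add: w_def)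
    have wp: "vdist n w p \<le> vdist n q p"
      unfolding w_def vdist_mv using t vnorm_nonneg[of n "\<lambda>i. q i - p i"] by (simp add: vdist_def mult_left_le_one_le)
    have "H q y - H p y - (\<Sum>i<n. b i * (q i - p i)) = (\<Sum>i<n. (DpH n H w y i - b i) * (q i - p i))"
      unfolding t(3) w_def DpH_def by (simp add: left_diff_distrib sum_subtractf)
    also have "\<bar>\<dots>\<bar> \<le> vdist n (DpH n H w y) b * vdist n q p" unfolding vdist_def by (rule CS)
    also have "\<dots> \<le> (vdist n (DpH n H w y) (DpH n H p y) + vdist n (DpH n H p y) b) * vdist n q p"
      by (intro mult_right_mono vdist_triangle) simp
    also have "\<dots> \<le> (12 * Co * vdist n q p + Co * (2 + R) * vnorm n e) * vdist n q p"
    proof (intro mult_right_mono add_mono)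
      show "vdist n (DpH n H w y) (DpH n H p y) \<le> 12 * Co * vdist n q p"
        using DpH_lip_p[OF w v(1) y(1)] mult_left_mono[OF wp, of "12 * Co"] Co1 by linarith
      have "vdist n (DpH n H p y) b \<le> Co * (2 + vnorm n p) * vnorm n e"
        using DpH_lip_x[OF v(1) y(1) v(4)] y by (simp add: b_def)
      also have "\<dots> \<le> Co * (2 + R) * vnorm n e" using R Co1 by (intro mult_right_mono mult_left_mono) auto
      finally show "vdist n (DpH n H p y) b \<le> Co * (2 + R) * vnorm n e" .
    qed simp
    finally show ?thesis by (simp add: power2_eq_square algebra_simps)
  qed
  define x1 where "x1 = mv n x 1 e" 
  define x2 where "x2 = mv n x (-1) e"
  have "vdist n x1 x = vnorm n e" "vdist n x2 x = vnorm n e" "x1 \<in> Rn n" "x2 \<in> Rn n"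
    by (simp_all add: x1_def x2_def vdist_mv)
  note o1 = one[OF v(2) this(3,1)] and o2 = one[OF v(3) this(4,2)]
  have o3: "\<bar>H p x1 + H p x2 - 2 * H p x\<bar> \<le> 2 * Co * (vnorm n e)\<^sup>2"
    unfolding x1_def x2_def by (rule H_second_difference_x[OF v(1,4,5)])
  have "(\<Sum>i<n. b i * (p1 i - p i)) + (\<Sum>i<n. b i * (p2 i - p i)) = (\<Sum>i<n. b i * (p1 i + p2 i - 2 * p i))"
    by (simp add: sum.distrib[symmetric] algebra_simps)
  moreover have "\<bar>\<Sum>i<n. b i * (p1 i + p2 i - 2 * p i)\<bar> \<le> 12 * Co * (1 + R) * vnorm n (\<lambda>i. p1 i + p2 i - 2 * p i)"
  proof -
    have "\<bar>\<Sum>i<n. b i * (p1 i + p2 i - 2 * p i)\<bar> \<le> vnorm n b * vnorm n (\<lambda>i. p1 i + p2 i - 2 * p i)" by (rule CS)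
    also have "\<dots> \<le> 12 * Co * (1 + vnorm n p) * vnorm n (\<lambda>i. p1 i + p2 i - 2 * p i)"
      unfolding b_def by (intro mult_right_mono DpH_bound v) simp
    also have "\<dots> \<le> 12 * Co * (1 + R) * vnorm n (\<lambda>i. p1 i + p2 i - 2 * p i)"
      using R Co1 by (intro mult_right_mono mult_left_mono) auto
    finally show ?thesis .
  qed
  ultimately have main: "\<bar>H p1 x1 + H p2 x2 - 2 * H p x\<bar> \<le> 12 * Co * (1 + R) * vnorm n (\<lambda>i. p1 i + p2 i - 2 * p i)
      + (12 * Co * (vdist n p1 p)\<^sup>2 + Co * (2 + R) * vnorm n e * vdist n p1 p)
      + (12 * Co * (vdist n p2 p)\<^sup>2 + Co * (2 + R) * vnorm n e * vdist n p2 p) + 2 * Co * (vnorm n e)\<^sup>2"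
    using o1 o2 o3 by linarith
  define K where "K = 40 * Co * (1 + R)"
  have K: "12 * Co * (1 + R) \<le> K" "12 * Co \<le> K" "Co * (2 + R) \<le> K" "2 * Co \<le> K"
    using R0 Co1 by (auto simp: K_def algebra_simps intro: add_nonneg_nonneg)
  have s: "12 * Co * (1 + R) * vnorm n (\<lambda>i. p1 i + p2 i - 2 * p i) \<le> K * vnorm n (\<lambda>i. p1 i + p2 i - 2 * p i)"
    "12 * Co * (vdist n p1 p)\<^sup>2 \<le> K * (vdist n p1 p)\<^sup>2" "12 * Co * (vdist n p2 p)\<^sup>2 \<le> K * (vdist n p2 p)\<^sup>2"
    "Co * (2 + R) * (vnorm n e * vdist n p1 p) \<le> K * (vnorm n e * vdist n p1 p)"
    "Co * (2 + R) * (vnorm n e * vdist n p2 p) \<le> K * (vnorm n e * vdist n p2 p)"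
    "2 * Co * (vnorm n e)\<^sup>2 \<le> K * (vnorm n e)\<^sup>2"
    by (intro mult_right_mono K; simp)+
  show ?thesis using main s unfolding K_def[symmetric] x1_def x2_def by (simp add: algebra_simps)
qed

end

section \<open>Gradient estimates for the Hamilton--Jacobi equation\<close>

text \<open>Self-improvement of an a priori bound: the least admissible \<open>B\<close> cannot
  exceed its image \<open>c + B / 2\<close>, so it is at most \<open>2 * c\<close>. The finite
  \<open>B0\<close> makes the infimum exist, and \<open>step\<close> is asked only up to
  \<open>B0\<close>, so that smallness of \<open>B0\<close> can be exploited.\<close>

lemma contraction_bound:
  fixes g h :: "'i \<Rightarrow> real"
  assumes h: "\<And>i. i \<in> S \<Longrightarrow> 0 \<le> h i" and c: "0 \<le> c" and B0: "0 \<le> B0" "\<And>i. i \<in> S \<Longrightarrow> g i \<le> B0 * h i"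
    and step: "\<And>B i. 0 \<le> B \<Longrightarrow> B \<le> B0 \<Longrightarrow> (\<And>i. i \<in> S \<Longrightarrow> g i \<le> B * h i) \<Longrightarrow> i \<in> S \<Longrightarrow> g i \<le> (c + B / 2) * h i"
    and i: "i \<in> S"
  shows "g i \<le> 2 * c * h i"
proof -
  define A where "A = {B. 0 \<le> B \<and> B \<le> B0 \<and> (\<forall>i\<in>S. g i \<le> B * h i)}"
  have B0A: "B0 \<in> A" using B0 by (auto simp: A_def)
  have bdd: "bdd_below A" by (rule bdd_belowI[of _ 0]) (auto simp: A_def)
  define s where "s = Inf A"
  have s0: "0 \<le> s" unfolding s_def by (rule cInf_greatest) (use B0A in \<open>auto simp: A_def\<close>)
  have sB: "s \<le> B0" unfolding s_def by (rule cInf_lower[OF B0A bdd])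
  have sv: "g i \<le> s * h i" if "i \<in> S" for i
  proof (cases "h i = 0")
    case True then show ?thesis using B0(2)[OF that] by simp
  next
    case False
    then have hp: "h i > 0" using h[OF that] by simp
    have "g i / h i \<le> s" unfolding s_def
      by (rule cInf_greatest) (use B0A that hp in \<open>auto simp: A_def pos_divide_le_eq\<close>)
    then show ?thesis using hp by (simp add: pos_divide_le_eq)
  qed
  have "s \<le> 2 * c"
  proof (rule ccontr)
    assume n: "\<not> s \<le> 2 * c"
    then have "c + s / 2 \<in> A" unfolding A_def using step[OF s0 sB sv] s0 sB c by auto
    then have "s \<le> c + s / 2" unfolding s_def by (rule cInf_lower[OF _ bdd])
    then show False using n by simp
  qed
  then have "s * h i \<le> 2 * c * h i" using h[OF i] by (rule mult_right_mono)
  then show ?thesis using sv[OF i] by simp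
qed

lemma Du_nth [simp]: "i < n \<Longrightarrow> Du n u x t i = pd i (\<lambda>y. u y t) x"
  by (simp add: Du_def)

lemma Du_Rn [simp]: "Du n u x t \<in> Rn n"
  by (simp add: Du_def)

lemma vdist_vscale [simp]: "vdist n (vscale n c v) (vscale n c w) = \<bar>c\<bar> * vdist n v w"
proof -
  have "vdist n (vscale n c v) (vscale n c w) = vnorm n (\<lambda>i. c * (v i - w i))"
    unfolding vdist_def by (rule vnorm_cong) (simp add: algebra_simps)
  then show ?thesis by (simp add: vnorm_cmult vdist_def)
qed

lemma vdist_Du: "vdist n (Du n u x t) (Du n v y s) = vnorm n (\<lambda>i. pd i (\<lambda>y. u y t) x - pd i (\<lambda>x. v x s) y)"
  unfolding vdist_def by (rule vnorm_cong) simp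

text \<open>One solution with the coupling frozen into the source \<open>f\<close>.
  \<open>hess2\<close> is the Hessian condition in the form of second differences. \<open>B0\<close>
  is purely qualitative: it starts the iterations and appears in no resulting estimate.\<close>

locale hjb = hamiltonian n \<alpha> Co H for n \<alpha> Co H +
  fixes L lam B0 :: real and u ut f :: "vec \<Rightarrow> real \<Rightarrow> real"
  assumes L0: "0 \<le> L" and lam1: "1 \<le> lam" "2 * Co \<le> lam"
    and D: "D21 n u ut (\<lambda>i x t. pd i (\<lambda>y. u y t) x) (\<lambda>i x t. pd i (pd i (\<lambda>y. u y t)) x)"
    and C1: "t > 0 \<Longrightarrow> C1f n (\<lambda>y. u y t)"
    and hess2: "t > 0 \<Longrightarrow> x \<in> Rn n \<Longrightarrow> e \<in> Rn n \<Longrightarrow>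
      \<bar>u (mv n x 1 e) t + u (mv n x (-1) e) t - 2 * u x t\<bar> \<le> 2 * (vnorm n e)\<^sup>2"
    and pde: "t > 0 \<Longrightarrow> x \<in> Rn n \<Longrightarrow> - ut x t - (\<Sum>i<n. pd i (pd i (\<lambda>y. u y t)) x)
        + 1 / lam * H (vscale n lam (Du n u x t)) x + lam * u x t = f x t"
    and grad0: "0 \<le> B0" "t > 0 \<Longrightarrow> x \<in> Rn n \<Longrightarrow> vnorm n (Du n u x t) \<le> B0"
    and f1: "t > 0 \<Longrightarrow> x \<in> Rn n \<Longrightarrow> y \<in> Rn n \<Longrightarrow> \<bar>f x t - f y t\<bar> \<le> L * vdist n x y"
    and f2: "t > 0 \<Longrightarrow> x \<in> Rn n \<Longrightarrow> e \<in> Rn n \<Longrightarrow>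
      \<bar>f (mv n x 1 e) t + f (mv n x (-1) e) t - 2 * f x t\<bar> \<le> 2 * L * (vnorm n e)\<^sup>2"
begin

abbreviation P :: "vec \<Rightarrow> real \<Rightarrow> vec" where "P x t \<equiv> vscale n lam (Du n u x t)"

text \<open>\<open>R0\<close> will bound \<open>|lam * Du|\<close>, and \<open>K\<close> is the
  constant of the difference estimates for \<open>H\<close> at radius \<open>R0\<close>. In
  \<open>r1\<close>, 145 is 12 * 12 for the increment of the momentum plus 1 for that of
  \<open>x\<close>. \<open>M1\<close>, twice \<open>12 * L + 6 * K\<close>, will be the Lipschitz
  constant of \<open>lam * Du\<close>.\<close>

definition "R0 = 2 * (L + Co)"
definition "K = 40 * Co * (1 + R0)"
definition "r1 = L + 145 * Co * (1 + R0)"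
definition "M1 = 24 * L + 12 * K"

lemma R0_pos: "R0 \<ge> 0" and K_pos: "K \<ge> 1" and r1_pos: "r1 \<ge> 0" and M1_pos: "M1 \<ge> 0"
proof -
  show 1: "R0 \<ge> 0" unfolding R0_def using L0 Co1 by simp
  have "1 * 1 \<le> (40 * Co) * (1 + R0)" using 1 Co1 by (intro mult_mono) auto
  then show 2: "K \<ge> 1" unfolding K_def by simp
  show "r1 \<ge> 0" unfolding r1_def using 1 L0 Co1 by simp
  show "M1 \<ge> 0" unfolding M1_def using 2 L0 by simp
qed

lemma lam_pos: "0 < lam" using lam1 by simp

lemma D_diff: "D21 n (\<lambda>x t. u (mv n x 1 e) t - u x t) (\<lambda>x t. ut (mv n x 1 e) t - ut x t)
    (\<lambda>i x t. pd i (\<lambda>y. u y t) (mv n x 1 e) - pd i (\<lambda>y. u y t) x)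
    (\<lambda>i x t. pd i (pd i (\<lambda>y. u y t)) (mv n x 1 e) - pd i (pd i (\<lambda>y. u y t)) x)"
  by (rule D21_diff[OF D21_shift[OF D] D])

lemma pde_diff:
  assumes "t > 0" "x \<in> Rn n"
  shows "- (ut (mv n x 1 e) t - ut x t) - (\<Sum>i<n. pd i (pd i (\<lambda>y. u y t)) (mv n x 1 e) - pd i (pd i (\<lambda>y. u y t)) x)
    + lam * (u (mv n x 1 e) t - u x t) = f (mv n x 1 e) t - f x t
      - 1 / lam * (H (P (mv n x 1 e) t) (mv n x 1 e) - H (P x t) x)"
  using pde[OF assms] pde[OF assms(1) mv_Rn[of n x 1 e]] by (simp add: sum_subtractf algebra_simps)

lemma P_norm: "vnorm n (P x t) = lam * vnorm n (Du n u x t)"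
  using lam_pos by simp

lemma P_dist: "vdist n (P x t) (P y t) = lam * vdist n (Du n u x t) (Du n u y t)"
  using lam_pos by simp

text \<open>Comparison for the increments \<open>u(x + e) - u(x)\<close>.\<close>

lemma gradient_step:
  assumes B: "0 \<le> B" "\<And>x t. x \<in> Rn n \<Longrightarrow> t > 0 \<Longrightarrow> vnorm n (Du n u x t) \<le> B"
    and x: "x \<in> Rn n" and t: "t > 0"
  shows "vnorm n (Du n u x t) \<le> (L + Co + Co * B) / lam"
  unfolding Du_def
proof (rule C1f_grad_bound[OF C1[OF t] x])
  show "0 \<le> (L + Co + Co * B) / lam" using L0 Co1 B lam_pos by simp
  fix e assume e: "e \<in> Rn n"
  have "u (mv n x 1 e) t - u x t \<le> ((L + Co + Co * B) * vnorm n e) / lam"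
  proof (rule max_principle[OF D_diff _ lam_pos _ _ x t])
    show "u (mv n x 1 e) t - u x t \<le> B * vnorm n e" if "x \<in> Rn n" "t > 0" for x t
    proof -
      have "\<bar>u (mv n x 1 e) t - u x t\<bar> \<le> B * vdist n (mv n x 1 e) x"
        by (rule C1f_lipschitz[OF C1]) (use that B in \<open>auto simp: Du_def\<close>)
      then show ?thesis by (simp add: vdist_mv)
    qed
    \<comment> \<open>This coefficient grows with \<open>lam * B\<close> but does not enter the
      bound: the maximum principle is insensitive to the size of first order terms.\<close>
    show "0 \<le> 12 * Co * (1 + lam * B)" using Co1 B lam_pos by simp
    fix x t assume x: "x \<in> Rn n" and t: "(t::real) > 0"
    define y where "y = mv n x 1 e"
    have y: "y \<in> Rn n" "vdist n y x = vnorm n e" by (simp_all add: y_def vdist_mv)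
    define z where "z = vnorm n (\<lambda>i. pd i (\<lambda>y. u y t) y - pd i (\<lambda>y. u y t) x)"
    have lB: "vnorm n (P w t) \<le> lam * B" if "w \<in> Rn n" for w
      unfolding P_norm using B(2)[OF that t] lam_pos by (intro mult_left_mono) auto
    have a: "\<bar>H (P y t) y - H (P x t) y\<bar> \<le> 12 * Co * (1 + lam * B) * (lam * z)"
      using H_lip_p[of "P y t" "P x t" y "lam * B"] y x lB lam_pos by (simp add: P_dist vdist_Du z_def)
    have "\<bar>H (P x t) y - H (P x t) x\<bar> \<le> Co * (1 + vnorm n (P x t)) * vnorm n e"
      using H_lip_x[of "P x t" x y] x y by simp
    also have "\<dots> \<le> Co * (1 + lam * B) * vnorm n e" using lB[OF x] Co1 by (intro mult_right_mono mult_left_mono) auto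
    finally have b: "\<bar>H (P x t) y - H (P x t) x\<bar> \<le> Co * (1 + lam * B) * vnorm n e" .
    have "- (1 / lam * (H (P y t) y - H (P x t) x)) \<le> 1 / lam * (12 * Co * (1 + lam * B) * (lam * z) + Co * (1 + lam * B) * vnorm n e)"
      unfolding mult_minus_right[symmetric] using a b lam_pos by (intro mult_left_mono) auto
    also have "\<dots> = 12 * Co * (1 + lam * B) * z + (Co / lam + Co * B) * vnorm n e"
      using lam_pos by (simp add: field_simps)
    also have "\<dots> \<le> 12 * Co * (1 + lam * B) * z + (Co + Co * B) * vnorm n e"
      using lam1 Co1 by (intro add_left_mono mult_right_mono add_right_mono) (auto simp: divide_le_eq)
    finally show "- (ut (mv n x 1 e) t - ut x t) - (\<Sum>i<n. pd i (pd i (\<lambda>y. u y t)) (mv n x 1 e) - pd i (pd i (\<lambda>y. u y t)) x)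
      + lam * (u (mv n x 1 e) t - u x t)
      \<le> 12 * Co * (1 + lam * B) * vnorm n (\<lambda>i. pd i (\<lambda>y. u y t) (mv n x 1 e) - pd i (\<lambda>y. u y t) x) + (L + Co + Co * B) * vnorm n e"
      unfolding pde_diff[OF t x] using f1[OF t y(1) x] y(2)
      unfolding y_def[symmetric] z_def[symmetric] by (simp add: distrib_right)
  qed
  then show "u (mv n x 1 e) t - u x t \<le> (L + Co + Co * B) / lam * vnorm n e" by simp
qed

text \<open>\<open>gradient_step\<close> sends a bound \<open>B\<close> to
  \<open>(L + Co) / lam + Co / lam * B\<close>, and \<open>2 * Co \<le> lam\<close> makes the slope
  at most one half.\<close>

lemma gradient_bound:
  assumes x: "x \<in> Rn n" and t: "t > 0"
  shows "lam * vnorm n (Du n u x t) \<le> R0"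
proof -
  have "vnorm n (Du n u (fst (x, t)) (snd (x, t))) \<le> 2 * ((L + Co) / lam) * 1"
  proof (rule contraction_bound[where S = "Rn n \<times> {0<..}" and h = "\<lambda>_. 1" and ?B0.0 = B0
        and g = "\<lambda>p. vnorm n (Du n u (fst p) (snd p))"])
    fix B and p :: "vec \<times> real" assume B: "0 \<le> B" "\<And>p :: vec \<times> real. p \<in> Rn n \<times> {0<..} \<Longrightarrow> vnorm n (Du n u (fst p) (snd p)) \<le> B * 1" "p \<in> Rn n \<times> {0<..}"
    have "vnorm n (Du n u (fst p) (snd p)) \<le> (L + Co + Co * B) / lam"
      by (rule gradient_step[OF B(1)]) (use B(2)[of "(a, b)" for a b] B(3) in auto)
    also have "\<dots> = (L + Co) / lam + Co / lam * B" by (simp add: add_divide_distrib)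
    also have "Co / lam * B \<le> 1 / 2 * B" using lam1 lam_pos B(1) by (intro mult_right_mono) (auto simp: divide_le_eq)
    finally show "vnorm n (Du n u (fst p) (snd p)) \<le> ((L + Co) / lam + B / 2) * 1" by simp
  qed (use L0 Co1 lam_pos grad0 x t in auto)
  then show ?thesis using lam_pos by (simp add: R0_def field_simps)
qed

lemma P_bound: "x \<in> Rn n \<Longrightarrow> t > 0 \<Longrightarrow> vnorm n (P x t) \<le> R0"
  unfolding P_norm by (rule gradient_bound)

lemma Du_lip0:
  assumes "x \<in> Rn n" "y \<in> Rn n" "t > 0"
  shows "vdist n (Du n u x t) (Du n u y t) \<le> 12 * vdist n x y"
  using second_difference_grad_lipschitz[OF C1[OF assms(3)] assms(1,2), of 2] hess2[OF assms(3)]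
  by (simp add: Du_def)

text \<open>The increment of the Hamiltonian is put into the source: \<open>Du_lip0\<close> bounds
  it by a multiple of \<open>lam * |e|\<close>, and the prefactor \<open>1 / lam\<close> cancels the
  \<open>lam\<close>. Reflection then gains \<open>1 / sqrt lam\<close>. The factor \<open>n\<close>
  comes from passing from single partial derivatives to the gradient.\<close>

lemma Du_lip_small:
  assumes x: "x \<in> Rn n" and y: "y \<in> Rn n" and t: "t > 0"
  shows "vdist n (Du n u x t) (Du n u y t) \<le> n * r1 / sqrt lam * vdist n x y"
proof -
  have one: "pd k (\<lambda>y. u y t) y - pd k (\<lambda>y. u y t) x \<le> r1 * vdist n x y / sqrt lam"
    if x: "x \<in> Rn n" and y: "y \<in> Rn n" and k: "k < n" for x y k
  proof -
    define e where "e = (\<lambda>i. y i - x i)"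
    have y1: "mv n x 1 e = y" by (rule Rn_eqI[OF _ y]) (auto simp: e_def)
    have en: "vnorm n e = vdist n x y" using vdist_commute[of n x y] by (simp add: vdist_def e_def)
    have "pd k (\<lambda>y. u y t) (mv n x 1 e) - pd k (\<lambda>y. u y t) x \<le> (r1 * vnorm n e) / sqrt lam"
    proof (rule reflection_gradient_bound[OF D_diff lam_pos _ _ x t k])
      show "\<bar>u (mv n x 1 e) t - u x t\<bar> \<le> B0 * vnorm n e" if "x \<in> Rn n" "t > 0" for x t
      proof -
        have "\<bar>u (mv n x 1 e) t - u x t\<bar> \<le> B0 * vdist n (mv n x 1 e) x"
          by (rule C1f_lipschitz[OF C1]) (use that grad0 in \<open>auto simp: Du_def\<close>)
        then show ?thesis by (simp add: vdist_mv)
      qed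
      fix x t assume x: "x \<in> Rn n" and t: "(t::real) > 0"
      define y where "y = mv n x 1 e"
      have y: "y \<in> Rn n" "vdist n y x = vnorm n e" by (simp_all add: y_def vdist_mv)
      have "\<bar>H (P y t) y - H (P x t) y\<bar> \<le> 12 * Co * (1 + R0) * (lam * vdist n (Du n u y t) (Du n u x t))"
        using H_lip_p[of "P y t" "P x t" y R0] y x t P_bound by (simp only: P_dist) simp
      also have "\<dots> \<le> 12 * Co * (1 + R0) * (lam * (12 * vnorm n e))"
        using Du_lip0[OF y(1) x t] y(2) Co1 R0_pos lam_pos by (intro mult_left_mono) auto
      finally have a: "\<bar>H (P y t) y - H (P x t) y\<bar> \<le> 12 * Co * (1 + R0) * (lam * (12 * vnorm n e))" .
      have "\<bar>H (P x t) y - H (P x t) x\<bar> \<le> Co * (1 + vnorm n (P x t)) * vnorm n e"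
        using H_lip_x[of "P x t" x y] x y by simp
      also have "\<dots> \<le> Co * (1 + R0) * vnorm n e" using P_bound[OF x t] Co1 by (intro mult_right_mono mult_left_mono) auto
      also have "\<dots> \<le> Co * (1 + R0) * (lam * vnorm n e)"
        using lam1 Co1 R0_pos mult_right_mono[of 1 lam "vnorm n e"] by (intro mult_left_mono) auto
      finally have "\<bar>H (P x t) y - H (P x t) x\<bar> \<le> Co * (1 + R0) * (lam * vnorm n e)" .
      with a have "\<bar>H (P y t) y - H (P x t) x\<bar> \<le> 145 * Co * (1 + R0) * (lam * vnorm n e)" by (simp add: algebra_simps)
      then have "\<bar>1 / lam * (H (P y t) y - H (P x t) x)\<bar> \<le> 1 / lam * (145 * Co * (1 + R0) * (lam * vnorm n e))"
        unfolding abs_mult using lam_pos by (intro mult_mono) auto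
      also have "\<dots> = 145 * Co * (1 + R0) * vnorm n e" using lam_pos by simp
      finally show "\<bar>- (ut (mv n x 1 e) t - ut x t) - (\<Sum>i<n. pd i (pd i (\<lambda>y. u y t)) (mv n x 1 e) - pd i (pd i (\<lambda>y. u y t)) x)
        + lam * (u (mv n x 1 e) t - u x t)\<bar> \<le> r1 * vnorm n e"
        unfolding pde_diff[OF t x] using f1[OF t y(1) x]
        unfolding y(2) y_def[symmetric] r1_def distrib_right by linarith
    qed
    then show ?thesis by (simp add: y1 en)
  qed
  have "vdist n (Du n u x t) (Du n u y t) \<le> real n * (r1 * vdist n x y / sqrt lam)"
    unfolding vdist_Du
  proof (rule vnorm_le_const)
    fix i assume "i < n"
    then show "\<bar>pd i (\<lambda>y. u y t) x - pd i (\<lambda>x. u x t) y\<bar> \<le> r1 * vdist n x y / sqrt lam"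
      using one[OF x y, of i] one[OF y x, of i] vdist_commute[of n x y] by (simp add: abs_le_iff)
  qed
  then show ?thesis by simp
qed

definition "z2 e x t = u (mv n x 1 e) t + u (mv n x (-1) e) t - 2 * u x t"

text \<open>In \<open>H_joint_second_difference\<close> the second difference of the momenta becomes
  the gradient term of the comparison, with coefficient \<open>K\<close>, while the squares of first
  differences contribute \<open>(lam * M)^2 / lam\<close>: the dependence on \<open>M\<close> is
  quadratic.\<close>

lemma second_step:
  assumes M: "0 \<le> M" "\<And>x y t. x \<in> Rn n \<Longrightarrow> y \<in> Rn n \<Longrightarrow> t > 0 \<Longrightarrow> vdist n (Du n u x t) (Du n u y t) \<le> M * vdist n x y"
    and e: "e \<in> Rn n" and x: "x \<in> Rn n" and t: "t > 0"
  shows "\<bar>z2 e x t\<bar> \<le> (2 * L + K / lam + 2 * K * lam * M\<^sup>2 + 2 * K * M) / lam * (vnorm n e)\<^sup>2"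
proof -
  define ui where "ui = (\<lambda>i x t. pd i (\<lambda>y. u y t) x)"
  define uii where "uii = (\<lambda>i x t. pd i (pd i (\<lambda>y. u y t)) x)"
  define G where "G = (2 * L + K / lam + 2 * K * lam * M\<^sup>2 + 2 * K * M) * (vnorm n e)\<^sup>2"
  have D': "D21 n u ut ui uii" using D by (simp add: ui_def uii_def)
  define zt where "zt x t = ut (mv n x 1 e) t + ut (mv n x (-1) e) t - 2 * ut x t" for x t
  define zi where "zi i x t = ui i (mv n x 1 e) t + ui i (mv n x (-1) e) t - 2 * ui i x t" for i x t
  define zii where "zii i x t = uii i (mv n x 1 e) t + uii i (mv n x (-1) e) t - 2 * uii i x t" for i x t
  have Dz: "D21 n (z2 e) zt zi zii"
    unfolding z2_def[abs_def] zt_def[abs_def] zi_def[abs_def] zii_def[abs_def]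
    by (intro D21_diff D21_add D21_shift D21_cmult D')
  have bd: "\<bar>z2 e x t\<bar> \<le> 2 * (vnorm n e)\<^sup>2" if "x \<in> Rn n" "t > 0" for x t
    unfolding z2_def by (rule hess2) (use that e in auto)
  have eqn: "\<bar>- zt x t - (\<Sum>i<n. zii i x t) + lam * z2 e x t\<bar> \<le> K * vnorm n (\<lambda>i. zi i x t) + G"
    if x: "x \<in> Rn n" and t: "t > 0" for x t
  proof -
    define x1 where "x1 = mv n x 1 e"
    define x2 where "x2 = mv n x (-1) e"
    have xs: "x1 \<in> Rn n" "x2 \<in> Rn n" "vdist n x1 x = vnorm n e" "vdist n x2 x = vnorm n e"
      by (simp_all add: x1_def x2_def vdist_mv)
    define Hd where "Hd = H (P x1 t) x1 + H (P x2 t) x2 - 2 * H (P x t) x"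
    have eq: "- zt x t - (\<Sum>i<n. zii i x t) + lam * z2 e x t = (f x1 t + f x2 t - 2 * f x t) - 1 / lam * Hd"
      using pde[OF t x] pde[OF t xs(1)] pde[OF t xs(2)]
      unfolding zt_def zii_def z2_def uii_def Hd_def x1_def[symmetric] x2_def[symmetric]
      by (simp add: sum_subtractf sum.distrib sum_distrib_left[symmetric] algebra_simps add_divide_distrib diff_divide_distrib)
    have dP: "vdist n (P w t) (P x t) \<le> lam * M * vnorm n e" if "w \<in> Rn n" "vdist n w x = vnorm n e" for w
      unfolding P_dist using M(2)[OF that(1) x t] that(2) lam_pos by simp
    have "vnorm n (\<lambda>i. P x1 t i + P x2 t i - 2 * P x t i) = vnorm n (\<lambda>i. lam * zi i x t)"
      by (rule vnorm_cong) (simp add: zi_def ui_def x1_def x2_def algebra_simps)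
    then have gr: "vnorm n (\<lambda>i. P x1 t i + P x2 t i - 2 * P x t i) = lam * vnorm n (\<lambda>i. zi i x t)"
      using lam_pos by (simp add: vnorm_cmult)
    have sq: "(vdist n (P w t) (P x t))\<^sup>2 \<le> (lam * M * vnorm n e)\<^sup>2" if "w \<in> Rn n" "vdist n w x = vnorm n e" for w
      by (rule power_mono[OF dP[OF that]]) simp
    have "\<bar>Hd\<bar> \<le> K * (lam * vnorm n (\<lambda>i. zi i x t)) +
        K * ((vdist n (P x1 t) (P x t))\<^sup>2 + (vdist n (P x2 t) (P x t))\<^sup>2 + vnorm n e * (vdist n (P x1 t) (P x t) + vdist n (P x2 t) (P x t)) + (vnorm n e)\<^sup>2)"
      using H_joint_second_difference[of "P x t" "P x1 t" "P x2 t" x e R0, OF vscale_Rn vscale_Rn vscale_Rn x e P_bound[OF x t]]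
      unfolding Hd_def K_def x1_def x2_def gr[unfolded x1_def x2_def] by simp
    also have "\<dots> \<le> K * (lam * vnorm n (\<lambda>i. zi i x t)) +
        K * ((lam * M * vnorm n e)\<^sup>2 + (lam * M * vnorm n e)\<^sup>2 + vnorm n e * (lam * M * vnorm n e + lam * M * vnorm n e) + (vnorm n e)\<^sup>2)"
      using K_pos sq dP xs by (intro add_left_mono mult_left_mono add_mono order_refl) auto
    finally have "1 / lam * \<bar>Hd\<bar> \<le> 1 / lam * (K * (lam * vnorm n (\<lambda>i. zi i x t)) +
        K * ((lam * M * vnorm n e)\<^sup>2 + (lam * M * vnorm n e)\<^sup>2 + vnorm n e * (lam * M * vnorm n e + lam * M * vnorm n e) + (vnorm n e)\<^sup>2))"
      using lam_pos by (intro mult_left_mono) auto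
    also have "\<dots> = K * vnorm n (\<lambda>i. zi i x t) + (K / lam + 2 * K * lam * M\<^sup>2 + 2 * K * M) * (vnorm n e)\<^sup>2"
      using lam_pos by (simp add: power2_eq_square field_simps)
    finally have h: "1 / lam * \<bar>Hd\<bar> \<le> K * vnorm n (\<lambda>i. zi i x t) + (K / lam + 2 * K * lam * M\<^sup>2 + 2 * K * M) * (vnorm n e)\<^sup>2" .
    have "\<bar>1 / lam * Hd\<bar> = 1 / lam * \<bar>Hd\<bar>" using lam_pos by (simp add: abs_mult)
    moreover have "G = 2 * L * (vnorm n e)\<^sup>2 + (K / lam + 2 * K * lam * M\<^sup>2 + 2 * K * M) * (vnorm n e)\<^sup>2"
      by (simp add: G_def distrib_right)
    ultimately show ?thesis unfolding eq using h f2[OF t x e, folded x1_def x2_def] by linarith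
  qed
  have G1: "z2 e x t \<le> G / lam"
    by (rule max_principle[OF Dz _ lam_pos _ _ x t, where \<beta> = K])
       (use bd eqn K_pos in \<open>auto simp: abs_le_iff\<close>)
  have "(-1) * z2 e x t \<le> G / lam"
  proof (rule max_principle[OF D21_cmult[OF Dz, of "-1"] _ lam_pos _ _ x t, where \<beta> = K])
    show "- 1 * z2 e x t \<le> 2 * (vnorm n e)\<^sup>2" if "x \<in> Rn n" "t > 0" for x t using bd[OF that] by simp
    show "0 \<le> K" using K_pos by simp
    show "- (- 1 * zt x t) - (\<Sum>i<n. - 1 * zii i x t) + lam * (- 1 * z2 e x t) \<le> K * vnorm n (\<lambda>i. - 1 * zi i x t) + G"
      if "x \<in> Rn n" "t > 0" for x t
      using eqn[OF that] by (simp add: vnorm_minus sum_negf abs_le_iff)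
  qed
  then show ?thesis using G1 by (simp add: G_def abs_le_iff)
qed

text \<open>The new constant \<open>6 * Q\<close> is below \<open>c + M / 2\<close> as long as
  \<open>48 * K * M \<le> 1\<close>. The bound \<open>n * r1 / sqrt lam\<close> from
  \<open>Du_lip_small\<close> lies in that range by \<open>big\<close>, so it can start the
  iteration, unlike the constant 12 of \<open>Du_lip0\<close>.\<close>

lemma Du_lip:
  assumes big: "48 * K \<le> lam" "48 * K * (n * r1) \<le> sqrt lam"
    and x: "x \<in> Rn n" and y: "y \<in> Rn n" and t: "t > 0"
  shows "lam * vdist n (Du n u x t) (Du n u y t) \<le> M1 * vdist n x y"
proof -
  define S where "S = {(x, y, t). x \<in> Rn n \<and> y \<in> Rn n \<and> (t::real) > 0}"
  define g where "g = (\<lambda>(x, y, t). vdist n (Du n u x t) (Du n u y t))"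
  define h where "h = (\<lambda>(x, y, t::real). vdist n x y)"
  define c where "c = (12 * L + 6 * K) / lam"
  have "g (x, y, t) \<le> 2 * c * h (x, y, t)"
  proof (rule contraction_bound[where S = S and ?B0.0 = "n * r1 / sqrt lam"])
    show "0 \<le> c" unfolding c_def using L0 K_pos lam_pos by simp
    show "0 \<le> n * r1 / sqrt lam" using r1_pos lam_pos by simp
    show "g i \<le> n * r1 / sqrt lam * h i" if "i \<in> S" for i
      using that Du_lip_small by (auto simp: S_def g_def h_def)
    fix M i assume M: "0 \<le> M" "M \<le> n * r1 / sqrt lam" "\<And>i. i \<in> S \<Longrightarrow> g i \<le> M * h i" "i \<in> S"
    have M': "vdist n (Du n u x t) (Du n u y t) \<le> M * vdist n x y" if "x \<in> Rn n" "y \<in> Rn n" "t > 0" for x y t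
      using M(3)[of "(x, y, t)"] that by (simp add: S_def g_def h_def)
    define Q where "Q = (2 * L + K / lam + 2 * K * lam * M\<^sup>2 + 2 * K * M) / lam"
    have Q0: "0 \<le> Q" unfolding Q_def using L0 K_pos M(1) lam_pos by simp
    have "6 * Q \<le> c + M / 2"
    proof -
      have "48 * K * M \<le> 1"
      proof -
        have "48 * K * M \<le> 48 * K * (n * r1 / sqrt lam)" using M(2) K_pos by (intro mult_left_mono) auto
        also have "\<dots> = 48 * K * (n * r1) / sqrt lam" by simp
        also have "\<dots> \<le> 1" using big(2) lam_pos by (simp add: divide_le_eq)
        finally show ?thesis .
      qed
      then have a: "48 * K * M * M \<le> 1 * M" using M(1) by (intro mult_right_mono) auto
      have b: "48 * K * M / lam \<le> M" using mult_right_mono[OF big(1) M(1)] lam_pos by (simp add: divide_le_eq mult.commute)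
      have d: "K / lam \<le> K" using lam1 K_pos by (simp add: divide_le_eq)
      have "6 * Q = (12 * L + 6 * (K / lam)) / lam + 12 * K * M * M + 12 * K * M / lam"
        unfolding Q_def using lam_pos by (simp add: field_simps power2_eq_square)
      also have "\<dots> \<le> (12 * L + 6 * K) / lam + M / 4 + M / 4"
        using a b d lam_pos by (intro add_mono divide_right_mono) auto
      finally show ?thesis by (simp add: c_def)
    qed
    moreover have "g i \<le> 6 * Q * h i"
    proof -
      obtain x y t where i: "i = (x, y, t)" "x \<in> Rn n" "y \<in> Rn n" "t > 0" using M(4) by (auto simp: S_def)
      have "vdist n (grad n (\<lambda>y. u y t) x) (grad n (\<lambda>y. u y t) y) \<le> 6 * Q * vdist n x y"
        by (rule second_difference_grad_lipschitz[OF C1[OF i(4)] i(2,3) Q0])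
           (use second_step[OF M(1) M' _ _ i(4)] in \<open>auto simp: z2_def Q_def\<close>)
      then show ?thesis by (simp add: i g_def h_def Du_def)
    qed
    moreover have "0 \<le> h i" by (auto simp: h_def split: prod.split)
    ultimately show "g i \<le> (c + M / 2) * h i" using mult_right_mono[of "6 * Q" "c + M / 2" "h i"] by linarith
  qed (use x y t in \<open>auto simp: S_def h_def\<close>)
  then have "lam * vdist n (Du n u x t) (Du n u y t) \<le> lam * (2 * c * vdist n x y)"
    using lam_pos by (simp add: g_def h_def)
  also have "\<dots> = M1 * vdist n x y" using lam_pos by (simp add: c_def M1_def field_simps)
  finally show ?thesis .
qed

end

locale hjb_pair = one: hjb n \<alpha> Co H L lam B0 u1 ut1 f1 + two: hjb n \<alpha> Co H L lam B0 u2 ut2 f2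
  for n \<alpha> Co H L lam B0 u1 ut1 f1 u2 ut2 f2 +
  assumes big: "48 * one.K \<le> lam" "48 * one.K * (n * one.r1) \<le> sqrt lam"
begin

text \<open>Multiplying increments of \<open>u1 - u2\<close> by \<open>exp (- A * t)\<close> lowers
  the discount to \<open>lam - A\<close>. A gap \<open>\<gamma>\<close> adds
  \<open>K * (M1 + 1) * \<gamma>\<close> to the source, the \<open>M1\<close> because an increment
  in \<open>x\<close> also moves the momentum. The conditions on \<open>A\<close> turn this share
  into at most \<open>\<gamma> / 2\<close> and allow \<open>lam / 2\<close> in place of
  \<open>lam - A\<close> under \<open>c\<close>.\<close>

lemma gradient_gap:
  assumes A: "0 \<le> A" "2 * A \<le> lam" "A + 2 * one.K * (one.M1 + 1) \<le> lam" and c: "0 \<le> c"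
    and ff: "\<And>x y t. x \<in> Rn n \<Longrightarrow> y \<in> Rn n \<Longrightarrow> t > 0 \<Longrightarrow>
      \<bar>(f1 x t - f2 x t) - (f1 y t - f2 y t)\<bar> \<le> c * exp (A * t) * vdist n x y"
    and x: "x \<in> Rn n" and t: "t > 0"
  shows "lam * vdist n (Du n u1 x t) (Du n u2 x t) \<le> 4 * c * exp (A * t)"
proof -
  note lam_pos = one.lam_pos
  define w where "w x t = u1 x t - u2 x t" for x t
  define wt where "wt x t = ut1 x t - ut2 x t" for x t
  define wi where "wi i x t = pd i (\<lambda>y. u1 y t) x - pd i (\<lambda>y. u2 y t) x" for i x t
  define wii where "wii i x t = pd i (pd i (\<lambda>y. u1 y t)) x - pd i (pd i (\<lambda>y. u2 y t)) x" for i x t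
  have Dw: "D21 n w wt wi wii"
    unfolding w_def[abs_def] wt_def[abs_def] wi_def[abs_def] wii_def[abs_def] by (rule D21_diff[OF one.D two.D])
  have wC1: "C1f n (\<lambda>y. w y t)" if "t > 0" for t
    unfolding w_def by (rule C1f_diff[OF one.C1[OF that] two.C1[OF that]])
  have pdw: "pd i (\<lambda>y. w y t) x = wi i x t" if "t > 0" "x \<in> Rn n" "i < n" for i x t
    unfolding w_def wi_def using grad_diff[OF one.C1[OF that(1)] two.C1[OF that(1)] that(2,3)] .
  define gw where "gw x t = vdist n (Du n u1 x t) (Du n u2 x t)" for x t
  have gw: "vnorm n (grad n (\<lambda>y. w y t) x) = gw x t" if "t > 0" "x \<in> Rn n" for x t
    unfolding gw_def vdist_Du by (rule vnorm_cong) (simp add: pdw that wi_def)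
  have gw0: "gw x t \<le> 2 * B0" if "t > 0" "x \<in> Rn n" for x t
    using vnorm_diff[of n "Du n u1 x t" "Du n u2 x t"] one.grad0(2)[OF that] two.grad0(2)[OF that]
    unfolding gw_def vdist_def by linarith
  have lA: "lam - A > 0" using A one.K_pos one.M1_pos mult_nonneg_nonneg[of "2 * one.K" "one.M1 + 1"] lam_pos
    by linarith
  have "gw (fst (x, t)) (snd (x, t)) \<le> 2 * (2 * c / lam) * exp (A * snd (x, t))"
  proof (rule contraction_bound[where S = "Rn n \<times> {0<..}" and ?B0.0 = "2 * B0" and g = "\<lambda>p. gw (fst p) (snd p)"])
    show "0 \<le> 2 * c / lam" using c lam_pos by simp
    show "0 \<le> 2 * B0" using one.grad0 by simp
    show "gw (fst p) (snd p) \<le> 2 * B0 * exp (A * snd p)" if "p \<in> Rn n \<times> {0<..}" for p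
    proof -
      have "2 * B0 * 1 \<le> 2 * B0 * exp (A * snd p)" using that A one.grad0 by (intro mult_left_mono) auto
      then show ?thesis using gw0[of "snd p" "fst p"] that by auto
    qed
    fix \<gamma> and p :: "vec \<times> real" assume g: "0 \<le> \<gamma>" "\<And>p. p \<in> Rn n \<times> {0<..} \<Longrightarrow> gw (fst p) (snd p) \<le> \<gamma> * exp (A * snd p)" "p \<in> Rn n \<times> {0<..}"
    obtain x t where p: "p = (x, t)" "x \<in> Rn n" "t > 0" using g(3) by auto
    have g2: "gw x t \<le> \<gamma> * exp (A * t)" if "x \<in> Rn n" "t > 0" for x t using g(2)[of "(x, t)"] that by simp
    define Gc where "Gc = c + one.K * (one.M1 + 1) * \<gamma>"
    have Gc: "0 \<le> Gc" unfolding Gc_def using c g(1) one.K_pos one.M1_pos by simp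
    have "vnorm n (grad n (\<lambda>y. w y t) x) \<le> Gc / (lam - A) * exp (A * t)"
    proof (rule C1f_grad_bound[OF wC1[OF p(3)] p(2)])
      show "0 \<le> Gc / (lam - A) * exp (A * t)" using Gc lA by simp
      fix e assume e: "e \<in> Rn n"
      define z where "z x t = exp (- A * (t::real)) * (w (mv n x 1 e) t - w x t)" for x t
      define zt where "zt x t = - A * exp (- A * t) * (w (mv n x 1 e) t - w x t) + exp (- A * t) * (wt (mv n x 1 e) t - wt x t)" for x t
      define zi where "zi i x t = exp (- A * t) * (wi i (mv n x 1 e) t - wi i x t)" for i x t
      define zii where "zii i x t = exp (- A * t) * (wii i (mv n x 1 e) t - wii i x t)" for i x t
      have Dz: "D21 n z zt zi zii"
        unfolding z_def[abs_def] zt_def[abs_def] zi_def[abs_def] zii_def[abs_def]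
        by (rule D21_scale_time[OF D21_diff[OF D21_shift[OF Dw] Dw]]) (auto intro!: derivative_eq_intros)
      have "z x t \<le> (Gc * vnorm n e) / (lam - A)"
      proof (rule max_principle[OF Dz _ lA _ _ p(2,3), where \<beta> = one.K])
        show "z x t \<le> \<gamma> * vnorm n e" if xt: "x \<in> Rn n" "t > 0" for x t
        proof -
          have "\<bar>w (mv n x 1 e) t - w x t\<bar> \<le> (\<gamma> * exp (A * t)) * vdist n (mv n x 1 e) x"
            by (rule C1f_lipschitz[OF wC1[OF xt(2)]]) (use xt gw g2 in auto)
          then have "\<bar>w (mv n x 1 e) t - w x t\<bar> \<le> exp (A * t) * (\<gamma> * vnorm n e)" by (simp add: vdist_mv mult_ac)
          then have "exp (- A * t) * (w (mv n x 1 e) t - w x t) \<le> exp (- A * t) * (exp (A * t) * (\<gamma> * vnorm n e))"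
            by (intro mult_left_mono) auto
          also have "\<dots> = \<gamma> * vnorm n e" by (simp add: mult_exp_exp mult.assoc[symmetric])
          finally show ?thesis by (simp add: z_def)
        qed
        show "0 \<le> one.K" using one.K_pos by simp
        fix x t assume x: "x \<in> Rn n" and t: "(t::real) > 0"
        define y where "y = mv n x 1 e"
        have y: "y \<in> Rn n" "vdist n y x = vnorm n e" by (simp_all add: y_def vdist_mv)
        define E where "E = exp (- A * t)"
        have E: "E > 0" "E * exp (A * t) = 1" by (simp_all add: E_def mult_exp_exp)
        define Hd where "Hd = (H (one.P y t) y - H (two.P y t) y) - (H (one.P x t) x - H (two.P x t) x)"
        have eq: "- (wt y t - wt x t) - (\<Sum>i<n. wii i y t - wii i x t) + lam * (w y t - w x t)
          = ((f1 y t - f2 y t) - (f1 x t - f2 x t)) - 1 / lam * Hd"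
          using one.pde[OF t x] one.pde[OF t y(1)] two.pde[OF t x] two.pde[OF t y(1)]
          unfolding wt_def wii_def w_def Hd_def sum_subtractf
          by (simp add: algebra_simps add_divide_distrib diff_divide_distrib)
        define N where "N = vnorm n (\<lambda>i. wi i y t - wi i x t)"
        have d1: "vnorm n (\<lambda>i. (one.P y t i - two.P y t i) - (one.P x t i - two.P x t i)) = lam * N"
        proof -
          have "vnorm n (\<lambda>i. (one.P y t i - two.P y t i) - (one.P x t i - two.P x t i)) = vnorm n (\<lambda>i. lam * (wi i y t - wi i x t))"
            by (rule vnorm_cong) (simp add: wi_def algebra_simps)
          then show ?thesis using lam_pos by (simp add: vnorm_cmult N_def)
        qed
        have d2: "vdist n (two.P y t) (two.P x t) \<le> one.M1 * vnorm n e"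
          unfolding two.P_dist using two.Du_lip[OF big y(1) x t] y(2) by simp
        have d3: "vdist n (one.P x t) (two.P x t) = lam * gw x t" using lam_pos by (simp add: gw_def)
        have "\<bar>Hd\<bar> \<le> one.K * (lam * N) + one.K * (vdist n (two.P y t) (two.P x t) + vnorm n e) * (lam * gw x t)"
          unfolding Hd_def one.K_def d1[symmetric] d3[symmetric] y(2)[symmetric]
          by (rule one.H_double_difference) (use x y t one.P_bound two.P_bound in auto)
        also have "\<dots> \<le> one.K * (lam * N) + one.K * (one.M1 * vnorm n e + vnorm n e) * (lam * (\<gamma> * exp (A * t)))"
          using one.K_pos one.M1_pos d2 g2[OF x t] lam_pos by (intro add_left_mono mult_mono) (auto simp: gw_def)
        finally have "1 / lam * \<bar>Hd\<bar> \<le> 1 / lam * (one.K * (lam * N) + one.K * (one.M1 * vnorm n e + vnorm n e) * (lam * (\<gamma> * exp (A * t))))"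
          using lam_pos by (intro mult_left_mono) auto
        also have "\<dots> = one.K * N + one.K * (one.M1 + 1) * \<gamma> * exp (A * t) * vnorm n e"
          using lam_pos by (simp add: field_simps)
        finally have h: "1 / lam * \<bar>Hd\<bar> \<le> one.K * N + one.K * (one.M1 + 1) * \<gamma> * exp (A * t) * vnorm n e" .
        have "\<bar>1 / lam * Hd\<bar> = 1 / lam * \<bar>Hd\<bar>" using lam_pos by (simp add: abs_mult)
        moreover have "\<bar>(f1 y t - f2 y t) - (f1 x t - f2 x t)\<bar> \<le> c * exp (A * t) * vnorm n e"
          using ff[OF y(1) x t] y(2) by simp
        ultimately have "- (wt y t - wt x t) - (\<Sum>i<n. wii i y t - wii i x t) + lam * (w y t - w x t)
            \<le> one.K * N + Gc * vnorm n e * exp (A * t)"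
        proof -
          have "Gc * vnorm n e * exp (A * t) = c * exp (A * t) * vnorm n e + one.K * (one.M1 + 1) * \<gamma> * exp (A * t) * vnorm n e"
            by (simp add: Gc_def algebra_simps)
          then show ?thesis unfolding eq using h \<open>\<bar>1 / lam * Hd\<bar> = 1 / lam * \<bar>Hd\<bar>\<close>
              \<open>\<bar>(f1 y t - f2 y t) - (f1 x t - f2 x t)\<bar> \<le> c * exp (A * t) * vnorm n e\<close> by linarith
        qed
        then have "E * (- (wt y t - wt x t) - (\<Sum>i<n. wii i y t - wii i x t) + lam * (w y t - w x t))
            \<le> E * (one.K * N + Gc * vnorm n e * exp (A * t))" using E by (intro mult_left_mono) auto
        also have "\<dots> = one.K * (E * N) + Gc * vnorm n e * (E * exp (A * t))" by (simp add: algebra_simps)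
        also have "E * N = vnorm n (\<lambda>i. zi i x t)"
          unfolding zi_def vnorm_cmult N_def y_def E_def by simp
        finally have "E * (- (wt y t - wt x t) - (\<Sum>i<n. wii i y t - wii i x t) + lam * (w y t - w x t))
          \<le> one.K * vnorm n (\<lambda>i. zi i x t) + Gc * vnorm n e" using E by simp
        moreover have "- zt x t - (\<Sum>i<n. zii i x t) + (lam - A) * z x t
          = E * (- (wt y t - wt x t) - (\<Sum>i<n. wii i y t - wii i x t) + lam * (w y t - w x t))"
          unfolding zt_def zii_def z_def y_def[symmetric] E_def[symmetric] sum_distrib_left[symmetric]
          by (simp add: algebra_simps)
        ultimately show "- zt x t - (\<Sum>i<n. zii i x t) + (lam - A) * z x t \<le> one.K * vnorm n (\<lambda>i. zi i x t) + Gc * vnorm n e"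
          by simp
      qed
      then have "exp (A * t) * z x t \<le> exp (A * t) * ((Gc * vnorm n e) / (lam - A))" by (intro mult_left_mono) auto
      moreover have "exp (A * t) * z x t = w (mv n x 1 e) t - w x t"
        unfolding z_def by (simp add: mult_exp_exp mult.assoc[symmetric])
      ultimately show "w (mv n x 1 e) t - w x t \<le> Gc / (lam - A) * exp (A * t) * vnorm n e"
        by (simp add: mult_ac)
    qed
    also have "\<dots> \<le> (2 * c / lam + \<gamma> / 2) * exp (A * t)"
    proof (intro mult_right_mono)
      have "c / (lam - A) \<le> c / (lam / 2)" using A lam_pos c lA by (intro divide_left_mono) auto
      moreover have "one.K * (one.M1 + 1) * \<gamma> / (lam - A) \<le> \<gamma> / 2"
      proof -
        have "2 * one.K * (one.M1 + 1) * \<gamma> \<le> (lam - A) * \<gamma>" using A g(1) by (intro mult_right_mono) auto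
        then show ?thesis using lA by (simp add: divide_le_eq mult_ac)
      qed
      ultimately have "c / (lam - A) + one.K * (one.M1 + 1) * \<gamma> / (lam - A) \<le> c / (lam / 2) + \<gamma> / 2" by (rule add_mono)
      then show "Gc / (lam - A) \<le> 2 * c / lam + \<gamma> / 2"
        by (simp add: Gc_def add_divide_distrib mult.commute)
    qed simp
    finally show "gw (fst p) (snd p) \<le> (2 * c / lam + \<gamma> / 2) * exp (A * snd p)"
      using gw[OF p(3,2)] by (simp add: p(1))
  qed (use x t in auto)
  then show ?thesis using lam_pos by (simp add: gw_def field_simps)
qed

end

section \<open>Finite optimal transport and gluing of couplings\<close>

text \<open>Tangent of \<open>exp\<close> at \<open>ln 2\<close>, together with
  \<open>ln 2 < 1\<close>. A slope above 1 is what makes the dual functional below coercive.\<close>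

lemma exp_ge_double: "2 * x \<le> exp x" for x :: real
proof -
  have "1 + (x - ln 2) \<le> exp (x - ln 2)" by (rule exp_ge_add_one_self)
  also have "exp (x - ln 2) = exp x / 2" by (simp add: exp_diff)
  finally show ?thesis using ln_2_less_1 by simp
qed

text \<open>Finite optimal transport by entropic regularisation: the exponential in the penalised dual
  functional is, at a maximum, a transport plan. Its entries are at most \<open>1\<close>, so that the
  maximising potentials are admissible.\<close>

lemma finite_transport:
  fixes p q :: "nat \<Rightarrow> real" and c :: "nat \<Rightarrow> nat \<Rightarrow> real"
  assumes p: "\<And>i. i < k \<Longrightarrow> 0 < p i" "(\<Sum>i<k. p i) = 1"
    and q: "\<And>j. j < l \<Longrightarrow> 0 < q j" "(\<Sum>j<l. q j) = 1"
    and c: "\<And>i j. 0 \<le> c i j" and \<epsilon>: "0 < \<epsilon>"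
  obtains \<pi> \<phi> \<psi> where "\<And>i j. 0 \<le> \<pi> i j" "\<And>i. i < k \<Longrightarrow> (\<Sum>j<l. \<pi> i j) = p i" "\<And>j. j < l \<Longrightarrow> (\<Sum>i<k. \<pi> i j) = q j"
    "\<And>i j. i < k \<Longrightarrow> j < l \<Longrightarrow> \<phi> i - \<psi> j \<le> c i j"
    "(\<Sum>i<k. \<Sum>j<l. \<pi> i j * c i j) \<le> (\<Sum>i<k. p i * \<phi> i) - (\<Sum>j<l. q j * \<psi> j) + \<epsilon> * (real k * real l)"
proof -
  have k0: "0 < k" using p(2) by (cases k) auto
  have l0: "0 < l" using q(2) by (cases l) auto
  have p1: "p i \<le> 1" if "i < k" for i
    using member_le_sum[of i "{..<k}" p] p that by (auto intro: less_imp_le)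
  have q1: "q i \<le> 1" if "i < l" for i
    using member_le_sum[of i "{..<l}" q] q that by (auto intro: less_imp_le)
  \<comment> \<open>Both potentials are stored in one vector: the first \<open>k\<close> entries
    belong to the rows, the next \<open>l\<close> to the columns.\<close>
  define E where "E z i j = exp ((z i - z (k + j) - c i j) / \<epsilon>)" for z :: vec and i j
  define G where "G z = (\<Sum>i<k. p i * z i) - (\<Sum>j<l. q j * z (k + j)) - \<epsilon> * (\<Sum>i<k. \<Sum>j<l. E z i j)" for z :: vec
  have Gpq: "G z = (\<Sum>i<k. \<Sum>j<l. p i * q j * (z i - z (k + j)) - \<epsilon> * E z i j)" for z
  proof -
    have "(\<Sum>i<k. p i * z i) = (\<Sum>i<k. \<Sum>j<l. p i * q j * z i)"
      using q(2) by (simp add: sum_distrib_left[symmetric] sum_distrib_right[symmetric])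
    moreover have "(\<Sum>j<l. q j * z (k + j)) = (\<Sum>i<k. \<Sum>j<l. p i * q j * z (k + j))"
    proof -
      have "(\<Sum>i<k. \<Sum>j<l. p i * q j * z (k + j)) = (\<Sum>i<k. p i * (\<Sum>j<l. q j * z (k + j)))"
        by (simp add: sum_distrib_left mult.assoc)
      also have "\<dots> = (\<Sum>i<k. p i) * (\<Sum>j<l. q j * z (k + j))" by (rule sum_distrib_right[symmetric])
      finally show ?thesis using p(2) by simp
    qed
    ultimately show ?thesis unfolding G_def
      by (simp add: sum_subtractf[symmetric] sum_distrib_left algebra_simps)
  qed
  \<comment> \<open>Coercivity constant: up to an additive constant, \<open>G\<close> lies below
    \<open>- \<delta>\<close> times each \<open>|z i - z (k + j)|\<close>.\<close>
  define \<delta> where "\<delta> = Min ((\<lambda>(i, j). p i * q j) ` ({..<k} \<times> {..<l}))"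
  have fin: "finite ((\<lambda>(i, j). p i * q j) ` ({..<k} \<times> {..<l}))" by simp
  have dl: "\<delta> \<le> p i * q j" if "i < k" "j < l" for i j
    unfolding \<delta>_def by (rule Min_le[OF fin]) (use that in auto)
  have "\<delta> \<in> (\<lambda>(i, j). p i * q j) ` ({..<k} \<times> {..<l})" unfolding \<delta>_def by (rule Min_in[OF fin]) (use k0 l0 in auto)
  then have d0: "0 < \<delta>" using p(1) q(1) by auto
  have pq1: "p i * q j \<le> 1" if "i < k" "j < l" for i j
    using mult_mono[OF p1[OF that(1)] q1[OF that(2)]] q(1)[OF that(2)] by simp
  have trm: "p i * q j * M - \<epsilon> * exp ((M - c i j) / \<epsilon>) \<le> 2 * c i j - \<delta> * \<bar>M\<bar>" if "i < k" "j < l" for i j M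
  proof (cases "M \<ge> 0")
    case True
    have "\<epsilon> * (2 * ((M - c i j) / \<epsilon>)) \<le> \<epsilon> * exp ((M - c i j) / \<epsilon>)" using \<epsilon> by (intro mult_left_mono exp_ge_double) auto
    moreover have "\<epsilon> * (2 * ((M - c i j) / \<epsilon>)) = 2 * (M - c i j)" using \<epsilon> by simp
    moreover have "p i * q j * M \<le> 1 * M" by (intro mult_right_mono pq1 that True)
    moreover have "\<delta> * M \<le> 1 * M" using dl[OF that] pq1[OF that] True by (intro mult_right_mono) auto
    ultimately show ?thesis using True by simp
  next
    case False
    then have "p i * q j * M \<le> \<delta> * M" using dl[OF that] by (intro mult_right_mono_neg) auto
    moreover have "0 \<le> \<epsilon> * exp ((M - c i j) / \<epsilon>)" using \<epsilon> by simp
    moreover have "\<delta> * \<bar>M\<bar> = - (\<delta> * M)" using False by simp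
    ultimately show ?thesis using c[of i j] by linarith
  qed
  define C where "C = (\<Sum>i<k. \<Sum>j<l. 2 * c i j)"
  have Gle: "G z \<le> C - \<delta> * \<bar>z i - z (k + j)\<bar>" if "i < k" "j < l" for z i j
  proof -
    have "G z \<le> (\<Sum>i<k. \<Sum>j<l. 2 * c i j - \<delta> * \<bar>z i - z (k + j)\<bar>)"
      unfolding Gpq E_def by (intro sum_mono trm) auto
    also have "\<dots> = C - \<delta> * (\<Sum>i<k. \<Sum>j<l. \<bar>z i - z (k + j)\<bar>)"
      unfolding C_def by (simp add: sum_subtractf sum_distrib_left)
    also have "\<bar>z i - z (k + j)\<bar> \<le> (\<Sum>j<l. \<bar>z i - z (k + j)\<bar>)"
      using member_le_sum[of j "{..<l}" "\<lambda>j. \<bar>z i - z (k + j)\<bar>"] that by auto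
    then have "\<bar>z i - z (k + j)\<bar> \<le> (\<Sum>i<k. \<Sum>j<l. \<bar>z i - z (k + j)\<bar>)"
      using member_le_sum[of i "{..<k}" "\<lambda>i. \<Sum>j<l. \<bar>z i - z (k + j)\<bar>"] that
      by (auto intro: order_trans sum_nonneg)
    then have "C - \<delta> * (\<Sum>i<k. \<Sum>j<l. \<bar>z i - z (k + j)\<bar>) \<le> C - \<delta> * \<bar>z i - z (k + j)\<bar>" using d0 by simp
    finally show ?thesis .
  qed
  define o' where "o' = (\<lambda>i\<in>{..<k + l}. 0::real)"
  have oR: "o' \<in> Rn (k + l)" by (simp add: o'_def Rn_def)
  define R1 where "R1 = (C - G o') / \<delta>"
  have R10: "0 \<le> R1" using Gle[OF k0 l0, of o'] d0 k0 l0 by (simp add: R1_def o'_def)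
  define Bx where "Bx = {z \<in> Rn (k + l). \<forall>i<k + l. \<bar>z i\<bar> \<le> 2 * R1}"
  have cont: "continuous_on S G" for S
    unfolding G_def E_def using \<epsilon> by (auto intro!: continuous_on_diff continuous_on_sum continuous_on_mult continuous_on_const
        continuous_on_exp continuous_on_divide continuous_on_coord)
  have oB: "o' \<in> Bx" using oR R10 by (auto simp: Bx_def o'_def)
  then have "Bx \<noteq> {}" by auto
  then have "\<exists>z\<in>Bx. \<forall>y\<in>Bx. G y \<le> G z"
    unfolding Bx_def by (intro continuous_attains_sup compact_box cont)
  then obtain z where z: "z \<in> Bx" "\<And>y. y \<in> Bx \<Longrightarrow> G y \<le> G z" by blast
  have zR: "z \<in> Rn (k + l)" using z by (simp add: Bx_def)
  have glob: "G y \<le> G z" if y: "y \<in> Rn (k + l)" for y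
  proof (cases "G y \<le> G o'")
    case True then show ?thesis using z(2)[OF oB] by simp
  next
    case False
    \<comment> \<open>\<open>G\<close> is invariant under adding a constant to all entries, because
      both weights sum to 1. Subtracting entry 0 removes this noncompact direction and brings
      \<open>y\<close> into the box.\<close>
    define y' where "y' = mv (k + l) y (-1) (\<lambda>_. y 0)"
    have y'i: "y' i = y i - y 0" if "i < k + l" for i using that by (simp add: y'_def)
    have EE: "E y' i j = E y i j" if "i < k" "j < l" for i j using that by (simp add: E_def y'i)
    have G': "G y' = G y" unfolding Gpq by (intro sum.cong) (auto simp: EE y'i)
    have R1b: "\<bar>y' i - y' (k + j)\<bar> \<le> R1" if "i < k" "j < l" for i j
    proof -
      have "\<delta> * \<bar>y' i - y' (k + j)\<bar> \<le> C - G o'" using Gle[OF that, of y'] G' False by simp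
      then show ?thesis unfolding R1_def using d0 by (simp add: pos_le_divide_eq mult.commute)
    qed
    have b2: "\<bar>y' (k + j)\<bar> \<le> R1" if "j < l" for j using R1b[OF k0 that] y'i[of 0] k0 by simp
    have b1: "\<bar>y' i\<bar> \<le> 2 * R1" if "i < k" for i using R1b[OF that l0] b2[OF l0] by linarith
    have "y' \<in> Bx" unfolding Bx_def
    proof (intro CollectI conjI allI impI)
      fix i assume i: "i < k + l"
      show "\<bar>y' i\<bar> \<le> 2 * R1"
      proof (cases "i < k")
        case False
        then have "i - k < l" "k + (i - k) = i" using i by auto
        then show ?thesis using b2[of "i - k"] R10 by simp
      qed (rule b1)
    qed (simp add: y'_def)
    then have "G y' \<le> G z" by (rule z(2))
    then show ?thesis using G' by simp
  qed
  define \<pi> where "\<pi> i j = E z i j" for i j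
  \<comment> \<open>Stationarity in a row potential is the row marginal condition; the columns are
    treated in the same way with the opposite sign.\<close>
  have row: "(\<Sum>j<l. \<pi> i j) = p i" if i: "i < k" for i
  proof -
    define g where "g s = G (z(i := s))" for s
    have gs: "g s = (\<Sum>i'<k. p i' * (if i' = i then s else z i')) - (\<Sum>j<l. q j * z (k + j))
      - \<epsilon> * (\<Sum>i'<k. \<Sum>j<l. exp (((if i' = i then s else z i') - z (k + j) - c i' j) / \<epsilon>))" for s
      unfolding g_def G_def E_def using i by simp
    have "(g has_real_derivative (\<Sum>i'<k. p i' * (if i' = i then 1 else 0)) - 0
      - \<epsilon> * (\<Sum>i'<k. \<Sum>j<l. exp (((if i' = i then z i else z i') - z (k + j) - c i' j) / \<epsilon>) * ((if i' = i then 1 else 0) / \<epsilon>))) (at (z i))"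
      unfolding gs[abs_def] using \<epsilon>
      by (intro DERIV_diff DERIV_cmult DERIV_sum DERIV_const) (auto intro!: derivative_eq_intros)
    moreover have "(\<Sum>i'<k. p i' * (if i' = i then 1 else 0)) = (\<Sum>i'<k. if i' = i then p i else 0)"
      by (rule sum.cong) auto
    then have "(\<Sum>i'<k. p i' * (if i' = i then 1 else 0)) = p i" using i by simp
    moreover have "(\<Sum>i'<k. \<Sum>j<l. exp (((if i' = i then z i else z i') - z (k + j) - c i' j) / \<epsilon>) * ((if i' = i then 1 else 0) / \<epsilon>))
      = (\<Sum>i'<k. if i' = i then (\<Sum>j<l. \<pi> i j / \<epsilon>) else 0)"
      by (rule sum.cong) (auto simp: \<pi>_def E_def)
    then have "(\<Sum>i'<k. \<Sum>j<l. exp (((if i' = i then z i else z i') - z (k + j) - c i' j) / \<epsilon>) * ((if i' = i then 1 else 0) / \<epsilon>))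
      = (\<Sum>j<l. \<pi> i j) / \<epsilon>" using i by (simp add: sum_divide_distrib)
    ultimately have "(g has_real_derivative p i - (\<Sum>j<l. \<pi> i j)) (at (z i))" using \<epsilon> by simp
    then have "p i - (\<Sum>j<l. \<pi> i j) = 0"
      by (rule DERIV_local_max[where d = 1]) (use glob zR i in \<open>auto simp: g_def\<close>)
    then show ?thesis by simp
  qed
  have col: "(\<Sum>i<k. \<pi> i j) = q j" if j: "j < l" for j
  proof -
    define g where "g s = G (z(k + j := s))" for s
    have gs: "g s = (\<Sum>i<k. p i * z i) - (\<Sum>j'<l. q j' * (if j' = j then s else z (k + j')))
      - \<epsilon> * (\<Sum>i<k. \<Sum>j'<l. exp ((z i - (if j' = j then s else z (k + j')) - c i j') / \<epsilon>))" for s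
      unfolding g_def G_def E_def using j by simp
    have "(g has_real_derivative 0 - (\<Sum>j'<l. q j' * (if j' = j then 1 else 0))
      - \<epsilon> * (\<Sum>i<k. \<Sum>j'<l. exp ((z i - (if j' = j then z (k + j) else z (k + j')) - c i j') / \<epsilon>) * (- (if j' = j then 1 else 0) / \<epsilon>))) (at (z (k + j)))"
      unfolding gs[abs_def] using \<epsilon>
      by (intro DERIV_diff DERIV_cmult DERIV_sum DERIV_const) (auto intro!: derivative_eq_intros)
    moreover have "(\<Sum>j'<l. q j' * (if j' = j then 1 else 0)) = (\<Sum>j'<l. if j' = j then q j else 0)"
      by (rule sum.cong) auto
    then have "(\<Sum>j'<l. q j' * (if j' = j then 1 else 0)) = q j" using j by simp
    moreover have "(\<Sum>i<k. \<Sum>j'<l. exp ((z i - (if j' = j then z (k + j) else z (k + j')) - c i j') / \<epsilon>) * (- (if j' = j then 1 else 0) / \<epsilon>))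
      = (\<Sum>i<k. \<Sum>j'<l. if j' = j then - \<pi> i j / \<epsilon> else 0)"
      by (intro sum.cong) (auto simp: \<pi>_def E_def)
    then have "(\<Sum>i<k. \<Sum>j'<l. exp ((z i - (if j' = j then z (k + j) else z (k + j')) - c i j') / \<epsilon>) * (- (if j' = j then 1 else 0) / \<epsilon>))
      = - (\<Sum>i<k. \<pi> i j) / \<epsilon>" using j by (simp add: sum_divide_distrib sum_negf)
    ultimately have "(g has_real_derivative (\<Sum>i<k. \<pi> i j) - q j) (at (z (k + j)))" using \<epsilon> by simp
    then have "(\<Sum>i<k. \<pi> i j) - q j = 0"
      by (rule DERIV_local_max[where d = 1]) (use glob zR j in \<open>auto simp: g_def\<close>)
    then show ?thesis by simp
  qed
  have pi0: "0 < \<pi> i j" for i j by (simp add: \<pi>_def E_def)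
  have pi1: "\<pi> i j \<le> 1" if "i < k" "j < l" for i j
  proof -
    have "\<pi> i j \<le> (\<Sum>j<l. \<pi> i j)"
      using that pi0[of i] by (intro member_le_sum) (auto intro: less_imp_le)
    then show ?thesis using row[OF that(1)] p1[OF that(1)] by linarith
  qed
  show ?thesis
  proof (rule that[of \<pi> z "\<lambda>j. z (k + j)"])
    show "0 \<le> \<pi> i j" for i j using pi0[of i j] by simp
    show "z i - z (k + j) \<le> c i j" if "i < k" "j < l" for i j
    proof -
      have "(z i - z (k + j) - c i j) / \<epsilon> \<le> 0" using pi1[OF that] by (simp add: \<pi>_def E_def)
      then show ?thesis using \<epsilon> by (simp add: divide_le_0_iff)
    qed
    \<comment> \<open>The cost exceeds the dual value by \<open>\<epsilon>\<close> times the
      entropy, to which each of the \<open>k * l\<close> entries contributes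
      \<open>- x * ln x \<le> 1\<close>.\<close>
    have each: "\<pi> i j * c i j \<le> \<pi> i j * z i - \<pi> i j * z (k + j) + \<epsilon>" for i j
    proof -
      have ln: "ln (\<pi> i j) = (z i - z (k + j) - c i j) / \<epsilon>" by (simp add: \<pi>_def E_def)
      then have cij: "c i j = z i - z (k + j) - \<epsilon> * ln (\<pi> i j)" using \<epsilon> by simp
      have "\<pi> i j * c i j = \<pi> i j * z i - \<pi> i j * z (k + j) + \<epsilon> * (\<pi> i j * (- ln (\<pi> i j)))"
        by (subst cij) (simp add: algebra_simps)
      moreover have "\<pi> i j * (- ln (\<pi> i j)) \<le> 1"
      proof -
        have "- ln (\<pi> i j) = ln (1 / \<pi> i j)" using pi0 by (simp add: ln_div)
        also have "\<dots> \<le> 1 / \<pi> i j - 1" using pi0 by (intro ln_le_minus_one) simp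
        finally have "\<pi> i j * (- ln (\<pi> i j)) \<le> \<pi> i j * (1 / \<pi> i j - 1)" using pi0[of i j] by (intro mult_left_mono) auto
        also have "\<dots> \<le> 1" using pi0[of i j] by (simp add: right_diff_distrib)
        finally show ?thesis .
      qed
      then have "\<epsilon> * (\<pi> i j * (- ln (\<pi> i j))) \<le> \<epsilon> * 1" using \<epsilon> by (intro mult_left_mono) auto
      ultimately show ?thesis by linarith
    qed
    have "(\<Sum>i<k. \<Sum>j<l. \<pi> i j * c i j) \<le> (\<Sum>i<k. \<Sum>j<l. \<pi> i j * z i - \<pi> i j * z (k + j) + \<epsilon>)"
      by (intro sum_mono each)
    also have "\<dots> = (\<Sum>i<k. \<Sum>j<l. \<pi> i j * z i) - (\<Sum>i<k. \<Sum>j<l. \<pi> i j * z (k + j)) + \<epsilon> * (real k * real l)"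
      by (simp add: sum.distrib sum_subtractf)
    also have "(\<Sum>i<k. \<Sum>j<l. \<pi> i j * z i) = (\<Sum>i<k. p i * z i)"
      by (intro sum.cong refl) (simp add: sum_distrib_right[symmetric] row)
    also have "(\<Sum>i<k. \<Sum>j<l. \<pi> i j * z (k + j)) = (\<Sum>j<l. \<Sum>i<k. \<pi> i j * z (k + j))" by (rule sum.swap)
    also have "\<dots> = (\<Sum>j<l. q j * z (k + j))"
      by (intro sum.cong refl) (simp add: sum_distrib_right[symmetric] col)
    finally show "(\<Sum>i<k. \<Sum>j<l. \<pi> i j * c i j) \<le> (\<Sum>i<k. p i * z i) - (\<Sum>j<l. q j * z (k + j)) + \<epsilon> * (real k * real l)" .
  qed (auto simp: row col)
qed

section \<open>Measures with first moment and the easy half of duality\<close>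

lemma space_Leb: "space (Leb n) = Rn n"
  by (simp add: Leb_def Rn_def space_PiM)

lemma P1D:
  assumes "\<mu> \<in> P1 n"
  shows "prob_space \<mu>" "sets \<mu> = sets (Leb n)" "(\<integral>\<^sup>+x. ennreal (vnorm n x) \<partial>\<mu>) < \<infinity>" "space \<mu> = Rn n"
    "measurable \<mu> M = measurable (Leb n) M"
  using assms sets_eq_imp_space_eq[of \<mu> "Leb n"] unfolding P1_def
  by (auto simp: space_Leb intro!: measurable_cong_sets)

lemma Leb_coord [measurable]: "i < n \<Longrightarrow> (\<lambda>x. x i) \<in> borel_measurable (Leb n)"
  unfolding Leb_def using measurable_component_singleton[of i "{..<n}" "\<lambda>_. lborel"] by simp

text \<open>Lets continuity in the product topology yield measurability for \<open>Leb n\<close>: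
  the coordinates from \<open>n\<close> on are constant on its space.\<close>

lemma Leb_id_borel: "(\<lambda>x. x) \<in> measurable (Leb n) (borel :: vec measure)"
proof -
  have "(\<lambda>x. x) \<in> measurable (Leb n) (Pi\<^sub>M UNIV (\<lambda>_::nat. borel :: real measure))"
  proof (rule measurable_PiM_single')
    show "(\<lambda>x. x i) \<in> borel_measurable (Leb n)" for i
    proof (cases "i < n")
      case False
      then have "x i = undefined" if "x \<in> space (Leb n)" for x
        using that by (auto simp: space_Leb Rn_def PiE_def extensional_def)
      then show ?thesis by (subst measurable_cong[where g = "\<lambda>_. undefined"]) auto
    qed simp
  qed auto
  then show ?thesis using measurable_cong_sets[OF refl sets_PiM_equal_borel] by blast
qed

lemma Leb_measurable_continuous:
  fixes f :: "vec \<Rightarrow> 'b::topological_space"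
  assumes "continuous_on (Rn n) f"
  shows "f \<in> borel_measurable (Leb n)"
proof -
  have f: "f \<in> borel_measurable (restrict_space borel (Rn n))"
    by (rule borel_measurable_continuous_on_restrict[OF assms])
  have "(\<lambda>x. x) \<in> measurable (Leb n) (restrict_space borel (Rn n))"
    by (rule measurable_restrict_space2[OF _ Leb_id_borel]) (auto simp: space_Leb)
  from measurable_compose[OF this f] show ?thesis .
qed

definition lip1 :: "nat \<Rightarrow> (vec \<Rightarrow> real) \<Rightarrow> bool" where
  "lip1 n \<phi> \<longleftrightarrow> (\<forall>x\<in>Rn n. \<forall>y\<in>Rn n. \<bar>\<phi> x - \<phi> y\<bar> \<le> vdist n x y)"

text \<open>Compactly supported test functions, the class for which the weak Fokker-Planck equation
  will be available.\<close>

definition lipc :: "nat \<Rightarrow> (vec \<Rightarrow> real) \<Rightarrow> bool" where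
  "lipc n \<phi> \<longleftrightarrow> lip1 n \<phi> \<and> (\<exists>R. \<forall>x\<in>Rn n. R \<le> vnorm n x \<longrightarrow> \<phi> x = 0)"

lemma lip_continuous:
  assumes "\<And>x y. x \<in> Rn n \<Longrightarrow> y \<in> Rn n \<Longrightarrow> \<bar>\<phi> x - \<phi> y\<bar> \<le> C * vdist n x y"
  shows "continuous_on (Rn n) \<phi>"
proof (unfold continuous_on_sequentially, intro allI ballI impI)
  fix X x assume x: "x \<in> Rn n" and X: "(\<forall>k. X k \<in> Rn n) \<and> X \<longlonglongrightarrow> x"
  have Xi: "(\<lambda>k. X k i) \<longlonglongrightarrow> x i" for i using X unfolding seq_tendsto_coord by blast
  have "(\<lambda>k. (X k i - x i)\<^sup>2) \<longlonglongrightarrow> (x i - x i)\<^sup>2" for i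
    by (intro tendsto_power tendsto_diff tendsto_const Xi)
  then have "(\<lambda>k. sqrt (\<Sum>i<n. (X k i - x i)\<^sup>2)) \<longlonglongrightarrow> sqrt (\<Sum>i<n. (x i - x i)\<^sup>2)"
    by (intro tendsto_real_sqrt tendsto_sum)
  then have "(\<lambda>k. vdist n (X k) x) \<longlonglongrightarrow> 0" by (simp add: vdist_def vnorm_def L2_set_def)
  then have l: "(\<lambda>k. C * vdist n (X k) x) \<longlonglongrightarrow> 0" by (rule tendsto_mult_right_zero)
  have "(\<lambda>k. \<phi> (X k) - \<phi> x) \<longlonglongrightarrow> 0"
    by (rule Lim_null_comparison[OF always_eventually l]) (use assms x X in \<open>simp del: fun_eq_iff\<close>)
  then show "(\<phi> \<circ> X) \<longlonglongrightarrow> \<phi> x" unfolding o_def by (simp add: LIM_zero_iff)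
qed

lemma continuous_on_vdist: "continuous_on S (\<lambda>x. vdist n x a)"
  unfolding vdist_def vnorm_def L2_set_def
  by (intro continuous_on_real_sqrt continuous_on_sum continuous_on_power continuous_on_diff continuous_on_const continuous_on_coord)

lemma vnorm_measurable [measurable]: "vnorm n \<in> borel_measurable (Leb n)"
  by (rule Leb_measurable_continuous) (intro continuous_on_vnorm continuous_on_id)

lemma P1_vnorm_integrable:
  assumes "\<mu> \<in> P1 n"
  shows "integrable \<mu> (vnorm n)"
  unfolding integrable_iff_bounded using P1D[OF assms] vnorm_measurable by simp

lemma P1_lip_integrable:
  assumes \<mu>: "\<mu> \<in> P1 n" and f: "\<And>x y. x \<in> Rn n \<Longrightarrow> y \<in> Rn n \<Longrightarrow> \<bar>\<phi> x - \<phi> y\<bar> \<le> C * vdist n x y"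
  shows "integrable \<mu> \<phi>"
proof -
  interpret prob_space \<mu> using P1D[OF \<mu>] by simp
  define o' where "o' = (\<lambda>i\<in>{..<n}. 0::real)"
  have o: "o' \<in> Rn n" "vdist n x o' = vnorm n x" for x
    unfolding vdist_def by (auto simp: o'_def Rn_def intro!: vnorm_cong)
  show ?thesis
  proof (rule Bochner_Integration.integrable_bound[where f = "\<lambda>x. \<bar>\<phi> o'\<bar> + C * vnorm n x"])
    show "integrable \<mu> (\<lambda>x. \<bar>\<phi> o'\<bar> + C * vnorm n x)" using P1_vnorm_integrable[OF \<mu>] by simp
    show "\<phi> \<in> borel_measurable \<mu>" unfolding P1D(5)[OF \<mu>] by (rule Leb_measurable_continuous[OF lip_continuous[OF f]])
    show "AE x in \<mu>. norm (\<phi> x) \<le> norm (\<bar>\<phi> o'\<bar> + C * vnorm n x)"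
    proof (rule AE_I2)
      fix x assume "x \<in> space \<mu>"
      then have "\<bar>\<phi> x - \<phi> o'\<bar> \<le> C * vnorm n x" using f[of x o'] o P1D(4)[OF \<mu>] by simp
      then show "norm (\<phi> x) \<le> norm (\<bar>\<phi> o'\<bar> + C * vnorm n x)" by simp
    qed
  qed
qed

text \<open>The easy half of Kantorovich duality: both integrals are written over one coupling of
  cost below \<open>B\<close>.\<close>

lemma coupling_bound:
  assumes \<mu>: "\<mu> \<in> P1 n" and \<nu>: "\<nu> \<in> P1 n" and C: "0 \<le> C"
    and f: "\<And>x y. x \<in> Rn n \<Longrightarrow> y \<in> Rn n \<Longrightarrow> \<bar>\<phi> x - \<phi> y\<bar> \<le> C * vdist n x y"
    and d: "d1 n \<mu> \<nu> < ennreal B"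
  shows "\<bar>(\<integral>x. \<phi> x \<partial>\<mu>) - (\<integral>x. \<phi> x \<partial>\<nu>)\<bar> \<le> C * B"
proof -
  obtain \<pi> where \<pi>: "\<pi> \<in> couplings \<mu> \<nu>" and cost: "(\<integral>\<^sup>+(x, y). ennreal (vdist n x y) \<partial>\<pi>) < ennreal B"
    using d unfolding d1_def INF_less_iff by auto
  have s: "sets \<pi> = sets (\<mu> \<Otimes>\<^sub>M \<nu>)" and m1: "distr \<pi> \<mu> fst = \<mu>" and m2: "distr \<pi> \<nu> snd = \<nu>"
    using \<pi> by (auto simp: couplings_def)
  have B0: "0 < B"
  proof (rule ccontr)
    assume "\<not> 0 < B"
    then have "ennreal B = 0" by (simp add: ennreal_eq_0_iff)
    then show False using d by simp
  qed
  have sp: "space \<pi> = Rn n \<times> Rn n" using sets_eq_imp_space_eq[OF s] P1D(4)[OF \<mu>] P1D(4)[OF \<nu>] by (simp add: space_pair_measure)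
  have f1: "fst \<in> measurable \<pi> \<mu>" and f2: "snd \<in> measurable \<pi> \<nu>"
    by (subst measurable_cong_sets[OF s refl], simp)+
  have i1: "integrable \<mu> \<phi>" and i2: "integrable \<nu> \<phi>" by (rule P1_lip_integrable[OF \<mu> f], assumption+, rule P1_lip_integrable[OF \<nu> f], assumption+)
  have j1: "integrable \<pi> (\<lambda>z. \<phi> (fst z))" using i1 integrable_distr[OF f1, of \<phi>] m1 by simp
  have j2: "integrable \<pi> (\<lambda>z. \<phi> (snd z))" using i2 integrable_distr[OF f2, of \<phi>] m2 by simp
  have e1: "(\<integral>x. \<phi> x \<partial>\<mu>) = (\<integral>z. \<phi> (fst z) \<partial>\<pi>)" using integral_distr[OF f1 borel_measurable_integrable[OF i1]] m1 by simp
  have e2: "(\<integral>x. \<phi> x \<partial>\<nu>) = (\<integral>z. \<phi> (snd z) \<partial>\<pi>)" using integral_distr[OF f2 borel_measurable_integrable[OF i2]] m2 by simp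
  have "(\<integral>x. \<phi> x \<partial>\<mu>) - (\<integral>x. \<phi> x \<partial>\<nu>) = (\<integral>z. \<phi> (fst z) - \<phi> (snd z) \<partial>\<pi>)"
    unfolding e1 e2 using j1 j2 by simp
  then have "ennreal \<bar>(\<integral>x. \<phi> x \<partial>\<mu>) - (\<integral>x. \<phi> x \<partial>\<nu>)\<bar> \<le> (\<integral>\<^sup>+z. ennreal \<bar>\<phi> (fst z) - \<phi> (snd z)\<bar> \<partial>\<pi>)"
    using integral_norm_bound_ennreal[of \<pi> "\<lambda>z. \<phi> (fst z) - \<phi> (snd z)"] j1 j2 by simp
  also have "\<dots> \<le> (\<integral>\<^sup>+z. ennreal C * ennreal (vdist n (fst z) (snd z)) \<partial>\<pi>)"
  proof (rule nn_integral_mono)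
    fix z assume "z \<in> space \<pi>"
    then have "fst z \<in> Rn n" "snd z \<in> Rn n" using sp by (simp_all add: mem_Times_iff)
    then have "\<bar>\<phi> (fst z) - \<phi> (snd z)\<bar> \<le> C * vdist n (fst z) (snd z)" by (rule f)
    then have "ennreal \<bar>\<phi> (fst z) - \<phi> (snd z)\<bar> \<le> ennreal (C * vdist n (fst z) (snd z))" by (rule ennreal_leI)
    also have "\<dots> = ennreal C * ennreal (vdist n (fst z) (snd z))" using C by (intro ennreal_mult) auto
    finally show "ennreal \<bar>\<phi> (fst z) - \<phi> (snd z)\<bar> \<le> ennreal C * ennreal (vdist n (fst z) (snd z))" .
  qed
  also have "\<dots> = ennreal C * (\<integral>\<^sup>+z. ennreal (vdist n (fst z) (snd z)) \<partial>\<pi>)"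
  proof (rule nn_integral_cmult)
    have "(\<lambda>z. \<Sum>i<n. (fst z i - snd z i)\<^sup>2) \<in> borel_measurable \<pi>"
    proof (rule borel_measurable_sum)
      fix i assume i: "i \<in> {..<n}"
      have "(\<lambda>x. x i) \<in> borel_measurable \<mu>" "(\<lambda>x. x i) \<in> borel_measurable \<nu>"
        unfolding P1D(5)[OF \<mu>] P1D(5)[OF \<nu>] using i by (simp_all add: Leb_coord)
      then have "(\<lambda>z. fst z i) \<in> borel_measurable \<pi>" "(\<lambda>z. snd z i) \<in> borel_measurable \<pi>"
        using measurable_compose[OF f1, of "\<lambda>x. x i" borel] measurable_compose[OF f2, of "\<lambda>x. x i" borel] by auto
      then show "(\<lambda>z. (fst z i - snd z i)\<^sup>2) \<in> borel_measurable \<pi>" by simp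
    qed
    then show "(\<lambda>z. ennreal (vdist n (fst z) (snd z))) \<in> borel_measurable \<pi>"
      unfolding vdist_def vnorm_def L2_set_def by simp
  qed
  also have "\<dots> \<le> ennreal C * ennreal B" 
  proof (rule mult_left_mono)
    have "(\<lambda>(x, y). ennreal (vdist n x y)) = (\<lambda>z. ennreal (vdist n (fst z) (snd z)))" by auto
    then show "(\<integral>\<^sup>+z. ennreal (vdist n (fst z) (snd z)) \<partial>\<pi>) \<le> ennreal B" using cost by simp
  qed simp
  also have "\<dots> = ennreal (C * B)" using C B0 by (simp add: ennreal_mult)
  finally show ?thesis using C B0 by (simp add: ennreal_le_iff)
qed


lemma vdist_pair_measurable:
  assumes \<mu>: "\<mu> \<in> P1 n" and \<nu>: "\<nu> \<in> P1 n"
  shows "(\<lambda>z. vdist n (fst z) (snd z)) \<in> borel_measurable (\<mu> \<Otimes>\<^sub>M \<nu>)"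
proof -
  have "(\<lambda>z. \<Sum>i<n. (fst z i - snd z i)\<^sup>2) \<in> borel_measurable (\<mu> \<Otimes>\<^sub>M \<nu>)"
  proof (rule borel_measurable_sum)
    fix i assume i: "i \<in> {..<n}"
    have m: "(\<lambda>x. x i) \<in> borel_measurable \<mu>" "(\<lambda>x. x i) \<in> borel_measurable \<nu>"
      unfolding P1D(5)[OF \<mu>] P1D(5)[OF \<nu>] using i by (simp_all add: Leb_coord)
    have "(\<lambda>z. fst z i) \<in> borel_measurable (\<mu> \<Otimes>\<^sub>M \<nu>)" "(\<lambda>z. snd z i) \<in> borel_measurable (\<mu> \<Otimes>\<^sub>M \<nu>)"
      by (rule measurable_compose[OF measurable_fst m(1)], rule measurable_compose[OF measurable_snd m(2)])
    then show "(\<lambda>z. (fst z i - snd z i)\<^sup>2) \<in> borel_measurable (\<mu> \<Otimes>\<^sub>M \<nu>)" by simp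
  qed
  then show ?thesis unfolding vdist_def vnorm_def L2_set_def by simp
qed

lemma nn_integral_product:
  assumes \<mu>: "prob_space \<mu>" and \<nu>: "prob_space \<nu>" and g: "g \<in> borel_measurable \<mu>" and h: "h \<in> borel_measurable \<nu>"
  shows "(\<integral>\<^sup>+z. g (fst z) * h (snd z) \<partial>(\<mu> \<Otimes>\<^sub>M \<nu>)) = (\<integral>\<^sup>+x. g x \<partial>\<mu>) * (\<integral>\<^sup>+y. h y \<partial>\<nu>)"
proof -
  interpret N: prob_space \<nu> by fact
  have m: "(\<lambda>z. g (fst z) * h (snd z)) \<in> borel_measurable (\<mu> \<Otimes>\<^sub>M \<nu>)"
    by (intro borel_measurable_times_ennreal measurable_compose[OF measurable_fst g] measurable_compose[OF measurable_snd h])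
  have "(\<integral>\<^sup>+z. g (fst z) * h (snd z) \<partial>(\<mu> \<Otimes>\<^sub>M \<nu>)) = (\<integral>\<^sup>+x. \<integral>\<^sup>+y. g x * h y \<partial>\<nu> \<partial>\<mu>)"
    using N.nn_integral_fst[OF m] by simp
  also have "\<dots> = (\<integral>\<^sup>+x. g x * (\<integral>\<^sup>+y. h y \<partial>\<nu>) \<partial>\<mu>)"
    by (intro nn_integral_cong nn_integral_cmult h)
  also have "\<dots> = (\<integral>\<^sup>+x. g x \<partial>\<mu>) * (\<integral>\<^sup>+y. h y \<partial>\<nu>)" by (rule nn_integral_multc[OF g])
  finally show ?thesis .
qed

text \<open>A finite transport plan between the cells of two partitions extends to a coupling with a
  density that is constant on products of cells.\<close>

lemma gluing:
  fixes k l :: nat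
  assumes \<mu>: "\<mu> \<in> P1 n" and \<nu>: "\<nu> \<in> P1 n"
    and X: "\<And>i. i < k \<Longrightarrow> X i \<in> sets \<mu>" "disjoint_family_on X {..<k}" "\<And>i. i < k \<Longrightarrow> 0 < measure \<mu> (X i)" "(\<Sum>i<k. measure \<mu> (X i)) = 1"
    and Y: "\<And>j. j < l \<Longrightarrow> Y j \<in> sets \<nu>" "disjoint_family_on Y {..<l}" "\<And>j. j < l \<Longrightarrow> 0 < measure \<nu> (Y j)" "(\<Sum>j<l. measure \<nu> (Y j)) = 1"
    and \<pi>: "\<And>i j. 0 \<le> \<pi> i j" "\<And>i. i < k \<Longrightarrow> (\<Sum>j<l. \<pi> i j) = measure \<mu> (X i)" "\<And>j. j < l \<Longrightarrow> (\<Sum>i<k. \<pi> i j) = measure \<nu> (Y j)"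
    and a: "\<And>i. a i \<in> Rn n" and b: "\<And>j. b j \<in> Rn n"
  shows "d1 n \<mu> \<nu> \<le> (\<Sum>i<k. \<integral>\<^sup>+x. indicator (X i) x * ennreal (vdist n x (a i)) \<partial>\<mu>)
    + ennreal (\<Sum>i<k. \<Sum>j<l. \<pi> i j * vdist n (a i) (b j))
    + (\<Sum>j<l. \<integral>\<^sup>+y. indicator (Y j) y * ennreal (vdist n y (b j)) \<partial>\<nu>)"
proof -
  interpret M: prob_space \<mu> using P1D[OF \<mu>] by simp
  interpret N: prob_space \<nu> using P1D[OF \<nu>] by simp
  define p where "p i = measure \<mu> (X i)" for i
  define q where "q j = measure \<nu> (Y j)" for j
  \<comment> \<open>Value of the density on the product of the cells \<open>X i\<close> and
    \<open>Y j\<close>, chosen so that this product receives mass \<open>\<pi> i j\<close>.\<close>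
  define co where "co i j = ennreal (\<pi> i j / (p i * q j))" for i j
  define w where "w z = (\<Sum>i<k. \<Sum>j<l. co i j * (indicator (X i) (fst z) * indicator (Y j) (snd z)))" for z
  have mX: "indicator (X i) \<in> borel_measurable \<mu>" if "i < k" for i using X(1)[OF that] by simp
  have mY: "indicator (Y j) \<in> borel_measurable \<nu>" if "j < l" for j using Y(1)[OF that] by simp
  have mXf: "(\<lambda>z. indicator (X i) (fst z) :: ennreal) \<in> borel_measurable (\<mu> \<Otimes>\<^sub>M \<nu>)" if "i < k" for i
    by (rule measurable_compose[OF measurable_fst mX[OF that]])
  have mYs: "(\<lambda>z. indicator (Y j) (snd z) :: ennreal) \<in> borel_measurable (\<mu> \<Otimes>\<^sub>M \<nu>)" if "j < l" for j
    by (rule measurable_compose[OF measurable_snd mY[OF that]])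
  have mw: "w \<in> borel_measurable (\<mu> \<Otimes>\<^sub>M \<nu>)"
    unfolding w_def[abs_def] using mXf mYs by (intro borel_measurable_sum borel_measurable_times_ennreal borel_measurable_const) auto
  have intw: "(\<integral>\<^sup>+z. w z * F z \<partial>(\<mu> \<Otimes>\<^sub>M \<nu>)) = (\<Sum>i<k. \<Sum>j<l. co i j * (\<integral>\<^sup>+z. indicator (X i) (fst z) * indicator (Y j) (snd z) * F z \<partial>(\<mu> \<Otimes>\<^sub>M \<nu>)))"
    if F: "F \<in> borel_measurable (\<mu> \<Otimes>\<^sub>M \<nu>)" for F
  proof -
    have "(\<integral>\<^sup>+z. w z * F z \<partial>(\<mu> \<Otimes>\<^sub>M \<nu>)) = (\<integral>\<^sup>+z. (\<Sum>i<k. \<Sum>j<l. co i j * (indicator (X i) (fst z) * indicator (Y j) (snd z) * F z)) \<partial>(\<mu> \<Otimes>\<^sub>M \<nu>))"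
      by (simp add: w_def sum_distrib_right mult.assoc)
    also have "\<dots> = (\<Sum>i<k. \<integral>\<^sup>+z. (\<Sum>j<l. co i j * (indicator (X i) (fst z) * indicator (Y j) (snd z) * F z)) \<partial>(\<mu> \<Otimes>\<^sub>M \<nu>))"
      using mXf mYs F by (intro nn_integral_sum borel_measurable_sum borel_measurable_times_ennreal borel_measurable_const) auto
    also have "\<dots> = (\<Sum>i<k. \<Sum>j<l. \<integral>\<^sup>+z. co i j * (indicator (X i) (fst z) * indicator (Y j) (snd z) * F z) \<partial>(\<mu> \<Otimes>\<^sub>M \<nu>))"
      using mXf mYs F by (intro sum.cong nn_integral_sum refl borel_measurable_times_ennreal borel_measurable_const) auto
    also have "\<dots> = (\<Sum>i<k. \<Sum>j<l. co i j * (\<integral>\<^sup>+z. indicator (X i) (fst z) * indicator (Y j) (snd z) * F z \<partial>(\<mu> \<Otimes>\<^sub>M \<nu>)))"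
      using mXf mYs F by (intro sum.cong nn_integral_cmult refl borel_measurable_times_ennreal) auto
    finally show ?thesis .
  qed
  have pp: "0 < p i" if "i < k" for i using X(3)[OF that] by (simp add: p_def)
  have qp: "0 < q j" if "j < l" for j using Y(3)[OF that] by (simp add: q_def)
  have coq: "(\<Sum>j<l. co i j * ennreal (q j)) = 1" if i: "i < k" for i
  proof -
    have "(\<Sum>j<l. co i j * ennreal (q j)) = (\<Sum>j<l. ennreal (\<pi> i j / p i))"
    proof (rule sum.cong[OF refl])
      fix j assume "j \<in> {..<l}"
      then have "0 < q j" using qp by simp
      then show "co i j * ennreal (q j) = ennreal (\<pi> i j / p i)"
        unfolding co_def using pp[OF i] \<pi>(1) by (simp add: ennreal_mult[symmetric])
    qed
    also have "\<dots> = ennreal (\<Sum>j<l. \<pi> i j / p i)" using \<pi>(1) pp[OF i] by (intro sum_ennreal) auto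
    also have "(\<Sum>j<l. \<pi> i j / p i) = 1" using \<pi>(2)[OF i] pp[OF i] by (simp add: sum_divide_distrib[symmetric] p_def)
    finally show ?thesis by simp
  qed
  have cop: "(\<Sum>i<k. co i j * ennreal (p i)) = 1" if j: "j < l" for j
  proof -
    have "(\<Sum>i<k. co i j * ennreal (p i)) = (\<Sum>i<k. ennreal (\<pi> i j / q j))"
    proof (rule sum.cong[OF refl])
      fix i assume "i \<in> {..<k}"
      then have "0 < p i" using pp by simp
      then show "co i j * ennreal (p i) = ennreal (\<pi> i j / q j)"
        unfolding co_def using qp[OF j] \<pi>(1) by (simp add: ennreal_mult[symmetric])
    qed
    also have "\<dots> = ennreal (\<Sum>i<k. \<pi> i j / q j)" using \<pi>(1) qp[OF j] by (intro sum_ennreal) auto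
    also have "(\<Sum>i<k. \<pi> i j / q j) = 1" using \<pi>(3)[OF j] qp[OF j] by (simp add: sum_divide_distrib[symmetric] q_def)
    finally show ?thesis by simp
  qed
  have eX: "(\<integral>\<^sup>+x. indicator (X i) x \<partial>\<mu>) = ennreal (p i)" if "i < k" for i
    using X(1)[OF that] by (simp add: p_def M.emeasure_eq_measure)
  have eY: "(\<integral>\<^sup>+x. indicator (Y j) x \<partial>\<nu>) = ennreal (q j)" if "j < l" for j
    using Y(1)[OF that] by (simp add: q_def N.emeasure_eq_measure)
  have marg1: "(\<integral>\<^sup>+z. w z * g (fst z) \<partial>(\<mu> \<Otimes>\<^sub>M \<nu>)) = (\<Sum>i<k. \<integral>\<^sup>+x. indicator (X i) x * g x \<partial>\<mu>)"
    if g: "g \<in> borel_measurable \<mu>" for g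
  proof -
    have "(\<integral>\<^sup>+z. w z * g (fst z) \<partial>(\<mu> \<Otimes>\<^sub>M \<nu>)) = (\<Sum>i<k. \<Sum>j<l. co i j * ((\<integral>\<^sup>+x. indicator (X i) x * g x \<partial>\<mu>) * ennreal (q j)))"
    proof (subst intw)
      show "(\<lambda>z. g (fst z)) \<in> borel_measurable (\<mu> \<Otimes>\<^sub>M \<nu>)" by (rule measurable_compose[OF measurable_fst g])
      show "(\<Sum>i<k. \<Sum>j<l. co i j * (\<integral>\<^sup>+z. indicator (X i) (fst z) * indicator (Y j) (snd z) * g (fst z) \<partial>(\<mu> \<Otimes>\<^sub>M \<nu>)))
        = (\<Sum>i<k. \<Sum>j<l. co i j * ((\<integral>\<^sup>+x. indicator (X i) x * g x \<partial>\<mu>) * ennreal (q j)))"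
      proof (intro sum.cong refl)
        fix i j assume ij: "i \<in> {..<k}" "j \<in> {..<l}"
        have "(\<integral>\<^sup>+z. indicator (X i) (fst z) * indicator (Y j) (snd z) * g (fst z) \<partial>(\<mu> \<Otimes>\<^sub>M \<nu>))
          = (\<integral>\<^sup>+z. (indicator (X i) (fst z) * g (fst z)) * indicator (Y j) (snd z) \<partial>(\<mu> \<Otimes>\<^sub>M \<nu>))"
          by (simp add: mult_ac)
        also have "\<dots> = (\<integral>\<^sup>+x. indicator (X i) x * g x \<partial>\<mu>) * (\<integral>\<^sup>+y. indicator (Y j) y \<partial>\<nu>)"
          using ij mX mY g M.prob_space_axioms N.prob_space_axioms
          by (intro nn_integral_product[where g = "\<lambda>x. indicator (X i) x * g x"] borel_measurable_times_ennreal) auto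
        finally show "co i j * (\<integral>\<^sup>+z. indicator (X i) (fst z) * indicator (Y j) (snd z) * g (fst z) \<partial>(\<mu> \<Otimes>\<^sub>M \<nu>))
          = co i j * ((\<integral>\<^sup>+x. indicator (X i) x * g x \<partial>\<mu>) * ennreal (q j))" using eY ij by simp
      qed
    qed
    also have "\<dots> = (\<Sum>i<k. (\<integral>\<^sup>+x. indicator (X i) x * g x \<partial>\<mu>) * (\<Sum>j<l. co i j * ennreal (q j)))"
      by (simp add: sum_distrib_left mult_ac)
    also have "\<dots> = (\<Sum>i<k. \<integral>\<^sup>+x. indicator (X i) x * g x \<partial>\<mu>)" by (intro sum.cong refl) (simp add: coq)
    finally show ?thesis .
  qed
  have marg2: "(\<integral>\<^sup>+z. w z * g (snd z) \<partial>(\<mu> \<Otimes>\<^sub>M \<nu>)) = (\<Sum>j<l. \<integral>\<^sup>+x. indicator (Y j) x * g x \<partial>\<nu>)"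
    if g: "g \<in> borel_measurable \<nu>" for g
  proof -
    have "(\<integral>\<^sup>+z. w z * g (snd z) \<partial>(\<mu> \<Otimes>\<^sub>M \<nu>)) = (\<Sum>i<k. \<Sum>j<l. co i j * (ennreal (p i) * (\<integral>\<^sup>+x. indicator (Y j) x * g x \<partial>\<nu>)))"
    proof (subst intw)
      show "(\<lambda>z. g (snd z)) \<in> borel_measurable (\<mu> \<Otimes>\<^sub>M \<nu>)" by (rule measurable_compose[OF measurable_snd g])
      show "(\<Sum>i<k. \<Sum>j<l. co i j * (\<integral>\<^sup>+z. indicator (X i) (fst z) * indicator (Y j) (snd z) * g (snd z) \<partial>(\<mu> \<Otimes>\<^sub>M \<nu>)))
        = (\<Sum>i<k. \<Sum>j<l. co i j * (ennreal (p i) * (\<integral>\<^sup>+x. indicator (Y j) x * g x \<partial>\<nu>)))"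
      proof (intro sum.cong refl)
        fix i j assume ij: "i \<in> {..<k}" "j \<in> {..<l}"
        have "(\<integral>\<^sup>+z. indicator (X i) (fst z) * indicator (Y j) (snd z) * g (snd z) \<partial>(\<mu> \<Otimes>\<^sub>M \<nu>))
          = (\<integral>\<^sup>+z. indicator (X i) (fst z) * (indicator (Y j) (snd z) * g (snd z)) \<partial>(\<mu> \<Otimes>\<^sub>M \<nu>))"
          by (simp add: mult_ac)
        also have "\<dots> = (\<integral>\<^sup>+x. indicator (X i) x \<partial>\<mu>) * (\<integral>\<^sup>+y. indicator (Y j) y * g y \<partial>\<nu>)"
          using ij mX mY g M.prob_space_axioms N.prob_space_axioms
          by (intro nn_integral_product[where h = "\<lambda>x. indicator (Y j) x * g x"] borel_measurable_times_ennreal) auto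
        finally show "co i j * (\<integral>\<^sup>+z. indicator (X i) (fst z) * indicator (Y j) (snd z) * g (snd z) \<partial>(\<mu> \<Otimes>\<^sub>M \<nu>))
          = co i j * (ennreal (p i) * (\<integral>\<^sup>+x. indicator (Y j) x * g x \<partial>\<nu>))" using eX ij by simp
      qed
    qed
    also have "\<dots> = (\<Sum>j<l. \<Sum>i<k. co i j * (ennreal (p i) * (\<integral>\<^sup>+x. indicator (Y j) x * g x \<partial>\<nu>)))" by (rule sum.swap)
    also have "\<dots> = (\<Sum>j<l. (\<Sum>i<k. co i j * ennreal (p i)) * (\<integral>\<^sup>+x. indicator (Y j) x * g x \<partial>\<nu>))"
      by (simp add: sum_distrib_right mult.assoc)
    also have "\<dots> = (\<Sum>j<l. \<integral>\<^sup>+x. indicator (Y j) x * g x \<partial>\<nu>)" by (intro sum.cong refl) (simp add: cop)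
    finally show ?thesis .
  qed
  have coverX: "(\<Sum>i<k. \<integral>\<^sup>+x. indicator (X i) x * g x \<partial>\<mu>) = (\<integral>\<^sup>+x. g x \<partial>\<mu>)" if g: "g \<in> borel_measurable \<mu>" for g
  proof -
    \<comment> \<open>The masses add up to 1, so the cells cover almost everything.\<close>
    have "measure \<mu> (\<Union>i<k. X i) = 1" using X by (subst M.finite_measure_finite_Union) auto
    then have ae: "AE x in \<mu>. x \<in> (\<Union>i<k. X i)" using X by (subst M.AE_in_set_eq_1) auto
    have "(\<Sum>i<k. \<integral>\<^sup>+x. indicator (X i) x * g x \<partial>\<mu>) = (\<integral>\<^sup>+x. (\<Sum>i<k. indicator (X i) x * g x) \<partial>\<mu>)"
      using mX g by (intro nn_integral_sum[symmetric] borel_measurable_times_ennreal) auto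
    also have "\<dots> = (\<integral>\<^sup>+x. g x \<partial>\<mu>)"
    proof (rule nn_integral_cong_AE, use ae in eventually_elim)
      fix x assume "x \<in> (\<Union>i<k. X i)"
      then obtain i where i: "i < k" "x \<in> X i" by auto
      have "(\<Sum>i<k. indicator (X i) x) = (1 :: ennreal)"
      proof -
        have "(\<Sum>i'<k. indicator (X i') x) = (\<Sum>i'<k. if i' = i then 1 else (0 :: ennreal))"
          using X(2) i by (intro sum.cong refl) (auto simp: disjoint_family_on_def indicator_def)
        then show ?thesis using i by simp
      qed
      then show "(\<Sum>i<k. indicator (X i) x * g x) = g x" by (simp add: sum_distrib_right[symmetric])
    qed
    finally show ?thesis .
  qed
  have coverY: "(\<Sum>j<l. \<integral>\<^sup>+x. indicator (Y j) x * g x \<partial>\<nu>) = (\<integral>\<^sup>+x. g x \<partial>\<nu>)" if g: "g \<in> borel_measurable \<nu>" for g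
  proof -
    have "measure \<nu> (\<Union>i<l. Y i) = 1" using Y by (subst N.finite_measure_finite_Union) auto
    then have ae: "AE x in \<nu>. x \<in> (\<Union>i<l. Y i)" using Y by (subst N.AE_in_set_eq_1) auto
    have "(\<Sum>i<l. \<integral>\<^sup>+x. indicator (Y i) x * g x \<partial>\<nu>) = (\<integral>\<^sup>+x. (\<Sum>i<l. indicator (Y i) x * g x) \<partial>\<nu>)"
      using mY g by (intro nn_integral_sum[symmetric] borel_measurable_times_ennreal) auto
    also have "\<dots> = (\<integral>\<^sup>+x. g x \<partial>\<nu>)"
    proof (rule nn_integral_cong_AE, use ae in eventually_elim)
      fix x assume "x \<in> (\<Union>i<l. Y i)"
      then obtain i where i: "i < l" "x \<in> Y i" by auto
      have "(\<Sum>i<l. indicator (Y i) x) = (1 :: ennreal)"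
      proof -
        have "(\<Sum>i'<l. indicator (Y i') x) = (\<Sum>i'<l. if i' = i then 1 else (0 :: ennreal))"
          using Y(2) i by (intro sum.cong refl) (auto simp: disjoint_family_on_def indicator_def)
        then show ?thesis using i by simp
      qed
      then show "(\<Sum>i<l. indicator (Y i) x * g x) = g x" by (simp add: sum_distrib_right[symmetric])
    qed
    finally show ?thesis .
  qed
  define \<Theta> where "\<Theta> = density (\<mu> \<Otimes>\<^sub>M \<nu>) w"
  have sP: "sets \<Theta> = sets (\<mu> \<Otimes>\<^sub>M \<nu>)" by (simp add: \<Theta>_def)
  have f1: "fst \<in> measurable \<Theta> \<mu>" and f2: "snd \<in> measurable \<Theta> \<nu>"
    by (subst measurable_cong_sets[OF sP refl], simp)+
  have "distr \<Theta> \<mu> fst = \<mu>"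
  proof (rule measure_eqI)
    fix A assume "A \<in> sets (distr \<Theta> \<mu> fst)"
    then have A: "A \<in> sets \<mu>" by simp
    then have iA: "indicator A \<in> borel_measurable \<mu>" by simp
    have "emeasure (distr \<Theta> \<mu> fst) A = (\<integral>\<^sup>+x. indicator A x \<partial>distr \<Theta> \<mu> fst)" using A by simp
    also have "\<dots> = (\<integral>\<^sup>+z. indicator A (fst z) \<partial>\<Theta>)" by (rule nn_integral_distr[OF f1]) (use A in simp)
    also have "\<dots> = (\<integral>\<^sup>+z. w z * indicator A (fst z) \<partial>(\<mu> \<Otimes>\<^sub>M \<nu>))"
      unfolding \<Theta>_def by (rule nn_integral_density[OF mw]) (rule measurable_compose[OF measurable_fst iA])
    also have "\<dots> = emeasure \<mu> A" unfolding marg1[OF iA] coverX[OF iA] using A by simp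
    finally show "emeasure (distr \<Theta> \<mu> fst) A = emeasure \<mu> A" .
  qed simp
  moreover have "distr \<Theta> \<nu> snd = \<nu>"
  proof (rule measure_eqI)
    fix A assume "A \<in> sets (distr \<Theta> \<nu> snd)"
    then have A: "A \<in> sets \<nu>" by simp
    then have iA: "indicator A \<in> borel_measurable \<nu>" by simp
    have "emeasure (distr \<Theta> \<nu> snd) A = (\<integral>\<^sup>+x. indicator A x \<partial>distr \<Theta> \<nu> snd)" using A by simp
    also have "\<dots> = (\<integral>\<^sup>+z. indicator A (snd z) \<partial>\<Theta>)" by (rule nn_integral_distr[OF f2]) (use A in simp)
    also have "\<dots> = (\<integral>\<^sup>+z. w z * indicator A (snd z) \<partial>(\<mu> \<Otimes>\<^sub>M \<nu>))"
      unfolding \<Theta>_def by (rule nn_integral_density[OF mw]) (rule measurable_compose[OF measurable_snd iA])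
    also have "\<dots> = emeasure \<nu> A" unfolding marg2[OF iA] coverY[OF iA] using A by simp
    finally show "emeasure (distr \<Theta> \<nu> snd) A = emeasure \<nu> A" .
  qed simp
  ultimately have "\<Theta> \<in> couplings \<mu> \<nu>" by (simp add: couplings_def sP)
  then have "d1 n \<mu> \<nu> \<le> (\<integral>\<^sup>+(x, y). ennreal (vdist n x y) \<partial>\<Theta>)" unfolding d1_def by (rule INF_lower)
  also have "\<dots> = (\<integral>\<^sup>+z. ennreal (vdist n (fst z) (snd z)) \<partial>\<Theta>)" by (intro nn_integral_cong) (simp add: case_prod_beta)
  also have "\<dots> = (\<integral>\<^sup>+z. w z * ennreal (vdist n (fst z) (snd z)) \<partial>(\<mu> \<Otimes>\<^sub>M \<nu>))"
    unfolding \<Theta>_def using vdist_pair_measurable[OF \<mu> \<nu>] by (intro nn_integral_density[OF mw]) simp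
  finally have le0: "d1 n \<mu> \<nu> \<le> (\<integral>\<^sup>+z. w z * ennreal (vdist n (fst z) (snd z)) \<partial>(\<mu> \<Otimes>\<^sub>M \<nu>))" .
  \<comment> \<open>Distance from a point to the representative of its cell; the path from
    \<open>x\<close> to \<open>y\<close> is led through \<open>a i\<close> and
    \<open>b j\<close>.\<close>
  define S1 where "S1 = (\<lambda>x. \<Sum>i<k. indicator (X i) x * ennreal (vdist n x (a i)))"
  define S2 where "S2 = (\<lambda>y. \<Sum>j<l. indicator (Y j) y * ennreal (vdist n y (b j)))"
  note S = S1_def S2_def
  have le1: "(\<integral>\<^sup>+z. w z * ennreal (vdist n (fst z) (snd z)) \<partial>(\<mu> \<Otimes>\<^sub>M \<nu>)) \<le> (\<integral>\<^sup>+z. w z * S1 (fst z) + (\<Sum>i<k. \<Sum>j<l. co i j * ennreal (vdist n (a i) (b j)) * (indicator (X i) (fst z) * indicator (Y j) (snd z))) + w z * S2 (snd z) \<partial>(\<mu> \<Otimes>\<^sub>M \<nu>))"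
  proof (rule nn_integral_mono)
    fix z :: "vec \<times> vec"
    obtain x y :: vec where z: "z = (x, y)" by (cases z)
    have *: "co i j * (indicator (X i) x * indicator (Y j) y) * ennreal (vdist n x y)
      \<le> co i j * (indicator (X i) x * indicator (Y j) y) * S1 x + co i j * ennreal (vdist n (a i) (b j)) * (indicator (X i) x * indicator (Y j) y)
       + co i j * (indicator (X i) x * indicator (Y j) y) * S2 y" if "i < k" "j < l" for i j
    proof (cases "x \<in> X i \<and> y \<in> Y j")
      case True
      have s1: "ennreal (vdist n x (a i)) \<le> S1 x"
        unfolding S1_def using member_le_sum[of i "{..<k}" "\<lambda>i. indicator (X i) x * ennreal (vdist n x (a i))"] that True by simp
      have s2: "ennreal (vdist n y (b j)) \<le> S2 y"
        unfolding S2_def using member_le_sum[of j "{..<l}" "\<lambda>j. indicator (Y j) y * ennreal (vdist n y (b j))"] that True by simp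
      have "vdist n x y \<le> vdist n x (a i) + vdist n (a i) (b j) + vdist n y (b j)"
        using vdist_triangle[of n x y "a i"] vdist_triangle[of n "a i" y "b j"] vdist_commute[of n "b j" y] by linarith
      then have "ennreal (vdist n x y) \<le> ennreal (vdist n x (a i)) + ennreal (vdist n (a i) (b j)) + ennreal (vdist n y (b j))"
        by (simp add: ennreal_plus[symmetric] del: ennreal_plus)
      also have "\<dots> \<le> S1 x + ennreal (vdist n (a i) (b j)) + S2 y" by (intro add_mono s1 s2 order_refl)
      finally have "co i j * ennreal (vdist n x y) \<le> co i j * (S1 x + ennreal (vdist n (a i) (b j)) + S2 y)"
        by (intro mult_left_mono) auto
      then show ?thesis using True by (simp add: distrib_left)
    qed auto
    show "w z * ennreal (vdist n (fst z) (snd z)) \<le> w z * S1 (fst z) + (\<Sum>i<k. \<Sum>j<l. co i j * ennreal (vdist n (a i) (b j)) * (indicator (X i) (fst z) * indicator (Y j) (snd z))) + w z * S2 (snd z)"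
      unfolding w_def z fst_conv snd_conv sum_distrib_right sum.distrib[symmetric]
      by (intro sum_mono *) auto
  qed
  have eq1: "(\<integral>\<^sup>+z. w z * S1 (fst z) + (\<Sum>i<k. \<Sum>j<l. co i j * ennreal (vdist n (a i) (b j)) * (indicator (X i) (fst z) * indicator (Y j) (snd z))) + w z * S2 (snd z) \<partial>(\<mu> \<Otimes>\<^sub>M \<nu>))
     = (\<Sum>i<k. \<integral>\<^sup>+x. indicator (X i) x * ennreal (vdist n x (a i)) \<partial>\<mu>)
    + ennreal (\<Sum>i<k. \<Sum>j<l. \<pi> i j * vdist n (a i) (b j))
    + (\<Sum>j<l. \<integral>\<^sup>+y. indicator (Y j) y * ennreal (vdist n y (b j)) \<partial>\<nu>)"
  proof -
    have md: "(\<lambda>x. ennreal (vdist n x c)) \<in> borel_measurable \<mu>" "(\<lambda>x. ennreal (vdist n x c)) \<in> borel_measurable \<nu>" for c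
      unfolding P1D(5)[OF \<mu>] P1D(5)[OF \<nu>] using Leb_measurable_continuous[OF continuous_on_vdist] by simp_all
    have mS1: "S1 \<in> borel_measurable \<mu>" unfolding S using mX md by (intro borel_measurable_sum borel_measurable_times_ennreal) auto
    have mS2: "S2 \<in> borel_measurable \<nu>" unfolding S using mY md by (intro borel_measurable_sum borel_measurable_times_ennreal) auto
    have m1: "(\<lambda>z. w z * S1 (fst z)) \<in> borel_measurable (\<mu> \<Otimes>\<^sub>M \<nu>)" "(\<lambda>z. w z * S2 (snd z)) \<in> borel_measurable (\<mu> \<Otimes>\<^sub>M \<nu>)"
      by (intro borel_measurable_times_ennreal mw measurable_compose[OF measurable_fst mS1] measurable_compose[OF measurable_snd mS2])+
    have m2: "(\<lambda>z. \<Sum>i<k. \<Sum>j<l. co i j * ennreal (vdist n (a i) (b j)) * (indicator (X i) (fst z) * indicator (Y j) (snd z))) \<in> borel_measurable (\<mu> \<Otimes>\<^sub>M \<nu>)"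
      using mXf mYs by (intro borel_measurable_sum borel_measurable_times_ennreal borel_measurable_const) auto
    have "(\<integral>\<^sup>+z. w z * S1 (fst z) \<partial>(\<mu> \<Otimes>\<^sub>M \<nu>)) = (\<integral>\<^sup>+x. S1 x \<partial>\<mu>)" by (simp add: marg1[OF mS1] coverX[OF mS1])
    also have "\<dots> = (\<Sum>i<k. \<integral>\<^sup>+x. indicator (X i) x * ennreal (vdist n x (a i)) \<partial>\<mu>)"
      unfolding S using mX md by (intro nn_integral_sum borel_measurable_times_ennreal) auto
    finally have i1: "(\<integral>\<^sup>+z. w z * S1 (fst z) \<partial>(\<mu> \<Otimes>\<^sub>M \<nu>)) = \<dots>" .
    have "(\<integral>\<^sup>+z. w z * S2 (snd z) \<partial>(\<mu> \<Otimes>\<^sub>M \<nu>)) = (\<integral>\<^sup>+x. S2 x \<partial>\<nu>)" by (simp add: marg2[OF mS2] coverY[OF mS2])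
    also have "\<dots> = (\<Sum>j<l. \<integral>\<^sup>+y. indicator (Y j) y * ennreal (vdist n y (b j)) \<partial>\<nu>)"
      unfolding S using mY md by (intro nn_integral_sum borel_measurable_times_ennreal) auto
    finally have i2: "(\<integral>\<^sup>+z. w z * S2 (snd z) \<partial>(\<mu> \<Otimes>\<^sub>M \<nu>)) = \<dots>" .
    have "(\<integral>\<^sup>+z. (\<Sum>i<k. \<Sum>j<l. co i j * ennreal (vdist n (a i) (b j)) * (indicator (X i) (fst z) * indicator (Y j) (snd z))) \<partial>(\<mu> \<Otimes>\<^sub>M \<nu>))
      = (\<Sum>i<k. \<Sum>j<l. co i j * ennreal (vdist n (a i) (b j)) * (ennreal (p i) * ennreal (q j)))"
    proof -
      have "(\<integral>\<^sup>+z. (\<Sum>i<k. \<Sum>j<l. co i j * ennreal (vdist n (a i) (b j)) * (indicator (X i) (fst z) * indicator (Y j) (snd z))) \<partial>(\<mu> \<Otimes>\<^sub>M \<nu>))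
        = (\<Sum>i<k. \<integral>\<^sup>+z. (\<Sum>j<l. co i j * ennreal (vdist n (a i) (b j)) * (indicator (X i) (fst z) * indicator (Y j) (snd z))) \<partial>(\<mu> \<Otimes>\<^sub>M \<nu>))"
        using mXf mYs by (intro nn_integral_sum borel_measurable_sum borel_measurable_times_ennreal borel_measurable_const) auto
      also have "\<dots> = (\<Sum>i<k. \<Sum>j<l. \<integral>\<^sup>+z. co i j * ennreal (vdist n (a i) (b j)) * (indicator (X i) (fst z) * indicator (Y j) (snd z)) \<partial>(\<mu> \<Otimes>\<^sub>M \<nu>))"
        using mXf mYs by (intro sum.cong nn_integral_sum refl borel_measurable_times_ennreal borel_measurable_const) auto
      also have "\<dots> = (\<Sum>i<k. \<Sum>j<l. co i j * ennreal (vdist n (a i) (b j)) * (\<integral>\<^sup>+z. indicator (X i) (fst z) * indicator (Y j) (snd z) \<partial>(\<mu> \<Otimes>\<^sub>M \<nu>)))"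
        using mXf mYs by (intro sum.cong nn_integral_cmult refl) auto
      also have "\<dots> = (\<Sum>i<k. \<Sum>j<l. co i j * ennreal (vdist n (a i) (b j)) * (ennreal (p i) * ennreal (q j)))"
        using nn_integral_product[OF M.prob_space_axioms N.prob_space_axioms mX mY] eX eY by (intro sum.cong refl) auto
      finally show ?thesis .
    qed
    also have "\<dots> = (\<Sum>i<k. \<Sum>j<l. ennreal (\<pi> i j * vdist n (a i) (b j)))"
    proof (intro sum.cong refl)
      fix i j assume "i \<in> {..<k}" "j \<in> {..<l}"
      then have "0 < p i" "0 < q j" using pp qp by auto
      then show "co i j * ennreal (vdist n (a i) (b j)) * (ennreal (p i) * ennreal (q j)) = ennreal (\<pi> i j * vdist n (a i) (b j))"
        unfolding co_def using \<pi>(1) by (simp add: ennreal_mult[symmetric])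
    qed
    also have "\<dots> = (\<Sum>i<k. ennreal (\<Sum>j<l. \<pi> i j * vdist n (a i) (b j)))"
      using \<pi>(1) by (intro sum.cong refl sum_ennreal) auto
    also have "\<dots> = ennreal (\<Sum>i<k. \<Sum>j<l. \<pi> i j * vdist n (a i) (b j))"
      using \<pi>(1) by (intro sum_ennreal sum_nonneg) auto
    finally have i3: "(\<integral>\<^sup>+z. (\<Sum>i<k. \<Sum>j<l. co i j * ennreal (vdist n (a i) (b j)) * (indicator (X i) (fst z) * indicator (Y j) (snd z))) \<partial>(\<mu> \<Otimes>\<^sub>M \<nu>)) = \<dots>" .
    show ?thesis
      using m1 m2 by (subst nn_integral_add, simp, simp)+ (simp add: i1 i2 i3)
  qed
  show ?thesis using order_trans[OF le0 le1] unfolding eq1 .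
qed

section \<open>Averaging\<close>

definition lipK :: "nat \<Rightarrow> real \<Rightarrow> (vec \<Rightarrow> real) \<Rightarrow> bool" where
  "lipK n K f \<longleftrightarrow> (\<forall>x\<in>Rn n. \<forall>y\<in>Rn n. \<bar>f x - f y\<bar> \<le> K * vdist n x y)"

lemma lipKD: "lipK n K f \<Longrightarrow> x \<in> Rn n \<Longrightarrow> y \<in> Rn n \<Longrightarrow> \<bar>f x - f y\<bar> \<le> K * vdist n x y"
  by (simp add: lipK_def)

lemma lipK_continuous: "lipK n K f \<Longrightarrow> continuous_on (Rn n) f"
  by (rule lip_continuous[of n f K]) (simp add: lipK_def)

lemma vdist_shift: "i < n \<Longrightarrow> vdist n (x(i := x i + s)) (y(i := y i + s)) = vdist n x y"
  unfolding vdist_def by (rule vnorm_cong) simp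

text \<open>One-sided mean in a single coordinate, a substitute for convolution with a mollifier
  that uses one-dimensional integrals.\<close>

definition avg :: "real \<Rightarrow> nat \<Rightarrow> (vec \<Rightarrow> real) \<Rightarrow> vec \<Rightarrow> real" where
  "avg \<delta> i f x = (1 / \<delta>) * integral {0..\<delta>} (\<lambda>s. f (x(i := x i + s)))"

lemma lipK_line_continuous:
  assumes f: "lipK n K f" and x: "x \<in> Rn n" and i: "i < n"
  shows "continuous_on S (\<lambda>s. f (x(i := c + s)))"
proof -
  have "continuous_on S (\<lambda>s. x(i := c + s))"
  proof (rule continuous_on_Rn_vec[where n = n])
    show "continuous_on S (\<lambda>s. (x(i := c + s)) j)" for j
      by (cases "j = i") (auto intro!: continuous_on_add continuous_on_const continuous_on_id)
  qed (use x i in simp)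
  then show ?thesis
    by (rule continuous_on_compose2[OF lipK_continuous[OF f]]) (use x i in auto)
qed

lemma avg_cong:
  assumes "\<And>x. x \<in> Rn n \<Longrightarrow> f x = g x" "x \<in> Rn n" "i < n"
  shows "avg \<delta> i f x = avg \<delta> i g x"
  unfolding avg_def using assms by simp

lemma avg_mono:
  assumes f: "lipK n K f" and g: "lipK n K' g" and x: "x \<in> Rn n" and y: "y \<in> Rn n" and i: "i < n" and d: "0 < \<delta>"
    and le: "\<And>s. 0 \<le> s \<Longrightarrow> s \<le> \<delta> \<Longrightarrow> f (x(i := x i + s)) \<le> g (y(i := y i + s)) + c"
  shows "avg \<delta> i f x \<le> avg \<delta> i g y + c"
proof -
  have i1: "(\<lambda>s. f (x(i := x i + s))) integrable_on {0..\<delta>}"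
    by (rule integrable_continuous_real[OF lipK_line_continuous[OF f x i]])
  have i2: "(\<lambda>s. g (y(i := y i + s))) integrable_on {0..\<delta>}"
    by (rule integrable_continuous_real[OF lipK_line_continuous[OF g y i]])
  have "integral {0..\<delta>} (\<lambda>s. f (x(i := x i + s))) \<le> integral {0..\<delta>} (\<lambda>s. g (y(i := y i + s)) + c)"
    by (rule integral_le[OF i1]) (use i2 le in \<open>auto intro: integrable_add\<close>)
  also have "\<dots> = integral {0..\<delta>} (\<lambda>s. g (y(i := y i + s))) + \<delta> * c"
    using i2 d by (subst Henstock_Kurzweil_Integration.integral_add) auto
  finally have "(1 / \<delta>) * integral {0..\<delta>} (\<lambda>s. f (x(i := x i + s))) \<le> (1 / \<delta>) * (integral {0..\<delta>} (\<lambda>s. g (y(i := y i + s))) + \<delta> * c)"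
    using d by (intro mult_left_mono) auto
  then show ?thesis unfolding avg_def using d by (simp add: distrib_left)
qed

lemma avg_lip:
  assumes f: "lipK n K f" and i: "i < n" and d: "0 < \<delta>"
  shows "lipK n K (avg \<delta> i f)"
  unfolding lipK_def
proof (intro ballI)
  fix x y assume x: "x \<in> Rn n" and y: "y \<in> Rn n"
  have *: "avg \<delta> i f x \<le> avg \<delta> i f y + K * vdist n x y" if x: "x \<in> Rn n" and y: "y \<in> Rn n" for x y
  proof (rule avg_mono[OF f f x y i d])
    fix s show "f (x(i := x i + s)) \<le> f (y(i := y i + s)) + K * vdist n x y"
      using lipKD[OF f, of "x(i := x i + s)" "y(i := y i + s)"] x y i by (simp add: vdist_shift)
  qed
  show "\<bar>avg \<delta> i f x - avg \<delta> i f y\<bar> \<le> K * vdist n x y"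
    using *[OF x y] *[OF y x] by (simp add: abs_le_iff vdist_commute)
qed

text \<open>Fubini for a continuous integrand on a square; it lets a chosen average be moved through
  a list.\<close>

lemma avg_commute:
  assumes f: "lipK n K f" and i: "i < n" and j: "j < n" and x: "x \<in> Rn n"
  shows "avg \<delta> i (avg \<delta> j f) x = avg \<delta> j (avg \<delta> i f) x"
proof (cases "i = j")
  case False
  define h where "h s r = f (x(i := x i + s, j := x j + r))" for s r
  have "continuous_on UNIV (\<lambda>p :: real \<times> real. x(i := x i + fst p, j := x j + snd p))"
  proof (rule continuous_on_Rn_vec[where n = n])
    fix k
    show "continuous_on UNIV (\<lambda>p :: real \<times> real. (x(i := x i + fst p, j := x j + snd p)) k)"
    proof -
      have "continuous_on UNIV (\<lambda>p :: real \<times> real. x i + fst p)" "continuous_on UNIV (\<lambda>p :: real \<times> real. x j + snd p)"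
        by (intro continuous_on_add continuous_on_const continuous_on_fst continuous_on_snd continuous_on_id)+
      then show ?thesis using False by (cases "k = i"; cases "k = j") auto
    qed
  qed (use x i j in simp)
  then have "continuous_on UNIV (\<lambda>p. f (x(i := x i + fst p, j := x j + snd p)))"
    by (rule continuous_on_compose2[OF lipK_continuous[OF f]]) (use x i j in auto)
  then have "continuous_on UNIV (\<lambda>(s, r). h s r)" by (simp add: h_def case_prod_beta)
  then have c: "continuous_on (cbox (0, 0) (\<delta>, \<delta>)) (\<lambda>(s, r). h s r)"
    by (rule continuous_on_subset) simp
  have sw: "integral {0..\<delta>} (\<lambda>s. integral {0..\<delta>} (h s)) = integral {0..\<delta>} (\<lambda>r. integral {0..\<delta>} (\<lambda>s. h s r))"
    using integral_swap_continuous[OF c] unfolding cbox_interval .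
  have hh: "h s r = f (x(j := x j + r, i := x i + s))" for s r
    unfolding h_def by (subst fun_upd_twist[OF False]) (rule refl)
  have "avg \<delta> i (avg \<delta> j f) x = (1 / \<delta>) * integral {0..\<delta>} (\<lambda>s. (1 / \<delta>) * integral {0..\<delta>} (h s))"
    unfolding avg_def h_def using fun_upd_other[OF False[symmetric], of x] by (simp only:)
  also have "\<dots> = (1 / \<delta>) * ((1 / \<delta>) * integral {0..\<delta>} (\<lambda>r. integral {0..\<delta>} (\<lambda>s. h s r)))"
    unfolding sw[symmetric] by (simp only: integral_mult_right)
  also have "\<dots> = (1 / \<delta>) * integral {0..\<delta>} (\<lambda>r. (1 / \<delta>) * integral {0..\<delta>} (\<lambda>s. h s r))"
    by (simp only: integral_mult_right)
  also have "\<dots> = avg \<delta> j (avg \<delta> i f) x"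
    unfolding avg_def hh using fun_upd_other[OF False, of x] by (simp only:)
  finally show ?thesis .
qed simp

definition avgs :: "real \<Rightarrow> nat list \<Rightarrow> (vec \<Rightarrow> real) \<Rightarrow> vec \<Rightarrow> real" where
  "avgs \<delta> l f = foldr (avg \<delta>) l f"

lemma avgs_simps [simp]: "avgs \<delta> [] f = f" "avgs \<delta> (i # l) f = avg \<delta> i (avgs \<delta> l f)"
  by (simp_all add: avgs_def)

lemma avgs_lip: "lipK n K f \<Longrightarrow> set l \<subseteq> {..<n} \<Longrightarrow> 0 < \<delta> \<Longrightarrow> lipK n K (avgs \<delta> l f)"
  by (induction l) (auto intro: avg_lip)

text \<open>The base points \<open>x\<close> and \<open>y\<close> are independent and
  \<open>w\<close> ranges over the averaging box. This single comparison later yields the support,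
  translation and closeness properties of the smoothing and its near commutation with an Euler
  step.\<close>

lemma avgs_mono:
  fixes \<delta> :: real
  assumes f: "lipK n K f" and g: "lipK n K' g" and l: "set l \<subseteq> {..<n}" and d: "0 < \<delta>"
    and x: "x \<in> Rn n" and y: "y \<in> Rn n"
    and le: "\<And>w :: vec. (\<And>i. i < n \<Longrightarrow> 0 \<le> w i \<and> w i \<le> \<delta> * length l) \<Longrightarrow> f (mv n x 1 w) \<le> g (mv n y 1 w) + c"
  shows "avgs \<delta> l f x \<le> avgs \<delta> l g y + c"
  using l x y le
proof (induction l arbitrary: x y)
  case Nil
  have "mv n x 1 (\<lambda>_. 0) = x" "mv n y 1 (\<lambda>_. 0) = y"
    by (rule Rn_eqI[where n = n]; use Nil in simp)+
  then show ?case using Nil(4)[of "\<lambda>_. 0"] by simp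
next
  case (Cons i l)
  have i: "i < n" using Cons.prems(1) by simp
  show ?case unfolding avgs_simps
  proof (rule avg_mono)
    show "lipK n K (avgs \<delta> l f)" "lipK n K' (avgs \<delta> l g)"
      using avgs_lip[OF f _ d, of l] avgs_lip[OF g _ d, of l] Cons.prems(1) by auto
    show "x \<in> Rn n" "y \<in> Rn n" "i < n" "0 < \<delta>" using Cons.prems(2,3) i d by auto
  next
    fix s assume s: "0 \<le> s" "s \<le> \<delta>"
    show "avgs \<delta> l f (x(i := x i + s)) \<le> avgs \<delta> l g (y(i := y i + s)) + c"
    proof (rule Cons.IH[where x = "x(i := x i + s)" and y = "y(i := y i + s)"])
      show "x(i := x i + s) \<in> Rn n" "y(i := y i + s) \<in> Rn n" by (rule upd_Rn[OF Cons.prems(2) i], rule upd_Rn[OF Cons.prems(3) i])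
      show "set l \<subseteq> {..<n}" using Cons.prems(1) by simp
      fix w :: vec assume w: "\<And>i. i < n \<Longrightarrow> 0 \<le> w i \<and> w i \<le> \<delta> * length l"
      have m: "mv n (z(i := z i + s)) 1 w = mv n z 1 (w(i := w i + s))" for z
        by (auto simp: mv_def fun_eq_iff)
      have "f (mv n x 1 (w(i := w i + s))) \<le> g (mv n y 1 (w(i := w i + s))) + c"
      proof (rule Cons.prems(4))
        fix j assume j: "j < n"
        have "\<delta> * length (i # l) = \<delta> * length l + \<delta>" by (simp add: algebra_simps)
        then show "0 \<le> (w(i := w i + s)) j \<and> (w(i := w i + s)) j \<le> \<delta> * length (i # l)"
          using w[OF j] s d by auto
      qed
      then show "f (mv n (x(i := x i + s)) 1 w) \<le> g (mv n (y(i := y i + s)) 1 w) + c" unfolding m .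
    qed
  qed
qed

lemma avgs_zero: "avgs \<delta> l (\<lambda>_. 0) x = 0"
  by (induction l arbitrary: x) (simp_all add: avg_def)

text \<open>Brings an average in direction \<open>i\<close> to the front, where
  \<open>avg_derivative\<close> applies.\<close>

lemma avgs_remove:
  assumes f: "lipK n K f" and l: "set l \<subseteq> {..<n}" and d: "0 < \<delta>" and i: "i \<in> set l" and x: "x \<in> Rn n"
  shows "avgs \<delta> l f x = avg \<delta> i (avgs \<delta> (remove1 i l) f) x"
  using l i x
proof (induction l arbitrary: x)
  case (Cons j l)
  show ?case
  proof (cases "i = j")
    case False
    then have il: "i \<in> set l" using Cons.prems by simp
    have ij: "i < n" "j < n" using Cons.prems by auto
    have rl: "set (remove1 i l) \<subseteq> {..<n}" using Cons.prems(1) set_remove1_subset[of i l] by auto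
    have "avgs \<delta> (j # l) f x = avg \<delta> j (avg \<delta> i (avgs \<delta> (remove1 i l) f)) x"
      unfolding avgs_simps by (rule avg_cong[where n = n]) (use Cons il ij in auto)
    also have "\<dots> = avg \<delta> i (avg \<delta> j (avgs \<delta> (remove1 i l) f)) x"
      by (rule avg_commute[OF avgs_lip[OF f rl d] ij(2,1) Cons.prems(3)])
    finally show ?thesis using False by simp
  qed simp
qed simp

text \<open>Fundamental theorem of calculus: the derivative of a moving mean is a difference
  quotient of the function itself.\<close>

lemma avg_derivative:
  assumes f: "lipK n K f" and x: "x \<in> Rn n" and i: "i < n" and d: "0 < \<delta>"
  shows "((\<lambda>r. avg \<delta> i f (x(i := r))) has_real_derivative (f (x(i := x i + \<delta>)) - f x) / \<delta>) (at (x i))"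
proof -
  \<comment> \<open>The interval has margin 1 on both sides, so it contains every point used while
    \<open>r\<close> is within 1 of \<open>x i\<close>.\<close>
  define a where "a = x i - 1"
  define b where "b = x i + \<delta> + 1"
  define h where "h s = f (x(i := s))" for s
  have hc: "continuous_on S h" for S
    unfolding h_def using lipK_line_continuous[OF f x i, of S 0] by simp
  obtain G where G: "\<And>s. s \<in> {a..b} \<Longrightarrow> (G has_vector_derivative h s) (at s within {a..b})"
    using antiderivative_continuous[OF hc[of "{a..b}"]] by blast
  have G1: "(G has_real_derivative h s) (at s)" if "a < s" "s < b" for s
    using G[of s] that by (simp add: has_real_derivative_iff_has_vector_derivative at_within_interior[of s "{a..b}"])
  have int: "avg \<delta> i f (x(i := r)) = (1 / \<delta>) * (G (r + \<delta>) - G r)" if r: "\<bar>r - x i\<bar> < 1" for r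
  proof -
    have "((\<lambda>s. h (r + s)) has_integral G (r + \<delta>) - G (r + 0)) {0..\<delta>}"
    proof (rule fundamental_theorem_of_calculus)
      fix s assume s: "s \<in> {0..\<delta>}"
      have "(G has_real_derivative h (r + s)) (at (r + s))"
        by (rule G1) (use s r in \<open>auto simp: a_def b_def\<close>)
      then have "((\<lambda>s. G (r + s)) has_real_derivative h (r + s) * 1) (at s)"
        by (rule DERIV_chain2) (auto intro!: derivative_eq_intros)
      then show "((\<lambda>s. G (r + s)) has_vector_derivative h (r + s)) (at s within {0..\<delta>})"
        by (simp add: has_real_derivative_iff_has_vector_derivative has_vector_derivative_at_within)
    qed (use d in simp)
    then have "integral {0..\<delta>} (\<lambda>s. h (r + s)) = G (r + \<delta>) - G r" by (simp add: integral_unique)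
    then show ?thesis by (simp add: avg_def h_def)
  qed
  have "((\<lambda>r. (1 / \<delta>) * (G (r + \<delta>) - G r)) has_real_derivative (1 / \<delta>) * (h (x i + \<delta>) * 1 - h (x i))) (at (x i))"
    by (intro DERIV_cmult DERIV_diff DERIV_chain2[where f = G] G1)
       (use d in \<open>auto simp: a_def b_def intro!: derivative_eq_intros\<close>)
  moreover have "\<forall>\<^sub>F r in nhds (x i). avg \<delta> i f (x(i := r)) = (1 / \<delta>) * (G (r + \<delta>) - G r)"
    unfolding eventually_nhds_metric by (intro exI[of _ 1]) (auto simp: int dist_real_def)
  ultimately have "((\<lambda>r. avg \<delta> i f (x(i := r))) has_real_derivative (1 / \<delta>) * (h (x i + \<delta>) * 1 - h (x i))) (at (x i))"
    using DERIV_cong_ev[OF refl, of "\<lambda>r. avg \<delta> i f (x(i := r))" "\<lambda>r. (1 / \<delta>) * (G (r + \<delta>) - G r)" "x i"] by blast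
  moreover have "(1 / \<delta>) * (h (x i + \<delta>) * 1 - h (x i)) = (f (x(i := x i + \<delta>)) - f x) / \<delta>"
    by (simp add: h_def)
  ultimately show ?thesis by (simp only:)
qed

text \<open>Averaging twice in every direction makes a Lipschitz function twice differentiable, with
  derivatives that are difference quotients of Lipschitz functions.\<close>

definition smooth :: "nat \<Rightarrow> real \<Rightarrow> (vec \<Rightarrow> real) \<Rightarrow> vec \<Rightarrow> real" where
  "smooth n \<delta> f = avgs \<delta> ([0..<n] @ [0..<n]) f"

context
  fixes n :: nat and \<delta> K :: real and f :: "vec \<Rightarrow> real"
  assumes f: "lipK n K f" and d: "0 < \<delta>" and K: "0 \<le> K"
begin

lemma smooth_list: "set ([0..<n] @ [0..<n]) \<subseteq> {..<n}" "length ([0..<n] @ [0..<n]) = 2 * n"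
  by auto

lemma smooth_lip: "lipK n K (smooth n \<delta> f)"
  unfolding smooth_def by (rule avgs_lip[OF f smooth_list(1) d])

lemma smooth_mono:
  assumes g: "lipK n K' g" and x: "x \<in> Rn n" and y: "y \<in> Rn n"
    and le: "\<And>w. vnorm n w \<le> 2 * n * n * \<delta> \<Longrightarrow> f (mv n x 1 w) \<le> g (mv n y 1 w) + c"
  shows "smooth n \<delta> f x \<le> smooth n \<delta> g y + c"
  unfolding smooth_def
proof (rule avgs_mono[OF f g smooth_list(1) d x y])
  fix w :: vec assume w: "\<And>i. i < n \<Longrightarrow> 0 \<le> w i \<and> w i \<le> \<delta> * length ([0..<n] @ [0..<n])"
  have "vnorm n w \<le> real n * (\<delta> * (2 * n))" by (rule vnorm_le_const) (use w smooth_list(2) in auto)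
  then show "f (mv n x 1 w) \<le> g (mv n y 1 w) + c" by (intro le) (simp add: mult_ac)
qed

text \<open>What is left of the smoothing once both averages in direction \<open>i\<close> are taken
  off; derivatives in that direction are difference quotients of it.\<close>

definition inner :: "nat \<Rightarrow> vec \<Rightarrow> real" where
  "inner i = avgs \<delta> (remove1 i (remove1 i ([0..<n] @ [0..<n]))) f"

lemma inner_lip: "lipK n K (inner i)"
  unfolding inner_def
proof (rule avgs_lip[OF f _ d])
  show "set (remove1 i (remove1 i ([0..<n] @ [0..<n]))) \<subseteq> {..<n}"
    using set_remove1_subset[of i "remove1 i ([0..<n] @ [0..<n])"] set_remove1_subset[of i "[0..<n] @ [0..<n]"]
      smooth_list(1) by blast
qed

lemma smooth_eq:
  assumes i: "i < n" and x: "x \<in> Rn n"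
  shows "smooth n \<delta> f x = avg \<delta> i (avg \<delta> i (inner i)) x"
proof -
  define l where "l = [0..<n] @ [0..<n]"
  have l: "set l \<subseteq> {..<n}" "i \<in> set l" using i by (auto simp: l_def)
  have r1: "remove1 i l = remove1 i [0..<n] @ [0..<n]" using i by (simp add: l_def remove1_append)
  have rs: "set (remove1 i l) \<subseteq> {..<n}" using set_remove1_subset[of i l] l by blast
  have "avgs \<delta> l f x = avg \<delta> i (avgs \<delta> (remove1 i l) f) x" by (rule avgs_remove[OF f l(1) d l(2) x])
  also have "\<dots> = avg \<delta> i (avg \<delta> i (avgs \<delta> (remove1 i (remove1 i l)) f)) x"
    by (rule avg_cong[where n = n, OF avgs_remove[OF f rs d]]) (use i x in \<open>auto simp: r1\<close>)
  finally show ?thesis unfolding smooth_def inner_def l_def .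
qed

definition sD :: "nat \<Rightarrow> vec \<Rightarrow> real" where
  "sD i x = (avg \<delta> i (inner i) (x(i := x i + \<delta>)) - avg \<delta> i (inner i) x) / \<delta>"

definition sDD :: "nat \<Rightarrow> vec \<Rightarrow> real" where
  "sDD i x = ((inner i (x(i := x i + 2 * \<delta>)) - inner i (x(i := x i + \<delta>))) / \<delta> - (inner i (x(i := x i + \<delta>)) - inner i x) / \<delta>) / \<delta>"

lemma smooth_D:
  assumes i: "i < n" and x: "x \<in> Rn n"
  shows "((\<lambda>r. smooth n \<delta> f (x(i := r))) has_real_derivative sD i x) (at (x i))"
  using avg_derivative[OF avg_lip[OF inner_lip i d] x i d] i x unfolding sD_def by (simp add: smooth_eq)

lemma smooth_DD:
  assumes i: "i < n" and x: "x \<in> Rn n"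
  shows "((\<lambda>r. sD i (x(i := r))) has_real_derivative sDD i x) (at (x i))"
proof -
  have 1: "((\<lambda>r. avg \<delta> i (inner i) (x(i := r))) has_real_derivative (inner i (x(i := x i + \<delta>)) - inner i x) / \<delta>) (at (x i))"
    by (rule avg_derivative[OF inner_lip x i d])
  have "((\<lambda>r. avg \<delta> i (inner i) ((x(i := x i + \<delta>))(i := r))) has_real_derivative
      (inner i ((x(i := x i + \<delta>))(i := (x(i := x i + \<delta>)) i + \<delta>)) - inner i (x(i := x i + \<delta>))) / \<delta>) (at ((x(i := x i + \<delta>)) i))"
    by (rule avg_derivative[OF inner_lip _ i d]) (use x i in simp)
  then have 2: "((\<lambda>r. avg \<delta> i (inner i) (x(i := r))) has_real_derivative
      (inner i (x(i := x i + 2 * \<delta>)) - inner i (x(i := x i + \<delta>))) / \<delta>) (at (x i + \<delta>))" by (simp add: add.commute)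
  have "((\<lambda>r. avg \<delta> i (inner i) (x(i := r + \<delta>))) has_real_derivative
      (inner i (x(i := x i + 2 * \<delta>)) - inner i (x(i := x i + \<delta>))) / \<delta> * 1) (at (x i))"
    by (rule DERIV_chain2[where g = "\<lambda>r. r + \<delta>" and x = "x i", OF 2]) (auto intro!: derivative_eq_intros)
  from DERIV_cdivide[OF DERIV_diff[OF this 1], of \<delta>] show ?thesis
    unfolding sD_def sDD_def by simp
qed

lemma sD_lip:
  assumes i: "i < n"
  shows "lipK n (2 * K / \<delta>) (sD i)"
  unfolding lipK_def
proof (intro ballI)
  fix x y assume xy: "x \<in> Rn n" "y \<in> Rn n"
  define g where "g = avg \<delta> i (inner i)"
  have g: "lipK n K g" unfolding g_def by (rule avg_lip[OF inner_lip i d])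
  have "\<bar>g (x(i := x i + \<delta>)) - g (y(i := y i + \<delta>))\<bar> \<le> K * vdist n x y"
    using lipKD[OF g, of "x(i := x i + \<delta>)" "y(i := y i + \<delta>)"] xy i by (simp add: vdist_shift)
  then have "\<bar>(g (x(i := x i + \<delta>)) - g x) - (g (y(i := y i + \<delta>)) - g y)\<bar> \<le> 2 * K * vdist n x y"
    using lipKD[OF g xy] by linarith
  then have "\<bar>(g (x(i := x i + \<delta>)) - g x) - (g (y(i := y i + \<delta>)) - g y)\<bar> / \<delta> \<le> 2 * K * vdist n x y / \<delta>"
    using d by (intro divide_right_mono) auto
  moreover have "sD i x - sD i y = ((g (x(i := x i + \<delta>)) - g x) - (g (y(i := y i + \<delta>)) - g y)) / \<delta>"
    by (simp add: sD_def g_def diff_divide_distrib)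
  ultimately show "\<bar>sD i x - sD i y\<bar> \<le> 2 * K / \<delta> * vdist n x y"
    using d by (simp add: abs_divide)
qed

lemma sDD_lip:
  assumes i: "i < n"
  shows "lipK n (4 * K / \<delta>\<^sup>2) (sDD i)"
  unfolding lipK_def
proof (intro ballI)
  fix x y assume xy: "x \<in> Rn n" "y \<in> Rn n"
  define g where "g = inner i"
  have g: "lipK n K g" unfolding g_def by (rule inner_lip)
  have s: "\<bar>g (x(i := x i + c)) - g (y(i := y i + c))\<bar> \<le> K * vdist n x y" for c
    using lipKD[OF g, of "x(i := x i + c)" "y(i := y i + c)"] xy i by (simp add: vdist_shift)
  define q where "q x = g (x(i := x i + 2 * \<delta>)) - 2 * g (x(i := x i + \<delta>)) + g x" for x
  have "\<bar>q x - q y\<bar> \<le> 4 * (K * vdist n x y)"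
    using s[of "2 * \<delta>"] s[of \<delta>] lipKD[OF g xy] unfolding q_def by linarith
  then have "\<bar>q x - q y\<bar> / \<delta>\<^sup>2 \<le> 4 * (K * vdist n x y) / \<delta>\<^sup>2" by (intro divide_right_mono) auto
  moreover have "sDD i x = q x / \<delta>\<^sup>2" for x
    unfolding sDD_def g_def[symmetric] q_def diff_divide_distrib[symmetric] power2_eq_square by simp
  ultimately show "\<bar>sDD i x - sDD i y\<bar> \<le> 4 * K / \<delta>\<^sup>2 * vdist n x y"
    by (simp add: diff_divide_distrib[symmetric] abs_divide)
qed

text \<open>Uniform in \<open>\<delta>\<close>, unlike the bounds on second derivatives, because
  averaging preserves the Lipschitz constant \<open>K\<close>.\<close>

lemma sD_bound:
  assumes i: "i < n" and x: "x \<in> Rn n"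
  shows "\<bar>sD i x\<bar> \<le> K"
proof -
  have "\<bar>avg \<delta> i (inner i) (x(i := x i + \<delta>)) - avg \<delta> i (inner i) x\<bar> \<le> K * vdist n (x(i := x i + \<delta>)) (x(i := x i))"
    using lipKD[OF avg_lip[OF inner_lip i d], of "x(i := x i + \<delta>)" x] x i by simp
  also have "\<dots> = K * \<delta>" using i d by (simp only: vdist_upd) simp
  finally show ?thesis unfolding sD_def using d by (simp add: abs_divide pos_divide_le_eq)
qed

lemma sDD_bound:
  assumes i: "i < n" and x: "x \<in> Rn n"
  shows "\<bar>sDD i x\<bar> \<le> 2 * K / \<delta>"
proof -
  have "\<bar>inner i (x(i := a)) - inner i (x(i := b))\<bar> \<le> K * \<bar>a - b\<bar>" for a b
    using lipKD[OF inner_lip, of "x(i := a)" "x(i := b)" i] x i by (simp add: vdist_upd)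
  from this[of "x i + 2 * \<delta>" "x i + \<delta>"] this[of "x i + \<delta>" "x i"]
  have "\<bar>(inner i (x(i := x i + 2 * \<delta>)) - inner i (x(i := x i + \<delta>))) - (inner i (x(i := x i + \<delta>)) - inner i x)\<bar> \<le> 2 * K * \<delta>"
    using d by simp
  then have "\<bar>(inner i (x(i := x i + 2 * \<delta>)) - inner i (x(i := x i + \<delta>))) - (inner i (x(i := x i + \<delta>)) - inner i x)\<bar> / \<delta>\<^sup>2 \<le> 2 * K * \<delta> / \<delta>\<^sup>2"
    by (intro divide_right_mono) auto
  moreover have "2 * K * \<delta> / \<delta>\<^sup>2 = 2 * K / \<delta>" using d by (simp add: power2_eq_square)
  moreover have "sDD i x = ((inner i (x(i := x i + 2 * \<delta>)) - inner i (x(i := x i + \<delta>))) - (inner i (x(i := x i + \<delta>)) - inner i x)) / \<delta>\<^sup>2"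
    unfolding sDD_def diff_divide_distrib[symmetric] power2_eq_square by simp
  ultimately show ?thesis by (simp add: abs_divide)
qed

lemma smooth_pd:
  assumes "i < n" "x \<in> Rn n"
  shows "pd i (smooth n \<delta> f) x = sD i x" "has_pd i (smooth n \<delta> f) x"
  using pd_eqI[OF smooth_D[OF assms]] by auto

lemma smooth_C1f: "C1f n (smooth n \<delta> f)"
  unfolding C1f_def
proof (intro allI impI conjI ballI)
  fix i assume i: "i < n"
  show "has_pd i (smooth n \<delta> f) x" if "x \<in> Rn n" for x using smooth_pd(2)[OF i that] .
  show "continuous_on (Rn n) (pd i (smooth n \<delta> f))"
    using lipK_continuous[OF sD_lip[OF i]] smooth_pd(1)[OF i] by (simp cong: continuous_on_cong)
qed

text \<open>Mean value theorem combined with the Lipschitz constant \<open>2 * K / \<delta>\<close>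
  of the first derivatives. Its growth for small \<open>\<delta>\<close> is harmless, since the step
  \<open>r\<close> will tend to 0 while \<open>\<delta>\<close> is fixed.\<close>

lemma smooth_taylor1:
  assumes x: "x \<in> Rn n" and r: "0 \<le> r"
  shows "\<bar>smooth n \<delta> f (mv n x r b) - smooth n \<delta> f x - r * (\<Sum>i<n. sD i x * b i)\<bar> \<le> (2 * K / \<delta>) * n * (vnorm n b)\<^sup>2 * r\<^sup>2"
proof -
  let ?y = "mv n x r b"
  obtain \<theta> where t: "0 < \<theta>" "\<theta> < 1"
    "smooth n \<delta> f ?y - smooth n \<delta> f x = (\<Sum>i<n. pd i (smooth n \<delta> f) (mv n x \<theta> (\<lambda>i. ?y i - x i)) * (?y i - x i))"
    by (rule C1f_mvt[OF smooth_C1f x mv_Rn[of n x r b]])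
  define z where "z = mv n x \<theta> (\<lambda>i. ?y i - x i)"
  have z: "z \<in> Rn n" by (simp add: z_def)
  have zx: "vdist n z x \<le> r * vnorm n b"
  proof -
    have "vdist n z x = \<theta> * (r * vnorm n b)" unfolding z_def vdist_mv using t vdist_mv[of n x r b] r by (simp add: vdist_def)
    also have "\<dots> \<le> 1 * (r * vnorm n b)" using t r by (intro mult_right_mono) auto
    finally show ?thesis by simp
  qed
  have *: "(\<Sum>i<n. pd i (smooth n \<delta> f) (mv n x \<theta> (\<lambda>i. ?y i - x i)) * (?y i - x i)) = (\<Sum>i<n. sD i z * (r * b i))"
    unfolding z_def[symmetric] by (rule sum.cong) (use z in \<open>auto simp: smooth_pd(1)\<close>)
  have "smooth n \<delta> f ?y - smooth n \<delta> f x - r * (\<Sum>i<n. sD i x * b i) = (\<Sum>i<n. (sD i z - sD i x) * (r * b i))"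
  proof -
    have "r * (\<Sum>i<n. sD i x * b i) = (\<Sum>i<n. sD i x * (r * b i))" by (simp add: sum_distrib_left mult_ac)
    moreover have "(\<Sum>i<n. (sD i z - sD i x) * (r * b i)) = (\<Sum>i<n. sD i z * (r * b i)) - (\<Sum>i<n. sD i x * (r * b i))"
      by (simp only: left_diff_distrib sum_subtractf)
    ultimately show ?thesis using t(3) * by linarith
  qed
  also have "\<bar>\<dots>\<bar> \<le> (\<Sum>i<n. (2 * K / \<delta> * (r * vnorm n b)) * (r * vnorm n b))"
  proof (rule order_trans[OF sum_abs], rule sum_mono)
    fix i assume "i \<in> {..<n}"
    then have i: "i < n" by simp
    have "\<bar>sD i z - sD i x\<bar> \<le> 2 * K / \<delta> * vdist n z x" by (rule lipKD[OF sD_lip[OF i] z x])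
    also have "\<dots> \<le> 2 * K / \<delta> * (r * vnorm n b)" using zx K d by (intro mult_left_mono) auto
    finally have 1: "\<bar>sD i z - sD i x\<bar> \<le> 2 * K / \<delta> * (r * vnorm n b)" .
    have 2: "\<bar>r * b i\<bar> \<le> r * vnorm n b" using vnorm_comp[OF i, of b] r by (simp add: abs_mult mult_left_mono)
    have "\<bar>(sD i z - sD i x) * (r * b i)\<bar> = \<bar>sD i z - sD i x\<bar> * \<bar>r * b i\<bar>" by (rule abs_mult)
    also have "\<dots> \<le> (2 * K / \<delta> * (r * vnorm n b)) * (r * vnorm n b)"
      by (rule mult_mono[OF 1 2]) (use K d r in simp_all)
    finally show "\<bar>(sD i z - sD i x) * (r * b i)\<bar> \<le> (2 * K / \<delta> * (r * vnorm n b)) * (r * vnorm n b)" .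
  qed
  also have "\<dots> = (2 * K / \<delta>) * n * (vnorm n b)\<^sup>2 * r\<^sup>2" by (simp add: power2_eq_square)
  finally show ?thesis .
qed

text \<open>The error is of third order, so it still vanishes with \<open>h\<close> after division
  by \<open>h^2\<close>. The symmetric combination \<open>k\<close> and its derivative
  \<open>k1\<close> vanish at 0, and the Lipschitz bound on \<open>sDD\<close> makes
  \<open>k2\<close> of order \<open>h\<close>.\<close>

lemma smooth_taylor2:
  assumes x: "x \<in> Rn n" and i: "i < n" and h: "0 < h"
  shows "\<bar>smooth n \<delta> f (x(i := x i + h)) + smooth n \<delta> f (x(i := x i - h)) - 2 * smooth n \<delta> f x - h\<^sup>2 * sDD i x\<bar>
    \<le> (8 * K / \<delta>\<^sup>2) * h ^ 3"
proof -
  define M where "M = 4 * K / \<delta>\<^sup>2"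
  have M0: "0 \<le> M" using K by (simp add: M_def)
  define g where "g s = smooth n \<delta> f (x(i := x i + s))" for s
  define g1 where "g1 s = sD i (x(i := x i + s))" for s
  define g2 where "g2 s = sDD i (x(i := x i + s))" for s
  have xs: "x(i := c) \<in> Rn n" for c using x i by simp
  have dg: "(g has_real_derivative g1 s) (at s)" for s
  proof -
    have "((\<lambda>r. smooth n \<delta> f (x(i := r))) has_real_derivative g1 s) (at (x i + s))"
      using smooth_D[OF i xs[of "x i + s"]] by (simp add: g1_def)
    moreover have "((\<lambda>s. x i + s) has_real_derivative 1) (at s)" by (auto intro!: derivative_eq_intros)
    ultimately show ?thesis
      unfolding g_def using DERIV_chain2[where g = "\<lambda>s. x i + s" and x = s and Db = 1 and s = UNIV] by fastforce
  qed
  have dg1: "(g1 has_real_derivative g2 s) (at s)" for s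
  proof -
    have "((\<lambda>r. sD i (x(i := r))) has_real_derivative g2 s) (at (x i + s))"
      using smooth_DD[OF i xs[of "x i + s"]] by (simp add: g2_def)
    moreover have "((\<lambda>s. x i + s) has_real_derivative 1) (at s)" by (auto intro!: derivative_eq_intros)
    ultimately show ?thesis
      unfolding g1_def using DERIV_chain2[where g = "\<lambda>s. x i + s" and x = s and Db = 1 and s = UNIV] by fastforce
  qed
  have lg2: "\<bar>g2 s - g2 0\<bar> \<le> M * \<bar>s\<bar>" for s
    using lipKD[OF sDD_lip[OF i] xs[of "x i + s"] xs[of "x i + 0"]] i by (simp only: vdist_upd) (simp add: g2_def M_def)
  define k where "k s = g s + g (- s) - 2 * g 0 - s\<^sup>2 * g2 0" for s
  define k1 where "k1 s = g1 s - g1 (- s) - 2 * s * g2 0" for s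
  define k2 where "k2 s = g2 s + g2 (- s) - 2 * g2 0" for s
  have dgm: "((\<lambda>s. g (- s)) has_real_derivative - g1 (- s)) (at s)" for s
  proof -
    have "(uminus has_real_derivative - 1) (at s)" by (auto intro!: derivative_eq_intros)
    from DERIV_chain2[where g = uminus and x = s and s = UNIV, OF dg this] show ?thesis by simp
  qed
  have dgm1: "((\<lambda>s. g1 (- s)) has_real_derivative - g2 (- s)) (at s)" for s
  proof -
    have "(uminus has_real_derivative - 1) (at s)" by (auto intro!: derivative_eq_intros)
    from DERIV_chain2[where g = uminus and x = s and s = UNIV, OF dg1 this] show ?thesis by simp
  qed
  have dk: "(k has_real_derivative k1 s) (at s)" for s
    unfolding k_def k1_def by (auto intro!: derivative_eq_intros dg dgm)
  have dk1: "(k1 has_real_derivative k2 s) (at s)" for s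
    unfolding k1_def k2_def by (auto intro!: derivative_eq_intros dg1 dgm1)
  have k2b: "\<bar>k2 s\<bar> \<le> 2 * M * h" if "0 \<le> s" "s \<le> h" for s
  proof -
    have "M * \<bar>s\<bar> \<le> M * h" using that M0 by (intro mult_left_mono) auto
    then show ?thesis using lg2[of s] lg2[of "- s"] unfolding k2_def by simp
  qed
  have k1b: "\<bar>k1 s\<bar> \<le> 2 * M * h * h" if s: "0 < s" "s \<le> h" for s
  proof -
    obtain c where c: "0 < c" "c < s" "k1 s - k1 0 = (s - 0) * k2 c" using MVT2[OF s(1), of k1 k2] dk1 by auto
    have "\<bar>k1 s\<bar> = s * \<bar>k2 c\<bar>" using c(3) s by (simp add: k1_def abs_mult)
    also have "\<dots> \<le> h * (2 * M * h)" using s c M0 h k2b[of c] by (intro mult_mono) auto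
    finally show ?thesis by (simp add: mult_ac)
  qed
  obtain c where c: "0 < c" "c < h" "k h - k 0 = (h - 0) * k1 c" using MVT2[OF h, of k k1] dk by auto
  have "\<bar>k h\<bar> = h * \<bar>k1 c\<bar>" using c(3) h by (simp add: k_def abs_mult)
  also have "\<dots> \<le> h * (2 * M * h * h)" using h c k1b[of c] by (intro mult_left_mono) auto
  finally show ?thesis by (simp add: k_def g_def g2_def M_def power3_eq_cube mult_ac)
qed

end

section \<open>Kantorovich duality\<close>

lemma vdist_integrable: "\<mu> \<in> P1 n \<Longrightarrow> a \<in> Rn n \<Longrightarrow> integrable \<mu> (\<lambda>x. vdist n x a)"
proof (rule P1_lip_integrable[where C = 1])
  fix x y show "\<bar>vdist n x a - vdist n y a\<bar> \<le> 1 * vdist n x y"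
    using vdist_triangle[of n x a y] vdist_triangle[of n y a x] vdist_commute[of n x y] by linarith
qed

lemma tail_moment:
  assumes \<mu>: "\<mu> \<in> P1 n" and e: "0 < \<eta>"
  obtains R where "0 \<le> R" "(\<integral>x. vnorm n x * indicator {x. R < vnorm n x} x \<partial>\<mu>) \<le> \<eta>"
    "integrable \<mu> (\<lambda>x. vnorm n x * indicator {x. R < vnorm n x} x)"
proof -
  have mv: "vnorm n \<in> borel_measurable \<mu>" unfolding P1D(5)[OF \<mu>] by (rule vnorm_measurable)
  have ms: "(\<lambda>x. vnorm n x * indicator {x. real m < vnorm n x} x) \<in> borel_measurable \<mu>" for m
  proof -
    have "(\<lambda>x. vnorm n x * indicator {x. real m < vnorm n x} x) = (\<lambda>x. if real m < vnorm n x then vnorm n x else 0)"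
      by (auto simp: indicator_def)
    then show ?thesis using mv by simp
  qed
  have "(\<lambda>m::nat. \<integral>x. vnorm n x * indicator {x. real m < vnorm n x} x \<partial>\<mu>) \<longlonglongrightarrow> (\<integral>x. 0 \<partial>\<mu>)"
  proof (rule integral_dominated_convergence[where w = "vnorm n"])
    show "integrable \<mu> (vnorm n)" by (rule P1_vnorm_integrable[OF \<mu>])
    show "AE x in \<mu>. (\<lambda>m. vnorm n x * indicator {x. real m < vnorm n x} x) \<longlonglongrightarrow> 0"
    proof (rule AE_I2)
      fix x
      obtain m0 :: nat where m0: "vnorm n x \<le> real m0" using real_arch_simple by blast
      show "(\<lambda>m. vnorm n x * indicator {x. real m < vnorm n x} x) \<longlonglongrightarrow> 0"
        by (rule tendsto_eventually) (use m0 in \<open>auto simp: eventually_sequentially indicator_def intro!: exI[of _ m0]\<close>)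
    qed
  qed (use ms in \<open>auto simp: indicator_def\<close>)
  then have "\<forall>\<^sub>F m in sequentially. (\<integral>x. vnorm n x * indicator {x. real m < vnorm n x} x \<partial>\<mu>) < \<eta>"
    using e by (auto dest: order_tendstoD(2))
  then obtain m where m: "(\<integral>x. vnorm n x * indicator {x. real m < vnorm n x} x \<partial>\<mu>) < \<eta>"
    by (auto simp: eventually_sequentially)
  have "integrable \<mu> (\<lambda>x. vnorm n x * indicator {x. real m < vnorm n x} x)"
    by (rule Bochner_Integration.integrable_bound[OF P1_vnorm_integrable[OF \<mu>] ms]) (auto simp: indicator_def)
  then show ?thesis using that[of "real m"] m by simp
qed

text \<open>The cells are level sets of a rounding: points of norm at most \<open>R\<close> go to a
  grid of mesh \<open>s\<close>, all others to the origin. The near part costs at most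
  \<open>n * s\<close>, the far part is a tail of the first moment, and each is at most half of
  \<open>\<eta>\<close>.\<close>

lemma partition:
  assumes \<mu>: "\<mu> \<in> P1 n" and e: "0 < \<eta>"
  obtains k :: nat and X a where "\<And>i. i < k \<Longrightarrow> X i \<in> sets \<mu>" "disjoint_family_on X {..<k}"
    "\<And>i. i < k \<Longrightarrow> 0 < measure \<mu> (X i)" "(\<Sum>i<k. measure \<mu> (X i)) = 1" "\<And>i. a i \<in> Rn n"
    "(\<Sum>i<k. \<integral>x. vdist n x (a i) * indicator (X i) x \<partial>\<mu>) \<le> \<eta>"
proof -
  interpret prob_space \<mu> using P1D[OF \<mu>] by simp
  obtain R where R: "0 \<le> R" "(\<integral>x. vnorm n x * indicator {x. R < vnorm n x} x \<partial>\<mu>) \<le> \<eta> / 2"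
    "integrable \<mu> (\<lambda>x. vnorm n x * indicator {x. R < vnorm n x} x)"
    using tail_moment[OF \<mu>, of "\<eta> / 2"] e by auto
  define s where "s = \<eta> / (2 * (real n + 1))"
  have s: "0 < s" "real n * s \<le> \<eta> / 2" using e by (auto simp: s_def field_simps)
  define o' where "o' = (\<lambda>i\<in>{..<n}. 0::real)"
  define T where "T x = (if vnorm n x \<le> R then (\<lambda>i\<in>{..<n}. s * real_of_int \<lfloor>x i / s\<rfloor>) else o')" for x
  have TR: "T x \<in> Rn n" for x by (simp add: T_def o'_def Rn_def)
  have dT: "vdist n x (T x) \<le> real n * s + vnorm n x * indicator {x. R < vnorm n x} x" for x
  proof (cases "vnorm n x \<le> R")
    case True
    have "vdist n x (T x) \<le> real n * s" unfolding vdist_def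
    proof (rule vnorm_le_const)
      fix i assume i: "i < n"
      have "\<bar>x i / s - real_of_int \<lfloor>x i / s\<rfloor>\<bar> \<le> 1" by linarith
      then have "s * \<bar>x i / s - real_of_int \<lfloor>x i / s\<rfloor>\<bar> \<le> s * 1" using s by (intro mult_left_mono) auto
      moreover have "\<bar>x i - T x i\<bar> = s * \<bar>x i / s - real_of_int \<lfloor>x i / s\<rfloor>\<bar>"
      proof -
        have "x i - T x i = s * (x i / s - real_of_int \<lfloor>x i / s\<rfloor>)"
          using i True s by (simp add: T_def right_diff_distrib)
        then show ?thesis using s by (simp only: abs_mult)
      qed
      ultimately show "\<bar>x i - T x i\<bar> \<le> s" by simp
    qed
    moreover have "indicator {x. R < vnorm n x} x = (0::real)" using True by (simp add: indicator_def)
    ultimately show ?thesis by simp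
  next
    case False
    have "vdist n x (T x) = vnorm n x" unfolding vdist_def using False by (intro vnorm_cong) (simp add: T_def o'_def)
    moreover have "indicator {x. R < vnorm n x} x = (1::real)" using False by (simp add: indicator_def)
    ultimately show ?thesis using s by simp
  qed
  have finT: "finite (T ` Rn n)"
  proof (rule finite_subset)
    define K where "K = \<lceil>R / s\<rceil> + 1"
    show "T ` Rn n \<subseteq> insert o' ((\<lambda>f. \<lambda>i\<in>{..<n}. s * real_of_int (f i)) ` PiE {..<n} (\<lambda>_. {- K..K}))"
    proof
      fix a assume "a \<in> T ` Rn n"
      then obtain x where x: "a = T x" by auto
      show "a \<in> insert o' ((\<lambda>f. \<lambda>i\<in>{..<n}. s * real_of_int (f i)) ` PiE {..<n} (\<lambda>_. {- K..K}))"
      proof (cases "vnorm n x \<le> R")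
        case True
        have "(\<lambda>i\<in>{..<n}. \<lfloor>x i / s\<rfloor>) \<in> PiE {..<n} (\<lambda>_. {- K..K})"
        proof (rule restrict_PiE_iff[THEN iffD2], intro ballI)
          fix i assume "i \<in> {..<n}"
          then have "\<bar>x i\<bar> \<le> R" using vnorm_comp[of i n x] True by simp
          then have "\<bar>x i / s\<bar> \<le> R / s" using s by (simp add: divide_right_mono abs_divide)
          then show "\<lfloor>x i / s\<rfloor> \<in> {- K..K}" unfolding K_def abs_le_iff atLeastAtMost_iff by linarith
        qed
        moreover have "a = (\<lambda>i\<in>{..<n}. s * real_of_int ((\<lambda>i\<in>{..<n}. \<lfloor>x i / s\<rfloor>) i))"
          using True by (auto simp: x T_def)
        ultimately show ?thesis by blast
      qed (simp add: x T_def)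
    qed
    show "finite (insert o' ((\<lambda>f. \<lambda>i\<in>{..<n}. s * real_of_int (f i)) ` PiE {..<n} (\<lambda>_. {- K..K})))"
      by (intro finite.insertI finite_imageI finite_PiE) auto
  qed
  define F where "F a = {x \<in> Rn n. T x = a}" for a
  have Fm: "F a \<in> sets \<mu>" if a: "a \<in> Rn n" for a
  proof -
    have "F a = {x \<in> space (Leb n). \<forall>i\<in>{..<n}. T x i = a i}"
      unfolding F_def space_Leb using Rn_eqI[OF TR a] by auto
    also have "\<dots> \<in> sets (Leb n)"
    proof (rule sets.sets_Collect_finite_All)
      fix i assume i: "i \<in> {..<n}"
      have m: "(\<lambda>x. x i) \<in> borel_measurable (Leb n)" using i by (simp add: Leb_coord)
      have "(\<lambda>x. real_of_int \<lfloor>x i / s\<rfloor>) \<in> borel_measurable (Leb n)"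
        by (rule measurable_compose[OF borel_measurable_divide[OF m borel_measurable_const] borel_measurable_real_floor])
      then have "(\<lambda>x. if vnorm n x \<le> R then s * real_of_int \<lfloor>x i / s\<rfloor> else 0) \<in> borel_measurable (Leb n)"
        by (intro measurable_If borel_measurable_times borel_measurable_const borel_measurable_le vnorm_measurable)
      moreover have "(\<lambda>x. T x i) = (\<lambda>x. if vnorm n x \<le> R then s * real_of_int \<lfloor>x i / s\<rfloor> else 0)"
        using i by (auto simp: T_def o'_def)
      ultimately have "(\<lambda>x. T x i) \<in> borel_measurable (Leb n)" by (simp only:)
      then show "{x \<in> space (Leb n). T x i = a i} \<in> sets (Leb n)"
        by (rule borel_measurable_eq) (rule borel_measurable_const)
    qed simp
    finally show ?thesis using P1D(2)[OF \<mu>] by simp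
  qed
  \<comment> \<open>Null cells are dropped because the finite transport problem asks for positive
    weights.\<close>
  define I where "I = {a \<in> T ` Rn n. 0 < measure \<mu> (F a)}"
  have finI: "finite I" using finT by (simp add: I_def)
  obtain h where h: "bij_betw h {..<card I} I"
    using ex_bij_betw_nat_finite[OF finI] by (auto simp: lessThan_atLeast0)
  define k where "k = card I"
  have hI: "h i \<in> I" if "i < k" for i using bij_betwE[OF h] that by (auto simp: k_def)
  have IR: "a \<in> Rn n" if "a \<in> I" for a using that TR by (auto simp: I_def)
  define a where "a i = (if i < k then h i else o')" for i
  show ?thesis
  proof (rule that[of k "\<lambda>i. F (h i)" a])
    show "F (h i) \<in> sets \<mu>" if "i < k" for i by (rule Fm[OF IR[OF hI[OF that]]])
    show "disjoint_family_on (\<lambda>i. F (h i)) {..<k}"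
      using bij_betw_imp_inj_on[OF h] by (auto simp: disjoint_family_on_def F_def k_def inj_on_def)
    show "0 < measure \<mu> (F (h i))" if "i < k" for i using hI[OF that] by (simp add: I_def)
    show "a i \<in> Rn n" for i using hI IR by (auto simp: a_def o'_def Rn_def[of n])
    have "(\<Sum>i<k. measure \<mu> (F (h i))) = (\<Sum>a\<in>I. measure \<mu> (F a))"
      unfolding k_def by (rule sum.reindex_bij_betw[OF h])
    also have "\<dots> = (\<Sum>a\<in>T ` Rn n. measure \<mu> (F a))"
      by (rule sum.mono_neutral_left[OF finT]) (auto simp: I_def zero_less_measure_iff)
    also have "\<dots> = measure \<mu> (\<Union>a\<in>T ` Rn n. F a)"
      by (rule finite_measure_finite_Union[symmetric, OF finT]) (use Fm TR in \<open>auto simp: disjoint_family_on_def F_def\<close>)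
    also have "(\<Union>a\<in>T ` Rn n. F a) = space \<mu>" using P1D(4)[OF \<mu>] by (auto simp: F_def)
    finally show "(\<Sum>i<k. measure \<mu> (F (h i))) = 1" by (simp add: prob_space)
    have int1: "integrable \<mu> (\<lambda>x. vdist n x (a i) * indicator (F (h i)) x)" if "i < k" for i
      by (rule integrable_real_mult_indicator[OF Fm[OF IR[OF hI[OF that]]]])
         (use hI[OF that] IR that vdist_integrable[OF \<mu>] in \<open>auto simp: a_def\<close>)
    have "(\<Sum>i<k. \<integral>x. vdist n x (a i) * indicator (F (h i)) x \<partial>\<mu>) = (\<integral>x. (\<Sum>i<k. vdist n x (a i) * indicator (F (h i)) x) \<partial>\<mu>)"
      using int1 by (intro Bochner_Integration.integral_sum[symmetric]) auto
    also have "\<dots> \<le> (\<integral>x. real n * s + vnorm n x * indicator {x. R < vnorm n x} x \<partial>\<mu>)"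
    proof (rule integral_mono)
      show "integrable \<mu> (\<lambda>x. \<Sum>i<k. vdist n x (a i) * indicator (F (h i)) x)"
        using int1 by (intro Bochner_Integration.integrable_sum) auto
      show "integrable \<mu> (\<lambda>x. real n * s + vnorm n x * indicator {x. R < vnorm n x} x)" using R(3) by simp
      fix x
      have "(\<Sum>i<k. vdist n x (a i) * indicator (F (h i)) x) = (\<Sum>i<k. vdist n x (h i) * indicator (F (h i)) x)"
        by (rule sum.cong) (auto simp: a_def)
      also have "\<dots> = (\<Sum>a\<in>I. vdist n x a * indicator (F a) x)"
        unfolding k_def by (rule sum.reindex_bij_betw[OF h])
      also have "\<dots> \<le> (\<Sum>a\<in>I. if a = T x then vdist n x (T x) else 0)"
        by (rule sum_mono) (auto simp: F_def indicator_def)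
      also have "\<dots> \<le> vdist n x (T x)" using finI by simp
      also have "\<dots> \<le> real n * s + vnorm n x * indicator {x. R < vnorm n x} x" by (rule dT)
      finally show "(\<Sum>i<k. vdist n x (a i) * indicator (F (h i)) x) \<le> real n * s + vnorm n x * indicator {x. R < vnorm n x} x" .
    qed
    also have "\<dots> = real n * s + (\<integral>x. vnorm n x * indicator {x. R < vnorm n x} x \<partial>\<mu>)" using R(3) by (simp add: prob_space)
    also have "\<dots> \<le> \<eta>" using s R(2) by simp
    finally show "(\<Sum>i<k. \<integral>x. vdist n x (a i) * indicator (F (h i)) x \<partial>\<mu>) \<le> \<eta>" .
  qed
qed

lemma cell_approximation:
  assumes \<mu>: "\<mu> \<in> P1 n" and X: "\<And>i. i < (k::nat) \<Longrightarrow> X i \<in> sets \<mu>" "disjoint_family_on X {..<k}" "(\<Sum>i<k. measure \<mu> (X i)) = 1"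
    and a: "\<And>i. a i \<in> Rn n" and f: "lip1 n \<Phi>"
  shows "\<bar>(\<Sum>i<k. measure \<mu> (X i) * \<Phi> (a i)) - (\<integral>x. \<Phi> x \<partial>\<mu>)\<bar> \<le> (\<Sum>i<k. \<integral>x. vdist n x (a i) * indicator (X i) x \<partial>\<mu>)"
proof -
  interpret prob_space \<mu> using P1D[OF \<mu>] by simp
  have fi: "integrable \<mu> \<Phi>" by (rule P1_lip_integrable[OF \<mu>, where C = 1]) (use f in \<open>auto simp: lip1_def\<close>)
  have "measure \<mu> (\<Union>i<k. X i) = 1" using X by (subst finite_measure_finite_Union) auto
  then have ae: "AE x in \<mu>. x \<in> (\<Union>i<k. X i)" using X by (subst AE_in_set_eq_1) auto
  have i1: "integrable \<mu> (\<lambda>x. \<Phi> x * indicator (X i) x)" if "i < k" for i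
    by (rule integrable_real_mult_indicator[OF X(1)[OF that] fi])
  have i2: "integrable \<mu> (\<lambda>x. \<Phi> (a i) * indicator (X i) x)" if "i < k" for i
    by (rule integrable_real_mult_indicator[OF X(1)[OF that]]) simp
  have i3: "integrable \<mu> (\<lambda>x. vdist n x (a i) * indicator (X i) x)" if "i < k" for i
    by (rule integrable_real_mult_indicator[OF X(1)[OF that] vdist_integrable[OF \<mu> a]])
  have "(\<integral>x. \<Phi> x \<partial>\<mu>) = (\<integral>x. (\<Sum>i<k. \<Phi> x * indicator (X i) x) \<partial>\<mu>)"
  proof (rule integral_cong_AE)
    show "AE x in \<mu>. \<Phi> x = (\<Sum>i<k. \<Phi> x * indicator (X i) x)" using ae
    proof eventually_elim
      case (elim x)
      then obtain i where i: "i < k" "x \<in> X i" by auto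
      have "(\<Sum>i'<k. \<Phi> x * indicator (X i') x) = (\<Sum>i'<k. if i' = i then \<Phi> x else 0)"
        using X(2) i by (intro sum.cong refl) (auto simp: disjoint_family_on_def indicator_def)
      then show ?case using i by simp
    qed
    show "(\<lambda>x. \<Sum>i<k. \<Phi> x * indicator (X i) x) \<in> borel_measurable \<mu>"
      by (intro borel_measurable_sum borel_measurable_integrable i1) auto
  qed (rule borel_measurable_integrable[OF fi])
  also have "\<dots> = (\<Sum>i<k. \<integral>x. \<Phi> x * indicator (X i) x \<partial>\<mu>)" using i1 by (intro Bochner_Integration.integral_sum) auto
  finally have A: "(\<integral>x. \<Phi> x \<partial>\<mu>) = (\<Sum>i<k. \<integral>x. \<Phi> x * indicator (X i) x \<partial>\<mu>)" .
  have B: "(\<Sum>i<k. measure \<mu> (X i) * \<Phi> (a i)) = (\<Sum>i<k. \<integral>x. \<Phi> (a i) * indicator (X i) x \<partial>\<mu>)"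
    by (rule sum.cong) (use X(1) in \<open>auto simp: mult.commute\<close>)
  have "\<bar>(\<Sum>i<k. measure \<mu> (X i) * \<Phi> (a i)) - (\<integral>x. \<Phi> x \<partial>\<mu>)\<bar> = \<bar>\<Sum>i<k. (\<integral>x. \<Phi> (a i) * indicator (X i) x \<partial>\<mu>) - (\<integral>x. \<Phi> x * indicator (X i) x \<partial>\<mu>)\<bar>"
    unfolding A B by (simp add: sum_subtractf)
  also have "\<dots> \<le> (\<Sum>i<k. \<bar>(\<integral>x. \<Phi> (a i) * indicator (X i) x \<partial>\<mu>) - (\<integral>x. \<Phi> x * indicator (X i) x \<partial>\<mu>)\<bar>)" by (rule sum_abs)
  also have "\<dots> \<le> (\<Sum>i<k. \<integral>x. vdist n x (a i) * indicator (X i) x \<partial>\<mu>)"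
  proof (rule sum_mono)
    fix i assume "i \<in> {..<k}"
    then have i: "i < k" by simp
    have "\<bar>(\<integral>x. \<Phi> (a i) * indicator (X i) x \<partial>\<mu>) - (\<integral>x. \<Phi> x * indicator (X i) x \<partial>\<mu>)\<bar> = \<bar>\<integral>x. \<Phi> (a i) * indicator (X i) x - \<Phi> x * indicator (X i) x \<partial>\<mu>\<bar>"
      using i1[OF i] i2[OF i] by simp
    also have "\<dots> \<le> (\<integral>x. \<bar>\<Phi> (a i) * indicator (X i) x - \<Phi> x * indicator (X i) x\<bar> \<partial>\<mu>)" by (rule integral_abs_bound)
    also have "\<dots> \<le> (\<integral>x. vdist n x (a i) * indicator (X i) x \<partial>\<mu>)"
    proof (rule integral_mono)
      show "integrable \<mu> (\<lambda>x. \<bar>\<Phi> (a i) * indicator (X i) x - \<Phi> x * indicator (X i) x\<bar>)" using i1[OF i] i2[OF i] by simp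
      fix x assume "x \<in> space \<mu>"
      then have "\<bar>\<Phi> (a i) - \<Phi> x\<bar> \<le> vdist n x (a i)"
        using f a[of i] P1D(4)[OF \<mu>] vdist_commute[of n x "a i"] by (auto simp: lip1_def)
      then show "\<bar>\<Phi> (a i) * indicator (X i) x - \<Phi> x * indicator (X i) x\<bar> \<le> vdist n x (a i) * indicator (X i) x"
        by (auto simp: indicator_def)
    qed (rule i3[OF i])
    finally show "\<bar>(\<integral>x. \<Phi> (a i) * indicator (X i) x \<partial>\<mu>) - (\<integral>x. \<Phi> x * indicator (X i) x \<partial>\<mu>)\<bar> \<le> (\<integral>x. vdist n x (a i) * indicator (X i) x \<partial>\<mu>)" .
  qed
  finally show ?thesis .
qed

lemma clamp_lip:
  fixes a a' c c' d :: real
  assumes "\<bar>a - a'\<bar> \<le> d" "\<bar>c - c'\<bar> \<le> d"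
  shows "\<bar>max (min a c) (- c) - max (min a' c') (- c')\<bar> \<le> d"
  using assms by (auto simp: max_def min_def abs_le_iff)

text \<open>Truncation by a cone: \<open>c m\<close> has slope 1 and vanishes outside radius
  \<open>m\<close>, and clamping between \<open>- c m\<close> and \<open>c m\<close> keeps the
  Lipschitz constant 1. Normalising to the value 0 at the origin provides the dominating function
  \<open>|x|\<close>, and the truncation is exact once \<open>m \<ge> 2 * |x|\<close>.\<close>

lemma lip1_dual_bound:
  assumes \<mu>: "\<mu> \<in> P1 n" and \<nu>: "\<nu> \<in> P1 n" and f: "lip1 n \<Phi>"
    and B: "\<And>\<phi>. lipc n \<phi> \<Longrightarrow> (\<integral>x. \<phi> x \<partial>\<mu>) - (\<integral>x. \<phi> x \<partial>\<nu>) \<le> B"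
  shows "(\<integral>x. \<Phi> x \<partial>\<mu>) - (\<integral>x. \<Phi> x \<partial>\<nu>) \<le> B"
proof -
  interpret M: prob_space \<mu> using P1D[OF \<mu>] by simp
  interpret N: prob_space \<nu> using P1D[OF \<nu>] by simp
  define o' where "o' = (\<lambda>i\<in>{..<n}. 0::real)"
  have o: "o' \<in> Rn n" "\<And>x. vdist n x o' = vnorm n x"
    unfolding vdist_def by (auto simp: o'_def Rn_def intro!: vnorm_cong)
  define c where "c m x = max 0 (real m - vnorm n x)" for m :: nat and x
  define \<Psi> where "\<Psi> x = \<Phi> x - \<Phi> o'" for x
  define \<phi> where "\<phi> m x = max (min (\<Psi> x) (c m x)) (- c m x)" for m x
  have Pl: "\<bar>\<Psi> x - \<Psi> y\<bar> \<le> vdist n x y" if "x \<in> Rn n" "y \<in> Rn n" for x y using f that by (simp add: \<Psi>_def lip1_def)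
  have Pb: "\<bar>\<Psi> x\<bar> \<le> vnorm n x" if "x \<in> Rn n" for x using Pl[OF that o(1)] o(2) by (simp add: \<Psi>_def)
  have cl: "\<bar>c m x - c m y\<bar> \<le> vdist n x y" for m x y using vnorm_dist[of n x y] by (auto simp: c_def max_def)
  have phl: "\<bar>\<phi> m x - \<phi> m y\<bar> \<le> 1 * vdist n x y" if "x \<in> Rn n" "y \<in> Rn n" for m x y
    unfolding \<phi>_def using clamp_lip[OF Pl[OF that] cl] by simp
  have phc: "lipc n (\<phi> m)" for m unfolding lipc_def
  proof (intro conjI exI[of _ "real m"] ballI impI)
    show "lip1 n (\<phi> m)" using phl by (simp add: lip1_def)
    show "\<phi> m x = 0" if "real m \<le> vnorm n x" for x using that by (simp add: \<phi>_def c_def)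
  qed
  have lim: "(\<lambda>m. \<integral>x. \<phi> m x \<partial>\<kappa>) \<longlonglongrightarrow> (\<integral>x. \<Psi> x \<partial>\<kappa>)" if \<kappa>: "\<kappa> \<in> P1 n" for \<kappa>
  proof (rule integral_dominated_convergence[where w = "vnorm n"])
    show "\<Psi> \<in> borel_measurable \<kappa>"
      by (rule borel_measurable_integrable[OF P1_lip_integrable[OF \<kappa>, where C = 1]]) (use Pl in simp)
    show "\<phi> m \<in> borel_measurable \<kappa>" for m
      by (rule borel_measurable_integrable[OF P1_lip_integrable[OF \<kappa> phl]])
    show "integrable \<kappa> (vnorm n)" by (rule P1_vnorm_integrable[OF \<kappa>])
    show "AE x in \<kappa>. norm (\<phi> m x) \<le> vnorm n x" for m
    proof (rule AE_I2)
      fix x assume "x \<in> space \<kappa>"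
      then have "\<bar>\<Psi> x\<bar> \<le> vnorm n x" using Pb P1D(4)[OF \<kappa>] by simp
      then show "norm (\<phi> m x) \<le> vnorm n x" by (auto simp: \<phi>_def c_def max_def min_def)
    qed
    show "AE x in \<kappa>. (\<lambda>m. \<phi> m x) \<longlonglongrightarrow> \<Psi> x"
    proof (rule AE_I2)
      fix x assume "x \<in> space \<kappa>"
      then have b: "\<bar>\<Psi> x\<bar> \<le> vnorm n x" using Pb P1D(4)[OF \<kappa>] by simp
      obtain m0 :: nat where m0: "2 * vnorm n x \<le> real m0" using real_arch_simple by blast
      have "\<phi> m x = \<Psi> x" if "m0 \<le> m" for m
      proof -
        have "\<bar>\<Psi> x\<bar> \<le> c m x" using m0 that b by (simp add: c_def max_def)
        then show ?thesis by (auto simp: \<phi>_def max_def min_def)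
      qed
      then show "(\<lambda>m. \<phi> m x) \<longlonglongrightarrow> \<Psi> x"
        by (intro tendsto_eventually) (auto simp: eventually_sequentially)
    qed
  qed
  have "(\<integral>x. \<Psi> x \<partial>\<mu>) - (\<integral>x. \<Psi> x \<partial>\<nu>) \<le> B"
    by (rule LIMSEQ_le_const2[OF tendsto_diff[OF lim[OF \<mu>] lim[OF \<nu>]]]) (use B[OF phc] in auto)
  moreover have "integrable \<mu> \<Phi>" "integrable \<nu> \<Phi>"
    using P1_lip_integrable[OF \<mu>, of \<Phi> 1] P1_lip_integrable[OF \<nu>, of \<Phi> 1] f by (auto simp: lip1_def)
  ultimately show ?thesis by (simp add: \<Psi>_def M.prob_space N.prob_space)
qed

text \<open>The hard half of duality. The finite dual potentials are extended by the McShane formula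
  \<open>\<Phi>\<close>, which at the representatives lies above the row potentials and below the
  column potentials, so the finite optimum is controlled by an honest Lipschitz test
  function.\<close>

theorem kantorovich_bound:
  assumes \<mu>: "\<mu> \<in> P1 n" and \<nu>: "\<nu> \<in> P1 n" and B0: "0 \<le> B"
    and B: "\<And>\<phi>. lipc n \<phi> \<Longrightarrow> (\<integral>x. \<phi> x \<partial>\<mu>) - (\<integral>x. \<phi> x \<partial>\<nu>) \<le> B"
  shows "d1 n \<mu> \<nu> \<le> ennreal B"
proof (rule ennreal_le_epsilon)
  fix e :: real assume e: "0 < e"
  \<comment> \<open>Five errors: two discretisations of integrals of \<open>\<Phi>\<close>, the
    entropic term, and two transports between points and the representatives of their cells.\<close>
  define \<eta> where "\<eta> = e / 5"
  have eta: "0 < \<eta>" using e by (simp add: \<eta>_def)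
  obtain k :: nat and X a where X: "\<And>i. i < k \<Longrightarrow> X i \<in> sets \<mu>" "disjoint_family_on X {..<k}"
    "\<And>i. i < k \<Longrightarrow> 0 < measure \<mu> (X i)" "(\<Sum>i<k. measure \<mu> (X i)) = 1" "\<And>i. a i \<in> Rn n"
    "(\<Sum>i<k. \<integral>x. vdist n x (a i) * indicator (X i) x \<partial>\<mu>) \<le> \<eta>"
    using partition[OF \<mu> eta] by blast
  obtain l :: nat and Y b where Y: "\<And>i. i < l \<Longrightarrow> Y i \<in> sets \<nu>" "disjoint_family_on Y {..<l}"
    "\<And>i. i < l \<Longrightarrow> 0 < measure \<nu> (Y i)" "(\<Sum>i<l. measure \<nu> (Y i)) = 1" "\<And>i. b i \<in> Rn n"
    "(\<Sum>i<l. \<integral>x. vdist n x (b i) * indicator (Y i) x \<partial>\<nu>) \<le> \<eta>"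
    using partition[OF \<nu> eta] by blast
  have k0: "0 < k" using X(4) by (cases k) auto
  have l0: "0 < l" using Y(4) by (cases l) auto
  have "0 < \<eta> / (real k * real l)" using eta k0 l0 by simp
  then obtain \<pi> \<phi> \<psi> where \<pi>: "\<And>i j. 0 \<le> \<pi> i j" "\<And>i. i < k \<Longrightarrow> (\<Sum>j<l. \<pi> i j) = measure \<mu> (X i)"
    "\<And>j. j < l \<Longrightarrow> (\<Sum>i<k. \<pi> i j) = measure \<nu> (Y j)"
    "\<And>i j. i < k \<Longrightarrow> j < l \<Longrightarrow> \<phi> i - \<psi> j \<le> vdist n (a i) (b j)"
    "(\<Sum>i<k. \<Sum>j<l. \<pi> i j * vdist n (a i) (b j)) \<le> (\<Sum>i<k. measure \<mu> (X i) * \<phi> i) - (\<Sum>j<l. measure \<nu> (Y j) * \<psi> j)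
       + \<eta> / (real k * real l) * (real k * real l)"
    using finite_transport[of k "\<lambda>i. measure \<mu> (X i)" l "\<lambda>j. measure \<nu> (Y j)" "\<lambda>i j. vdist n (a i) (b j)" "\<eta> / (real k * real l)"]
      X(3,4) Y(3,4) vdist_nonneg by blast
  define \<Phi> where "\<Phi> x = Min ((\<lambda>j. \<psi> j + vdist n x (b j)) ` {..<l})" for x
  have fin: "finite ((\<lambda>j. \<psi> j + vdist n x (b j)) ` {..<l})" "(\<lambda>j. \<psi> j + vdist n x (b j)) ` {..<l} \<noteq> {}" for x
    using l0 by auto
  have PhL: "\<Phi> x \<le> \<Phi> y + vdist n x y" for x y
  proof -
    have "\<Phi> y \<in> (\<lambda>j. \<psi> j + vdist n y (b j)) ` {..<l}" unfolding \<Phi>_def by (rule Min_in[OF fin])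
    then obtain j where j: "j < l" "\<Phi> y = \<psi> j + vdist n y (b j)" by auto
    have "\<Phi> x \<le> \<psi> j + vdist n x (b j)" unfolding \<Phi>_def by (rule Min_le[OF fin(1)]) (use j in auto)
    then show ?thesis using j(2) vdist_triangle[of n x "b j" y] by linarith
  qed
  have lip: "lip1 n \<Phi>" unfolding lip1_def
  proof (intro ballI)
    fix x y show "\<bar>\<Phi> x - \<Phi> y\<bar> \<le> vdist n x y" using PhL[of x y] PhL[of y x] vdist_commute[of n x y] by linarith
  qed
  have a1: "\<phi> i \<le> \<Phi> (a i)" if "i < k" for i
    unfolding \<Phi>_def using fin \<pi>(4)[OF that] by (subst Min_ge_iff) (auto simp: algebra_simps)
  have b1: "\<Phi> (b j) \<le> \<psi> j" if "j < l" for j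
  proof -
    have "\<Phi> (b j) \<le> \<psi> j + vdist n (b j) (b j)" 
      unfolding \<Phi>_def by (rule Min_le[OF fin(1)], rule image_eqI[of _ _ j], rule refl) (use that in simp)
    then show ?thesis by simp
  qed
  have "(\<Sum>i<k. measure \<mu> (X i) * \<phi> i) \<le> (\<Sum>i<k. measure \<mu> (X i) * \<Phi> (a i))"
    by (intro sum_mono mult_left_mono a1) auto
  also have "\<dots> \<le> (\<integral>x. \<Phi> x \<partial>\<mu>) + \<eta>" using cell_approximation[where a = a and X = X and k = k, OF \<mu> X(1,2,4,5) lip] X(6) by linarith
  finally have A: "(\<Sum>i<k. measure \<mu> (X i) * \<phi> i) \<le> (\<integral>x. \<Phi> x \<partial>\<mu>) + \<eta>" .
  have "(\<integral>x. \<Phi> x \<partial>\<nu>) - \<eta> \<le> (\<Sum>j<l. measure \<nu> (Y j) * \<Phi> (b j))" using cell_approximation[where a = b and X = Y and k = l, OF \<nu> Y(1,2,4,5) lip] Y(6) by linarith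
  also have "\<dots> \<le> (\<Sum>j<l. measure \<nu> (Y j) * \<psi> j)" by (intro sum_mono mult_left_mono b1) auto
  finally have A': "(\<integral>x. \<Phi> x \<partial>\<nu>) - \<eta> \<le> (\<Sum>j<l. measure \<nu> (Y j) * \<psi> j)" .
  have "(\<integral>x. \<Phi> x \<partial>\<mu>) - (\<integral>x. \<Phi> x \<partial>\<nu>) \<le> B" by (rule lip1_dual_bound[OF \<mu> \<nu> lip B])
  moreover have "\<eta> / (real k * real l) * (real k * real l) = \<eta>" using k0 l0 by simp
  ultimately have C: "(\<Sum>i<k. \<Sum>j<l. \<pi> i j * vdist n (a i) (b j)) \<le> B + 3 * \<eta>" using A A' \<pi>(5) by linarith
  have conv: "(\<Sum>i<k. \<integral>\<^sup>+x. indicator (X i) x * ennreal (vdist n x (a i)) \<partial>\<mu>) \<le> ennreal \<eta>"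
    if \<mu>: "\<mu> \<in> P1 n" and X: "\<And>i. i < k \<Longrightarrow> X i \<in> sets \<mu>" "\<And>i. a i \<in> Rn n" "(\<Sum>i<k. \<integral>x. vdist n x (a i) * indicator (X i) x \<partial>\<mu>) \<le> \<eta>"
    for \<mu> and k :: nat and X a
  proof -
    have "(\<integral>\<^sup>+x. indicator (X i) x * ennreal (vdist n x (a i)) \<partial>\<mu>) = ennreal (\<integral>x. vdist n x (a i) * indicator (X i) x \<partial>\<mu>)" if "i < k" for i
    proof -
      have "(\<integral>\<^sup>+x. indicator (X i) x * ennreal (vdist n x (a i)) \<partial>\<mu>) = (\<integral>\<^sup>+x. ennreal (vdist n x (a i) * indicator (X i) x) \<partial>\<mu>)"
        by (intro nn_integral_cong) (auto simp: indicator_def)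
      also have "\<dots> = ennreal (\<integral>x. vdist n x (a i) * indicator (X i) x \<partial>\<mu>)"
        by (intro nn_integral_eq_integral integrable_real_mult_indicator X(1)[OF that] vdist_integrable[OF \<mu> X(2)]) auto
      finally show ?thesis .
    qed
    then have "(\<Sum>i<k. \<integral>\<^sup>+x. indicator (X i) x * ennreal (vdist n x (a i)) \<partial>\<mu>) = (\<Sum>i<k. ennreal (\<integral>x. vdist n x (a i) * indicator (X i) x \<partial>\<mu>))"
      by (intro sum.cong) auto
    also have "\<dots> = ennreal (\<Sum>i<k. \<integral>x. vdist n x (a i) * indicator (X i) x \<partial>\<mu>)"
      by (intro sum_ennreal Bochner_Integration.integral_nonneg) auto
    also have "\<dots> \<le> ennreal \<eta>" using X(3) by (rule ennreal_leI)
    finally show ?thesis .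
  qed
  have "d1 n \<mu> \<nu> \<le> (\<Sum>i<k. \<integral>\<^sup>+x. indicator (X i) x * ennreal (vdist n x (a i)) \<partial>\<mu>)
    + ennreal (\<Sum>i<k. \<Sum>j<l. \<pi> i j * vdist n (a i) (b j))
    + (\<Sum>j<l. \<integral>\<^sup>+y. indicator (Y j) y * ennreal (vdist n y (b j)) \<partial>\<nu>)"
    by (rule gluing[OF \<mu> \<nu> X(1,2,3,4) Y(1,2,3,4) \<pi>(1,2,3) X(5) Y(5)])
  also have "\<dots> \<le> ennreal \<eta> + ennreal (B + 3 * \<eta>) + ennreal \<eta>"
    by (intro add_mono conv[OF \<mu> X(1,5,6)] conv[OF \<nu> Y(1,5,6)] ennreal_leI C)
  also have "\<dots> = ennreal B + ennreal e"
    using eta B0 by (simp add: ennreal_plus[symmetric] \<eta>_def del: ennreal_plus)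
  finally show "d1 n \<mu> \<nu> \<le> ennreal B + ennreal e" .
qed

section \<open>Weak form of the Fokker--Planck equation\<close>

lemma C21_slice:
  assumes "continuous_on (Rn n \<times> I) (\<lambda>(x, t). g x t)" "t \<in> I"
  shows "continuous_on (Rn n) (\<lambda>x. g x t)"
proof -
  have "continuous_on (Rn n) (\<lambda>x. (\<lambda>(x, t). g x t) (x, t))"
    by (rule continuous_on_compose2[OF assms(1)]) (use assms(2) in \<open>auto intro!: continuous_on_Pair continuous_on_id continuous_on_const\<close>)
  then show ?thesis by simp
qed

lemma continuous_on_upd:
  assumes "x \<in> Rn n" "i < n" shows "continuous_on S (\<lambda>s. x(i := s))"
proof (rule continuous_on_Rn_vec[where n = n])
  show "continuous_on S (\<lambda>s. (x(i := s)) j)" for j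
    by (cases "j = i") (auto intro!: continuous_on_const continuous_on_id)
qed (use assms in simp)

lemma box_emeasure:
  "{x \<in> Rn n. \<forall>i<n. \<bar>x i\<bar> \<le> R} \<in> sets (Leb n)" "emeasure (Leb n) {x \<in> Rn n. \<forall>i<n. \<bar>x i\<bar> \<le> R} < \<infinity>"
proof -
  interpret product_sigma_finite "\<lambda>_ :: nat. lborel :: real measure" by standard
  have eq: "{x \<in> Rn n. \<forall>i<n. \<bar>x i\<bar> \<le> R} = PiE {..<n} (\<lambda>_. {- R..R})"
    by (auto simp: Rn_def PiE_def Pi_def abs_le_iff)
  show "{x \<in> Rn n. \<forall>i<n. \<bar>x i\<bar> \<le> R} \<in> sets (Leb n)"
    unfolding eq Leb_def by (rule sets_PiM_I_finite) auto
  have "emeasure (Leb n) (PiE {..<n} (\<lambda>_. {- R..R})) = (\<Prod>i<n. emeasure lborel {- R..R})"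
    unfolding Leb_def by (rule emeasure_PiM) auto
  also have "\<dots> = emeasure lborel {- R..R} ^ n" by simp
  also have "\<dots> < \<infinity>"
  proof -
    have "emeasure lborel {- R..R} = ennreal (max 0 (2 * R))" by (cases "0 \<le> R") (auto simp: max_def)
    then show ?thesis by (simp add: ennreal_power)
  qed
  finally show "emeasure (Leb n) {x \<in> Rn n. \<forall>i<n. \<bar>x i\<bar> \<le> R} < \<infinity>" unfolding eq .
qed

lemma continuous_support_bound:
  assumes c: "continuous_on (Rn n) W" and s: "\<And>x. x \<in> Rn n \<Longrightarrow> R < vnorm n x \<Longrightarrow> W x = (0::real)"
  obtains M where "0 \<le> M" "\<And>x. x \<in> Rn n \<Longrightarrow> \<bar>W x\<bar> \<le> M * indicator {x \<in> Rn n. \<forall>i<n. \<bar>x i\<bar> \<le> R} x"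
proof -
  define B where "B = {x \<in> Rn n. \<forall>i<n. \<bar>x i\<bar> \<le> R}"
  have "compact (W ` B)" unfolding B_def
    by (rule compact_continuous_image[OF continuous_on_subset[OF c] compact_box]) auto
  then obtain M where M: "\<And>x. x \<in> B \<Longrightarrow> \<bar>W x\<bar> \<le> M"
    using compact_imp_bounded[of "W ` B"] unfolding bounded_iff by auto
  show ?thesis
  proof (rule that[of "max 0 M"])
    fix x assume x: "x \<in> Rn n"
    show "\<bar>W x\<bar> \<le> max 0 M * indicator {x \<in> Rn n. \<forall>i<n. \<bar>x i\<bar> \<le> R} x"
    proof (cases "x \<in> B")
      case True then show ?thesis using M[OF True] by (simp add: B_def)
    next
      case False
      then obtain i where "i < n" "\<bar>x i\<bar> > R" using x by (auto simp: B_def not_le)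
      then have "R < vnorm n x" using vnorm_comp[of i n x] by simp
      then show ?thesis using s[OF x] by simp
    qed
  qed simp
qed

lemma support_integrable:
  assumes c: "continuous_on (Rn n) W" and s: "\<And>x. x \<in> Rn n \<Longrightarrow> R < vnorm n x \<Longrightarrow> W x = (0::real)"
  shows "integrable (Leb n) W"
proof -
  obtain M where M: "0 \<le> M" "\<And>x. x \<in> Rn n \<Longrightarrow> \<bar>W x\<bar> \<le> M * indicator {x \<in> Rn n. \<forall>i<n. \<bar>x i\<bar> \<le> R} x"
    using continuous_support_bound[OF c s] by blast
  show ?thesis
  proof (rule Bochner_Integration.integrable_bound[where f = "\<lambda>x. M * indicator {x \<in> Rn n. \<forall>i<n. \<bar>x i\<bar> \<le> R} x"])
    show "integrable (Leb n) (\<lambda>x. M * indicator {x \<in> Rn n. \<forall>i<n. \<bar>x i\<bar> \<le> R} x)"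
      by (intro integrable_mult_right integrable_real_indicator box_emeasure)
    show "AE x in Leb n. norm (W x) \<le> norm (M * indicator {x \<in> Rn n. \<forall>i<n. \<bar>x i\<bar> \<le> R} x)"
      using M by (intro AE_I2) (auto simp: space_Leb abs_mult)
  qed (rule Leb_measurable_continuous[OF c])
qed

text \<open>Fubini with coordinate \<open>i\<close> innermost, then the fundamental theorem on an
  interval whose end points lie outside the support.\<close>

lemma integral_partial_derivative:
  assumes i: "i < n" and W: "continuous_on (Rn n) W"
    and d: "\<And>x. x \<in> Rn n \<Longrightarrow> ((\<lambda>s. V (x(i := s))) has_real_derivative W x) (at (x i))"
    and s: "\<And>x. x \<in> Rn n \<Longrightarrow> R < vnorm n x \<Longrightarrow> V x = 0 \<and> W x = 0"
  shows "(\<integral>x. W x \<partial>Leb n) = 0"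
proof -
  interpret product_sigma_finite "\<lambda>_ :: nat. lborel :: real measure" by standard
  define I where "I = {..<n} - {i}"
  have I: "finite I" "i \<notin> I" "insert i I = {..<n}" using i by (auto simp: I_def)
  have int: "integrable (Leb n) W" by (rule support_integrable[OF W, of R]) (use s in blast)
  have "(\<integral>x. W x \<partial>Leb n) = (\<integral>x. (\<integral>y. W (x(i := y)) \<partial>lborel) \<partial>Pi\<^sub>M I (\<lambda>_. lborel))"
    unfolding Leb_def I(3)[symmetric]
    by (rule product_integral_insert[OF I(1,2)]) (use int in \<open>simp add: Leb_def I(3)\<close>)
  also have "\<dots> = (\<integral>x. 0 \<partial>Pi\<^sub>M I (\<lambda>_. lborel :: real measure))"
  proof (rule Bochner_Integration.integral_cong[OF refl])
    fix x assume "x \<in> space (Pi\<^sub>M I (\<lambda>_. lborel :: real measure))"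
    then have xI: "x \<in> extensional I" by (simp add: space_PiM PiE_def)
    have xR: "x(i := y) \<in> Rn n" for y
      using xI I(3) i by (auto simp: Rn_def PiE_def extensional_def I_def)
    define Q where "Q = \<bar>R\<bar> + 1"
    have out: "V (x(i := y)) = 0" "W (x(i := y)) = 0" if "Q \<le> \<bar>y\<bar>" for y
      using s[OF xR[of y]] vnorm_comp[OF i, of "x(i := y)"] that by (auto simp: Q_def)
    have "(\<integral>y. W (x(i := y)) \<partial>lborel) = (\<integral>y. indicator {- Q..Q} y *\<^sub>R W (x(i := y)) \<partial>lborel)"
      by (rule Bochner_Integration.integral_cong[OF refl]) (auto simp: indicator_def intro!: out(2))
    also have "\<dots> = V (x(i := Q)) - V (x(i := - Q))"
    proof (rule integral_FTC_atLeastAtMost)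
      show "- Q \<le> Q" by (simp add: Q_def)
      have "((\<lambda>s. V (x(i := s))) has_real_derivative W (x(i := y))) (at y)" for y
        using d[OF xR[of y]] by simp
      then show "((\<lambda>s. V (x(i := s))) has_vector_derivative W (x(i := y))) (at y within {- Q..Q})" for y
        by (simp add: has_real_derivative_iff_has_vector_derivative[symmetric] has_field_derivative_at_within)
      have "continuous_on {- Q..Q} (\<lambda>y. (x(i := 0))(i := y))" by (rule continuous_on_upd[OF xR i])
      then show "continuous_on {- Q..Q} (\<lambda>y. W (x(i := y)))"
        by (intro continuous_on_compose2[OF W]) (use xR in auto)
    qed
    also have "\<dots> = 0" using out(1)[of Q] out(1)[of "- Q"] by simp
    finally show "(\<integral>y. W (x(i := y)) \<partial>lborel) = 0" .
  qed
  finally show ?thesis by simp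
qed

text \<open>Differentiation under the integral. The compact set \<open>B\<close> times
  \<open>[t0 / 2, 2 * t0]\<close> stays away from time 0, where the density is not defined, and
  provides the dominating bound.\<close>

lemma density_time_derivative:
  assumes c: "continuous_on (Rn n \<times> {0<..}) (\<lambda>(x, t). \<rho> x t)" "continuous_on (Rn n \<times> {0<..}) (\<lambda>(x, t). \<rho>t x t)"
    and d: "\<And>x t. x \<in> Rn n \<Longrightarrow> t > 0 \<Longrightarrow> (\<rho> x has_real_derivative \<rho>t x t) (at t)"
    and \<zeta>: "continuous_on (Rn n) \<zeta>" "\<And>x. x \<in> Rn n \<Longrightarrow> R < vnorm n x \<Longrightarrow> \<zeta> x = 0" and t0: "t0 > 0"
  shows "((\<lambda>t. \<integral>x. \<zeta> x * \<rho> x t \<partial>Leb n) has_real_derivative (\<integral>x. \<zeta> x * \<rho>t x t0 \<partial>Leb n)) (at t0)"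
proof -
  define B where "B = {x \<in> Rn n. \<forall>i<n. \<bar>x i\<bar> \<le> R}"
  have "compact ((\<lambda>p. \<zeta> (fst p) * \<rho>t (fst p) (snd p)) ` (B \<times> {t0 / 2..2 * t0}))"
  proof (rule compact_continuous_image)
    have "continuous_on (B \<times> {t0 / 2..2 * t0}) (\<lambda>p. \<zeta> (fst p))"
      by (rule continuous_on_compose2[OF \<zeta>(1)]) (auto simp: B_def intro!: continuous_on_fst continuous_on_id)
    moreover have "continuous_on (B \<times> {t0 / 2..2 * t0}) (\<lambda>p. \<rho>t (fst p) (snd p))"
    proof -
      have "B \<times> {t0 / 2..2 * t0} \<subseteq> Rn n \<times> {0<..}" using t0 by (auto simp: B_def)
      from continuous_on_subset[OF c(2) this] show ?thesis by (simp add: case_prod_beta)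
    qed
    ultimately show "continuous_on (B \<times> {t0 / 2..2 * t0}) (\<lambda>p. \<zeta> (fst p) * \<rho>t (fst p) (snd p))" by (rule continuous_on_mult)
    show "compact (B \<times> {t0 / 2..2 * t0})" unfolding B_def by (intro compact_Times compact_box) simp
  qed
  then obtain M0 where "\<forall>p\<in>(\<lambda>p. \<zeta> (fst p) * \<rho>t (fst p) (snd p)) ` (B \<times> {t0 / 2..2 * t0}). norm p \<le> M0"
    using compact_imp_bounded[of "(\<lambda>p. \<zeta> (fst p) * \<rho>t (fst p) (snd p)) ` (B \<times> {t0 / 2..2 * t0})"] unfolding bounded_iff by metis
  then have M0: "\<bar>\<zeta> x * \<rho>t x t\<bar> \<le> M0" if "x \<in> B" "t \<in> {t0 / 2..2 * t0}" for x t
    using imageI[of "(x, t)" "B \<times> {t0 / 2..2 * t0}" "\<lambda>p. \<zeta> (fst p) * \<rho>t (fst p) (snd p)"] that by fastforce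
  define M where "M = max 0 M0"
  have bd: "\<bar>\<zeta> x * \<rho>t x t\<bar> \<le> M * indicator B x" if x: "x \<in> Rn n" and t: "t \<in> {t0 / 2..2 * t0}" for x t
  proof (cases "x \<in> B")
    case True then show ?thesis using M0[OF True t] by (simp add: M_def)
  next
    case False
    then obtain i where "i < n" "\<bar>x i\<bar> > R" using x by (auto simp: B_def not_le)
    then have "R < vnorm n x" using vnorm_comp[of i n x] by simp
    then show ?thesis using \<zeta>(2)[OF x] False by simp
  qed
  have mes: "(\<lambda>x. \<zeta> x * \<rho> x t) \<in> borel_measurable (Leb n)" "(\<lambda>x. \<zeta> x * \<rho>t x t) \<in> borel_measurable (Leb n)" if "t > 0" for t
    by (intro Leb_measurable_continuous continuous_on_mult \<zeta>(1) C21_slice[OF c(1)]; use that in simp)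
      (intro Leb_measurable_continuous continuous_on_mult \<zeta>(1) C21_slice[OF c(2)]; use that in simp)
  have intg: "integrable (Leb n) (\<lambda>x. \<zeta> x * \<rho> x t)" if "t > 0" for t
    by (rule support_integrable[where R = R, OF continuous_on_mult[OF \<zeta>(1) C21_slice[OF c(1)]]]) (use that \<zeta>(2) in auto)
  define q where "q t = (\<integral>x. \<zeta> x * \<rho> x t \<partial>Leb n)" for t
  have "((\<lambda>h. (q (t0 + h) - q t0) / h) \<longlongrightarrow> (\<integral>x. \<zeta> x * \<rho>t x t0 \<partial>Leb n)) (at 0)"
    unfolding tendsto_at_iff_sequentially
  proof (intro allI impI)
    fix X :: "nat \<Rightarrow> real" assume X: "\<forall>k. X k \<in> UNIV - {0}" "X \<longlonglongrightarrow> 0"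
    have X0: "filterlim X (at 0) sequentially"
      unfolding filterlim_at using X by simp
    \<comment> \<open>Set to 0 for the steps that could leave the positive times, so that domination
      holds for every \<open>k\<close>.\<close>
    define s where "s k x = (if \<bar>X k\<bar> < t0 / 2 then (\<zeta> x * \<rho> x (t0 + X k) - \<zeta> x * \<rho> x t0) / X k else 0)" for k x
    have ev: "\<forall>\<^sub>F k in sequentially. \<bar>X k\<bar> < t0 / 2"
      using tendstoD[OF X(2), of "t0 / 2"] t0 by (simp add: dist_real_def)
    have "(\<lambda>k. \<integral>x. s k x \<partial>Leb n) \<longlonglongrightarrow> (\<integral>x. \<zeta> x * \<rho>t x t0 \<partial>Leb n)"
    proof (rule integral_dominated_convergence[where w = "\<lambda>x. M * indicator B x"])
      show "(\<lambda>x. \<zeta> x * \<rho>t x t0) \<in> borel_measurable (Leb n)" by (rule mes(2)[OF t0])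
      show "s k \<in> borel_measurable (Leb n)" for k
      proof (cases "\<bar>X k\<bar> < t0 / 2")
        case True
        then have "t0 + X k > 0" by linarith
        then show ?thesis using mes(1)[of "t0 + X k"] mes(1)[OF t0] True by (simp add: s_def[abs_def])
      qed (simp add: s_def[abs_def])
      show "integrable (Leb n) (\<lambda>x. M * indicator B x)"
        unfolding B_def by (intro integrable_mult_right integrable_real_indicator box_emeasure)
      show "AE x in Leb n. (\<lambda>k. s k x) \<longlonglongrightarrow> \<zeta> x * \<rho>t x t0"
      proof (rule AE_I2)
        fix x assume "x \<in> space (Leb n)"
        then have x: "x \<in> Rn n" by (simp add: space_Leb)
        have "((\<lambda>t. \<zeta> x * \<rho> x t) has_real_derivative \<zeta> x * \<rho>t x t0) (at t0)" by (rule DERIV_cmult[OF d[OF x t0]])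
        then have "(\<lambda>k. (\<zeta> x * \<rho> x (t0 + X k) - \<zeta> x * \<rho> x t0) / X k) \<longlonglongrightarrow> \<zeta> x * \<rho>t x t0"
          unfolding DERIV_def by (rule filterlim_compose[OF _ X0])
        then show "(\<lambda>k. s k x) \<longlonglongrightarrow> \<zeta> x * \<rho>t x t0"
          by (rule Lim_transform_eventually) (use ev in \<open>eventually_elim, simp add: s_def\<close>)
      qed
      show "AE x in Leb n. norm (s k x) \<le> M * indicator B x" for k
      proof (rule AE_I2)
        fix x assume "x \<in> space (Leb n)"
        then have x: "x \<in> Rn n" by (simp add: space_Leb)
        show "norm (s k x) \<le> M * indicator B x"
        proof (cases "\<bar>X k\<bar> < t0 / 2")
          case True
          have Xk: "X k \<noteq> 0" using X(1) by simp
          have dd: "((\<lambda>t. \<zeta> x * \<rho> x t) has_real_derivative \<zeta> x * \<rho>t x t) (at t)" if "t > 0" for t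
            by (rule DERIV_cmult[OF d[OF x that]])
          have "\<exists>z\<in>{t0 / 2..2 * t0}. \<zeta> x * \<rho> x (t0 + X k) - \<zeta> x * \<rho> x t0 = X k * (\<zeta> x * \<rho>t x z)"
          proof (cases "X k > 0")
            case pos: True
            obtain z where "t0 < z" "z < t0 + X k" "\<zeta> x * \<rho> x (t0 + X k) - \<zeta> x * \<rho> x t0 = (t0 + X k - t0) * (\<zeta> x * \<rho>t x z)"
              using MVT2[of t0 "t0 + X k" "\<lambda>t. \<zeta> x * \<rho> x t" "\<lambda>t. \<zeta> x * \<rho>t x t"] dd pos t0 by auto
            then show ?thesis using True pos t0 by (intro bexI[of _ z]) auto
          next
            case False
            then have neg: "X k < 0" using Xk by simp
            have "\<exists>z. t0 + X k < z \<and> z < t0 \<and> \<zeta> x * \<rho> x t0 - \<zeta> x * \<rho> x (t0 + X k) = (t0 - (t0 + X k)) * (\<zeta> x * \<rho>t x z)"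
              using True neg by (intro MVT2 dd) auto
            then obtain z where "t0 + X k < z" "z < t0" "\<zeta> x * \<rho> x t0 - \<zeta> x * \<rho> x (t0 + X k) = (t0 - (t0 + X k)) * (\<zeta> x * \<rho>t x z)" by blast
            then show ?thesis using True neg t0 by (intro bexI[of _ z]) auto
          qed
          then obtain z where z: "z \<in> {t0 / 2..2 * t0}" "\<zeta> x * \<rho> x (t0 + X k) - \<zeta> x * \<rho> x t0 = X k * (\<zeta> x * \<rho>t x z)" by blast
          have "s k x = \<zeta> x * \<rho>t x z" using True z(2) Xk by (simp add: s_def)
          then show ?thesis using bd[OF x z(1)] by simp
        qed (auto simp: s_def M_def)
      qed
    qed
    then have "(\<lambda>k. (q (t0 + X k) - q t0) / X k) \<longlonglongrightarrow> (\<integral>x. \<zeta> x * \<rho>t x t0 \<partial>Leb n)"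
    proof (rule Lim_transform_eventually)
      show "\<forall>\<^sub>F k in sequentially. (\<integral>x. s k x \<partial>Leb n) = (q (t0 + X k) - q t0) / X k"
        using ev
      proof eventually_elim
        case (elim k)
        then have "t0 + X k > 0" by linarith
        then show ?case using intg[of "t0 + X k"] intg[OF t0] elim by (simp add: s_def q_def)
      qed
    qed
    then show "((\<lambda>h. (q (t0 + h) - q t0) / h) \<circ> X) \<longlonglongrightarrow> (\<integral>x. \<zeta> x * \<rho>t x t0 \<partial>Leb n)" by (simp add: o_def)
  qed
  then show ?thesis unfolding DERIV_def q_def .
qed

lemma zero_outside_derivative:
  assumes f: "\<And>x. x \<in> Rn n \<Longrightarrow> R < vnorm n x \<Longrightarrow> f x = 0" and x: "x \<in> Rn n" "R < vnorm n x" and i: "i < n"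
    and d: "((\<lambda>s. f (x(i := s))) has_real_derivative D) (at (x i))"
  shows "D = (0::real)"
proof -
  have "\<forall>\<^sub>F s in nhds (x i). f (x(i := s)) = 0"
    unfolding eventually_nhds_metric
  proof (intro exI[of _ "vnorm n x - R"] conjI allI impI)
    fix s assume "dist s (x i) < vnorm n x - R"
    then have "vdist n (x(i := s)) x < vnorm n x - R"
      using vdist_upd[OF i, of x s "x i"] by (simp add: dist_real_def)
    then have "R < vnorm n (x(i := s))" using vnorm_dist[of n "x(i := s)" x] by linarith
    then show "f (x(i := s)) = 0" using f x i by simp
  qed (use x in simp)
  then have "((\<lambda>s. f (x(i := s))) has_real_derivative D) (at (x i)) \<longleftrightarrow> ((\<lambda>s. 0) has_real_derivative D) (at (x i))"
    by (intro DERIV_cong_ev refl)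
  then have "((\<lambda>s. 0) has_real_derivative D) (at (x i))" using d by simp
  then show ?thesis using DERIV_unique DERIV_const by blast
qed

definition drift :: "nat \<Rightarrow> real \<Rightarrow> (vec \<Rightarrow> vec \<Rightarrow> real) \<Rightarrow> (vec \<Rightarrow> real \<Rightarrow> real) \<Rightarrow> vec \<Rightarrow> real \<Rightarrow> vec" where
  "drift n lam H u x t = DpH n H (vscale n lam (Du n u x t)) x"

lemma drift_Rn [simp]: "drift n lam H u x t \<in> Rn n"
  by (simp add: drift_def DpH_def)

context hamiltonian
begin

text \<open>A drift component is a first partial derivative of the joint Hamiltonian composed with
  the map from \<open>x\<close> to \<open>(lam * Du, x)\<close>; both are C^1, so the chain rule in
  \<open>2 * n\<close> variables applies.\<close>

lemma drift_derivative:
  assumes u: "C21 n {0..} u" and t: "t > 0" and i: "i < n"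
  obtains Bd where "continuous_on (Rn n) Bd" "continuous_on (Rn n) (\<lambda>x. drift n lam H u x t i)"
    "\<And>x. x \<in> Rn n \<Longrightarrow> ((\<lambda>s. drift n lam H u (x(i := s)) t i) has_real_derivative Bd x) (at (x i))"
proof -
  define J where "J = pd i (joint n H)"
  have JC: "C1f (2 * n) J" unfolding J_def by (rule J2) (use i in simp)
  define P where "P x = vscale n lam (Du n u x t)" for x
  have P: "P x \<in> Rn n" for x by (simp add: P_def)
  have uc: "continuous_on (Rn n) (\<lambda>x. pd k (\<lambda>y. u y t) x)" "continuous_on (Rn n) (\<lambda>x. pd i (pd k (\<lambda>y. u y t)) x)"
    "x \<in> Rn n \<Longrightarrow> has_pd i (pd k (\<lambda>y. u y t)) x" if "k < n" for k x
    using u that i t unfolding C21_def by (auto intro!: C21_slice[where I = "{0..}" and t = t])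
  have Pc: "continuous_on (Rn n) P"
    by (rule continuous_on_Rn_vec[where n = n]) (use uc in \<open>auto simp: P_def intro!: continuous_on_mult continuous_on_const\<close>)
  define cp where "cp x = cat n (P x) x" for x
  have cpc: "continuous_on (Rn n) cp" unfolding cp_def by (intro continuous_on_cat Pc continuous_on_id)
  have cpR: "cp x \<in> Rn (2 * n)" for x by (simp add: cp_def)
  \<comment> \<open>Derivative in direction \<open>i\<close> of entry \<open>k\<close> of
    \<open>(lam * Du, x)\<close>.\<close>
  define G where "G k x = (if k < n then lam * pd i (pd k (\<lambda>y. u y t)) x else if k - n = i then 1 else 0)" for k x
  define Bd where "Bd x = (\<Sum>k<2 * n. pd k J (cp x) * G k x)" for x
  have dr: "drift n lam H u x t i = J (cp x)" if "x \<in> Rn n" for x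
    using pd_p[OF P that i] i by (simp add: drift_def DpH_def J_def cp_def P_def)
  show ?thesis
  proof (rule that[of Bd])
    have "continuous_on (Rn n) (\<lambda>x. pd k J (cp x) * G k x)" if k: "k < 2 * n" for k
    proof (rule continuous_on_mult)
      have "continuous_on (Rn (2 * n)) (pd k J)" using JC k by (auto simp: C1f_def)
      then show "continuous_on (Rn n) (\<lambda>x. pd k J (cp x))" by (rule continuous_on_compose2[OF _ cpc]) (use cpR in auto)
      show "continuous_on (Rn n) (G k)"
        using uc(2)[of k] by (cases "k < n") (auto simp: G_def[abs_def] intro!: continuous_on_mult continuous_on_const)
    qed
    then show "continuous_on (Rn n) Bd" unfolding Bd_def by (intro continuous_on_sum) auto
    have "continuous_on (Rn (2 * n)) J"
      using aH i unfolding assumptions_H_def C2_alpha_def C2_def J_def by auto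
    then have "continuous_on (Rn n) (\<lambda>x. J (cp x))" by (rule continuous_on_compose2[OF _ cpc]) (use cpR in auto)
    then show "continuous_on (Rn n) (\<lambda>x. drift n lam H u x t i)" using dr by (simp cong: continuous_on_cong)
    fix x assume x: "x \<in> Rn n"
    have "((\<lambda>s. J (cp (x(i := s)))) has_real_derivative (\<Sum>k<2 * n. pd k J (cp (x(i := x i))) * G k x)) (at (x i))"
    proof (rule C1f_chain[OF JC cpR])
      fix k assume k: "k < 2 * n"
      show "((\<lambda>s. cp (x(i := s)) k) has_real_derivative G k x) (at (x i))"
      proof (cases "k < n")
        case True
        have "((\<lambda>s. pd k (\<lambda>y. u y t) (x(i := s))) has_real_derivative pd i (pd k (\<lambda>y. u y t)) x) (at (x i))"
          by (rule pd_has_derivative[OF uc(3)[OF True x]])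
        from DERIV_cmult[OF this, of lam] show ?thesis using True k by (simp add: cp_def cat_def P_def G_def)
      next
        case False
        then show ?thesis using k by (auto simp: cp_def cat_def G_def intro!: derivative_eq_intros)
      qed
    qed
    then show "((\<lambda>s. drift n lam H u (x(i := s)) t i) has_real_derivative Bd x) (at (x i))"
      using dr x i by (simp add: Bd_def)
  qed
qed

text \<open>A Lipschitz function enters through its smoothing, which has the second derivatives that
  the equation puts on the test function. All integrations by parts are one statement:
  \<open>W i\<close> is the derivative in direction \<open>i\<close> of a compactly supported flux,
  so its integral vanishes.\<close>

lemma FP_weak:
  assumes u: "C21 n {0..} u" and fp: "solves_FP n lam m0 H u m"
    and \<phi>: "lipK n K \<phi>" "0 \<le> K" and d: "0 < \<delta>"
    and R: "\<And>x. x \<in> Rn n \<Longrightarrow> R < vnorm n x \<Longrightarrow> smooth n \<delta> \<phi> x = 0" and t: "t > 0"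
  shows "((\<lambda>t. \<integral>x. smooth n \<delta> \<phi> x \<partial>m t) has_real_derivative
    (\<integral>x. (\<Sum>i<n. sDD n \<delta> \<phi> i x - sD n \<delta> \<phi> i x * drift n lam H u x t i) \<partial>m t)) (at t)"
proof -
  obtain \<rho> where \<rho>: "C21 n {0<..} \<rho>" "\<And>x t. x \<in> Rn n \<Longrightarrow> t > 0 \<Longrightarrow> 0 \<le> \<rho> x t"
    "\<And>t. t > 0 \<Longrightarrow> m t = density (Leb n) (\<lambda>x. ennreal (\<rho> x t))"
    "\<And>x t. x \<in> Rn n \<Longrightarrow> t > 0 \<Longrightarrow> dt {0<..} \<rho> x t - laplacian n (\<lambda>y. \<rho> y t) x
       - divergence n (\<lambda>y. vscale n (\<rho> y t) (DpH n H (vscale n lam (Du n u y t)) y)) x = 0"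
    using fp unfolding solves_FP_def by auto
  define \<zeta> where "\<zeta> = smooth n \<delta> \<phi>"
  define D where "D = sD n \<delta> \<phi>"
  define DD where "DD = sDD n \<delta> \<phi>"
  have \<zeta>D: "((\<lambda>r. \<zeta> (x(i := r))) has_real_derivative D i x) (at (x i))" if "x \<in> Rn n" "i < n" for x i
    unfolding \<zeta>_def D_def by (rule smooth_D[OF \<phi>(1) d \<phi>(2) that(2,1)])
  have \<zeta>DD: "((\<lambda>r. D i (x(i := r))) has_real_derivative DD i x) (at (x i))" if "x \<in> Rn n" "i < n" for x i
    unfolding DD_def D_def by (rule smooth_DD[OF \<phi>(1) d \<phi>(2) that(2,1)])
  have \<zeta>0: "\<zeta> x = 0" if "x \<in> Rn n" "R < vnorm n x" for x using R[OF that] by (simp add: \<zeta>_def)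
  have D0: "D i x = 0" if "x \<in> Rn n" "R < vnorm n x" "i < n" for i x
    by (rule zero_outside_derivative[OF \<zeta>0 that \<zeta>D[OF that(1,3)]])
  have DD0: "DD i x = 0" if "x \<in> Rn n" "R < vnorm n x" "i < n" for i x
    by (rule zero_outside_derivative[OF D0[OF _ _ that(3)] that \<zeta>DD[OF that(1,3)]])
  have \<zeta>c: "continuous_on (Rn n) \<zeta>" unfolding \<zeta>_def by (rule lipK_continuous[OF smooth_lip[OF \<phi>(1) d \<phi>(2)]])
  have Dc: "continuous_on (Rn n) (D i)" "continuous_on (Rn n) (DD i)" if "i < n" for i
    unfolding D_def DD_def using lipK_continuous[OF sD_lip[OF \<phi>(1) d \<phi>(2) that]] lipK_continuous[OF sDD_lip[OF \<phi>(1) d \<phi>(2) that]] by auto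
  define \<rho>t where "\<rho>t = dt {0<..} \<rho>"
  have dr: "(\<rho> x has_real_derivative \<rho>t x t) (at t)" if "x \<in> Rn n" "t > 0" for x t
  proof -
    have "\<rho> x differentiable (at t within {0<..})" using \<rho>(1) that unfolding C21_def by auto
    then have "(\<rho> x has_vector_derivative \<rho>t x t) (at t within {0<..})"
      unfolding \<rho>t_def dt_def by (simp add: vector_derivative_works)
    then show ?thesis using that by (simp add: has_real_derivative_iff_has_vector_derivative at_within_open[of t "{0<..}"])
  qed
  have c1: "continuous_on (Rn n \<times> {0<..}) (\<lambda>(x, t). \<rho> x t)" "continuous_on (Rn n \<times> {0<..}) (\<lambda>(x, t). \<rho>t x t)"
    using \<rho>(1) unfolding C21_def \<rho>t_def by auto
  have rc: "continuous_on (Rn n) (\<lambda>x. \<rho> x t)" by (rule C21_slice[OF c1(1)]) (use t in simp)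
  have ri: "continuous_on (Rn n) (\<lambda>x. pd i (\<lambda>y. \<rho> y t) x)" "continuous_on (Rn n) (\<lambda>x. pd i (pd i (\<lambda>y. \<rho> y t)) x)"
    "\<And>x. x \<in> Rn n \<Longrightarrow> has_pd i (\<lambda>y. \<rho> y t) x" "\<And>x. x \<in> Rn n \<Longrightarrow> has_pd i (pd i (\<lambda>y. \<rho> y t)) x" if "i < n" for i
    using \<rho>(1) that t unfolding C21_def by (auto intro!: C21_slice[where I = "{0<..}" and t = t])
  define \<beta> where "\<beta> i x = drift n lam H u x t i" for i x
  have "\<forall>i\<in>{..<n}. \<exists>Bd. continuous_on (Rn n) Bd \<and> continuous_on (Rn n) (\<beta> i) \<and>
    (\<forall>x\<in>Rn n. ((\<lambda>s. \<beta> i (x(i := s))) has_real_derivative Bd x) (at (x i)))"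
    unfolding \<beta>_def using drift_derivative[OF u t, of _ lam] by (metis lessThan_iff)
  then obtain Bd where Bd: "\<And>i. i < n \<Longrightarrow> continuous_on (Rn n) (Bd i)" "\<And>i. i < n \<Longrightarrow> continuous_on (Rn n) (\<beta> i)"
    "\<And>i x. i < n \<Longrightarrow> x \<in> Rn n \<Longrightarrow> ((\<lambda>s. \<beta> i (x(i := s))) has_real_derivative Bd i x) (at (x i))"
    unfolding bchoice_iff by auto
  define r1 where "r1 i x = pd i (\<lambda>y. \<rho> y t) x" for i x
  define r2 where "r2 i x = pd i (pd i (\<lambda>y. \<rho> y t)) x" for i x
  have dr1: "((\<lambda>s. \<rho> (x(i := s)) t) has_real_derivative r1 i x) (at (x i))" if "i < n" "x \<in> Rn n" for i x
    unfolding r1_def by (rule pd_has_derivative[OF ri(3)[OF that]])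
  have dr2: "((\<lambda>s. r1 i (x(i := s))) has_real_derivative r2 i x) (at (x i))" if "i < n" "x \<in> Rn n" for i x
    unfolding r1_def r2_def by (rule pd_has_derivative[OF ri(4)[OF that]])
  define Bp where "Bp i x = r1 i x * \<beta> i x + Bd i x * \<rho> x t" for i x
  have dB: "((\<lambda>s. \<rho> (x(i := s)) t * \<beta> i (x(i := s))) has_real_derivative Bp i x) (at (x i))" if "i < n" "x \<in> Rn n" for i x
    using DERIV_mult[OF dr1[OF that] Bd(3)[OF that]] by (simp add: Bp_def)
  have divB: "divergence n (\<lambda>y. vscale n (\<rho> y t) (DpH n H (vscale n lam (Du n u y t)) y)) x = (\<Sum>i<n. Bp i x)" if x: "x \<in> Rn n" for x
    unfolding divergence_def
  proof (rule sum.cong[OF refl])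
    fix i assume "i \<in> {..<n}"
    then have i: "i < n" by simp
    show "pd i (\<lambda>y. vscale n (\<rho> y t) (DpH n H (vscale n lam (Du n u y t)) y) i) x = Bp i x"
      by (rule pd_eqI(1)) (use dB[OF i x] i in \<open>simp add: \<beta>_def drift_def\<close>)
  qed
  define W where "W i x = \<zeta> x * (r2 i x + Bp i x) - DD i x * \<rho> x t + D i x * (\<rho> x t * \<beta> i x)" for i x
  have Wc: "continuous_on (Rn n) (W i)" if i: "i < n" for i
    unfolding W_def Bp_def r1_def r2_def
    by (intro continuous_on_add continuous_on_diff continuous_on_mult \<zeta>c Dc[OF i] rc ri(1,2)[OF i] Bd(1,2)[OF i])
  have W0: "(\<integral>x. W i x \<partial>Leb n) = 0" if i: "i < n" for i
  proof (rule integral_partial_derivative[OF i Wc[OF i], where R = R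
        and V = "\<lambda>x. \<zeta> x * r1 i x - D i x * \<rho> x t + \<zeta> x * (\<rho> x t * \<beta> i x)"])
    fix x assume x: "x \<in> Rn n"
    have "((\<lambda>s. \<zeta> (x(i := s)) * r1 i (x(i := s)) - D i (x(i := s)) * \<rho> (x(i := s)) t + \<zeta> (x(i := s)) * (\<rho> (x(i := s)) t * \<beta> i (x(i := s))))
      has_real_derivative (D i x * r1 i (x(i := x i)) + r2 i x * \<zeta> (x(i := x i))) - (DD i x * \<rho> (x(i := x i)) t + r1 i x * D i (x(i := x i)))
        + (D i x * (\<rho> (x(i := x i)) t * \<beta> i (x(i := x i))) + Bp i x * \<zeta> (x(i := x i)))) (at (x i))"
      by (intro DERIV_add DERIV_diff DERIV_mult \<zeta>D \<zeta>DD dr1 dr2 dB x i)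
    then show "((\<lambda>s. \<zeta> (x(i := s)) * r1 i (x(i := s)) - D i (x(i := s)) * \<rho> (x(i := s)) t + \<zeta> (x(i := s)) * (\<rho> (x(i := s)) t * \<beta> i (x(i := s))))
      has_real_derivative W i x) (at (x i))"
      by (rule DERIV_cong) (simp add: W_def algebra_simps)
    show "R < vnorm n x \<Longrightarrow> \<zeta> x * r1 i x - D i x * \<rho> x t + \<zeta> x * (\<rho> x t * \<beta> i x) = 0 \<and> W i x = 0"
      using \<zeta>0[OF x] D0[OF x _ i] DD0[OF x _ i] by (simp add: W_def)
  qed
  define S where "S x = (\<Sum>i<n. DD i x - D i x * \<beta> i x)" for x
  have Sc: "continuous_on (Rn n) S"
    unfolding S_def by (intro continuous_on_sum continuous_on_diff continuous_on_mult Dc Bd(2)) auto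
  have iS: "integrable (Leb n) (\<lambda>x. S x * \<rho> x t)"
    by (rule support_integrable[where R = R, OF continuous_on_mult[OF Sc rc]]) (simp add: S_def D0 DD0)
  have iW: "integrable (Leb n) (W i)" if i: "i < n" for i
    by (rule support_integrable[where R = R, OF Wc[OF i]]) (simp add: W_def \<zeta>0 D0[OF _ _ i] DD0[OF _ _ i])
  have pt: "\<zeta> x * \<rho>t x t = (\<Sum>i<n. W i x) + S x * \<rho> x t" if x: "x \<in> Rn n" for x
  proof -
    have "\<rho>t x t = (\<Sum>i<n. r2 i x + Bp i x)"
      using \<rho>(4)[OF x t] unfolding divB[OF x] laplacian_def \<rho>t_def r2_def by (simp add: sum.distrib)
    then have "\<zeta> x * \<rho>t x t = (\<Sum>i<n. \<zeta> x * (r2 i x + Bp i x))" by (simp add: sum_distrib_left)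
    moreover have "(\<Sum>i<n. W i x) + S x * \<rho> x t = (\<Sum>i<n. W i x + (DD i x - D i x * \<beta> i x) * \<rho> x t)"
      unfolding S_def by (simp only: sum_distrib_right sum.distrib)
    moreover have "(\<Sum>i<n. W i x + (DD i x - D i x * \<beta> i x) * \<rho> x t) = (\<Sum>i<n. \<zeta> x * (r2 i x + Bp i x))"
      by (rule sum.cong) (auto simp: W_def algebra_simps)
    ultimately show ?thesis by simp
  qed
  have "(\<integral>x. \<zeta> x * \<rho>t x t \<partial>Leb n) = (\<integral>x. (\<Sum>i<n. W i x) + S x * \<rho> x t \<partial>Leb n)"
    by (rule Bochner_Integration.integral_cong[OF refl]) (simp add: pt space_Leb)
  also have "\<dots> = (\<Sum>i<n. \<integral>x. W i x \<partial>Leb n) + (\<integral>x. S x * \<rho> x t \<partial>Leb n)"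
  proof -
    have "integrable (Leb n) (\<lambda>x. \<Sum>i<n. W i x)" by (intro Bochner_Integration.integrable_sum iW) auto
    from Bochner_Integration.integral_add[OF this iS] show ?thesis
      using Bochner_Integration.integral_sum[of "{..<n}" "Leb n" W] iW by simp
  qed
  also have "\<dots> = (\<integral>x. S x * \<rho> x t \<partial>Leb n)" by (simp add: W0)
  finally have main: "(\<integral>x. \<zeta> x * \<rho>t x t \<partial>Leb n) = (\<integral>x. S x * \<rho> x t \<partial>Leb n)" .
  have dens: "(\<integral>x. g x \<partial>m s) = (\<integral>x. g x * \<rho> x s \<partial>Leb n)" if s: "s > 0" and g: "continuous_on (Rn n) g" for g s
  proof -
    have "(\<integral>x. g x \<partial>m s) = (\<integral>x. \<rho> x s * g x \<partial>Leb n)"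
      unfolding \<rho>(3)[OF s]
    proof (rule integral_real_density)
      show "g \<in> borel_measurable (Leb n)" by (rule Leb_measurable_continuous[OF g])
      show "(\<lambda>x. \<rho> x s) \<in> borel_measurable (Leb n)"
        by (rule Leb_measurable_continuous[OF C21_slice[OF c1(1)]]) (use s in simp)
      show "AE x in Leb n. 0 \<le> \<rho> x s" using \<rho>(2) s by (intro AE_I2) (simp add: space_Leb)
    qed
    then show ?thesis by (simp add: mult.commute)
  qed
  have "((\<lambda>t. \<integral>x. \<zeta> x * \<rho> x t \<partial>Leb n) has_real_derivative (\<integral>x. \<zeta> x * \<rho>t x t \<partial>Leb n)) (at t)"
    by (rule density_time_derivative[OF c1 dr \<zeta>c \<zeta>0 t])
  moreover have "\<forall>\<^sub>F s in nhds t. (\<integral>x. \<zeta> x \<partial>m s) = (\<integral>x. \<zeta> x * \<rho> x s \<partial>Leb n)"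
  proof -
    have "\<forall>\<^sub>F s in nhds t. s \<in> {0<..}" by (rule eventually_nhds_in_open) (use t in auto)
    then show ?thesis by eventually_elim (use dens[OF _ \<zeta>c] in simp)
  qed
  ultimately have "((\<lambda>t. \<integral>x. \<zeta> x \<partial>m t) has_real_derivative (\<integral>x. \<zeta> x * \<rho>t x t \<partial>Leb n)) (at t)"
    using DERIV_cong_ev[OF refl, of "\<lambda>s. \<integral>x. \<zeta> x \<partial>m s" "\<lambda>s. \<integral>x. \<zeta> x * \<rho> x s \<partial>Leb n" t] by blast
  then show ?thesis
    unfolding main dens[OF t Sc, symmetric] unfolding S_def D_def DD_def \<beta>_def \<zeta>_def .
qed

end

section \<open>Stability of the Fokker--Planck flow\<close>

text \<open>Integrating factor \<open>exp (\<Lambda> * t)\<close>: \<open>Y\<close> is chosen so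
  that \<open>p\<close> has nonpositive derivative, and the limit of \<open>p\<close> at 0 is
  \<open>- Y\<close>. The damping rate \<open>\<Lambda>\<close> is kept in the denominator because
  it will be large and has to cancel later.\<close>

lemma backward_gronwall:
  fixes q q' :: "real \<Rightarrow> real"
  assumes d: "\<And>t. t > 0 \<Longrightarrow> (q has_real_derivative q' t) (at t)"
    and le: "\<And>t. t > 0 \<Longrightarrow> q' t \<le> F * exp (A * t) - \<Lambda> * q t"
    and A: "0 \<le> A" "0 \<le> \<Lambda>" "0 < A + \<Lambda>" and F: "0 \<le> F" and l: "(q \<longlongrightarrow> 0) (at_right 0)" and t: "t > 0"
  shows "q t \<le> F / (A + \<Lambda>) * exp (A * t)"
proof -
  define Y where "Y = F / (A + \<Lambda>)"
  have Y: "0 \<le> Y" "Y * (A + \<Lambda>) = F" using A F by (auto simp: Y_def)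
  define p where "p t = exp (\<Lambda> * t) * q t - Y * exp ((A + \<Lambda>) * t)" for t
  have dp: "(p has_real_derivative (\<Lambda> * exp (\<Lambda> * t)) * q t + q' t * exp (\<Lambda> * t) - Y * ((A + \<Lambda>) * exp ((A + \<Lambda>) * t))) (at t)" if "t > 0" for t
    unfolding p_def by (intro DERIV_diff DERIV_mult DERIV_cmult d that) (auto intro!: derivative_eq_intros)
  have np: "(\<Lambda> * exp (\<Lambda> * t)) * q t + q' t * exp (\<Lambda> * t) - Y * ((A + \<Lambda>) * exp ((A + \<Lambda>) * t)) \<le> 0" if "t > 0" for t
  proof -
    have "exp (\<Lambda> * t) * q' t \<le> exp (\<Lambda> * t) * (F * exp (A * t) - \<Lambda> * q t)" using le[OF that] by (intro mult_left_mono) auto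
    moreover have "exp ((A + \<Lambda>) * t) = exp (A * t) * exp (\<Lambda> * t)" by (simp add: distrib_right exp_add)
    then have "Y * ((A + \<Lambda>) * exp ((A + \<Lambda>) * t)) = F * (exp (A * t) * exp (\<Lambda> * t))" by (simp add: mult.assoc[symmetric] Y(2))
    ultimately show ?thesis by (simp add: algebra_simps)
  qed
  have mono: "p t \<le> p s" if "0 < s" "s < t" for s
    by (rule DERIV_nonpos_imp_nonincreasing[OF less_imp_le[OF that(2)]]) (use dp np that in \<open>meson less_le_trans\<close>)
  have e1: "((\<lambda>t::real. exp (c * t)) \<longlongrightarrow> exp (c * 0)) (at_right 0)" for c :: real
    by (intro tendsto_exp tendsto_mult tendsto_const tendsto_ident_at)
  have "(p \<longlongrightarrow> exp (\<Lambda> * 0) * 0 - Y * exp ((A + \<Lambda>) * 0)) (at_right 0)"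
    unfolding p_def by (rule tendsto_diff[OF tendsto_mult[OF e1 l] tendsto_mult[OF tendsto_const e1]])
  then have "(p \<longlongrightarrow> - Y) (at_right 0)" by simp
  then have "p t \<le> - Y"
  proof (rule tendsto_lowerbound)
    show "\<forall>\<^sub>F s in at_right 0. p t \<le> p s"
      unfolding eventually_at_right_field using mono t by (intro exI[of _ t]) auto
  qed simp
  then have "exp (\<Lambda> * t) * q t \<le> Y * exp ((A + \<Lambda>) * t)" using Y(1) by (simp add: p_def)
  also have "\<dots> = exp (\<Lambda> * t) * (Y * exp (A * t))" by (simp add: distrib_right exp_add)
  finally have "q t \<le> Y * exp (A * t)" by (simp only: mult_le_cancel_left_pos[OF exp_gt_zero])
  then show ?thesis unfolding Y_def .
qed

section \<open>Test functions under scaling, smoothing and translation\<close>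

lemma avgs_scale: "avgs \<delta> l (\<lambda>x. c * f x) x = c * avgs \<delta> l f x"
proof (induction l arbitrary: x)
  case (Cons i l)
  have "avgs \<delta> (i # l) (\<lambda>x. c * f x) x = (1 / \<delta>) * integral {0..\<delta>} (\<lambda>s. c * avgs \<delta> l f (x(i := x i + s)))"
    unfolding avgs_simps avg_def Cons ..
  also have "\<dots> = (1 / \<delta>) * (c * integral {0..\<delta>} (\<lambda>s. avgs \<delta> l f (x(i := x i + s))))" by (simp only: integral_mult_right)
  finally show ?case unfolding avgs_simps avg_def by simp
qed simp

lemma smooth_scale: "smooth n \<delta> (\<lambda>x. c * f x) x = c * smooth n \<delta> f x"
  unfolding smooth_def by (rule avgs_scale)

lemma smooth_zero: "smooth n \<delta> (\<lambda>_. 0) x = 0"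
  unfolding smooth_def by (rule avgs_zero)

lemma vnorm_mv_ge: "vnorm n x - \<bar>s\<bar> * vnorm n w \<le> vnorm n (mv n x s w)"
  using vnorm_dist[of n "mv n x s w" x] vdist_mv[of n x s w] by linarith

lemma lipK_zero: "lipK n 0 (\<lambda>_. 0)"
  by (simp add: lipK_def)

lemma smooth_support:
  fixes \<delta> :: real
  assumes f: "lipK n K f" "0 \<le> K" and d: "0 < \<delta>" and R: "\<And>x. x \<in> Rn n \<Longrightarrow> R \<le> vnorm n x \<Longrightarrow> f x = 0"
    and x: "x \<in> Rn n" "R + real (2 * n * n) * \<delta> < vnorm n x"
  shows "smooth n \<delta> f x = 0"
proof -
  have z: "f (mv n x 1 w) = 0" if "vnorm n w \<le> real (2 * n * n) * \<delta>" for w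
    by (rule R) (use vnorm_mv_ge[of n x 1 w] that x in auto)
  have "smooth n \<delta> f x \<le> smooth n \<delta> (\<lambda>_. 0) x + 0"
    by (rule smooth_mono[OF f(1) d f(2) lipK_zero[of n] x(1) x(1)]) (use z in auto)
  moreover have "smooth n \<delta> (\<lambda>_. 0) x \<le> smooth n \<delta> f x + 0"
    by (rule smooth_mono[OF lipK_zero d order_refl f(1) x(1) x(1)]) (use z in auto)
  ultimately show ?thesis by (simp add: smooth_zero)
qed

lemma lipK_shift:
  assumes f: "lipK n K f" and i: "i < n"
  shows "lipK n K (\<lambda>x. f (x(i := x i + s)))"
  unfolding lipK_def
proof (intro ballI)
  fix x y assume "x \<in> Rn n" "y \<in> Rn n"
  then show "\<bar>f (x(i := x i + s)) - f (y(i := y i + s))\<bar> \<le> K * vdist n x y"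
    using lipKD[OF f, of "x(i := x i + s)" "y(i := y i + s)"] i by (simp add: vdist_shift)
qed

text \<open>Both inequalities come from \<open>smooth_mono\<close> with error 0, since translates of
  the two base points by the same \<open>w\<close> lead to the same values.\<close>

lemma smooth_shift:
  assumes f: "lipK n K f" "0 \<le> K" and d: "0 < \<delta>" and i: "i < n" and x: "x \<in> Rn n"
  shows "smooth n \<delta> (\<lambda>x. f (x(i := x i + s))) x = smooth n \<delta> f (x(i := x i + s))"
proof -
  have xi: "x(i := x i + s) \<in> Rn n" using x i by simp
  have e: "(mv n x 1 w)(i := mv n x 1 w i + s) = mv n (x(i := x i + s)) 1 w" for w
    using i by (auto simp: mv_def fun_eq_iff)
  have "smooth n \<delta> (\<lambda>x. f (x(i := x i + s))) x \<le> smooth n \<delta> f (x(i := x i + s)) + 0"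
    by (rule smooth_mono[OF lipK_shift[OF f(1) i] d f(2) f(1) x xi]) (simp only: e add_0_right order_refl)
  moreover have "smooth n \<delta> f (x(i := x i + s)) \<le> smooth n \<delta> (\<lambda>x. f (x(i := x i + s))) x + 0"
    by (rule smooth_mono[OF f(1) d f(2) lipK_shift[OF f(1) i] xi x]) (simp only: e add_0_right order_refl)
  ultimately show ?thesis by simp
qed

lemma lipc_lipK: "lipc n \<phi> \<Longrightarrow> lipK n 1 \<phi>"
  by (simp add: lipc_def lip1_def lipK_def)

lemma lipc_shift:
  assumes f: "lipc n \<phi>" and i: "i < n"
  shows "lipc n (\<lambda>x. \<phi> (x(i := x i + s)))"
proof -
  obtain R where R: "\<And>x. x \<in> Rn n \<Longrightarrow> R \<le> vnorm n x \<Longrightarrow> \<phi> x = 0" using f unfolding lipc_def by auto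
  have "lip1 n (\<lambda>x. \<phi> (x(i := x i + s)))" using lipK_shift[OF lipc_lipK[OF f] i, of s] by (simp add: lip1_def lipK_def)
  moreover have "\<phi> (x(i := x i + s)) = 0" if x: "x \<in> Rn n" "R + \<bar>s\<bar> \<le> vnorm n x" for x
  proof (rule R)
    have "vdist n (x(i := x i + s)) x = \<bar>s\<bar>" using vdist_upd[OF i, of x "x i + s" "x i"] by simp
    then show "R \<le> vnorm n (x(i := x i + s))" using vnorm_dist[of n "x(i := x i + s)" x] x by linarith
  qed (use x i in simp)
  ultimately show ?thesis unfolding lipc_def by blast
qed

lemma vdist_mv_diff: "vdist n (mv n x s b) (mv n y s c) \<le> vdist n x y + \<bar>s\<bar> * vdist n b c"
proof -
  have "vdist n (mv n x s b) (mv n y s c) = vnorm n (\<lambda>i. (x i - y i) + s * (b i - c i))"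
    unfolding vdist_def by (rule vnorm_cong) (simp add: algebra_simps)
  also have "\<dots> \<le> vdist n x y + vnorm n (\<lambda>i. s * (b i - c i))" unfolding vdist_def by (rule vnorm_add)
  finally show ?thesis by (simp add: vnorm_cmult vdist_def)
qed

lemma vdist_uminus: "vdist n (\<lambda>i. - b i) (\<lambda>i. - c i) = vdist n b c"
proof -
  have "vdist n (\<lambda>i. - b i) (\<lambda>i. - c i) = vnorm n (\<lambda>i. - (b i - c i))" unfolding vdist_def by (rule vnorm_cong) simp
  then show ?thesis by (simp only: vnorm_minus vdist_def)
qed

lemma P1_lipK_integrable: "\<mu> \<in> P1 n \<Longrightarrow> lipK n K f \<Longrightarrow> integrable \<mu> f"
  by (rule P1_lip_integrable[where C = K]) (auto simp: lipK_def)

text \<open>Two flows known only through weak equations against compactly supported smoothed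
  functions and through continuity at time 0. The drift gap may grow like
  \<open>exp (A * t)\<close>; \<open>C < A\<close> lets the weight outgrow the rate \<open>C\<close>
  at which Lipschitz drifts separate points.\<close>

locale fp_pair =
  fixes n :: nat and m1 m2 :: "real \<Rightarrow> vec measure" and \<beta>1 \<beta>2 :: "vec \<Rightarrow> real \<Rightarrow> vec" and Bb C A k :: real
  assumes P: "\<And>t. 0 \<le> t \<Longrightarrow> m1 t \<in> P1 n" "\<And>t. 0 \<le> t \<Longrightarrow> m2 t \<in> P1 n"
    and init: "m1 0 = m2 0"
    and cont: "((\<lambda>s. d1 n (m1 s) (m1 0)) \<longlongrightarrow> 0) (at_right 0)" "((\<lambda>s. d1 n (m2 s) (m2 0)) \<longlongrightarrow> 0) (at_right 0)"
    and W1: "\<And>\<phi> K \<delta> R t. lipK n K \<phi> \<Longrightarrow> 0 \<le> K \<Longrightarrow> 0 < \<delta> \<Longrightarrow> (\<And>x. x \<in> Rn n \<Longrightarrow> R < vnorm n x \<Longrightarrow> smooth n \<delta> \<phi> x = 0) \<Longrightarrow> 0 < t \<Longrightarrow>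
      ((\<lambda>t. \<integral>x. smooth n \<delta> \<phi> x \<partial>m1 t) has_real_derivative (\<integral>x. (\<Sum>i<n. sDD n \<delta> \<phi> i x - sD n \<delta> \<phi> i x * \<beta>1 x t i) \<partial>m1 t)) (at t)"
    and W2: "\<And>\<phi> K \<delta> R t. lipK n K \<phi> \<Longrightarrow> 0 \<le> K \<Longrightarrow> 0 < \<delta> \<Longrightarrow> (\<And>x. x \<in> Rn n \<Longrightarrow> R < vnorm n x \<Longrightarrow> smooth n \<delta> \<phi> x = 0) \<Longrightarrow> 0 < t \<Longrightarrow>
      ((\<lambda>t. \<integral>x. smooth n \<delta> \<phi> x \<partial>m2 t) has_real_derivative (\<integral>x. (\<Sum>i<n. sDD n \<delta> \<phi> i x - sD n \<delta> \<phi> i x * \<beta>2 x t i) \<partial>m2 t)) (at t)"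
    and bb: "\<And>x t. x \<in> Rn n \<Longrightarrow> 0 < t \<Longrightarrow> vnorm n (\<beta>1 x t) \<le> Bb" "\<And>x t. x \<in> Rn n \<Longrightarrow> 0 < t \<Longrightarrow> vnorm n (\<beta>2 x t) \<le> Bb"
    and bl: "\<And>x y t. x \<in> Rn n \<Longrightarrow> y \<in> Rn n \<Longrightarrow> 0 < t \<Longrightarrow> vdist n (\<beta>1 x t) (\<beta>1 y t) \<le> C * vdist n x y"
      "\<And>x y t. x \<in> Rn n \<Longrightarrow> y \<in> Rn n \<Longrightarrow> 0 < t \<Longrightarrow> vdist n (\<beta>2 x t) (\<beta>2 y t) \<le> C * vdist n x y"
    and bg: "\<And>x t. x \<in> Rn n \<Longrightarrow> 0 < t \<Longrightarrow> vdist n (\<beta>1 x t) (\<beta>2 x t) \<le> k * exp (A * t)"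
    and pos: "0 \<le> Bb" "0 \<le> C" "C < A" "0 \<le> k"
begin

definition q :: "real \<Rightarrow> (vec \<Rightarrow> real) \<Rightarrow> real \<Rightarrow> real" where
  "q \<delta> \<phi> t = (\<integral>x. smooth n \<delta> \<phi> x \<partial>m1 t) - (\<integral>x. smooth n \<delta> \<phi> x \<partial>m2 t)"

definition q' :: "real \<Rightarrow> (vec \<Rightarrow> real) \<Rightarrow> real \<Rightarrow> real" where
  "q' \<delta> \<phi> t = (\<integral>x. (\<Sum>i<n. sDD n \<delta> \<phi> i x - sD n \<delta> \<phi> i x * \<beta>1 x t i) \<partial>m1 t)
    - (\<integral>x. (\<Sum>i<n. sDD n \<delta> \<phi> i x - sD n \<delta> \<phi> i x * \<beta>2 x t i) \<partial>m2 t)"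

context
  fixes \<delta> :: real
  assumes d: "0 < \<delta>"
begin

lemma sm_lip: "lipc n \<phi> \<Longrightarrow> lipK n 1 (smooth n \<delta> \<phi>)"
  by (rule smooth_lip[OF lipc_lipK d]) auto

lemma q_derivative:
  assumes f: "lipc n \<phi>" and t: "0 < t"
  shows "(q \<delta> \<phi> has_real_derivative q' \<delta> \<phi> t) (at t)"
proof -
  obtain R where R: "\<And>x. x \<in> Rn n \<Longrightarrow> R \<le> vnorm n x \<Longrightarrow> \<phi> x = 0" using f unfolding lipc_def by auto
  have s: "smooth n \<delta> \<phi> x = 0" if "x \<in> Rn n" "R + 2 * n * n * \<delta> < vnorm n x" for x
    by (rule smooth_support[OF lipc_lipK[OF f] _ d R that]) auto
  show ?thesis unfolding q_def[abs_def] q'_def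
    by (intro DERIV_diff W1[OF lipc_lipK[OF f] _ d s t] W2[OF lipc_lipK[OF f] _ d s t]) auto
qed

lemma q_limit:
  assumes f: "lipc n \<phi>"
  shows "(q \<delta> \<phi> \<longlongrightarrow> 0) (at_right 0)"
proof -
  have one: "((\<lambda>t. \<integral>x. smooth n \<delta> \<phi> x \<partial>m t) \<longlongrightarrow> (\<integral>x. smooth n \<delta> \<phi> x \<partial>m 0)) (at_right 0)"
    if m: "\<And>t. 0 \<le> t \<Longrightarrow> m t \<in> P1 n" and c: "((\<lambda>s. d1 n (m s) (m 0)) \<longlongrightarrow> 0) (at_right 0)" for m :: "real \<Rightarrow> vec measure"
  proof (rule tendstoI)
    fix e :: real assume e: "0 < e"
    have "\<forall>\<^sub>F s in at_right 0. d1 n (m s) (m 0) < ennreal (e / 2)" by (rule order_tendstoD(2)[OF c]) (use e in simp)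
    moreover have "\<forall>\<^sub>F s in at_right (0::real). 0 < s" by (simp add: eventually_at_right_less)
    ultimately show "\<forall>\<^sub>F s in at_right 0. dist (\<integral>x. smooth n \<delta> \<phi> x \<partial>m s) (\<integral>x. smooth n \<delta> \<phi> x \<partial>m 0) < e"
    proof eventually_elim
      case (elim s)
      have "\<bar>(\<integral>x. smooth n \<delta> \<phi> x \<partial>m s) - (\<integral>x. smooth n \<delta> \<phi> x \<partial>m 0)\<bar> \<le> 1 * (e / 2)"
        by (rule coupling_bound[OF m m _ _ elim(1)]) (use elim sm_lip[OF f] in \<open>auto simp: lipK_def\<close>)
      then show ?case using e by (simp add: dist_real_def)
    qed
  qed
  from tendsto_diff[OF one[OF P(1) cont(1)] one[OF P(2) cont(2)]] show ?thesis
    by (simp add: q_def[abs_def] init)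
qed

text \<open>The second derivative is replaced by a second difference of step \<open>h\<close>. Its
  outer terms are the functional at translates of \<open>\<phi>\<close>, which are again admissible
  and hence contribute at most \<open>S\<close> each; the middle term is the damping
  \<open>- 2 * q / h^2\<close>.\<close>

lemma diffusion_step:
  assumes f: "lipc n \<phi>" and t: "0 < t" and h: "0 < h" and i: "i < n"
    and S: "\<And>\<phi>. lipc n \<phi> \<Longrightarrow> q \<delta> \<phi> t \<le> S"
  shows "(\<integral>x. sDD n \<delta> \<phi> i x \<partial>m1 t) - (\<integral>x. sDD n \<delta> \<phi> i x \<partial>m2 t) \<le> (2 * S - 2 * q \<delta> \<phi> t) / h\<^sup>2 + 16 / \<delta>\<^sup>2 * h"
proof -
  have t0: "0 \<le> t" using t by simp
  define w where "w = smooth n \<delta> \<phi>"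
  define u where "u s = smooth n \<delta> (\<lambda>x. \<phi> (x(i := x i + s)))" for s
  have u: "u s x = w (x(i := x i + s))" if "x \<in> Rn n" for s x
    unfolding u_def w_def by (rule smooth_shift[OF lipc_lipK[OF f] _ d i that]) simp
  define v where "v x = u h x + u (- h) x - 2 * w x" for x
  define E where "E = 8 / \<delta>\<^sup>2 * h ^ 3"
  have tay: "\<bar>v x - h\<^sup>2 * sDD n \<delta> \<phi> i x\<bar> \<le> E" if x: "x \<in> Rn n" for x
    using smooth_taylor2[OF lipc_lipK[OF f] d _ x i h] unfolding v_def u[OF x] w_def E_def by simp
  have tay1: "h\<^sup>2 * sDD n \<delta> \<phi> i x \<le> v x + E" and tay2: "v x - E \<le> h\<^sup>2 * sDD n \<delta> \<phi> i x" if x: "x \<in> Rn n" for x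
    using tay[OF x] by linarith+
  have lsh: "lipc n (\<lambda>x. \<phi> (x(i := x i + s)))" for s by (rule lipc_shift[OF f i])
  have each: "integrable m v" "integrable m (sDD n \<delta> \<phi> i)" "prob_space m" "space m = Rn n"
    "(\<integral>x. v x \<partial>m) = (\<integral>x. u h x \<partial>m) + (\<integral>x. u (- h) x \<partial>m) - 2 * (\<integral>x. w x \<partial>m)" if m: "m \<in> P1 n" for m
  proof -
    have iu: "integrable m (u s)" "integrable m w" for s
      unfolding u_def w_def using P1_lipK_integrable[OF m sm_lip[OF lsh]] P1_lipK_integrable[OF m sm_lip[OF f]] by auto
    show "integrable m v" "(\<integral>x. v x \<partial>m) = (\<integral>x. u h x \<partial>m) + (\<integral>x. u (- h) x \<partial>m) - 2 * (\<integral>x. w x \<partial>m)"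
      unfolding v_def using iu by simp_all
    show "integrable m (sDD n \<delta> \<phi> i)" by (rule P1_lipK_integrable[OF m sDD_lip[OF lipc_lipK[OF f] d _ i]]) simp
    show "prob_space m" "space m = Rn n" using P1D[OF m] by auto
  qed
  have up: "h\<^sup>2 * (\<integral>x. sDD n \<delta> \<phi> i x \<partial>m1 t) \<le> (\<integral>x. v x \<partial>m1 t) + E"
  proof -
    interpret prob_space "m1 t" by (rule each(3)[OF P(1)[OF t0]])
    have "(\<integral>x. h\<^sup>2 * sDD n \<delta> \<phi> i x \<partial>m1 t) \<le> (\<integral>x. v x + E \<partial>m1 t)"
      by (rule integral_mono) (use each(1,2,4)[OF P(1)[OF t0]] in \<open>simp_all add: tay1\<close>)
    then show ?thesis using each(1)[OF P(1)[OF t0]] by (simp add: prob_space)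
  qed
  have lo: "(\<integral>x. v x \<partial>m2 t) - E \<le> h\<^sup>2 * (\<integral>x. sDD n \<delta> \<phi> i x \<partial>m2 t)"
  proof -
    interpret prob_space "m2 t" by (rule each(3)[OF P(2)[OF t0]])
    have "(\<integral>x. v x - E \<partial>m2 t) \<le> (\<integral>x. h\<^sup>2 * sDD n \<delta> \<phi> i x \<partial>m2 t)"
      by (rule integral_mono) (use each(1,2,4)[OF P(2)[OF t0]] in \<open>simp_all add: tay2\<close>)
    then show ?thesis using each(1)[OF P(2)[OF t0]] by (simp add: prob_space)
  qed
  have "(\<integral>x. v x \<partial>m1 t) - (\<integral>x. v x \<partial>m2 t) = q \<delta> (\<lambda>x. \<phi> (x(i := x i + h))) t + q \<delta> (\<lambda>x. \<phi> (x(i := x i + - h))) t - 2 * q \<delta> \<phi> t"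
    unfolding each(5)[OF P(1)[OF t0]] each(5)[OF P(2)[OF t0]] q_def u_def w_def by simp
  also have "\<dots> \<le> 2 * S - 2 * q \<delta> \<phi> t" using S[OF lsh, of h] S[OF lsh, of "- h"] by linarith
  finally have "h\<^sup>2 * ((\<integral>x. sDD n \<delta> \<phi> i x \<partial>m1 t) - (\<integral>x. sDD n \<delta> \<phi> i x \<partial>m2 t)) \<le> 2 * S - 2 * q \<delta> \<phi> t + 2 * E"
    using up lo by (simp add: right_diff_distrib)
  then have "(\<integral>x. sDD n \<delta> \<phi> i x \<partial>m1 t) - (\<integral>x. sDD n \<delta> \<phi> i x \<partial>m2 t) \<le> (2 * S - 2 * q \<delta> \<phi> t + 2 * E) / h\<^sup>2"
    using h by (simp add: pos_le_divide_eq mult.commute)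
  also have "\<dots> = (2 * S - 2 * q \<delta> \<phi> t) / h\<^sup>2 + 16 / \<delta>\<^sup>2 * h"
    using h by (simp add: E_def add_divide_distrib power2_eq_square power3_eq_cube)
  finally show ?thesis .
qed

lemma drift_integrable:
  assumes f: "lipc n \<phi>" and m: "m \<in> P1 n"
    and b: "\<And>x. x \<in> Rn n \<Longrightarrow> vnorm n (b x) \<le> Bb" "\<And>x y. x \<in> Rn n \<Longrightarrow> y \<in> Rn n \<Longrightarrow> vdist n (b x) (b y) \<le> C * vdist n x y"
  shows "integrable m (\<lambda>x. \<Sum>i<n. sD n \<delta> \<phi> i x * b x i)"
proof (rule Bochner_Integration.integrable_sum)
  fix i assume "i \<in> {..<n}"
  then have i: "i < n" by simp
  show "integrable m (\<lambda>x. sD n \<delta> \<phi> i x * b x i)"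
  proof (rule P1_lipK_integrable[OF m, where K = "2 * 1 / \<delta> * Bb + C"], unfold lipK_def, intro ballI)
    fix x y assume xy: "x \<in> Rn n" "y \<in> Rn n"
    have 1: "\<bar>sD n \<delta> \<phi> i x - sD n \<delta> \<phi> i y\<bar> \<le> 2 * 1 / \<delta> * vdist n x y"
      by (rule lipKD[OF sD_lip[OF lipc_lipK[OF f] d _ i] xy]) simp
    have 2: "\<bar>sD n \<delta> \<phi> i y\<bar> \<le> 1" by (rule sD_bound[OF lipc_lipK[OF f] d _ i xy(2)]) simp
    have 3: "\<bar>b x i\<bar> \<le> Bb" using vnorm_comp[OF i, of "b x"] b(1)[OF xy(1)] by simp
    have 4: "\<bar>b x i - b y i\<bar> \<le> C * vdist n x y" using vnorm_comp[OF i, of "\<lambda>i. b x i - b y i"] b(2)[OF xy] by (simp add: vdist_def)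
    have "\<bar>sD n \<delta> \<phi> i x * b x i - sD n \<delta> \<phi> i y * b y i\<bar> = \<bar>(sD n \<delta> \<phi> i x - sD n \<delta> \<phi> i y) * b x i + sD n \<delta> \<phi> i y * (b x i - b y i)\<bar>"
      by (simp add: algebra_simps)
    also have "\<dots> \<le> \<bar>sD n \<delta> \<phi> i x - sD n \<delta> \<phi> i y\<bar> * \<bar>b x i\<bar> + \<bar>sD n \<delta> \<phi> i y\<bar> * \<bar>b x i - b y i\<bar>"
      by (rule order_trans[OF abs_triangle_ineq]) (simp add: abs_mult)
    also have "\<dots> \<le> (2 * 1 / \<delta> * vdist n x y) * Bb + 1 * (C * vdist n x y)"
      by (intro add_mono mult_mono 1 2 3 4) (use d pos in auto)
    finally show "\<bar>sD n \<delta> \<phi> i x * b x i - sD n \<delta> \<phi> i y * b y i\<bar> \<le> (2 * 1 / \<delta> * Bb + C) * vdist n x y"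
      by (simp add: algebra_simps)
  qed
qed

text \<open>An Euler step: \<open>\<phi>\<close> is composed with the map \<open>X1\<close> along
  \<open>- \<beta>1\<close>, whose Lipschitz constant is \<open>1 + h * C\<close>, so the rescaled
  composition \<open>\<Psi>\<close> is admissible. Exchanging smoothing and Euler step costs
  \<open>C * r\<close> for each measure, using \<open>\<beta>2\<close> for the second measure costs
  the drift gap, and linearising costs order \<open>h\<close>.\<close>

lemma drift_step:
  assumes f: "lipc n \<phi>" and t: "0 < t" and h: "0 < h"
    and S: "\<And>\<phi>. lipc n \<phi> \<Longrightarrow> q \<delta> \<phi> t \<le> S"
  shows "(\<integral>x. (\<Sum>i<n. sD n \<delta> \<phi> i x * \<beta>2 x t i) \<partial>m2 t) - (\<integral>x. (\<Sum>i<n. sD n \<delta> \<phi> i x * \<beta>1 x t i) \<partial>m1 t)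
    \<le> (S - q \<delta> \<phi> t) / h + C * S + k * exp (A * t) + 4 * n * n * \<delta> * C + 4 / \<delta> * n * Bb\<^sup>2 * h"
proof -
  have t0: "0 \<le> t" using t by simp
  \<comment> \<open>A crude bound for the displacement caused by smoothing: at most
    \<open>2 * n\<close> averages of length \<open>\<delta>\<close> in each of \<open>n\<close>
    coordinates.\<close>
  define r where "r = 2 * real n * real n * \<delta>"
  define T where "T = 2 / \<delta> * n * Bb\<^sup>2"
  define w where "w = smooth n \<delta> \<phi>"
  define X1 where "X1 x = mv n x h (\<lambda>i. - \<beta>1 x t i)" for x
  define X2 where "X2 x = mv n x h (\<lambda>i. - \<beta>2 x t i)" for x
  have XR: "X1 x \<in> Rn n" "X2 x \<in> Rn n" for x by (simp_all add: X1_def X2_def)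
  have X1l: "vdist n (X1 x) (X1 y) \<le> (1 + h * C) * vdist n x y" if "x \<in> Rn n" "y \<in> Rn n" for x y
  proof -
    have "vdist n (X1 x) (X1 y) \<le> vdist n x y + h * vdist n (\<beta>1 x t) (\<beta>1 y t)"
      using vdist_mv_diff[of n x h "\<lambda>i. - \<beta>1 x t i" y "\<lambda>i. - \<beta>1 y t i"] h by (simp add: X1_def vdist_uminus)
    also have "\<dots> \<le> vdist n x y + h * (C * vdist n x y)" using bl(1)[OF that t] h by (intro add_left_mono mult_left_mono) auto
    finally show ?thesis by (simp add: algebra_simps)
  qed
  have hC: "0 < 1 + h * C" using h pos by (simp add: add_pos_nonneg)
  have tay: "\<bar>w (mv n x h (\<lambda>i. - b i)) - w x + h * (\<Sum>i<n. sD n \<delta> \<phi> i x * b i)\<bar> \<le> T * h\<^sup>2"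
    if x: "x \<in> Rn n" and b: "vnorm n b \<le> Bb" for x b
  proof -
    have "\<bar>w (mv n x h (\<lambda>i. - b i)) - w x - h * (\<Sum>i<n. sD n \<delta> \<phi> i x * - b i)\<bar> \<le> (2 * 1 / \<delta>) * n * (vnorm n (\<lambda>i. - b i))\<^sup>2 * h\<^sup>2"
      unfolding w_def by (rule smooth_taylor1[OF lipc_lipK[OF f] d _ x]) (use h in auto)
    also have "\<dots> \<le> (2 * 1 / \<delta>) * n * Bb\<^sup>2 * h\<^sup>2"
      unfolding vnorm_minus using b d by (intro mult_right_mono mult_left_mono power_mono) auto
    finally show ?thesis by (simp add: T_def sum_negf)
  qed
  define \<Phi> where "\<Phi> x = \<phi> (X1 x)" for x
  have Pl: "lipK n (1 + h * C) \<Phi>" unfolding lipK_def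
  proof (intro ballI)
    fix x y assume xy: "x \<in> Rn n" "y \<in> Rn n"
    have "\<bar>\<Phi> x - \<Phi> y\<bar> \<le> 1 * vdist n (X1 x) (X1 y)" unfolding \<Phi>_def by (rule lipKD[OF lipc_lipK[OF f] XR(1) XR(1)])
    then show "\<bar>\<Phi> x - \<Phi> y\<bar> \<le> (1 + h * C) * vdist n x y" using X1l[OF xy] by simp
  qed
  define \<Psi> where "\<Psi> x = (1 / (1 + h * C)) * \<Phi> x" for x
  have Psc: "lipc n \<Psi>"
  proof -
    obtain R where R: "\<And>x. x \<in> Rn n \<Longrightarrow> R \<le> vnorm n x \<Longrightarrow> \<phi> x = 0" using f unfolding lipc_def by auto
    have "lip1 n \<Psi>" unfolding lip1_def
    proof (intro ballI)
      fix x y assume xy: "x \<in> Rn n" "y \<in> Rn n"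
      have "\<bar>\<Psi> x - \<Psi> y\<bar> = (1 / (1 + h * C)) * \<bar>\<Phi> x - \<Phi> y\<bar>"
        unfolding \<Psi>_def right_diff_distrib[symmetric] abs_mult using hC by simp
      also have "\<dots> \<le> (1 / (1 + h * C)) * ((1 + h * C) * vdist n x y)" using lipKD[OF Pl xy] hC by (intro mult_left_mono) auto
      finally show "\<bar>\<Psi> x - \<Psi> y\<bar> \<le> vdist n x y" using hC by simp
    qed
    moreover have "\<Psi> x = 0" if x: "x \<in> Rn n" "R + h * Bb \<le> vnorm n x" for x
    proof -
      have "vnorm n x - h * vnorm n (\<beta>1 x t) \<le> vnorm n (X1 x)"
        using vnorm_mv_ge[of n x h "\<lambda>i. - \<beta>1 x t i"] h by (simp add: X1_def vnorm_minus)
      moreover have "h * vnorm n (\<beta>1 x t) \<le> h * Bb" using bb(1)[OF x(1) t] h by (intro mult_left_mono) auto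
      ultimately have "\<phi> (X1 x) = 0" using x by (intro R XR) linarith
      then show ?thesis by (simp add: \<Psi>_def \<Phi>_def)
    qed
    ultimately show ?thesis unfolding lipc_def by blast
  qed
  have shift: "vdist n (mv n (mv n x h b) 1 z) (mv n (mv n x 1 z) h c) = h * vdist n b c" for x b z c
  proof -
    have "vdist n (mv n (mv n x h b) 1 z) (mv n (mv n x 1 z) h c) = vnorm n (\<lambda>i. h * (b i - c i))"
      unfolding vdist_def by (rule vnorm_cong) (simp add: algebra_simps)
    then show ?thesis using h by (simp add: vnorm_cmult vdist_def)
  qed
  have cmp1: "w (X1 x) \<le> smooth n \<delta> \<Phi> x + h * (C * r)" if x: "x \<in> Rn n" for x
    unfolding w_def
  proof (rule smooth_mono[OF lipc_lipK[OF f] d _ Pl XR(1) x])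
    fix z assume z: "vnorm n z \<le> 2 * n * n * \<delta>"
    have "\<bar>\<phi> (mv n (X1 x) 1 z) - \<Phi> (mv n x 1 z)\<bar> \<le> 1 * vdist n (mv n (X1 x) 1 z) (X1 (mv n x 1 z))"
      unfolding \<Phi>_def by (rule lipKD[OF lipc_lipK[OF f]]) (auto simp: XR)
    also have "\<dots> = h * vdist n (\<beta>1 x t) (\<beta>1 (mv n x 1 z) t)" unfolding X1_def shift vdist_uminus by simp
    also have "\<dots> \<le> h * (C * r)"
    proof (rule mult_left_mono)
      have "vdist n (\<beta>1 x t) (\<beta>1 (mv n x 1 z) t) \<le> C * vdist n x (mv n x 1 z)" by (rule bl(1)[OF x mv_Rn t])
      also have "\<dots> \<le> C * r" using z pos vdist_mv[of n x 1 z] by (intro mult_left_mono) (auto simp: r_def vdist_commute)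
      finally show "vdist n (\<beta>1 x t) (\<beta>1 (mv n x 1 z) t) \<le> C * r" .
    qed (use h in simp)
    finally show "\<phi> (mv n (X1 x) 1 z) \<le> \<Phi> (mv n x 1 z) + h * (C * r)" by linarith
  qed simp
  have cmp2: "smooth n \<delta> \<Phi> x \<le> w (X2 x) + h * (C * r + k * exp (A * t))" if x: "x \<in> Rn n" for x
    unfolding w_def
  proof (rule smooth_mono[OF Pl d _ lipc_lipK[OF f] x XR(2)])
    show "0 \<le> 1 + h * C" using hC by simp
    fix z assume z: "vnorm n z \<le> 2 * n * n * \<delta>"
    have "\<bar>\<Phi> (mv n x 1 z) - \<phi> (mv n (X2 x) 1 z)\<bar> \<le> 1 * vdist n (X1 (mv n x 1 z)) (mv n (X2 x) 1 z)"
      unfolding \<Phi>_def by (rule lipKD[OF lipc_lipK[OF f]]) (auto simp: XR)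
    also have "\<dots> = h * vdist n (\<beta>2 x t) (\<beta>1 (mv n x 1 z) t)"
      using shift[of x "\<lambda>i. - \<beta>2 x t i" z "\<lambda>i. - \<beta>1 (mv n x 1 z) t i"]
      unfolding X1_def X2_def vdist_uminus by (simp add: vdist_commute)
    also have "\<dots> \<le> h * (C * r + k * exp (A * t))"
    proof (rule mult_left_mono)
      have "vdist n (\<beta>1 x t) (\<beta>1 (mv n x 1 z) t) \<le> C * vdist n x (mv n x 1 z)" by (rule bl(1)[OF x mv_Rn t])
      also have "\<dots> \<le> C * r" using z pos vdist_mv[of n x 1 z] by (intro mult_left_mono) (auto simp: r_def vdist_commute)
      finally show "vdist n (\<beta>2 x t) (\<beta>1 (mv n x 1 z) t) \<le> C * r + k * exp (A * t)"
        using bg[OF x t] vdist_triangle[of n "\<beta>2 x t" "\<beta>1 (mv n x 1 z) t" "\<beta>1 x t"] vdist_commute[of n "\<beta>2 x t" "\<beta>1 x t"] by linarith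
    qed (use h in simp)
    finally show "\<Phi> (mv n x 1 z) \<le> \<phi> (mv n (X2 x) 1 z) + h * (C * r + k * exp (A * t))" by linarith
  qed
  have wl: "lipK n 1 w" unfolding w_def by (rule sm_lip[OF f])
  have sPl: "lipK n (1 + h * C) (smooth n \<delta> \<Phi>)" by (rule smooth_lip[OF Pl d]) (use hC in simp)
  define D1 where "D1 x = (\<Sum>i<n. sD n \<delta> \<phi> i x * \<beta>1 x t i)" for x
  define D2 where "D2 x = (\<Sum>i<n. sD n \<delta> \<phi> i x * \<beta>2 x t i)" for x
  have i1: "integrable (m1 t) D1" unfolding D1_def by (rule drift_integrable[OF f P(1)[OF t0] bb(1)[OF _ t] bl(1)[OF _ _ t]])
  have i2: "integrable (m2 t) D2" unfolding D2_def by (rule drift_integrable[OF f P(2)[OF t0] bb(2)[OF _ t] bl(2)[OF _ _ t]])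
  have I: "integrable (m1 t) w" "integrable (m2 t) w" "integrable (m1 t) (smooth n \<delta> \<Phi>)" "integrable (m2 t) (smooth n \<delta> \<Phi>)"
    using P1_lipK_integrable[OF P(1)[OF t0]] P1_lipK_integrable[OF P(2)[OF t0]] wl sPl by blast+
  have one: "- (h * (\<integral>x. D1 x \<partial>m1 t)) \<le> (\<integral>x. smooth n \<delta> \<Phi> x \<partial>m1 t) - (\<integral>x. w x \<partial>m1 t) + (h * (C * r) + T * h\<^sup>2)"
  proof -
    interpret prob_space "m1 t" using P1D[OF P(1)[OF t0]] by simp
    have "(\<integral>x. - (h * D1 x) \<partial>m1 t) \<le> (\<integral>x. smooth n \<delta> \<Phi> x - w x + (h * (C * r) + T * h\<^sup>2) \<partial>m1 t)"
    proof (rule integral_mono)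
      fix x assume "x \<in> space (m1 t)"
      then have x: "x \<in> Rn n" using P1D(4)[OF P(1)[OF t0]] by simp
      have "\<bar>w (X1 x) - w x + h * D1 x\<bar> \<le> T * h\<^sup>2" unfolding X1_def D1_def by (rule tay[OF x bb(1)[OF x t]])
      then show "- (h * D1 x) \<le> smooth n \<delta> \<Phi> x - w x + (h * (C * r) + T * h\<^sup>2)" using cmp1[OF x] by linarith
    qed (use i1 I in auto)
    then show ?thesis using i1 I by (simp add: prob_space)
  qed
  have two: "(\<integral>x. smooth n \<delta> \<Phi> x \<partial>m2 t) - (\<integral>x. w x \<partial>m2 t) - (h * (C * r + k * exp (A * t)) + T * h\<^sup>2) \<le> - (h * (\<integral>x. D2 x \<partial>m2 t))"
  proof -
    interpret prob_space "m2 t" using P1D[OF P(2)[OF t0]] by simp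
    have "(\<integral>x. smooth n \<delta> \<Phi> x - w x - (h * (C * r + k * exp (A * t)) + T * h\<^sup>2) \<partial>m2 t) \<le> (\<integral>x. - (h * D2 x) \<partial>m2 t)"
    proof (rule integral_mono)
      fix x assume "x \<in> space (m2 t)"
      then have x: "x \<in> Rn n" using P1D(4)[OF P(2)[OF t0]] by simp
      have "\<bar>w (X2 x) - w x + h * D2 x\<bar> \<le> T * h\<^sup>2" unfolding X2_def D2_def by (rule tay[OF x bb(2)[OF x t]])
      then show "smooth n \<delta> \<Phi> x - w x - (h * (C * r + k * exp (A * t)) + T * h\<^sup>2) \<le> - (h * D2 x)" using cmp2[OF x] by linarith
    qed (use i2 I in auto)
    then show ?thesis using i2 I by (simp add: prob_space)
  qed
  have Phi: "(\<integral>x. smooth n \<delta> \<Phi> x \<partial>m1 t) - (\<integral>x. smooth n \<delta> \<Phi> x \<partial>m2 t) \<le> (1 + h * C) * S"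
  proof -
    have "\<Phi> = (\<lambda>x. (1 + h * C) * \<Psi> x)" using hC by (auto simp: \<Psi>_def)
    then have "smooth n \<delta> \<Phi> x = (1 + h * C) * smooth n \<delta> \<Psi> x" for x using smooth_scale[of n \<delta> "1 + h * C" \<Psi> x] by simp
    then have "(\<integral>x. smooth n \<delta> \<Phi> x \<partial>m1 t) - (\<integral>x. smooth n \<delta> \<Phi> x \<partial>m2 t) = (1 + h * C) * q \<delta> \<Psi> t"
      by (simp add: q_def right_diff_distrib)
    also have "\<dots> \<le> (1 + h * C) * S" using S[OF Psc] hC by (intro mult_left_mono) auto
    finally show ?thesis .
  qed
  have "h * ((\<integral>x. D2 x \<partial>m2 t) - (\<integral>x. D1 x \<partial>m1 t)) \<le> (1 + h * C) * S - q \<delta> \<phi> t + h * (2 * (C * r) + k * exp (A * t)) + 2 * T * h\<^sup>2"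
    using one two Phi unfolding q_def w_def by (simp add: algebra_simps)
  also have "\<dots> = h * ((S - q \<delta> \<phi> t) / h + C * S + (2 * (C * r) + k * exp (A * t)) + 2 * T * h)"
    using h by (simp add: field_simps power2_eq_square)
  finally have "(\<integral>x. D2 x \<partial>m2 t) - (\<integral>x. D1 x \<partial>m1 t) \<le> (S - q \<delta> \<phi> t) / h + C * S + (2 * (C * r) + k * exp (A * t)) + 2 * T * h"
    using h by simp
  then show ?thesis unfolding D1_def D2_def r_def T_def by (simp add: algebra_simps)
qed

lemma q'_split:
  assumes f: "lipc n \<phi>" and t: "0 < t"
  shows "q' \<delta> \<phi> t = (\<Sum>i<n. (\<integral>x. sDD n \<delta> \<phi> i x \<partial>m1 t) - (\<integral>x. sDD n \<delta> \<phi> i x \<partial>m2 t))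
    + ((\<integral>x. (\<Sum>i<n. sD n \<delta> \<phi> i x * \<beta>2 x t i) \<partial>m2 t) - (\<integral>x. (\<Sum>i<n. sD n \<delta> \<phi> i x * \<beta>1 x t i) \<partial>m1 t))"
proof -
  have one: "(\<integral>x. (\<Sum>i<n. sDD n \<delta> \<phi> i x - sD n \<delta> \<phi> i x * b x i) \<partial>m)
    = (\<Sum>i<n. \<integral>x. sDD n \<delta> \<phi> i x \<partial>m) - (\<integral>x. (\<Sum>i<n. sD n \<delta> \<phi> i x * b x i) \<partial>m)"
    if m: "m \<in> P1 n" and b: "integrable m (\<lambda>x. \<Sum>i<n. sD n \<delta> \<phi> i x * b x i)" for m and b :: "vec \<Rightarrow> vec"
  proof -
    have i: "integrable m (\<lambda>x. sDD n \<delta> \<phi> i x)" if "i < n" for i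
      by (rule P1_lipK_integrable[OF m sDD_lip[OF lipc_lipK[OF f] d _ that]]) simp
    have "integrable m (\<lambda>x. \<Sum>i<n. sDD n \<delta> \<phi> i x)" by (intro Bochner_Integration.integrable_sum i) auto
    from Bochner_Integration.integral_diff[OF this b] show ?thesis
      unfolding sum_subtractf using Bochner_Integration.integral_sum[of "{..<n}" m "sDD n \<delta> \<phi>"] i by simp
  qed
  have t0: "0 \<le> t" using t by simp
  have "integrable (m1 t) (\<lambda>x. \<Sum>i<n. sD n \<delta> \<phi> i x * \<beta>1 x t i)"
    by (rule drift_integrable[OF f P(1)[OF t0] bb(1)[OF _ t] bl(1)[OF _ _ t]])
  moreover have "integrable (m2 t) (\<lambda>x. \<Sum>i<n. sD n \<delta> \<phi> i x * \<beta>2 x t i)"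
    by (rule drift_integrable[OF f P(2)[OF t0] bb(2)[OF _ t] bl(2)[OF _ _ t]])
  ultimately show ?thesis
    unfolding q'_def using one[OF P(1)[OF t0], of "\<lambda>x. \<beta>1 x t"] one[OF P(2)[OF t0], of "\<lambda>x. \<beta>2 x t"] by (simp add: sum_subtractf)
qed

text \<open>Degenerates for small \<open>\<delta>\<close> through the second derivatives; its
  purpose is to make the supremum in \<open>q_bound\<close> finite.\<close>

lemma q_a_priori:
  assumes f: "lipc n \<phi>" and t: "0 < t"
  shows "q \<delta> \<phi> t \<le> (2 * n * (2 / \<delta> + Bb)) / A * exp (A * t)"
proof -
  have A: "0 < A" using pos by simp
  define c where "c = real n * (2 / \<delta> + Bb)"
  have c0: "0 \<le> c" using d pos by (simp add: c_def)
  have bnd: "\<bar>\<integral>x. (\<Sum>i<n. sDD n \<delta> \<phi> i x - sD n \<delta> \<phi> i x * b x i) \<partial>m\<bar> \<le> c"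
    if m: "m \<in> P1 n" and b: "\<And>x. x \<in> Rn n \<Longrightarrow> vnorm n (b x) \<le> Bb" for m and b :: "vec \<Rightarrow> vec"
  proof -
    interpret prob_space m using P1D[OF m] by simp
    have pt: "\<bar>\<Sum>i<n. sDD n \<delta> \<phi> i x - sD n \<delta> \<phi> i x * b x i\<bar> \<le> c" if x: "x \<in> Rn n" for x
    proof -
      have "\<bar>\<Sum>i<n. sDD n \<delta> \<phi> i x - sD n \<delta> \<phi> i x * b x i\<bar> \<le> (\<Sum>i<n. 2 / \<delta> + Bb)"
      proof (rule order_trans[OF sum_abs], rule sum_mono)
        fix i assume "i \<in> {..<n}"
        then have i: "i < n" by simp
        have "\<bar>sD n \<delta> \<phi> i x * b x i\<bar> \<le> 1 * Bb" unfolding abs_mult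
          using sD_bound[OF lipc_lipK[OF f] d _ i x] vnorm_comp[OF i, of "b x"] b[OF x] by (intro mult_mono) auto
        then show "\<bar>sDD n \<delta> \<phi> i x - sD n \<delta> \<phi> i x * b x i\<bar> \<le> 2 / \<delta> + Bb"
          using sDD_bound[OF lipc_lipK[OF f] d _ i x] by simp
      qed
      then show ?thesis by (simp add: c_def)
    qed
    have "\<bar>\<integral>x. (\<Sum>i<n. sDD n \<delta> \<phi> i x - sD n \<delta> \<phi> i x * b x i) \<partial>m\<bar> \<le> (\<integral>x. \<bar>\<Sum>i<n. sDD n \<delta> \<phi> i x - sD n \<delta> \<phi> i x * b x i\<bar> \<partial>m)"
      by (rule integral_abs_bound)
    also have "\<dots> \<le> (\<integral>x. c \<partial>m)"
    proof (rule Bochner_Integration.integral_mono')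
      show "\<bar>\<Sum>i<n. sDD n \<delta> \<phi> i x - sD n \<delta> \<phi> i x * b x i\<bar> \<le> c" if "x \<in> space m" for x
        using pt P1D(4)[OF m] that by simp
    qed (use c0 in auto)
    finally show ?thesis by (simp add: prob_space)
  qed
  have "q \<delta> \<phi> t \<le> (2 * c) / (A + 0) * exp (A * t)"
  proof (rule backward_gronwall[OF q_derivative[OF f]])
    fix s :: real assume s: "0 < s"
    have "q' \<delta> \<phi> s \<le> 2 * c"
      using bnd[OF P(1)[OF less_imp_le[OF s]], of "\<lambda>x. \<beta>1 x s", OF bb(1)[OF _ s]]
        bnd[OF P(2)[OF less_imp_le[OF s]], of "\<lambda>x. \<beta>2 x s", OF bb(2)[OF _ s]] unfolding q'_def by linarith
    also have "2 * c * 1 \<le> 2 * c * exp (A * s)" using c0 A s by (intro mult_left_mono) auto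
    finally show "q' \<delta> \<phi> s \<le> 2 * c * exp (A * s) - 0 * q \<delta> \<phi> s" by simp
  qed (use A c0 t q_limit[OF f] in auto)
  then show ?thesis by (simp add: c_def mult.assoc)
qed

text \<open>\<open>\<Lambda>\<close> is the total rate of the discrete random walk:
  \<open>2 / h^2\<close> for each coordinate and \<open>1 / h\<close> for the Euler step. The bound
  \<open>S\<close> returns with the same rate, increased only by the growth
  \<open>C\<close>.\<close>

lemma q_step:
  assumes S0: "0 \<le> S" and S: "\<And>\<phi> t. lipc n \<phi> \<Longrightarrow> 0 < t \<Longrightarrow> q \<delta> \<phi> t \<le> S * exp (A * t)"
    and h: "0 < h" and f: "lipc n \<phi>" and t: "0 < t"
    and e: "e = 4 * n * n * \<delta> * C + 4 / \<delta> * n * Bb\<^sup>2 * h + n * (16 / \<delta>\<^sup>2 * h)" and L: "\<Lambda> = 2 * n / h\<^sup>2 + 1 / h"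
  shows "q \<delta> \<phi> t \<le> (S * (\<Lambda> + C) + k + e) / (A + \<Lambda>) * exp (A * t)"
proof -
  have L0: "0 < \<Lambda>" unfolding L using h by (simp add: add_nonneg_pos)
  have e0: "0 \<le> e" unfolding e using d pos h by simp
  show ?thesis
  proof (rule backward_gronwall[OF q_derivative[OF f]])
    fix s :: real assume s: "0 < s"
    define E where "E = exp (A * s)"
    have E: "1 \<le> E" unfolding E_def using s pos by simp
    have "q' \<delta> \<phi> s \<le> (\<Sum>i<n. (2 * (S * E) - 2 * q \<delta> \<phi> s) / h\<^sup>2 + 16 / \<delta>\<^sup>2 * h)
      + ((S * E - q \<delta> \<phi> s) / h + C * (S * E) + k * E + 4 * n * n * \<delta> * C + 4 / \<delta> * n * Bb\<^sup>2 * h)"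
      unfolding q'_split[OF f s] E_def
      by (intro add_mono sum_mono diffusion_step[OF f s h _ S[OF _ s]] drift_step[OF f s h S[OF _ s]]) auto
    also have "\<dots> = (\<Lambda> * S + C * S + k) * E + e - \<Lambda> * q \<delta> \<phi> s"
      unfolding L e using h by (simp add: field_simps)
    also have "e \<le> e * E" using e0 E by (simp add: mult_le_cancel_left1)
    finally show "q' \<delta> \<phi> s \<le> (S * (\<Lambda> + C) + k + e) * exp (A * s) - \<Lambda> * q \<delta> \<phi> s"
      unfolding E_def by (simp add: algebra_simps)
  qed (use pos L0 S0 e0 t q_limit[OF f] in auto)
qed

text \<open>For the best weighted bound \<open>S\<close>, \<open>q_step\<close> gives
  \<open>S * (A + \<Lambda>) \<le> S * (\<Lambda> + C) + k + e\<close>. The large rate cancels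
  exactly and leaves \<open>S * (A - C) \<le> k + e\<close>, where \<open>h\<close> can tend to 0 at
  fixed \<open>\<delta>\<close>.\<close>

lemma q_bound:
  assumes f: "lipc n \<phi>" and t: "0 < t"
  shows "q \<delta> \<phi> t \<le> (k + 4 * n * n * \<delta> * C) / (A - C) * exp (A * t)"
proof -
  have A: "0 < A" using pos by simp
  define V where "V = {q \<delta> \<phi> t * exp (- A * t) | \<phi> t. lipc n \<phi> \<and> 0 < t}"
  have ex: "exp (A * t) * exp (- A * t) = 1" for t by (simp add: mult_exp_exp)
  have "v \<le> (2 * n * (2 / \<delta> + Bb)) / A" if "v \<in> V" for v
  proof -
    obtain \<phi> t where v: "v = q \<delta> \<phi> t * exp (- A * t)" "lipc n \<phi>" "0 < t" using \<open>v \<in> V\<close> unfolding V_def by blast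
    have "v \<le> ((2 * n * (2 / \<delta> + Bb)) / A * exp (A * t)) * exp (- A * t)"
      unfolding v(1) by (intro mult_right_mono q_a_priori v) simp
    then show ?thesis using ex[of t] by (simp add: mult.assoc)
  qed
  then have bdd: "bdd_above V" by (rule bdd_aboveI)
  have z: "lipc n (\<lambda>_. 0)" by (simp add: lipc_def lip1_def)
  have "q \<delta> (\<lambda>_. 0) 1 * exp (- A * 1) \<in> V" unfolding V_def using z by (intro CollectI exI[of _ "\<lambda>_. 0"] exI[of _ "1::real"]) auto
  then have zV: "0 \<in> V" by (simp add: q_def smooth_zero)
  define S where "S = Sup V"
  have S0: "0 \<le> S" unfolding S_def by (rule cSup_upper[OF zV bdd])
  have S: "q \<delta> \<phi> t \<le> S * exp (A * t)" if "lipc n \<phi>" "0 < t" for \<phi> t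
  proof -
    have "q \<delta> \<phi> t * exp (- A * t) \<le> S" unfolding S_def by (rule cSup_upper[OF _ bdd]) (use that in \<open>auto simp: V_def\<close>)
    then have "q \<delta> \<phi> t * exp (- A * t) * exp (A * t) \<le> S * exp (A * t)" by (intro mult_right_mono) auto
    then show ?thesis using ex[of t]
      by (simp only: mult.assoc mult.commute[of "exp (- A * t)" "exp (A * t)"] mult_1_right)
  qed
  define c where "c = 4 / \<delta> * n * Bb\<^sup>2 + n * (16 / \<delta>\<^sup>2)"
  have c0: "0 \<le> c" unfolding c_def using d by simp
  have small: "S * (A - C) \<le> k + 4 * n * n * \<delta> * C + c * h" if h: "0 < h" for h
  proof -
    define e where "e = 4 * n * n * \<delta> * C + 4 / \<delta> * n * Bb\<^sup>2 * h + n * (16 / \<delta>\<^sup>2 * h)"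
    define L where "L = 2 * n / h\<^sup>2 + 1 / h"
    have L0: "0 < L" unfolding L_def using h by (simp add: add_nonneg_pos)
    have "S \<le> (S * (L + C) + k + e) / (A + L)" unfolding S_def
    proof (rule cSup_least)
      show "V \<noteq> {}" using zV by auto
      fix v assume "v \<in> V"
      then obtain \<phi> t where v: "v = q \<delta> \<phi> t * exp (- A * t)" "lipc n \<phi>" "0 < t" unfolding V_def by blast
      have "v \<le> ((S * (L + C) + k + e) / (A + L) * exp (A * t)) * exp (- A * t)"
        unfolding v(1) by (intro mult_right_mono q_step[OF S0 S h v(2,3) e_def L_def]) auto
      then show "v \<le> (Sup V * (L + C) + k + e) / (A + L)" using ex[of t] unfolding S_def[symmetric] by (simp add: mult.assoc)
    qed
    then have "S * (A + L) \<le> S * (L + C) + k + e" using L0 A by (simp add: pos_le_divide_eq)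
    then show ?thesis unfolding e_def c_def by (simp add: algebra_simps)
  qed
  have "S * (A - C) \<le> k + 4 * n * n * \<delta> * C"
  proof (rule field_le_epsilon)
    fix e :: real assume e: "0 < e"
    have "S * (A - C) \<le> k + 4 * n * n * \<delta> * C + c * (e / (c + 1))" by (rule small) (use e c0 in simp)
    also have "c * (e / (c + 1)) \<le> e" using e c0 by (simp add: divide_le_eq mult.commute mult_left_mono)
    finally show "S * (A - C) \<le> k + 4 * n * n * \<delta> * C + e" by simp
  qed
  then have "S \<le> (k + 4 * n * n * \<delta> * C) / (A - C)" using pos by (simp add: pos_le_divide_eq)
  then have "S * exp (A * t) \<le> (k + 4 * n * n * \<delta> * C) / (A - C) * exp (A * t)" by (intro mult_right_mono) auto
  then show ?thesis using S[OF f t] by simp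
qed

lemma smooth_close:
  assumes f: "lipc n \<phi>" and x: "x \<in> Rn n"
  shows "\<bar>smooth n \<delta> \<phi> x - \<phi> x\<bar> \<le> 2 * n * n * \<delta>"
proof -
  define c where "c = \<phi> x"
  have one: "avgs \<delta> l (\<lambda>_. 1) y = 1" for l and y :: vec
    by (induction l arbitrary: y) (use d in \<open>simp_all add: avg_def\<close>)
  have sc: "smooth n \<delta> (\<lambda>_. c) x = c"
    using smooth_scale[of n \<delta> c "\<lambda>_. 1" x] one unfolding smooth_def by simp
  have cl: "lipK n 0 (\<lambda>_. c)" by (simp add: lipK_def)
  have near: "\<phi> (mv n x 1 w) \<le> c + 2 * n * n * \<delta>" "c \<le> \<phi> (mv n x 1 w) + 2 * n * n * \<delta>"
    if "vnorm n w \<le> 2 * n * n * \<delta>" for w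
    using lipKD[OF lipc_lipK[OF f] mv_Rn[of n x 1 w] x] vdist_mv[of n x 1 w] that by (auto simp: c_def abs_le_iff)
  have "smooth n \<delta> \<phi> x \<le> smooth n \<delta> (\<lambda>_. c) x + 2 * n * n * \<delta>"
    by (rule smooth_mono[OF lipc_lipK[OF f] d zero_le_one cl x x near(1)])
  moreover have "smooth n \<delta> (\<lambda>_. c) x \<le> smooth n \<delta> \<phi> x + 2 * n * n * \<delta>"
    by (rule smooth_mono[OF cl d order_refl lipc_lipK[OF f] x x near(2)])
  ultimately show ?thesis unfolding sc unfolding c_def by linarith
qed

end

text \<open>Duality reduces the distance to compactly supported Lipschitz functions, and both the
  smoothing error and the extra term in \<open>q_bound\<close> are of order \<open>\<delta>\<close>,
  which is now sent to 0.\<close>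

theorem d1_bound:
  assumes t: "0 < t"
  shows "d1 n (m1 t) (m2 t) \<le> ennreal (k / (A - C) * exp (A * t))"
proof (rule kantorovich_bound[OF P(1) P(2)])
  show "0 \<le> k / (A - C) * exp (A * t)" using pos by simp
  fix \<phi> assume f: "lipc n \<phi>"
  define E where "E = exp (A * t)"
  define c where "c = 4 * real n * real n * C / (A - C) * E + 4 * real n * real n"
  have c0: "0 \<le> c" unfolding c_def E_def using pos by simp
  have main: "(\<integral>x. \<phi> x \<partial>m1 t) - (\<integral>x. \<phi> x \<partial>m2 t) \<le> k / (A - C) * E + c * \<delta>" if d: "0 < \<delta>" for \<delta>
  proof -
    have close: "\<bar>(\<integral>x. smooth n \<delta> \<phi> x \<partial>m) - (\<integral>x. \<phi> x \<partial>m)\<bar> \<le> 2 * n * n * \<delta>" if m: "m \<in> P1 n" for m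
    proof -
      interpret prob_space m using P1D[OF m] by simp
      have i: "integrable m (smooth n \<delta> \<phi>)" "integrable m \<phi>"
        by (rule P1_lipK_integrable[OF m sm_lip[OF d f]], rule P1_lipK_integrable[OF m lipc_lipK[OF f]])
      have "\<bar>(\<integral>x. smooth n \<delta> \<phi> x \<partial>m) - (\<integral>x. \<phi> x \<partial>m)\<bar> = \<bar>\<integral>x. smooth n \<delta> \<phi> x - \<phi> x \<partial>m\<bar>" using i by simp
      also have "\<dots> \<le> (\<integral>x. \<bar>smooth n \<delta> \<phi> x - \<phi> x\<bar> \<partial>m)" by (rule integral_abs_bound)
      also have "\<dots> \<le> (\<integral>x. 2 * n * n * \<delta> \<partial>m)"
        by (rule integral_mono) (use i smooth_close[OF d f] P1D(4)[OF m] in auto)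
      finally show ?thesis by (simp add: prob_space)
    qed
    have "(\<integral>x. \<phi> x \<partial>m1 t) - (\<integral>x. \<phi> x \<partial>m2 t) \<le> q \<delta> \<phi> t + 4 * n * n * \<delta>"
      using close[OF P(1)[OF less_imp_le[OF t]]] close[OF P(2)[OF less_imp_le[OF t]]] unfolding q_def by linarith
    also have "\<dots> \<le> (k + 4 * n * n * \<delta> * C) / (A - C) * E + 4 * n * n * \<delta>"
      unfolding E_def by (intro add_right_mono q_bound[OF d f t])
    also have "\<dots> = k / (A - C) * E + c * \<delta>" unfolding c_def by (simp add: add_divide_distrib algebra_simps)
    finally show ?thesis .
  qed
  show "(\<integral>x. \<phi> x \<partial>m1 t) - (\<integral>x. \<phi> x \<partial>m2 t) \<le> k / (A - C) * exp (A * t)"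
  proof (rule field_le_epsilon)
    fix e :: real assume e: "0 < e"
    have "(\<integral>x. \<phi> x \<partial>m1 t) - (\<integral>x. \<phi> x \<partial>m2 t) \<le> k / (A - C) * E + c * (e / (c + 1))" by (rule main) (use e c0 in simp)
    also have "c * (e / (c + 1)) \<le> e" using e c0 by (simp add: divide_le_eq mult.commute mult_left_mono)
    finally show "(\<integral>x. \<phi> x \<partial>m1 t) - (\<integral>x. \<phi> x \<partial>m2 t) \<le> k / (A - C) * exp (A * t) + e" by (simp add: E_def)
  qed
qed (use t in auto)

end

section \<open>Coincidence of the gradients\<close>

lemma d1_self: "\<mu> \<in> P1 n \<Longrightarrow> d1 n \<mu> \<mu> = 0"
  using kantorovich_bound[of \<mu> n \<mu> 0] by simp

section \<open>Solutions of the system as instances of the abstract estimates\<close>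

lemma C21_D21:
  assumes u: "C21 n {0..} u"
  shows "D21 n u (dt {0..} u) (\<lambda>i x t. pd i (\<lambda>y. u y t) x) (\<lambda>i x t. pd i (pd i (\<lambda>y. u y t)) x)"
  unfolding D21_def
proof (intro conjI ballI allI impI)
  show "continuous_on (Rn n \<times> {0<..}) (\<lambda>(x, t). u x t)"
    by (rule continuous_on_subset[of "Rn n \<times> {0..}"]) (use u in \<open>auto simp: C21_def\<close>)
  fix x and t :: real assume x: "x \<in> Rn n" and t: "0 < t"
  have "u x differentiable (at t within {0..})" using u x t unfolding C21_def by auto
  then have "(u x has_vector_derivative dt {0..} u x t) (at t within {0..})"
    unfolding dt_def by (simp add: vector_derivative_works)
  then show "(u x has_real_derivative dt {0..} u x t) (at t)"
    using t by (simp add: has_real_derivative_iff_has_vector_derivative at_within_interior[of t "{0..}"])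
  fix i assume i: "i < n"
  have "has_pd i (\<lambda>y. u y t) x" "has_pd i (pd i (\<lambda>y. u y t)) x" using u x t i unfolding C21_def by auto
  then show "((\<lambda>s. u (x(i := s)) t) has_real_derivative pd i (\<lambda>y. u y t) x) (at (x i))"
    "((\<lambda>s. pd i (\<lambda>y. u y t) (x(i := s))) has_real_derivative pd i (pd i (\<lambda>y. u y t)) x) (at (x i))"
    by (auto dest: pd_has_derivative)
qed

lemma C21_C1f:
  assumes u: "C21 n {0..} u" and t: "0 \<le> t"
  shows "C1f n (\<lambda>y. u y t)" "j < n \<Longrightarrow> C1f n (pd j (\<lambda>y. u y t))"
  using u t unfolding C21_def C1f_def by (auto intro!: C21_slice[where I = "{0..}" and t = t])

text \<open>The joint Lipschitz assumption with equal measures, where \<open>d1\<close> vanishes. In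
  the second difference the mean value theorem places both gradients within \<open>|e|\<close> of
  \<open>x\<close>, so their arguments are at most \<open>2 * |e|\<close> apart.\<close>

lemma F_facts:
  assumes F: "assumptions_F n \<alpha> Co L F" and L: "0 \<le> L" and \<mu>: "\<mu> \<in> P1 n"
  shows "C1f n (\<lambda>x. F x \<mu>)"
    and "\<And>x y. x \<in> Rn n \<Longrightarrow> y \<in> Rn n \<Longrightarrow> \<bar>F x \<mu> - F y \<mu>\<bar> \<le> L * vdist n x y"
    and "\<And>x y. x \<in> Rn n \<Longrightarrow> y \<in> Rn n \<Longrightarrow> vdist n (grad n (\<lambda>z. F z \<mu>) x) (grad n (\<lambda>z. F z \<mu>) y) \<le> L * vdist n x y"
    and "\<And>x e. x \<in> Rn n \<Longrightarrow> e \<in> Rn n \<Longrightarrow> \<bar>F (mv n x 1 e) \<mu> + F (mv n x (-1) e) \<mu> - 2 * F x \<mu>\<bar> \<le> 2 * L * (vnorm n e)\<^sup>2"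
proof -
  show C1: "C1f n (\<lambda>x. F x \<mu>)"
    using F \<mu> unfolding assumptions_F_def C2_alpha_def C2_def C1f_def by blast
  have b: "ennreal \<bar>F x \<mu> - F y \<mu>\<bar> \<le> ennreal L * (ennreal (vdist n x y) + d1 n \<mu> \<mu>)"
    "ennreal (vdist n (grad n (\<lambda>z. F z \<mu>) x) (grad n (\<lambda>z. F z \<mu>) y)) \<le> ennreal L * (ennreal (vdist n x y) + d1 n \<mu> \<mu>)"
    if "x \<in> Rn n" "y \<in> Rn n" for x y
    using F \<mu> that unfolding assumptions_F_def by blast+
  show "\<bar>F x \<mu> - F y \<mu>\<bar> \<le> L * vdist n x y" if "x \<in> Rn n" "y \<in> Rn n" for x y
    using b(1)[OF that] L by (simp add: d1_self[OF \<mu>] ennreal_mult[symmetric])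
  show l2: "vdist n (grad n (\<lambda>z. F z \<mu>) x) (grad n (\<lambda>z. F z \<mu>) y) \<le> L * vdist n x y" if "x \<in> Rn n" "y \<in> Rn n" for x y
    using b(2)[OF that] L by (simp add: d1_self[OF \<mu>] ennreal_mult[symmetric])
  show "\<bar>F (mv n x 1 e) \<mu> + F (mv n x (-1) e) \<mu> - 2 * F x \<mu>\<bar> \<le> 2 * L * (vnorm n e)\<^sup>2"
    if x: "x \<in> Rn n" and e: "e \<in> Rn n" for x e
  proof -
    have one: "\<exists>z\<in>Rn n. vdist n z x \<le> vnorm n e \<and> F (mv n x s e) \<mu> - F x \<mu> = s * (\<Sum>i<n. grad n (\<lambda>x. F x \<mu>) z i * e i)"
      if s: "\<bar>s\<bar> = 1" for s
    proof -
      obtain \<theta> where t: "0 < \<theta>" "\<theta> < 1"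
        "F (mv n x s e) \<mu> - F x \<mu> = (\<Sum>i<n. pd i (\<lambda>x. F x \<mu>) (mv n x \<theta> (\<lambda>i. mv n x s e i - x i)) * (mv n x s e i - x i))"
        by (rule C1f_mvt[OF C1 x mv_Rn[of n x s e]])
      define z where "z = mv n x \<theta> (\<lambda>i. mv n x s e i - x i)"
      have z: "z \<in> Rn n" by (simp add: z_def)
      have "vdist n z x = \<theta> * vnorm n e"
        unfolding z_def vdist_mv using t s vdist_mv[of n x s e] by (simp add: vdist_def)
      then have "vdist n z x \<le> vnorm n e" using t by (simp add: mult_left_le_one_le)
      moreover have "F (mv n x s e) \<mu> - F x \<mu> = s * (\<Sum>i<n. grad n (\<lambda>x. F x \<mu>) z i * e i)"
        unfolding t(3) z_def[symmetric] by (simp add: sum_distrib_left mult_ac)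
      ultimately show ?thesis using z by blast
    qed
    obtain z1 where z1: "z1 \<in> Rn n" "vdist n z1 x \<le> vnorm n e"
      "F (mv n x 1 e) \<mu> - F x \<mu> = 1 * (\<Sum>i<n. grad n (\<lambda>x. F x \<mu>) z1 i * e i)" using one[of 1] by auto
    obtain z2 where z2: "z2 \<in> Rn n" "vdist n z2 x \<le> vnorm n e"
      "F (mv n x (-1) e) \<mu> - F x \<mu> = (-1) * (\<Sum>i<n. grad n (\<lambda>x. F x \<mu>) z2 i * e i)" using one[of "-1"] by auto
    have eq: "F (mv n x 1 e) \<mu> + F (mv n x (-1) e) \<mu> - 2 * F x \<mu> = (\<Sum>i<n. (grad n (\<lambda>x. F x \<mu>) z1 i - grad n (\<lambda>x. F x \<mu>) z2 i) * e i)"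
      using z1(3) z2(3) unfolding left_diff_distrib sum_subtractf by linarith
    have "\<bar>F (mv n x 1 e) \<mu> + F (mv n x (-1) e) \<mu> - 2 * F x \<mu>\<bar> = \<bar>\<Sum>i<n. (grad n (\<lambda>x. F x \<mu>) z1 i - grad n (\<lambda>x. F x \<mu>) z2 i) * e i\<bar>"
      unfolding eq ..
    also have "\<dots> \<le> vdist n (grad n (\<lambda>x. F x \<mu>) z1) (grad n (\<lambda>x. F x \<mu>) z2) * vnorm n e"
      unfolding vdist_def by (rule CS)
    also have "\<dots> \<le> L * vdist n z1 z2 * vnorm n e" by (intro mult_right_mono l2 z1 z2) simp
    also have "\<dots> \<le> L * (2 * vnorm n e) * vnorm n e"
      using vdist_triangle[of n z1 z2 x] z1(2) z2(2) vdist_commute[of n x z2] L by (intro mult_right_mono mult_left_mono) auto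
    finally show ?thesis by (simp add: power2_eq_square)
  qed
qed

lemma MFG_hjb:
  assumes s: "standing_assumptions n \<alpha> Co L m0 F H" and Co: "1 \<le> Co" and L: "0 < L"
    and lam: "1 \<le> lam" "2 * Co \<le> lam" and m: "MFG_solution n lam m0 F H u m"
    and B: "0 \<le> B" "\<And>t x. 0 < t \<Longrightarrow> x \<in> Rn n \<Longrightarrow> vnorm n (Du n u x t) \<le> B"
  shows "hjb n \<alpha> Co H L lam B u (dt {0..} u) (\<lambda>x t. F x (m t))"
proof -
  have F: "assumptions_F n \<alpha> Co L F" and H: "assumptions_H n \<alpha> Co H" using s by (auto simp: standing_assumptions_def)
  have u: "C21 n {0..} u" using m by (simp add: MFG_solution_def solves_HJB_def)
  have mP: "m t \<in> P1 n" if "0 < t" for t using m that by (simp add: MFG_solution_def solves_FP_def)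
  note Ff = F_facts[OF F less_imp_le[OF L] mP]
  have mn: "mnorm n (hess (\<lambda>y. u y t) x) \<le> 1" if "x \<in> Rn n" "0 < t" for x t
  proof -
    have "ennreal (mnorm n (hess (\<lambda>y. u y t) x)) \<le> (SUP (x, t)\<in>Rn n \<times> {0..}. ennreal (mnorm n (hess (\<lambda>y. u y t) x)))"
      by (rule SUP_upper2[of "(x, t)"]) (use that in auto)
    also have "\<dots> \<le> 1" using m by (simp add: MFG_solution_def)
    finally show ?thesis by simp
  qed
  show ?thesis
  proof
    show "assumptions_H n \<alpha> Co H" "1 \<le> Co" "0 \<le> L" "1 \<le> lam" "2 * Co \<le> lam" "0 \<le> B" using H Co L lam B by auto
    show "D21 n u (dt {0..} u) (\<lambda>i x t. pd i (\<lambda>y. u y t) x) (\<lambda>i x t. pd i (pd i (\<lambda>y. u y t)) x)" by (rule C21_D21[OF u])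
    fix t :: real assume t: "0 < t"
    show "C1f n (\<lambda>y. u y t)" by (rule C21_C1f(1)[OF u less_imp_le[OF t]])
    show "- dt {0..} u x t - (\<Sum>i<n. pd i (pd i (\<lambda>y. u y t)) x) + 1 / lam * H (vscale n lam (Du n u x t)) x + lam * u x t = F x (m t)"
      if "x \<in> Rn n" for x
      using m t that unfolding MFG_solution_def solves_HJB_def laplacian_def by blast
    show "vnorm n (Du n u x t) \<le> B" if "x \<in> Rn n" for x by (rule B(2)[OF t that])
    show "\<bar>F x (m t) - F y (m t)\<bar> \<le> L * vdist n x y" if "x \<in> Rn n" "y \<in> Rn n" for x y by (rule Ff(2)[OF t that])
    show "\<bar>F (mv n x 1 e) (m t) + F (mv n x (- 1) e) (m t) - 2 * F x (m t)\<bar> \<le> 2 * L * (vnorm n e)\<^sup>2" if "x \<in> Rn n" "e \<in> Rn n" for x e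
      by (rule Ff(4)[OF t that])
    show "\<bar>u (mv n x 1 e) t + u (mv n x (- 1) e) t - 2 * u x t\<bar> \<le> 2 * (vnorm n e)\<^sup>2" if x: "x \<in> Rn n" and e: "e \<in> Rn n" for x e
    proof -
      have "\<bar>u (mv n x 1 e) t + u (mv n x (- 1) e) t - 2 * u x t\<bar> \<le> 2 * 1 * (vnorm n e)\<^sup>2"
      proof (rule hess_second_difference[OF C21_C1f(1)[OF u less_imp_le[OF t]] C21_C1f(2)[OF u less_imp_le[OF t]] _ x])
        fix z assume z: "z \<in> Rn n"
        show "\<bar>\<Sum>i<n. \<Sum>j<n. hess (\<lambda>y. u y t) z i j * e i * e j\<bar> \<le> 1 * (vnorm n e)\<^sup>2"
          using mnorm_quad[OF e, of "hess (\<lambda>y. u y t) z"] mult_right_mono[OF mn[OF z t], of "(vnorm n e)\<^sup>2"] by simp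
      qed
      then show ?thesis by simp
    qed
  qed
qed

lemma MFG_gradient_bounded:
  assumes m: "MFG_solution n lam m0 F H u m"
  obtains B where "0 \<le> B" "\<And>t x. 0 < t \<Longrightarrow> x \<in> Rn n \<Longrightarrow> vnorm n (Du n u x t) \<le> B"
proof -
  define S where "S = (SUP (x, t)\<in>Rn n \<times> {0..}. ennreal (vnorm n (Du n u x t)))"
  have S: "S < \<infinity>" using m by (simp add: MFG_solution_def S_def)
  show ?thesis
  proof (rule that[of "enn2real S"])
    fix t :: real and x assume "0 < t" "x \<in> Rn n"
    then have "ennreal (vnorm n (Du n u x t)) \<le> S" unfolding S_def by (intro SUP_upper2[of "(x, t)"]) auto
    also have "S = ennreal (enn2real S)" using S by (simp add: less_top)
    finally show "vnorm n (Du n u x t) \<le> enn2real S" by (simp add: ennreal_le_iff)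
  qed simp
qed

lemma drift_bounds:
  assumes "hjb n \<alpha> Co H L lam B u ut f" and big: "48 * hjb.K Co L \<le> lam" "48 * hjb.K Co L * (n * hjb.r1 Co L) \<le> sqrt lam"
    and x: "x \<in> Rn n" and y: "y \<in> Rn n" and t: "0 < t"
  shows "vnorm n (drift n lam H u x t) \<le> 12 * Co * (1 + hjb.R0 Co L)"
    and "vdist n (drift n lam H u x t) (drift n lam H u y t) \<le> (12 * Co * hjb.M1 Co L + Co * (2 + hjb.R0 Co L)) * vdist n x y"
proof -
  interpret hjb n \<alpha> Co H L lam B u ut f by fact
  have Px: "vnorm n (P x t) \<le> R0" "vnorm n (P y t) \<le> R0" using P_bound x y t by auto
  have "vnorm n (DpH n H (P x t) x) \<le> 12 * Co * (1 + vnorm n (P x t))" by (rule DpH_bound) (use x in auto)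
  also have "\<dots> \<le> 12 * Co * (1 + R0)" using Px Co1 by (intro mult_left_mono) auto
  finally show "vnorm n (drift n lam H u x t) \<le> 12 * Co * (1 + R0)" by (simp add: drift_def)
  have a: "vdist n (DpH n H (P x t) x) (DpH n H (P y t) x) \<le> 12 * Co * vdist n (P x t) (P y t)"
    by (rule DpH_lip_p) (use x in auto)
  have "vdist n (P x t) (P y t) \<le> M1 * vdist n x y"
    unfolding P_dist by (rule Du_lip[OF big x y t])
  then have "12 * Co * vdist n (P x t) (P y t) \<le> 12 * Co * (M1 * vdist n x y)" using Co1 by (intro mult_left_mono) auto
  moreover have "vdist n (DpH n H (P y t) x) (DpH n H (P y t) y) \<le> Co * (2 + vnorm n (P y t)) * vdist n x y"
    by (rule DpH_lip_x) (use x y in auto)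
  moreover have "Co * (2 + vnorm n (P y t)) * vdist n x y \<le> Co * (2 + R0) * vdist n x y"
    using Px Co1 by (intro mult_right_mono mult_left_mono) auto
  moreover have "vdist n (DpH n H (P x t) x) (DpH n H (P y t) y) \<le> vdist n (DpH n H (P x t) x) (DpH n H (P y t) x) + vdist n (DpH n H (P y t) x) (DpH n H (P y t) y)"
    by (rule vdist_triangle)
  ultimately show "vdist n (drift n lam H u x t) (drift n lam H u y t) \<le> (12 * Co * M1 + Co * (2 + R0)) * vdist n x y"
    using a unfolding drift_def distrib_right by linarith
qed

text \<open>One turn around the loop: a gap \<open>k\<close> of \<open>lam * Du\<close> gives the
  drift gap \<open>12 * Co * k\<close>, then the distance \<open>12 * Co * k / (A - C)\<close>, then
  \<open>L\<close> times this for the gradients of the sources, and \<open>gradient_gap\<close>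
  multiplies by 4. With \<open>A - C = 96 * L * Co\<close> the result is
  \<open>k / 2\<close>.\<close>

theorem MFG_unique_gradient:
  assumes s: "standing_assumptions n \<alpha> Co L m0 F H" and Co: "1 \<le> Co" and L: "0 < L"
    and lam: "1 \<le> lam" "2 * Co \<le> lam" and big: "48 * hjb.K Co L \<le> lam" "48 * hjb.K Co L * (n * hjb.r1 Co L) \<le> sqrt lam"
    and C: "C = 12 * Co * hjb.M1 Co L + Co * (2 + hjb.R0 Co L)" and A: "A = C + 96 * L * Co"
    and lamA: "2 * A \<le> lam" "A + 2 * hjb.K Co L * (hjb.M1 Co L + 1) \<le> lam"
    and m1: "MFG_solution n lam m0 F H u1 m1" and m2: "MFG_solution n lam m0 F H u2 m2"
    and x: "x \<in> Rn n" and t: "0 < t"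
  shows "vdist n (Du n u1 x t) (Du n u2 x t) = 0"
proof -
  obtain B1 where B1: "0 \<le> B1" "\<And>t x. 0 < t \<Longrightarrow> x \<in> Rn n \<Longrightarrow> vnorm n (Du n u1 x t) \<le> B1"
    using MFG_gradient_bounded[OF m1] by blast
  obtain B2 where B2: "0 \<le> B2" "\<And>t x. 0 < t \<Longrightarrow> x \<in> Rn n \<Longrightarrow> vnorm n (Du n u2 x t) \<le> B2"
    using MFG_gradient_bounded[OF m2] by blast
  define B where "B = max B1 B2"
  have h1: "hjb n \<alpha> Co H L lam B u1 (dt {0..} u1) (\<lambda>x t. F x (m1 t))"
    by (rule MFG_hjb[OF s Co L lam m1]) (use B1 in \<open>auto simp: B_def le_max_iff_disj\<close>)
  have h2: "hjb n \<alpha> Co H L lam B u2 (dt {0..} u2) (\<lambda>x t. F x (m2 t))"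
    by (rule MFG_hjb[OF s Co L lam m2]) (use B2 in \<open>auto simp: B_def le_max_iff_disj\<close>)
  interpret one: hjb n \<alpha> Co H L lam B u1 "dt {0..} u1" "\<lambda>x t. F x (m1 t)" by fact
  interpret two: hjb n \<alpha> Co H L lam B u2 "dt {0..} u2" "\<lambda>x t. F x (m2 t)" by fact
  interpret hjb_pair n \<alpha> Co H L lam B u1 "dt {0..} u1" "\<lambda>x t. F x (m1 t)" u2 "dt {0..} u2" "\<lambda>x t. F x (m2 t)"
    by unfold_locales (use big in auto)
  have F: "assumptions_F n \<alpha> Co L F" using s by (simp add: standing_assumptions_def)
  have P: "m1 t \<in> P1 n" "m2 t \<in> P1 n" if "0 \<le> t" for t using m1 m2 that by (auto simp: MFG_solution_def solves_FP_def)
  have C0: "0 \<le> C" unfolding C using Co one.M1_pos one.R0_pos by simp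
  have LC: "0 < L * Co" using L Co by simp
  have AC: "C < A" "A - C = 96 * L * Co" using LC unfolding A by linarith+
  have gap: "d1 n (m1 t) (m2 t) \<le> ennreal (12 * Co * k / (A - C) * exp (A * t))"
    if k: "0 \<le> k" and g: "\<And>x t. x \<in> Rn n \<Longrightarrow> 0 < t \<Longrightarrow> lam * vdist n (Du n u1 x t) (Du n u2 x t) \<le> k * exp (A * t)" and t: "0 < t"
    for k t
  proof -
    have fp1: "solves_FP n lam m0 H u1 m1" and fp2: "solves_FP n lam m0 H u2 m2"
      and c1: "C21 n {0..} u1" and c2: "C21 n {0..} u2"
      using m1 m2 by (auto simp: MFG_solution_def solves_HJB_def)
    have cont: "((\<lambda>s. d1 n (m s) (m 0)) \<longlongrightarrow> 0) (at_right 0)" if "solves_FP n lam m0 H u m" for u m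
    proof -
      have "\<forall>t\<ge>0. ((\<lambda>s. d1 n (m s) (m t)) \<longlongrightarrow> 0) (at t within {0..})"
        using that unfolding solves_FP_def by blast
      from this[rule_format, OF order_refl] show ?thesis by (rule tendsto_within_subset) auto
    qed
    interpret fp_pair n m1 m2 "drift n lam H u1" "drift n lam H u2" "12 * Co * (1 + one.R0)" C A "12 * Co * k"
    proof
      show "m1 t \<in> P1 n" "m2 t \<in> P1 n" if "0 \<le> t" for t using P that by auto
      show "m1 0 = m2 0" using fp1 fp2 by (simp add: solves_FP_def)
      show "((\<lambda>s. d1 n (m1 s) (m1 0)) \<longlongrightarrow> 0) (at_right 0)" "((\<lambda>s. d1 n (m2 s) (m2 0)) \<longlongrightarrow> 0) (at_right 0)"
        by (rule cont[OF fp1], rule cont[OF fp2])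
      show "((\<lambda>t. \<integral>x. smooth n \<delta> \<phi> x \<partial>m1 t) has_real_derivative (\<integral>x. (\<Sum>i<n. sDD n \<delta> \<phi> i x - sD n \<delta> \<phi> i x * drift n lam H u1 x t i) \<partial>m1 t)) (at t)"
        if "lipK n K' \<phi>" "0 \<le> K'" "0 < \<delta>" "\<And>x. x \<in> Rn n \<Longrightarrow> R < vnorm n x \<Longrightarrow> smooth n \<delta> \<phi> x = 0" "0 < t" for \<phi> K' \<delta> R t
        by (rule one.FP_weak[OF c1 fp1 that])
      show "((\<lambda>t. \<integral>x. smooth n \<delta> \<phi> x \<partial>m2 t) has_real_derivative (\<integral>x. (\<Sum>i<n. sDD n \<delta> \<phi> i x - sD n \<delta> \<phi> i x * drift n lam H u2 x t i) \<partial>m2 t)) (at t)"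
        if "lipK n K' \<phi>" "0 \<le> K'" "0 < \<delta>" "\<And>x. x \<in> Rn n \<Longrightarrow> R < vnorm n x \<Longrightarrow> smooth n \<delta> \<phi> x = 0" "0 < t" for \<phi> K' \<delta> R t
        by (rule one.FP_weak[OF c2 fp2 that])
      fix x and t :: real assume x: "x \<in> Rn n" and t: "0 < t"
      show "vnorm n (drift n lam H u1 x t) \<le> 12 * Co * (1 + one.R0)" by (rule drift_bounds(1)[OF h1 big x x t])
      show "vnorm n (drift n lam H u2 x t) \<le> 12 * Co * (1 + one.R0)" by (rule drift_bounds(1)[OF h2 big x x t])
      show "vdist n (drift n lam H u1 x t) (drift n lam H u1 y t) \<le> C * vdist n x y" if "y \<in> Rn n" for y
        unfolding C by (rule drift_bounds(2)[OF h1 big x that t])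
      show "vdist n (drift n lam H u2 x t) (drift n lam H u2 y t) \<le> C * vdist n x y" if "y \<in> Rn n" for y
        unfolding C by (rule drift_bounds(2)[OF h2 big x that t])
      have "vdist n (drift n lam H u1 x t) (drift n lam H u2 x t) \<le> 12 * Co * vdist n (one.P x t) (two.P x t)"
        unfolding drift_def by (rule one.DpH_lip_p) (use x in auto)
      also have "\<dots> \<le> 12 * Co * (k * exp (A * t))"
        using g[OF x t] Co one.lam_pos by (intro mult_left_mono) auto
      finally show "vdist n (drift n lam H u1 x t) (drift n lam H u2 x t) \<le> 12 * Co * k * exp (A * t)" by (simp add: mult.assoc)
    qed (use Co one.R0_pos C0 AC k in auto)
    show ?thesis using d1_bound[OF t] by simp
  qed
  have step: "lam * vdist n (Du n u1 x t) (Du n u2 x t) \<le> k / 2 * exp (A * t)"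
    if k: "0 \<le> k" and g: "\<And>x t. x \<in> Rn n \<Longrightarrow> 0 < t \<Longrightarrow> lam * vdist n (Du n u1 x t) (Du n u2 x t) \<le> k * exp (A * t)" and x: "x \<in> Rn n" and t: "0 < t"
    for k x t
  proof -
    define c where "c = L * (12 * Co * k / (A - C))"
    have c0: "0 \<le> c" unfolding c_def using L Co k AC by simp
    have "lam * vdist n (Du n u1 x t) (Du n u2 x t) \<le> 4 * c * exp (A * t)"
    proof (rule gradient_gap[OF _ lamA c0 _ x t])
      show "0 \<le> A" using AC C0 by simp
      fix x y and t :: real assume x: "x \<in> Rn n" and y: "y \<in> Rn n" and t: "0 < t"
      note P1 = P(1)[OF less_imp_le[OF t]] and P2 = P(2)[OF less_imp_le[OF t]]
      note F1 = F_facts(1)[OF F less_imp_le[OF L] P1] and F2 = F_facts(1)[OF F less_imp_le[OF L] P2]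
      have D0: "0 \<le> 12 * Co * k / (A - C) * exp (A * t)" using Co L k AC by simp
      have "vnorm n (grad n (\<lambda>x. F x (m1 t) - F x (m2 t)) z) \<le> L * (12 * Co * k / (A - C) * exp (A * t))" if z: "z \<in> Rn n" for z
      proof -
        have "ennreal (vdist n (grad n (\<lambda>z. F z (m1 t)) z) (grad n (\<lambda>z. F z (m2 t)) z)) \<le> ennreal L * (ennreal (vdist n z z) + d1 n (m1 t) (m2 t))"
          using F P1 P2 z unfolding assumptions_F_def by blast
        also have "\<dots> \<le> ennreal L * ennreal (12 * Co * k / (A - C) * exp (A * t))"
          using gap[OF k g t] by (intro mult_left_mono) auto
        also have "\<dots> = ennreal (L * (12 * Co * k / (A - C) * exp (A * t)))" by (rule ennreal_mult[OF less_imp_le[OF L] D0, symmetric])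
        finally have "vdist n (grad n (\<lambda>z. F z (m1 t)) z) (grad n (\<lambda>z. F z (m2 t)) z) \<le> L * (12 * Co * k / (A - C) * exp (A * t))"
          by (simp only: ennreal_le_iff[OF mult_nonneg_nonneg[OF less_imp_le[OF L] D0]])
        moreover have "vnorm n (grad n (\<lambda>x. F x (m1 t) - F x (m2 t)) z) = vdist n (grad n (\<lambda>z. F z (m1 t)) z) (grad n (\<lambda>z. F z (m2 t)) z)"
          unfolding vdist_def using grad_diff[OF F1 F2 z] by (intro vnorm_cong) auto
        ultimately show ?thesis by simp
      qed
      from C1f_lipschitz[OF C1f_diff[OF F1 F2] y x this]
      show "\<bar>F x (m1 t) - F x (m2 t) - (F y (m1 t) - F y (m2 t))\<bar> \<le> c * exp (A * t) * vdist n x y"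
        by (simp add: c_def mult.assoc)
    qed
    also have "4 * c = k / 2" using L Co unfolding c_def AC(2) by (simp add: field_simps)
    finally show ?thesis .
  qed
  \<comment> \<open>The loop has no inhomogeneous term, so \<open>contraction_bound\<close> applies
    with \<open>c = 0\<close>. It starts from \<open>2 * R0\<close>, since the weight
    \<open>exp (A * t)\<close> is at least 1.\<close>
  have "lam * vdist n (Du n u1 (fst (x, t)) (snd (x, t))) (Du n u2 (fst (x, t)) (snd (x, t))) \<le> 2 * 0 * exp (A * snd (x, t))"
  proof (rule contraction_bound[where S = "Rn n \<times> {0<..}" and ?B0.0 = "2 * one.R0"
        and g = "\<lambda>p. lam * vdist n (Du n u1 (fst p) (snd p)) (Du n u2 (fst p) (snd p))"])
    show "lam * vdist n (Du n u1 (fst p) (snd p)) (Du n u2 (fst p) (snd p)) \<le> 2 * one.R0 * exp (A * snd p)" if "p \<in> Rn n \<times> {0<..}" for p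
    proof -
      have p: "fst p \<in> Rn n" "0 < snd p" using that by auto
      have "vdist n (Du n u1 (fst p) (snd p)) (Du n u2 (fst p) (snd p)) \<le> vnorm n (Du n u1 (fst p) (snd p)) + vnorm n (Du n u2 (fst p) (snd p))"
        unfolding vdist_def by (rule vnorm_diff)
      then have "lam * vdist n (Du n u1 (fst p) (snd p)) (Du n u2 (fst p) (snd p)) \<le> lam * (vnorm n (Du n u1 (fst p) (snd p)) + vnorm n (Du n u2 (fst p) (snd p)))"
        using one.lam_pos by (intro mult_left_mono) auto
      also have "\<dots> \<le> 2 * one.R0 * 1" using one.gradient_bound[OF p] two.gradient_bound[OF p] by (simp add: distrib_left)
      also have "\<dots> \<le> 2 * one.R0 * exp (A * snd p)" using one.R0_pos p AC C0 by (intro mult_left_mono) auto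
      finally show ?thesis .
    qed
    fix k and p :: "vec \<times> real"
    assume k: "0 \<le> k" "\<And>p. p \<in> Rn n \<times> {0<..} \<Longrightarrow> lam * vdist n (Du n u1 (fst p) (snd p)) (Du n u2 (fst p) (snd p)) \<le> k * exp (A * snd p)"
      "p \<in> Rn n \<times> {0<..}"
    have "lam * vdist n (Du n u1 (fst p) (snd p)) (Du n u2 (fst p) (snd p)) \<le> k / 2 * exp (A * snd p)"
      by (rule step[OF k(1)]) (use k(2)[of "(a, b)" for a b] k(3) in auto)
    then show "lam * vdist n (Du n u1 (fst p) (snd p)) (Du n u2 (fst p) (snd p)) \<le> (0 + k / 2) * exp (A * snd p)" by simp
  qed (use one.R0_pos x t in auto)
  then have "vdist n (Du n u1 x t) (Du n u2 x t) \<le> 0" using one.lam_pos by (simp add: mult_le_0_iff)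
  then show ?thesis using vdist_nonneg[of n "Du n u1 x t" "Du n u2 x t"] by linarith
qed

text \<open>The estimates concern positive times; \<open>t = 0\<close> is reached through continuity
  of the spatial gradient up to the initial time.\<close>

lemma Du_gap_continuous:
  assumes u: "C21 n {0..} u1" "C21 n {0..} u2" and x: "x \<in> Rn n"
    and z: "\<And>t. 0 < t \<Longrightarrow> vdist n (Du n u1 x t) (Du n u2 x t) = 0"
  shows "vdist n (Du n u1 x 0) (Du n u2 x 0) = 0"
  unfolding vdist_Du vnorm_eq_0
proof (intro allI impI)
  fix i assume i: "i < n"
  define g where "g t = pd i (\<lambda>y. u1 y t) x - pd i (\<lambda>y. u2 y t) x" for t
  have c: "continuous_on {0..} (\<lambda>t. pd i (\<lambda>y. u y t) x)" if "C21 n {0..} u" for u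
  proof -
    have "continuous_on (Rn n \<times> {0..}) (\<lambda>(x, t). pd i (\<lambda>y. u y t) x)" using that i by (simp add: C21_def)
    then have "continuous_on {0..} (\<lambda>t. (\<lambda>(x, t). pd i (\<lambda>y. u y t) x) (x, t))"
      by (rule continuous_on_compose2) (use x in \<open>auto intro!: continuous_on_Pair continuous_on_const continuous_on_id\<close>)
    then show ?thesis by simp
  qed
  have "continuous_on {0..} g" unfolding g_def by (intro continuous_on_diff c u)
  then have "(g \<longlongrightarrow> g 0) (at 0 within {0..})" by (simp add: continuous_on)
  then have l: "(g \<longlongrightarrow> g 0) (at_right 0)" by (rule tendsto_within_subset) auto
  have "g t = 0" if "0 < t" for t using z[OF that] i unfolding vdist_Du vnorm_eq_0 g_def by simp
  then have "(g \<longlongrightarrow> 0) (at_right 0)"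
    by (intro tendsto_eventually) (auto simp: eventually_at_right_field intro!: exI[of _ "1::real"])
  then have "g 0 = 0" using tendsto_unique[OF _ l] by simp
  then show "pd i (\<lambda>y. u1 y 0) x - pd i (\<lambda>x. u2 x 0) x = 0" by (simp add: g_def)
qed

theorem proposition3p4:
  fixes Co L :: real
  assumes "1 \<le> Co" and "0 < L"
  shows "\<exists>K>0. \<exists>\<eta>>0. \<forall>n\<ge>1. \<exists>lam0\<ge>1.
    \<forall>\<alpha>\<in>{0<..<1}. \<forall>m0 F H. standing_assumptions n \<alpha> Co L m0 F H \<longrightarrow>
      (\<forall>lam>max lam0 \<eta>. \<forall>u1 m1 u2 m2.
         MFG_solution n lam m0 F H u1 m1 \<longrightarrow> MFG_solution n lam m0 F H u2 m2 \<longrightarrow>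
         (\<forall>T>0. \<forall>t\<in>{0..T}.
            grad_gap n lam u1 u2 t
              \<le> ennreal K * d1 n (m1 t) (m2 t) + ennreal (K * exp (- lam * T / 2))
                + ennreal K * (\<integral>\<^sup>+r\<in>{t..T}.
                    (d1 n (m1 r) (m2 r) * ennreal (exp (- (lam - \<eta>) * (r - t)))) \<partial>lborel)) \<and>
         (\<forall>t\<ge>0.
            grad_gap n lam u1 u2 t
              \<le> ennreal K * d1 n (m1 t) (m2 t)
                + ennreal K * (\<integral>\<^sup>+r\<in>{t..}.
                    (d1 n (m1 r) (m2 r) * ennreal (exp (- (lam - \<eta>) * (r - t)))) \<partial>lborel)))"
proof -
  define C where "C = 12 * Co * hjb.M1 Co L + Co * (2 + hjb.R0 Co L)"
  define A where "A = C + 96 * L * Co"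
  \<comment> \<open>The sum dominates every threshold at once. The square encodes the condition on
    \<open>sqrt lam\<close> and is the only term that depends on the dimension.\<close>
  define lam0 where "lam0 n = 1 + \<bar>2 * Co\<bar> + \<bar>48 * hjb.K Co L\<bar> + (48 * hjb.K Co L * (real n * hjb.r1 Co L))\<^sup>2 + \<bar>2 * A\<bar>
    + \<bar>A + 2 * hjb.K Co L * (hjb.M1 Co L + 1)\<bar>" for n :: nat
  have zero: "grad_gap n lam u1 u2 t = 0"
    if s: "standing_assumptions n \<alpha> Co L m0 F H" and lam: "lam0 n < lam"
      and m: "MFG_solution n lam m0 F H u1 m1" "MFG_solution n lam m0 F H u2 m2" and t: "0 \<le> t"
    for n \<alpha> m0 F H lam u1 m1 u2 m2 t
  proof -
    define sq where "sq = (48 * hjb.K Co L * (real n * hjb.r1 Co L))\<^sup>2"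
    have sq0: "0 \<le> sq" by (simp add: sq_def)
    have l: "1 \<le> lam" "2 * Co \<le> lam" "48 * hjb.K Co L \<le> lam" "sq \<le> lam" "2 * A \<le> lam"
      "A + 2 * hjb.K Co L * (hjb.M1 Co L + 1) \<le> lam"
      using lam sq0 unfolding lam0_def sq_def[symmetric] by linarith+
    have l2: "48 * hjb.K Co L * (real n * hjb.r1 Co L) \<le> sqrt lam" by (rule real_le_rsqrt) (use l(4) in \<open>simp add: sq_def\<close>)
    have pos: "vdist n (Du n u1 x t) (Du n u2 x t) = 0" if "x \<in> Rn n" "0 < t" for x t
      by (rule MFG_unique_gradient[OF s assms l(1,2,3) l2 C_def A_def l(5,6) m that])
    have "vdist n (Du n u1 x t) (Du n u2 x t) = 0" if x: "x \<in> Rn n" for x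
    proof (cases "t = 0")
      case True
      have "vdist n (Du n u1 x 0) (Du n u2 x 0) = 0"
        by (rule Du_gap_continuous[OF _ _ x pos[OF x]]) (use m in \<open>auto simp: MFG_solution_def solves_HJB_def\<close>)
      then show ?thesis using True by simp
    qed (use pos[OF x] t in simp)
    then have "grad_gap n lam u1 u2 t \<le> 0" unfolding grad_gap_def by (intro SUP_least) simp
    then show ?thesis by simp
  qed
  have one: "1 \<le> lam0 n" for n unfolding lam0_def by simp
  \<comment> \<open>A vanishing left side lies below every \<open>c\<close>, so one fact serves both
    the finite and the infinite horizon.\<close>
  have fin: "grad_gap n lam u1 u2 t \<le> c"
    if "standing_assumptions n \<alpha> Co L m0 F H" "max (lam0 n) 1 < lam"
      "MFG_solution n lam m0 F H u1 m1" "MFG_solution n lam m0 F H u2 m2" "0 \<le> t"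
    for n \<alpha> m0 F H lam u1 m1 u2 m2 t c
    using zero[OF that(1) _ that(3-5)] that(2) by simp
  show ?thesis
    by (rule exI[of _ "1::real"], rule conjI[OF zero_less_one], rule exI[of _ "1::real"], rule conjI[OF zero_less_one],
        intro allI impI, rule_tac x = "lam0 n" in exI, intro conjI allI ballI impI one)
      (rule fin; (assumption | simp))+
qed

end
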